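(* Let $A \in \mathbb{R}^{n\times m}$ with $n \ge m$ and let $Z \in \mathbb{R}^{n\times p}$, $2<p\le\mathrm{rank}(A)$, be given by $Z=A_qG$ with $A_q=(AA^{T})^qA\in\mathbb{R}^{n\times m}$ ($q\in\mathbb{N}$, $q=0$ allowed) and $G\in\mathbb{R}^{m\times p}$ a standard Gaussian matrix. Let $\pi(Z)$ denote the orthogonal projection onto the space spanned by the columns of $Z$. For a given $k\in\{1,\dots,p-2\}$, set $\Omega_k=U_k^{T}Z\in\mathbb{R}^{k\times p}$, with $\Omega_k$ of full row rank (i.e. $\mathrm{rank}(\Omega_k)=k$). Let $\varphi(x)=x/\sqrt{1+x^2}$ for $x\ge0$. Then $$\mathbb{E}\left[\|[I_n-\pi(Z)]A\|_2-\|[I_n-\pi(Z)]\underline{A}_k\|_2\right]\le\min\left\{c_k,\ \varphi(d_k)\,\sigma_1\right\},$$ where, with $\gamma_i=\sigma_{k+1}/\sigma_i$ for $i=1,\dots,\mathrm{rank}(A)$, $$c_k=\frac{\sigma_{k+1}}{\sqrt{p-k-1}}\left(\sum_{i=1}^k\gamma_i^{4q}\right)^{1/2}+\sigma_k\left(\sum_{i=k+1}^{\mathrm{rank}(A)}\left(\frac{\sigma_i}{\sigma_k}\right)^{4q+2}\right)^{1/2}\frac{e\sqrt{p}}{p-k},$$ $$d_k=\frac{1}{\sqrt{p-k-1}}\left(\sum_{i=1}^k\gamma_i^{4q+2}\right)^{1/2}+\left(\sum_{i=k+1}^{\mathrm{rank}(A)}\left(\frac{\sigma_i}{\sigma_k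}\right)^{4q+2}\right)^{1/2}\frac{e\sqrt{p}}{p-k}.$$
   Context: $A = U\Sigma V^{T}$ is a singular value decomposition, with $U\in\mathbb{R}^{n\times n}$, $V\in\mathbb{R}^{m\times m}$ orthogonal and $\Sigma\in\mathbb{R}^{n\times m}$ diagonal with singular values $\sigma_1\ge\dots\ge\sigma_m\ge 0$. Partition $U=[U_k\ \ \underline{U}_k]$, $V=[V_k\ \ \underline{V}_k]$, $\Sigma=\mathrm{diag}(\Sigma_k,\underline{\Sigma}_k)$ with $U_k\in\mathbb{R}^{n\times k}$, $V_k\in\mathbb{R}^{m\times k}$, $\Sigma_k=\mathrm{diag}(\sigma_1,\dots,\sigma_k)$, $\underline{\Sigma}_k\in\mathbb{R}^{(n-k)\times(m-k)}$, and set $\underline{A}_k=\underline{U}_k\underline{\Sigma}_k\underline{V}_k^{T}$. A standard Gaussian matrix has independent columns, each distributed as $\mathcal{N}(0,I_m)$. $e=\exp(1)$ and $\|\cdot\|_2$ is the spectral norm. *)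

theory Defs
  imports "HOL-Probability.Probability" "Jordan_Normal_Form.DL_Rank"
begin

unbundle no inner_syntax

definition vec_norm2 :: "real vec \<Rightarrow> real" where
  "vec_norm2 x = sqrt (x \<bullet> x)"

definition spectral_norm :: "real mat \<Rightarrow> real" where
  "spectral_norm A = (SUP x\<in>{x \<in> carrier_vec (dim_col A). vec_norm2 x \<le> 1}. vec_norm2 (A *\<^sub>v x))"

lemma vec_norm2_mult_bdd_above:
  "bdd_above ((\<lambda>x. vec_norm2 (A *\<^sub>v x)) ` {x \<in> carrier_vec (dim_col A). vec_norm2 x \<le> 1})"
proof (rule bdd_aboveI2)
  fix x assume x: "x \<in> {x \<in> carrier_vec (dim_col A). vec_norm2 x \<le> 1}"
  then have dx: "dim_vec x = dim_col A" by auto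
  have xi: "\<bar>x $ j\<bar> \<le> 1" if "j < dim_col A" for j
  proof -
    have "x $ j * x $ j \<le> (\<Sum>i\<in>{0..<dim_vec x}. x $ i * x $ i)"
      by (rule member_le_sum) (use that dx in auto)
    also have "\<dots> \<le> 1" using x by (simp add: vec_norm2_def scalar_prod_def)
    finally show ?thesis using abs_square_le_1[of "x $ j"] by (simp add: power2_eq_square)
  qed
  have yi: "\<bar>(A *\<^sub>v x) $ i\<bar> \<le> (\<Sum>j<dim_col A. \<bar>A $$ (i,j)\<bar>)" if "i < dim_row A" for i
  proof -
    have "(A *\<^sub>v x) $ i = (\<Sum>j<dim_col A. A $$ (i,j) * x $ j)"
      using that dx by (simp add: scalar_prod_def atLeast0LessThan)
    also have "\<bar>\<dots>\<bar> \<le> (\<Sum>j<dim_col A. \<bar>A $$ (i,j) * x $ j\<bar>)" by (rule sum_abs)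
    also have "\<dots> \<le> (\<Sum>j<dim_col A. \<bar>A $$ (i,j)\<bar>)"
      by (rule sum_mono) (use xi in \<open>auto simp: abs_mult intro: mult_left_le\<close>)
    finally show ?thesis .
  qed
  have "(A *\<^sub>v x) \<bullet> (A *\<^sub>v x) \<le> (\<Sum>i<dim_row A. (\<Sum>j<dim_col A. \<bar>A $$ (i,j)\<bar>)\<^sup>2)"
    unfolding scalar_prod_def atLeast0LessThan
  proof (simp only: dim_mult_mat_vec, rule sum_mono)
    fix i assume "i \<in> {..<dim_row A}"
    then show "(A *\<^sub>v x) $ i * (A *\<^sub>v x) $ i \<le> (\<Sum>j<dim_col A. \<bar>A $$ (i,j)\<bar>)\<^sup>2"
      using power_mono[OF yi[of i], of 2] by (simp add: power2_eq_square[symmetric])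
  qed
  then show "vec_norm2 (A *\<^sub>v x) \<le> sqrt (\<Sum>i<dim_row A. (\<Sum>j<dim_col A. \<bar>A $$ (i,j)\<bar>)\<^sup>2)"
    by (simp add: vec_norm2_def)
qed

definition is_orth_proj :: "nat \<Rightarrow> real vec set \<Rightarrow> real mat \<Rightarrow> bool" where
  "is_orth_proj n W P \<longleftrightarrow> P \<in> carrier_mat n n \<and>
     (\<forall>x\<in>carrier_vec n. P *\<^sub>v x \<in> W \<and> (\<forall>w\<in>W. (x - P *\<^sub>v x) \<bullet> w = 0))"

definition orth_proj :: "real mat \<Rightarrow> real mat" where
  "orth_proj Z = (THE P. is_orth_proj (dim_row Z) (vec_space.col_space (dim_row Z) Z) P)"

context
  fixes n :: nat
begin

interpretation vec_space "TYPE(real)" n .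

lemma ex_is_orth_proj:
  assumes "set xs \<subseteq> carrier_vec n"
  shows "\<exists>P. is_orth_proj n (span (set xs)) P"
  using assms
proof (induction xs)
  case Nil
  have "is_orth_proj n (span (set [])) (0\<^sub>m n n)"
    by (auto simp: is_orth_proj_def span_empty intro!: scalar_prod_right_zero[of _ n] minus_carrier_vec mult_mat_vec_carrier[of _ n n])
  then show ?case by blast
next
  case (Cons v xs)
  then obtain P where P: "is_orth_proj n (span (set xs)) P" by auto
  have v: "v \<in> carrier_vec n" and xs: "set xs \<subseteq> carrier_vec n" using Cons.prems by auto
  let ?S = "span (set xs)" and ?T = "span (set (v # xs))"
  have Pc: "P \<in> carrier_mat n n" and PS: "\<And>x. x \<in> carrier_vec n \<Longrightarrow> P *\<^sub>v x \<in> ?S"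
    and PO: "\<And>x w. x \<in> carrier_vec n \<Longrightarrow> w \<in> ?S \<Longrightarrow> (x - P *\<^sub>v x) \<bullet> w = 0"
    using P by (auto simp: is_orth_proj_def)
  have ST: "?S \<subseteq> ?T" by (rule span_is_monotone) auto
  have Sc: "?S \<subseteq> carrier_vec n" using span_is_subset2[OF xs] .
  have Tc: "?T \<subseteq> carrier_vec n" using span_is_subset2 Cons.prems by blast
  have vT: "v \<in> ?T" using Cons.prems span_mem by auto
  have ortho: "y \<bullet> w = 0"
    if y: "y \<in> carrier_vec n" and gen: "\<And>u. u \<in> set (v # xs) \<Longrightarrow> y \<bullet> u = 0"
      and w: "w \<in> ?T" for y w
  proof -
    have "w \<in> span_list (v # xs)" using w span_list_as_span[OF Cons.prems] by simp
    then obtain c where "w = lincomb_list c (v # xs)" by (auto elim: in_span_listE)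
    moreover have "y \<bullet> lincomb_list c us = 0"
      if "set us \<subseteq> carrier_vec n" "\<And>u. u \<in> set us \<Longrightarrow> y \<bullet> u = 0" for c us
      using that
    proof (induction us arbitrary: c)
      case (Cons u us)
      have "lincomb_list (c \<circ> Suc) us \<in> carrier_vec n"
        using Cons.prems by (intro lincomb_list_carrier) auto
      then show ?case using Cons y
        by (simp add: lincomb_list_Cons scalar_prod_add_distrib[of _ n])
    qed (use y in simp)
    ultimately show ?thesis using gen Cons.prems by blast
  qed
  have add_back: "b = (b - a) + a" and sub_neg: "b - a = b + (- 1) \<cdot>\<^sub>v a"
    if "b \<in> carrier_vec n" "a \<in> carrier_vec n" for a b :: "real vec"
    using that by (auto intro!: eq_vecI)
  define w where "w = v - P *\<^sub>v v"
  have Pv: "P *\<^sub>v v \<in> carrier_vec n" using Pc v by auto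
  have wc: "w \<in> carrier_vec n" unfolding w_def using v Pv by auto
  have wS: "w \<bullet> u = 0" if "u \<in> ?S" for u using PO[OF v that] by (simp add: w_def)
  have v_eq: "v = w + P *\<^sub>v v" unfolding w_def using v Pv by (rule add_back)
  have wT: "w \<in> ?T"
  proof -
    have "w = v + (- 1) \<cdot>\<^sub>v (P *\<^sub>v v)" unfolding w_def using v Pv by (rule sub_neg)
    moreover have "(- 1) \<cdot>\<^sub>v (P *\<^sub>v v) \<in> ?T"
      using PS[OF v] ST Cons.prems by (intro smult_in_span) auto
    ultimately show ?thesis using span_add1[OF Cons.prems vT] by simp
  qed
  define Q where "Q = P + mat n n (\<lambda>(i,j). w $ i * w $ j / (w \<bullet> w))"
  have Qc: "Q \<in> carrier_mat n n" using Pc by (simp add: Q_def)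
  have Qx: "Q *\<^sub>v x = P *\<^sub>v x + (w \<bullet> x / (w \<bullet> w)) \<cdot>\<^sub>v w" if x: "x \<in> carrier_vec n" for x
  proof (rule eq_vecI)
    fix i assume "i < dim_vec (P *\<^sub>v x + (w \<bullet> x / (w \<bullet> w)) \<cdot>\<^sub>v w)"
    then have i: "i < n" using wc by simp
    have "(\<Sum>j<n. w $ i * w $ j / (w \<bullet> w) * x $ j) = (w \<bullet> x / (w \<bullet> w)) * w $ i"
      using x by (simp add: scalar_prod_def[of w x] atLeast0LessThan sum_distrib_right
          sum_divide_distrib sum_distrib_left field_simps)
    then show "(Q *\<^sub>v x) $ i = (P *\<^sub>v x + (w \<bullet> x / (w \<bullet> w)) \<cdot>\<^sub>v w) $ i"
      using i Pc x wc
      by (simp add: Q_def scalar_prod_def atLeast0LessThan distrib_right sum.distrib)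
  qed (use Pc wc in \<open>simp add: Q_def\<close>)
  have "is_orth_proj n ?T Q"
    unfolding is_orth_proj_def
  proof (intro conjI ballI Qc)
    fix x :: "real vec" assume x: "x \<in> carrier_vec n"
    have Px: "P *\<^sub>v x \<in> carrier_vec n" using Pc x by auto
    have cw: "(w \<bullet> x / (w \<bullet> w)) \<cdot>\<^sub>v w \<in> ?T"
      using wT Cons.prems by (intro smult_in_span) auto
    show "Q *\<^sub>v x \<in> ?T"
      unfolding Qx[OF x] by (rule span_add1[OF Cons.prems]) (use PS[OF x] ST cw in auto)
    have Qxc: "Q *\<^sub>v x \<in> carrier_vec n" using Qc x by auto
    have decomp: "(x - Q *\<^sub>v x) \<bullet> u = (x - P *\<^sub>v x) \<bullet> u - (w \<bullet> x / (w \<bullet> w)) * (w \<bullet> u)"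
      if "u \<in> carrier_vec n" for u
      unfolding Qx[OF x] using x Px wc that
      by (simp add: minus_scalar_prod_distrib[of _ n] add_scalar_prod_distrib[of _ n])
    have oS: "(x - Q *\<^sub>v x) \<bullet> u = 0" if "u \<in> ?S" for u
      using decomp[of u] PO[OF x that] wS[OF that] that Sc by auto
    have "(x - P *\<^sub>v x) \<bullet> w = w \<bullet> x"
      using x Px wc wS[OF PS[OF x]]
      by (simp add: comm_scalar_prod[of _ n w] scalar_prod_minus_distrib[of _ n])
    moreover have "w = 0\<^sub>v n" if "w \<bullet> w = 0"
      using that wc by (simp add: scalar_prod_def sum_nonneg_eq_0_iff) (auto intro!: eq_vecI)
    ultimately have ow: "(x - Q *\<^sub>v x) \<bullet> w = 0"
      using decomp[OF wc] x wc by (cases "w \<bullet> w = 0") auto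
    have "(x - Q *\<^sub>v x) \<bullet> v = (x - Q *\<^sub>v x) \<bullet> w + (x - Q *\<^sub>v x) \<bullet> (P *\<^sub>v v)"
      by (subst v_eq, rule scalar_prod_add_distrib[of _ n]) (use x Qxc wc Pv in auto)
    then have ov: "(x - Q *\<^sub>v x) \<bullet> v = 0" using ow oS PS[OF v] by simp
    have "(x - Q *\<^sub>v x) \<bullet> u = 0" if "u \<in> set (v # xs)" for u
      using that ov oS span_mem[OF xs] by auto
    note gen = this
    have c: "x - Q *\<^sub>v x \<in> carrier_vec n" using x Qxc by simp
    fix u assume u: "u \<in> ?T"
    show "(x - Q *\<^sub>v x) \<bullet> u = 0" by (rule ortho[OF c gen u])
  qed
  then show ?case by blast
qed

lemma is_orth_proj_unique:
  assumes P: "is_orth_proj n W P" and Q: "is_orth_proj n W Q"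
  shows "P = Q"
proof (rule eq_matI)
  have Pc: "P \<in> carrier_mat n n" and Qc: "Q \<in> carrier_mat n n"
    using P Q by (auto simp: is_orth_proj_def)
  have eq: "P *\<^sub>v x = Q *\<^sub>v x" if x: "x \<in> carrier_vec n" for x
  proof -
    define y where "y = P *\<^sub>v x - Q *\<^sub>v x"
    have c: "P *\<^sub>v x \<in> carrier_vec n" "Q *\<^sub>v x \<in> carrier_vec n" using Pc Qc x by auto
    have y: "y \<in> carrier_vec n" unfolding y_def using c by auto
    have z: "(x - P *\<^sub>v x) \<bullet> u = 0 \<and> (x - Q *\<^sub>v x) \<bullet> u = 0" if "u \<in> W" for u
      using P Q x that by (auto simp: is_orth_proj_def)
    have "y \<bullet> u = 0" if "u \<in> W" "u \<in> carrier_vec n" for u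
      using z[OF that(1)] c x that by (simp add: y_def minus_scalar_prod_distrib[of _ n])
    moreover have "P *\<^sub>v x \<in> W" "Q *\<^sub>v x \<in> W" using P Q x by (auto simp: is_orth_proj_def)
    ultimately have "y \<bullet> (P *\<^sub>v x) = 0" "y \<bullet> (Q *\<^sub>v x) = 0" using c by auto
    then have "y \<bullet> y = 0" using c y
      by (subst (2) y_def) (simp add: scalar_prod_minus_distrib[of _ n])
    then have "\<And>i. i < n \<Longrightarrow> y $ i = 0"
      using y by (auto simp: scalar_prod_def sum_nonneg_eq_0_iff)
    moreover have "a = b" if "\<And>i. i < n \<Longrightarrow> (a - b) $ i = 0"
      "a \<in> carrier_vec n" "b \<in> carrier_vec n" for a b :: "real vec"
      using that by (intro eq_vecI) auto
    ultimately show ?thesis using c unfolding y_def by blast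
  qed
  fix i j assume "i < dim_row Q" "j < dim_col Q"
  then have ij: "i < n" "j < n" using Qc by auto
  have "P $$ (i,j) = (P *\<^sub>v unit_vec n j) $ i" "Q $$ (i,j) = (Q *\<^sub>v unit_vec n j) $ i"
    using ij Pc Qc by (auto simp: scalar_prod_right_unit)
  then show "P $$ (i,j) = Q $$ (i,j)" using eq by simp
qed (use P Q in \<open>auto simp: is_orth_proj_def\<close>)

end

lemma is_orth_proj_orth_proj:
  "is_orth_proj (dim_row Z) (vec_space.col_space (dim_row Z) Z) (orth_proj Z)"
proof -
  have "\<exists>P. is_orth_proj (dim_row Z) (vec_space.col_space (dim_row Z) Z) P"
    unfolding vec_space.col_space_def
    by (rule ex_is_orth_proj) (metis carrier_matI cols_dim)
  then have "\<exists>!P. is_orth_proj (dim_row Z) (vec_space.col_space (dim_row Z) Z) P"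
    using is_orth_proj_unique by (rule ex_ex1I)
  then show ?thesis
    unfolding orth_proj_def by (rule theI')
qed

text \<open>The singular values are indexed from 1, whereas matrix entries are indexed from 0.\<close>

definition sing_mat :: "nat \<Rightarrow> nat \<Rightarrow> (nat \<Rightarrow> real) \<Rightarrow> real mat" where
  "sing_mat n m \<sigma> = mat n m (\<lambda>(i, j). if i = j then \<sigma> (Suc i) else 0)"

definition is_svd ::
    "nat \<Rightarrow> nat \<Rightarrow> real mat \<Rightarrow> real mat \<Rightarrow> (nat \<Rightarrow> real) \<Rightarrow> real mat \<Rightarrow> bool" where
  "is_svd n m A U \<sigma> V \<longleftrightarrow>
     U \<in> carrier_mat n n \<and> U\<^sup>T * U = 1\<^sub>m n \<and> V \<in> carrier_mat m m \<and> V\<^sup>T * V = 1\<^sub>m m \<and>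
     (\<forall>i\<in>{1..m}. 0 \<le> \<sigma> i) \<and> (\<forall>i\<in>{1..m}. \<forall>j\<in>{1..m}. i \<le> j \<longrightarrow> \<sigma> j \<le> \<sigma> i) \<and>
     A = U * sing_mat n m \<sigma> * V\<^sup>T"

definition first_cols :: "nat \<Rightarrow> real mat \<Rightarrow> real mat" where
  "first_cols k B = mat_of_cols (dim_row B) (take k (cols B))"

definition remaining_cols :: "nat \<Rightarrow> real mat \<Rightarrow> real mat" where
  "remaining_cols k B = mat_of_cols (dim_row B) (drop k (cols B))"

definition svd_tail ::
    "nat \<Rightarrow> nat \<Rightarrow> nat \<Rightarrow> real mat \<Rightarrow> (nat \<Rightarrow> real) \<Rightarrow> real mat \<Rightarrow> real mat" where
  "svd_tail n m k U \<sigma> V =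
     remaining_cols k U * sing_mat (n - k) (m - k) (\<lambda>i. \<sigma> (k + i)) * (remaining_cols k V)\<^sup>T"

definition power_scheme :: "nat \<Rightarrow> real mat \<Rightarrow> real mat" where
  "power_scheme q A = ((A * A\<^sup>T) ^\<^sub>m q) * A"

definition std_gaussian_vec :: "nat \<Rightarrow> (nat \<Rightarrow> real) measure" where
  "std_gaussian_vec m = PiM {..<m} (\<lambda>_. density lborel std_normal_density)"

text \<open>A random vector in dimension \<open>m\<close> is represented by its coordinate function on \<open>{..<m}\<close>,
  since the type of matrices carries no measurable structure.\<close>

definition col_coords :: "nat \<Rightarrow> real mat \<Rightarrow> nat \<Rightarrow> nat \<Rightarrow> real" where
  "col_coords m B j = (\<lambda>i\<in>{..<m}. B $$ (i, j))"

definition std_gaussian_mat :: "'a measure \<Rightarrow> nat \<Rightarrow> nat \<Rightarrow> ('a \<Rightarrow> real mat) \<Rightarrow> bool" where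
  "std_gaussian_mat M m p G \<longleftrightarrow>
     (\<forall>\<omega>\<in>space M. G \<omega> \<in> carrier_mat m p) \<and>
     prob_space.indep_vars M (\<lambda>_. PiM {..<m} (\<lambda>_. borel)) (\<lambda>j \<omega>. col_coords m (G \<omega>) j) {..<p} \<and>
     (\<forall>j<p. distr M (PiM {..<m} (\<lambda>_. borel)) (\<lambda>\<omega>. col_coords m (G \<omega>) j) = std_gaussian_vec m)"

definition phi :: "real \<Rightarrow> real" where
  "phi x = x / sqrt (1 + x\<^sup>2)"

text \<open>Below \<open>\<sigma> (k + 1) / \<sigma> i\<close> is \<open>\<gamma>\<^sub>i\<close>, and \<open>r\<close> is the rank of the matrix.\<close>

definition c_bound :: "(nat \<Rightarrow> real) \<Rightarrow> nat \<Rightarrow> nat \<Rightarrow> nat \<Rightarrow> nat \<Rightarrow> real" where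
  "c_bound \<sigma> r p q k =
     \<sigma> (k + 1) / sqrt (real p - real k - 1) * sqrt (\<Sum>i=1..k. (\<sigma> (k + 1) / \<sigma> i) ^ (4 * q))
     + \<sigma> k * sqrt (\<Sum>i=k+1..r. (\<sigma> i / \<sigma> k) ^ (4 * q + 2))
         * (exp 1 * sqrt (real p) / (real p - real k))"

definition d_bound :: "(nat \<Rightarrow> real) \<Rightarrow> nat \<Rightarrow> nat \<Rightarrow> nat \<Rightarrow> nat \<Rightarrow> real" where
  "d_bound \<sigma> r p q k =
     1 / sqrt (real p - real k - 1) * sqrt (\<Sum>i=1..k. (\<sigma> (k + 1) / \<sigma> i) ^ (4 * q + 2))
     + sqrt (\<Sum>i=k+1..r. (\<sigma> i / \<sigma> k) ^ (4 * q + 2))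
         * (exp 1 * sqrt (real p) / (real p - real k))"

end

theory Submission
  imports Defs
begin

text \<open>Write \<open>X = V\<^sup>T G\<close>, let \<open>H\<close> be the first \<open>k\<close> rows of \<open>X\<close> and \<open>K\<close> the
  remaining ones. As the Gaussian measure is rotation invariant, \<open>X\<close> is again standard Gaussian. If the
  columns of \<open>T\<close> are dual to the rows of \<open>H\<close>, testing the projection residual on combinations of the columns
  of \<open>Z T\<close> bounds the difference of the two norms by \<open>c = \<parallel>S K T \<delta>\<parallel>\<close> for diagonal matrices \<open>S\<close> and \<open>\<delta>\<close>,
  or, for a different \<open>\<delta>\<close> and after optimising the scaling of the combination, by \<open>phi c * \<sigma> 1\<close>.

  Given \<open>H\<close>, Chevet's inequality bounds the mean of \<open>\<parallel>S K T \<delta>\<parallel>\<close> by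
  \<open>\<parallel>S\<parallel> \<parallel>T \<delta>\<parallel>\<^sub>F + \<parallel>S\<parallel>\<^sub>F \<parallel>T \<delta>\<parallel>\<close>, where the index \<open>F\<close> marks Frobenius norms. It is derived from Slepian's
  inequality, which is obtained by exchanging small Gaussian increments inside the smooth maximum
  \<open>ln (\<Sum>i. exp (w i))\<close>. The norms of \<open>T\<close> are controlled through single vectors: for fixed \<open>g\<close>,
  \<open>\<bar>g\<bar> / \<bar>T g\<bar>\<close> is the distance of a Gaussian vector from a random subspace of dimension \<open>k - 1\<close>, hence
  a chi variable with \<open>p - k + 1\<close> degrees of freedom. Coordinate vectors \<open>g\<close> give the Frobenius norm.
  For the operator norm \<open>g\<close> is taken Gaussian as well, with \<open>d = p - k\<close>: a Gaussian vector has a component along the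
  top singular direction of \<open>T\<close>, so \<open>\<parallel>T\<parallel> ^ d\<close> times the \<open>d\<close>-th absolute Gaussian moment is at most the
  mean of \<open>\<bar>T g\<bar> ^ d\<close>; the constant \<open>exp 1 * sqrt p / d\<close> results from elementary estimates of
  the moments. Finally \<open>phi\<close> is concave.\<close>

section \<open>Rotation invariance of the Gaussian measure\<close>

text \<open>The exponent \<open>d = p - k\<close> is the largest integer for which a chi variable
  with \<open>d + 1\<close> degrees of freedom has a finite inverse moment, and this moment is
  \<open>1 / abs_moment d\<close>. Passing from a Gaussian argument to the operator norm costs
  another factor \<open>abs_moment d\<close>, and the norm of a Gaussian vector in dimension
  \<open>k\<close> contributes \<open>sqrt p ^ d\<close> because \<open>p = k + d\<close>. Since the
  square of \<open>abs_moment d\<close> is at least \<open>(d / exp 1) ^ d\<close>, the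
  \<open>d\<close>-th root is at most \<open>exp 1 * sqrt p / d\<close>. The obstacle is that
  neither finiteness nor measurability is given beforehand: \<open>H\<close> may have dependent
  rows, \<open>orth_proj\<close> is a definite description, and matrices carry no sigma-algebra.
  Hence norms of \<open>T g\<close> become suprema over rational vectors in \<open>ennreal\<close>,
  a singular \<open>H\<close> receives the bound infinity, and Jensen's inequality takes the form of
  tangent lines whose terms are integrated separately. Chevet's inequality and its consequence speak
  of an arbitrary function that lies below every bound of the bilinear form. So one theorem serves
  both the norm difference and its image under the tangent of \<open>phi\<close>.\<close>

definition std_gauss :: "real measure" where
  "std_gauss = density lborel std_normal_density"

lemma sets_std_gauss [simp, measurable_cong]: "sets std_gauss = sets borel"
  by (simp add: std_gauss_def)

lemma space_std_gauss [simp]: "space std_gauss = UNIV"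
  by (simp add: std_gauss_def)

lemma prob_space_std_gauss: "prob_space std_gauss"
  unfolding std_gauss_def by (rule prob_space_normal_density) simp

interpretation SG: prob_space std_gauss by (rule prob_space_std_gauss)

interpretation PG: product_sigma_finite "\<lambda>_. std_gauss"
  unfolding product_sigma_finite_def using SG.sigma_finite_measure_axioms by simp

interpretation PS: pair_sigma_finite std_gauss std_gauss ..

lemma nn_integral_std_gauss:
  assumes [measurable]: "f \<in> borel_measurable borel"
  shows "(\<integral>\<^sup>+x. f x \<partial>std_gauss) = (\<integral>\<^sup>+x. ennreal (std_normal_density x) * f x \<partial>lborel)"
  unfolding std_gauss_def by (subst nn_integral_density) auto

text \<open>The rotation is split into two one-dimensional affine substitutions:
  \<open>x = (u - s * y) / c\<close> at fixed \<open>y\<close>, then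
  \<open>y = s * u + c * v\<close> at fixed \<open>u\<close>. Their Jacobian factors cancel, the
  division by \<open>c\<close> being the reason for \<open>c \<noteq> 0\<close>, and the product
  density depends on the norm only.\<close>

lemma std_gauss_rotate:
  fixes c s :: real
  assumes [measurable]: "f \<in> borel_measurable borel" and cs: "c\<^sup>2 + s\<^sup>2 = 1" and c: "c \<noteq> 0"
  shows "(\<integral>\<^sup>+x. \<integral>\<^sup>+y. f (c * x + s * y, c * y - s * x) \<partial>std_gauss \<partial>std_gauss)
       = (\<integral>\<^sup>+x. \<integral>\<^sup>+y. f (x, y) \<partial>std_gauss \<partial>std_gauss)"
proof -
  let ?D = "\<lambda>x y. ennreal (std_normal_density x) * ennreal (std_normal_density y)"
  have pair: "(\<integral>\<^sup>+x. \<integral>\<^sup>+y. g x y \<partial>std_gauss \<partial>std_gauss) = (\<integral>\<^sup>+x. \<integral>\<^sup>+y. ?D x y * g x y \<partial>lborel \<partial>lborel)"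
    if [measurable]: "case_prod g \<in> borel_measurable (borel \<Otimes>\<^sub>M borel)" for g
    by (subst nn_integral_std_gauss, measurable, intro nn_integral_cong, subst nn_integral_std_gauss)
       (auto simp: nn_integral_cmult[symmetric] mult.assoc)
  have D: "?D ((u - s * (s * u + c * v)) / c) (s * u + c * v) = ?D u v" for u v
  proof -
    have s2: "s * s = 1 - c * c" using cs by (simp add: power2_eq_square)
    have e: "(u - s * (s * u + c * v)) / c = c * u - s * v"
    proof -
      have "u - s * (s * u + c * v) = u - (s * s) * u - c * s * v" by (simp add: algebra_simps)
      also have "\<dots> = c * (c * u - s * v)" unfolding s2 by (simp add: algebra_simps)
      finally show ?thesis using c by simp
    qed
    have "(c * u - s * v)\<^sup>2 + (s * u + c * v)\<^sup>2 = (c\<^sup>2 + s\<^sup>2) * (u\<^sup>2 + v\<^sup>2)"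
      by (simp add: power2_eq_square algebra_simps)
    then have "(c * u - s * v)\<^sup>2 + (s * u + c * v)\<^sup>2 = u\<^sup>2 + v\<^sup>2" using cs by simp
    moreover have *: "std_normal_density x * std_normal_density y = exp (-(x\<^sup>2 + y\<^sup>2)/2) / (2 * pi)" for x y
      by (simp add: std_normal_density_def exp_add[symmetric] add_divide_distrib diff_divide_distrib power2_eq_square[symmetric])
    ultimately show ?thesis unfolding e by (simp add: ennreal_mult[symmetric] *)
  qed
  have arg: "c * (s * u + c * v) - s * ((u - s * (s * u + c * v)) / c) = v" for u v
  proof -
    have s2: "s * s = 1 - c * c" using cs by (simp add: power2_eq_square)
    have "u - s * (s * u + c * v) = u - (s * s) * u - c * s * v" by (simp add: algebra_simps)
    also have "\<dots> = c * (c * u - s * v)" unfolding s2 by (simp add: algebra_simps)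
    finally have e: "(u - s * (s * u + c * v)) / c = c * u - s * v" using c by simp
    have "c * (s * u + c * v) - s * (c * u - s * v) = (c * c + s * s) * v" by (simp add: algebra_simps)
    then show ?thesis unfolding e s2 by simp
  qed
  have "(\<integral>\<^sup>+x. \<integral>\<^sup>+y. f (c * x + s * y, c * y - s * x) \<partial>std_gauss \<partial>std_gauss)
      = (\<integral>\<^sup>+x. \<integral>\<^sup>+y. ?D x y * f (c * x + s * y, c * y - s * x) \<partial>lborel \<partial>lborel)"
    by (rule pair) measurable
  also have "\<dots> = (\<integral>\<^sup>+y. \<integral>\<^sup>+x. ?D x y * f (c * x + s * y, c * y - s * x) \<partial>lborel \<partial>lborel)"
    by (rule lborel_pair.Fubini') measurable
  also have "\<dots> = (\<integral>\<^sup>+y. ennreal \<bar>1 / c\<bar> * (\<integral>\<^sup>+u. ?D ((u - s * y) / c) y * f (u, c * y - s * ((u - s * y) / c)) \<partial>lborel) \<partial>lborel)"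
  proof (intro nn_integral_cong)
    fix y :: real
    have e: "- s * y / c + 1 / c * u = (u - s * y) / c" "c * (- s * y / c + 1 / c * u) + s * y = u" for u
      using c by (auto simp: field_simps)
    show "(\<integral>\<^sup>+x. ?D x y * f (c * x + s * y, c * y - s * x) \<partial>lborel)
      = ennreal \<bar>1 / c\<bar> * (\<integral>\<^sup>+u. ?D ((u - s * y) / c) y * f (u, c * y - s * ((u - s * y) / c)) \<partial>lborel)"
      by (subst nn_integral_real_affine[where c = "1 / c" and t = "- s * y / c"]) (use c e in \<open>simp_all only:\<close>, auto)
  qed
  also have "\<dots> = ennreal \<bar>1 / c\<bar> * (\<integral>\<^sup>+y. \<integral>\<^sup>+u. ?D ((u - s * y) / c) y * f (u, c * y - s * ((u - s * y) / c)) \<partial>lborel \<partial>lborel)"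
    by (rule nn_integral_cmult) measurable
  also have "(\<integral>\<^sup>+y. \<integral>\<^sup>+u. ?D ((u - s * y) / c) y * f (u, c * y - s * ((u - s * y) / c)) \<partial>lborel \<partial>lborel)
     = (\<integral>\<^sup>+u. \<integral>\<^sup>+y. ?D ((u - s * y) / c) y * f (u, c * y - s * ((u - s * y) / c)) \<partial>lborel \<partial>lborel)"
    by (rule lborel_pair.Fubini') measurable
  also have "\<dots> = (\<integral>\<^sup>+u. ennreal \<bar>c\<bar> * (\<integral>\<^sup>+v. ?D u v * f (u, v) \<partial>lborel) \<partial>lborel)"
  proof (intro nn_integral_cong)
    fix u
    show "(\<integral>\<^sup>+y. ?D ((u - s * y) / c) y * f (u, c * y - s * ((u - s * y) / c)) \<partial>lborel)
       = ennreal \<bar>c\<bar> * (\<integral>\<^sup>+v. ?D u v * f (u, v) \<partial>lborel)"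
      by (subst nn_integral_real_affine[where c = c and t = "s * u"]) (use c in \<open>simp_all only: D arg\<close>, auto)
  qed
  also have "\<dots> = ennreal \<bar>c\<bar> * (\<integral>\<^sup>+u. \<integral>\<^sup>+v. ?D u v * f (u, v) \<partial>lborel \<partial>lborel)"
    by (rule nn_integral_cmult) measurable
  also have "(\<integral>\<^sup>+u. \<integral>\<^sup>+v. ?D u v * f (u, v) \<partial>lborel \<partial>lborel) = (\<integral>\<^sup>+x. \<integral>\<^sup>+y. f (x, y) \<partial>std_gauss \<partial>std_gauss)"
    by (rule pair[symmetric]) measurable
  finally show ?thesis using c by (simp add: mult.assoc[symmetric] ennreal_mult[symmetric])
qed

text \<open>The mean of \<open>f\<close> at \<open>w\<close> plus a linear combination of the list
  with independent standard Gaussian coefficients. As an iterated integral along a list, it lets two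
  neighbouring vectors be rotated while the rest stays opaque.\<close>

primrec gint :: "('j \<Rightarrow> real) list \<Rightarrow> (('j \<Rightarrow> real) \<Rightarrow> ennreal) \<Rightarrow> ('j \<Rightarrow> real) \<Rightarrow> ennreal" where
  "gint [] f w = f w"
| "gint (v # vs) f w = (\<integral>\<^sup>+x. gint vs f (\<lambda>l. w l + x * v l) \<partial>std_gauss)"

abbreviation bfun :: "('j \<Rightarrow> real) measure" where "bfun \<equiv> PiM UNIV (\<lambda>_. borel)"

lemma measurable_gint [measurable]:
  assumes [measurable]: "f \<in> borel_measurable bfun"
  shows "gint vs f \<in> borel_measurable bfun"
proof (induction vs)
  case (Cons v vs)
  note [measurable] = Cons
  have m: "(\<lambda>(w, x). (\<lambda>l. w l + x * v l)) \<in> bfun \<Otimes>\<^sub>M std_gauss \<rightarrow>\<^sub>M bfun"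
    unfolding case_prod_beta'
  proof (rule measurable_PiM_single')
    fix l :: 'a
    have "(\<lambda>p. fst p l) \<in> borel_measurable (bfun \<Otimes>\<^sub>M std_gauss)"
      by (rule measurable_compose[OF measurable_fst]) simp
    moreover have "snd \<in> borel_measurable (bfun \<Otimes>\<^sub>M std_gauss)"
      using measurable_snd[of bfun std_gauss] by (simp cong: measurable_cong_sets)
    ultimately show "(\<lambda>p. fst p l + snd p * v l) \<in> borel_measurable (bfun \<Otimes>\<^sub>M std_gauss)"
      by simp
  qed (auto simp: space_PiM)
  have "(\<lambda>p. gint vs f (case p of (w, x) \<Rightarrow> \<lambda>l. w l + x * v l)) \<in> borel_measurable (bfun \<Otimes>\<^sub>M std_gauss)"
    by (rule measurable_compose[OF m Cons])
  then have "(\<lambda>w. \<integral>\<^sup>+x. gint vs f (\<lambda>l. w l + x * v l) \<partial>std_gauss) \<in> borel_measurable bfun"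
    by (intro SG.borel_measurable_nn_integral) (simp add: case_prod_beta')
  then show ?case by (simp cong: measurable_cong)
qed simp

text \<open>Plane rotations preserve this relation, and each list of vectors can be brought into a normal form that
  depends only on its covariance.\<close>

definition gequiv :: "('j \<Rightarrow> real) list \<Rightarrow> ('j \<Rightarrow> real) list \<Rightarrow> bool" where
  "gequiv vs ws \<longleftrightarrow> (\<forall>f\<in>borel_measurable bfun. \<forall>w. gint vs f w = gint ws f w) \<and> length vs = length ws \<and>
     (\<forall>l l'. (\<Sum>v\<leftarrow>vs. v l * v l') = (\<Sum>v\<leftarrow>ws. v l * v l'))"

lemma gequiv_refl: "gequiv vs vs" by (simp add: gequiv_def)

lemma gequiv_trans [trans]: "gequiv us vs \<Longrightarrow> gequiv vs ws \<Longrightarrow> gequiv us ws"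
  by (simp add: gequiv_def)

lemma gequiv_Cons: "gequiv vs ws \<Longrightarrow> gequiv (v # vs) (v # ws)"
  by (simp add: gequiv_def)

lemma gint_pair_measurable:
  assumes f: "f \<in> borel_measurable bfun"
  shows "(\<lambda>(x, y). f (\<lambda>l. w l + x * u l + y * v l)) \<in> borel_measurable borel"
proof -
  have "(\<lambda>p::real \<times> real. (\<lambda>l. w l + fst p * u l + snd p * v l)) \<in> borel \<rightarrow>\<^sub>M bfun"
    unfolding borel_prod[symmetric] by (rule measurable_PiM_single') (auto simp: space_PiM)
  from measurable_compose[OF this f] show ?thesis by (simp add: case_prod_beta')
qed

text \<open>Because \<open>(c * x + s * y) * u + (c * y - s * x) * v = x * (c * u - s * v) + y * (s
  * u + c * v)\<close>, turning the pair of coefficients amounts to turning the pair of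
  vectors.\<close>

lemma gequiv_rotate:
  assumes cs: "c\<^sup>2 + s\<^sup>2 = 1" and c: "c \<noteq> 0"
  shows "gequiv (u # v # vs) ((\<lambda>l. c * u l - s * v l) # (\<lambda>l. s * u l + c * v l) # vs)"
  unfolding gequiv_def
proof (intro conjI ballI allI)
  fix f :: "('a \<Rightarrow> real) \<Rightarrow> ennreal" and w assume f: "f \<in> borel_measurable bfun"
  let ?F = "\<lambda>(x, y). gint vs f (\<lambda>l. w l + x * u l + y * v l)"
  have "gint (u # v # vs) f w = (\<integral>\<^sup>+x. \<integral>\<^sup>+y. ?F (x, y) \<partial>std_gauss \<partial>std_gauss)" by simp
  also have "\<dots> = (\<integral>\<^sup>+x. \<integral>\<^sup>+y. ?F (c * x + s * y, c * y - s * x) \<partial>std_gauss \<partial>std_gauss)"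
    by (rule std_gauss_rotate[OF _ cs c, symmetric]) (rule gint_pair_measurable[OF measurable_gint[OF f]])
  also have "\<dots> = gint ((\<lambda>l. c * u l - s * v l) # (\<lambda>l. s * u l + c * v l) # vs) f w"
    by (simp add: algebra_simps)
  finally show "gint (u # v # vs) f w = gint ((\<lambda>l. c * u l - s * v l) # (\<lambda>l. s * u l + c * v l) # vs) f w" .
next
  fix l l'
  have "(c * u l - s * v l) * (c * u l' - s * v l') + (s * u l + c * v l) * (s * u l' + c * v l')
      = (c\<^sup>2 + s\<^sup>2) * (u l * u l' + v l * v l')" by (simp add: power2_eq_square algebra_simps)
  then show "(\<Sum>v\<leftarrow>u # v # vs. v l * v l') = (\<Sum>v\<leftarrow>(\<lambda>l. c * u l - s * v l) # (\<lambda>l. s * u l + c * v l) # vs. v l * v l')"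
    using cs by simp
qed simp

text \<open>One column of a QR factorisation by Givens rotations: working from the end of the list,
  coordinate \<open>l\<close> is pushed into the head.\<close>

lemma gequiv_eliminate:
  "\<exists>v' vs'. gequiv (v # vs) (v' # vs') \<and> (\<forall>u\<in>set vs'. u l = 0)"
proof (induction vs arbitrary: v)
  case Nil
  show ?case by (rule exI[of _ v], rule exI[of _ "[]"]) (simp add: gequiv_refl)
next
  case (Cons u vs)
  from Cons[of u] obtain u' vs' where e: "gequiv (u # vs) (u' # vs')" and z: "\<forall>x\<in>set vs'. x l = 0" by blast
  have e1: "gequiv (v # u # vs) (v # u' # vs')" using e by (rule gequiv_Cons)
  show ?case
  proof (cases "u' l = 0")
    case True
    then show ?thesis using e1 z by (intro exI[of _ v] exI[of _ "u' # vs'"]) auto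
  next
    case False
    define r where "r = sqrt ((v l)\<^sup>2 + (u' l)\<^sup>2)"
    have r2: "r\<^sup>2 = (v l)\<^sup>2 + (u' l)\<^sup>2" by (simp add: r_def)
    have r: "r \<noteq> 0" using False by (simp add: r_def sum_power2_eq_zero_iff)
    show ?thesis
    proof (cases "v l = 0")
      case True
      \<comment> \<open>The rotation that clears \<open>u' l\<close> would have cosine
        \<open>v l / r = 0\<close>, which \<open>gequiv_rotate\<close> excludes; two eighth turns
        make up the quarter turn.\<close>
      have sw3: "gequiv (v # u' # vs') ((\<lambda>l. - u' l) # v # vs')"
      proof -
        have a: "gequiv (v # u' # vs') ((\<lambda>l. (1/sqrt 2) * v l - (1/sqrt 2) * u' l) # (\<lambda>l. (1/sqrt 2) * v l + (1/sqrt 2) * u' l) # vs')"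
          by (rule gequiv_rotate) (auto simp: power2_eq_square)
        have b: "gequiv ((\<lambda>l. (1/sqrt 2) * v l - (1/sqrt 2) * u' l) # (\<lambda>l. (1/sqrt 2) * v l + (1/sqrt 2) * u' l) # vs')
          ((\<lambda>l. (1/sqrt 2) * ((1/sqrt 2) * v l - (1/sqrt 2) * u' l) - (1/sqrt 2) * ((1/sqrt 2) * v l + (1/sqrt 2) * u' l)) #
           (\<lambda>l. (1/sqrt 2) * ((1/sqrt 2) * v l - (1/sqrt 2) * u' l) + (1/sqrt 2) * ((1/sqrt 2) * v l + (1/sqrt 2) * u' l)) # vs')"
          by (rule gequiv_rotate) (auto simp: power2_eq_square)
        have "(\<lambda>l. (1/sqrt 2) * ((1/sqrt 2) * v l - (1/sqrt 2) * u' l) - (1/sqrt 2) * ((1/sqrt 2) * v l + (1/sqrt 2) * u' l)) = (\<lambda>l. - u' l)"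
          "(\<lambda>l. (1/sqrt 2) * ((1/sqrt 2) * v l - (1/sqrt 2) * u' l) + (1/sqrt 2) * ((1/sqrt 2) * v l + (1/sqrt 2) * u' l)) = v"
          by (auto simp: algebra_simps fun_eq_iff)
        with gequiv_trans[OF a b] show ?thesis by simp
      qed
      show ?thesis using gequiv_trans[OF e1 sw3] z True
        by (intro exI[of _ "\<lambda>l. - u' l"] exI[of _ "v # vs'"]) auto
    next
      case False
      have "gequiv (v # u' # vs') ((\<lambda>x. (v l / r) * v x - (- (u' l / r)) * u' x) # (\<lambda>x. (- (u' l / r)) * v x + (v l / r) * u' x) # vs')"
        by (rule gequiv_rotate) (use r r2 False in \<open>auto simp: power_divide add_divide_distrib[symmetric]\<close>)
      from gequiv_trans[OF e1 this] show ?thesis using z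
        by (intro exI[of _ "\<lambda>x. (v l / r) * v x - (- (u' l / r)) * u' x"] exI[of _ "(\<lambda>x. (- (u' l / r)) * v x + (v l / r) * u' x) # vs'"]) auto
    qed
  qed
qed
lemma std_gauss_uminus:
  assumes [measurable]: "f \<in> borel_measurable borel"
  shows "(\<integral>\<^sup>+x. f (- x) \<partial>std_gauss) = (\<integral>\<^sup>+x. f x \<partial>std_gauss)"
proof -
  have "(\<integral>\<^sup>+x. f x \<partial>std_gauss) = (\<integral>\<^sup>+x. ennreal (std_normal_density x) * f x \<partial>lborel)"
    by (rule nn_integral_std_gauss) simp
  also have "\<dots> = (\<integral>\<^sup>+x. ennreal (std_normal_density x) * f (- x) \<partial>lborel)"
    by (subst nn_integral_real_affine[where c = "-1" and t = 0]) (auto simp: std_normal_density_def)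
  also have "\<dots> = (\<integral>\<^sup>+x. f (- x) \<partial>std_gauss)"
    by (rule nn_integral_std_gauss[symmetric]) simp
  finally show ?thesis ..
qed

text \<open>Once \<open>l\<close> is eliminated, the covariances force the head to be plus or minus
  the unit vector at \<open>l\<close>, and the rest of the list has the covariances belonging to
  \<open>ls\<close>. The symmetry of the Gaussian measure absorbs the sign. When no coordinate is
  left, all vectors vanish.\<close>

lemma gint_orthonormal:
  assumes f: "f \<in> borel_measurable bfun" and "distinct ls"
    and "\<And>l l'. (\<Sum>v\<leftarrow>vs. v l * v l') = (if l = l' \<and> l \<in> set ls then 1 else 0)"
  shows "gint vs f w = gint (map (\<lambda>l l'. if l' = l then 1 else 0) ls) f w"
  using assms(2,3)
proof (induction ls arbitrary: vs w)
  case Nil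
  have "gint vs f w = f w" if "\<forall>v\<in>set vs. \<forall>l. v l = 0"
    using that by (induction vs) (auto simp: SG.emeasure_space_1[simplified])
  moreover have "v l = 0" if v: "v \<in> set vs" for v l
  proof -
    have "v l * v l \<le> (\<Sum>v\<leftarrow>vs. v l * v l)"
      by (rule member_le_sum_list) (use v in auto)
    then have "v l * v l \<le> 0" using Nil(2)[of l l] by simp
    then have "v l * v l = 0" using zero_le_square[of "v l"] by linarith
    then show ?thesis by simp
  qed
  ultimately show ?case by simp
next
  case (Cons l ls)
  have "vs \<noteq> []" using Cons.prems(2)[of l l] by auto
  then obtain u us where vs: "vs = u # us" by (cases vs) auto
  obtain v0 vs' where e: "gequiv vs (v0 # vs')" and z: "\<forall>x\<in>set vs'. x l = 0"
    using gequiv_eliminate[of u us l] unfolding vs by blast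
  have cov: "v0 a * v0 b + (\<Sum>v\<leftarrow>vs'. v a * v b) = (if a = b \<and> a \<in> set (l # ls) then 1 else 0)" for a b
    using e Cons.prems(2)[of a b] by (simp add: gequiv_def)
  have zs: "(\<Sum>v\<leftarrow>vs'. v l * v b) = 0" for b
    using z by (induction vs') auto
  have v0l: "v0 l * v0 l = 1" using cov[of l l] zs[of l] by simp
  have v0b: "v0 b = 0" if "b \<noteq> l" for b
  proof -
    have "v0 l * v0 b = 0" using cov[of l b] zs[of b] that by simp
    then show ?thesis using v0l by auto
  qed
  define e0 where "e0 = (\<lambda>l'. if l' = l then 1 else 0 :: real)"
  have v0: "v0 = e0 \<or> v0 = (\<lambda>x. - e0 x)"
  proof -
    have "v0 l = 1 \<or> v0 l = -1" using v0l square_eq_1_iff by blast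
    then show ?thesis using v0b by (auto simp: e0_def fun_eq_iff)
  qed
  have "(\<Sum>v\<leftarrow>vs'. v a * v b) = (if a = b \<and> a \<in> set ls then 1 else 0)" for a b
    using cov[of a b] v0l v0b[of a] v0b[of b] Cons.prems(1) by (cases "a = l"; cases "b = l") auto
  then have IH: "gint vs' f w = gint (map (\<lambda>l l'. if l' = l then 1 else 0) ls) f w" for w
    using Cons.IH Cons.prems(1) by auto
  let ?h = "\<lambda>x. gint (map (\<lambda>l l'. if l' = l then 1 else 0) ls) f (\<lambda>l'. w l' + x * e0 l')"
  have [measurable]: "?h \<in> borel_measurable borel"
  proof -
    have "(\<lambda>x l'. w l' + x * e0 l') \<in> borel \<rightarrow>\<^sub>M bfun"
      by (rule measurable_PiM_single') (auto simp: space_PiM)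
    from measurable_compose[OF this measurable_gint[OF f]] show ?thesis .
  qed
  have "gint vs f w = gint (v0 # vs') f w" using e f by (simp add: gequiv_def)
  also have "\<dots> = (\<integral>\<^sup>+x. ?h x \<partial>std_gauss)"
    using v0
  proof
    assume "v0 = (\<lambda>x. - e0 x)"
    then have "gint (v0 # vs') f w = (\<integral>\<^sup>+x. ?h (- x) \<partial>std_gauss)" by (simp add: IH)
    also have "\<dots> = (\<integral>\<^sup>+x. ?h x \<partial>std_gauss)" by (rule std_gauss_uminus) simp
    finally show ?thesis .
  qed (simp add: IH)
  also have "\<dots> = gint (map (\<lambda>l l'. if l' = l then 1 else 0) (l # ls)) f w"
    by (simp add: e0_def)
  finally show ?case .
qed

lemma measurable_lincomb_bfun:
  "finite I \<Longrightarrow> (\<lambda>x l. w l + (\<Sum>i\<in>I. x i * c i l)) \<in> PiM I (\<lambda>_. borel) \<rightarrow>\<^sub>M bfun"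
  by (rule measurable_PiM_single') (auto simp: space_PiM)

lemma gint_PiM:
  assumes f: "f \<in> borel_measurable bfun"
  shows "distinct xs \<Longrightarrow> gint (map c xs) f w = (\<integral>\<^sup>+x. f (\<lambda>l. w l + (\<Sum>i\<in>set xs. x i * c i l)) \<partial>PiM (set xs) (\<lambda>_. std_gauss))"
proof (induction xs arbitrary: w)
  case Nil
  show ?case by (simp add: PG.nn_integral_empty del: nn_integral_const)
next
  case (Cons a xs)
  have sets: "sets (PiM I (\<lambda>_. std_gauss)) = sets (PiM I (\<lambda>_. borel))" for I :: "'b set"
    by (rule sets_PiM_cong) auto
  have m: "(\<lambda>x. f (\<lambda>l. w l + (\<Sum>i\<in>I. x i * c i l))) \<in> borel_measurable (PiM I (\<lambda>_. std_gauss))" if "finite I" for I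
    using measurable_compose[OF measurable_lincomb_bfun[OF that] f] unfolding measurable_cong_sets[OF sets refl] .
  have "(\<integral>\<^sup>+x. f (\<lambda>l. w l + (\<Sum>i\<in>set (a # xs). x i * c i l)) \<partial>PiM (set (a # xs)) (\<lambda>_. std_gauss))
     = (\<integral>\<^sup>+y. \<integral>\<^sup>+x. f (\<lambda>l. w l + (\<Sum>i\<in>set (a # xs). (x(a := y)) i * c i l)) \<partial>PiM (set xs) (\<lambda>_. std_gauss) \<partial>std_gauss)"
    using Cons.prems m[of "set (a # xs)"] by (simp add: PG.product_nn_integral_insert_rev)
  also have "\<dots> = (\<integral>\<^sup>+y. gint (map c xs) f (\<lambda>l. w l + y * c a l) \<partial>std_gauss)"
  proof (intro nn_integral_cong)
    fix y
    have "(\<Sum>i\<in>set (a # xs). (x(a := y)) i * c i l) = y * c a l + (\<Sum>i\<in>set xs. x i * c i l)" for x l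
    proof -
      have "(\<Sum>i\<in>set xs. (x(a := y)) i * c i l) = (\<Sum>i\<in>set xs. x i * c i l)"
        by (rule sum.cong) (use Cons.prems in auto)
      then show ?thesis using Cons.prems by simp
    qed
    then show "(\<integral>\<^sup>+x. f (\<lambda>l. w l + (\<Sum>i\<in>set (a # xs). (x(a := y)) i * c i l)) \<partial>PiM (set xs) (\<lambda>_. std_gauss))
      = gint (map c xs) f (\<lambda>l. w l + y * c a l)"
      using Cons by (simp add: add.assoc)
  qed
  finally show ?case by simp
qed

lemma sets_PiM_std_gauss [simp, measurable_cong]: "sets (PiM I (\<lambda>_. std_gauss)) = sets (PiM I (\<lambda>_. borel))"
  by (rule sets_PiM_cong) auto

lemma space_PiM_std_gauss [simp]: "space (PiM I (\<lambda>_. std_gauss)) = space (PiM I (\<lambda>_. borel))"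
  by (simp add: space_PiM)

text \<open>Only the columns of \<open>c\<close> have to be orthonormal, so \<open>J\<close> may be
  smaller than \<open>I\<close>: besides rotations, this covers the coordinates of a Gaussian vector
  along an orthonormal system of a subspace.\<close>

theorem nn_integral_PiM_orthonormal:
  fixes c :: "'i \<Rightarrow> 'j \<Rightarrow> real"
  assumes I: "finite I" and J: "finite J"
    and c: "\<And>l l'. l \<in> J \<Longrightarrow> l' \<in> J \<Longrightarrow> (\<Sum>i\<in>I. c i l * c i l') = (if l = l' then 1 else 0)"
    and f: "f \<in> borel_measurable (PiM J (\<lambda>_. borel))"
  shows "(\<integral>\<^sup>+x. f (\<lambda>l\<in>J. \<Sum>i\<in>I. x i * c i l) \<partial>PiM I (\<lambda>_. std_gauss)) = (\<integral>\<^sup>+x. f x \<partial>PiM J (\<lambda>_. std_gauss))"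
proof -
  define f' where "f' = (\<lambda>w. f (restrict w J))"
  \<comment> \<open>Extended by zero, because \<open>gint_orthonormal\<close> prescribes the
    covariances of all pairs of indices, also outside \<open>J\<close>.\<close>
  define c' where "c' = (\<lambda>i l. if l \<in> J then c i l else 0)"
  have f': "f' \<in> borel_measurable bfun" unfolding f'_def
    by (rule measurable_compose[OF measurable_restrict_subset f]) auto
  obtain xs where xs: "set xs = I" "distinct xs" using finite_distinct_list[OF I] by blast
  obtain ls where ls: "set ls = J" "distinct ls" using finite_distinct_list[OF J] by blast
  have "(\<integral>\<^sup>+x. f (\<lambda>l\<in>J. \<Sum>i\<in>I. x i * c i l) \<partial>PiM I (\<lambda>_. std_gauss))
     = (\<integral>\<^sup>+x. f' (\<lambda>l. 0 + (\<Sum>i\<in>set xs. x i * c' i l)) \<partial>PiM (set xs) (\<lambda>_. std_gauss))"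
    unfolding f'_def xs by (intro nn_integral_cong arg_cong[of _ _ f]) (auto simp: c'_def restrict_def)
  also have "\<dots> = gint (map c' xs) f' (\<lambda>l. 0)"
    by (rule gint_PiM[OF f' xs(2), symmetric])
  also have "\<dots> = gint (map (\<lambda>l l'. if l' = l then 1 else 0) ls) f' (\<lambda>l. 0)"
  proof (rule gint_orthonormal[OF f' ls(2)])
    fix l l'
    have "(\<Sum>v\<leftarrow>map c' xs. v l * v l') = (\<Sum>i\<in>I. c' i l * c' i l')"
      using xs by (simp add: sum_list_distinct_conv_sum_set o_def)
    then show "(\<Sum>v\<leftarrow>map c' xs. v l * v l') = (if l = l' \<and> l \<in> set ls then 1 else 0)"
      using c[of l l'] unfolding ls(1) c'_def by (cases "l \<in> J"; cases "l' \<in> J") auto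
  qed
  also have "\<dots> = (\<integral>\<^sup>+x. f' (\<lambda>l. 0 + (\<Sum>i\<in>set ls. x i * (if l = i then 1 else 0))) \<partial>PiM (set ls) (\<lambda>_. std_gauss))"
    by (rule gint_PiM[OF f' ls(2)])
  also have "\<dots> = (\<integral>\<^sup>+x. f x \<partial>PiM J (\<lambda>_. std_gauss))"
    unfolding f'_def ls
  proof (intro nn_integral_cong arg_cong[of _ _ f])
    fix x assume "x \<in> space (PiM J (\<lambda>_. std_gauss))"
    then have "x \<in> extensional J" by (simp add: space_PiM PiE_def)
    then show "(\<lambda>l\<in>J. 0 + (\<Sum>i\<in>J. x i * (if l = i then 1 else 0))) = x"
      using J by (intro extensionalityI[of _ J]) (auto simp: sum.delta' if_distrib cong: if_cong)
  qed
  finally show ?thesis .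
qed

lemma prob_space_PiM_std_gauss: "prob_space (PiM I (\<lambda>_. std_gauss))"
  by (rule prob_space_PiM) (rule prob_space_std_gauss)

section \<open>Moments of chi variables\<close>

text \<open>The exponential factor turns the standard density into \<open>r\<close> times the
  density of a centred normal variable with standard deviation
  \<open>r = 1 / sqrt (1 - 2 * a)\<close>.\<close>

lemma nn_integral_std_gauss_exp_square:
  assumes a: "a < 1/2"
  shows "(\<integral>\<^sup>+x. ennreal (exp (a * x\<^sup>2)) \<partial>std_gauss) = ennreal (1 / sqrt (1 - 2 * a))"
proof -
  define r where "r = 1 / sqrt (1 - 2 * a)"
  have r: "r > 0" "r\<^sup>2 = 1 / (1 - 2 * a)" using a by (auto simp: r_def power_divide)
  have "std_normal_density x * exp (a * x\<^sup>2) = r * normal_density 0 r x" for x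
  proof -
    have "- x\<^sup>2 / 2 + a * x\<^sup>2 = - x\<^sup>2 / (2 * r\<^sup>2)" using a by (simp add: r field_simps)
    moreover have "sqrt (2 * pi * r\<^sup>2) = r * sqrt (2 * pi)" using r(1) by (simp add: real_sqrt_mult)
    ultimately show ?thesis using r by (simp add: normal_density_def exp_add[symmetric])
  qed
  then have "(\<integral>\<^sup>+x. ennreal (exp (a * x\<^sup>2)) \<partial>std_gauss) = (\<integral>\<^sup>+x. ennreal r * ennreal (normal_density 0 r x) \<partial>lborel)"
    using r by (subst nn_integral_std_gauss) (auto simp: ennreal_mult'[symmetric])
  also have "\<dots> = ennreal r * (\<integral>\<^sup>+x. ennreal (normal_density 0 r x) \<partial>lborel)"
    by (rule nn_integral_cmult) simp
  also have "(\<integral>\<^sup>+x. ennreal (normal_density 0 r x) \<partial>lborel) = 1"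
    using r by (subst nn_integral_eq_integral) auto
  finally show ?thesis by (simp add: r_def)
qed

lemma nn_integral_PiM_exp_sum_squares:
  assumes "finite J" and a: "a < 1/2"
  shows "(\<integral>\<^sup>+x. ennreal (exp (a * (\<Sum>l\<in>J. (x l)\<^sup>2))) \<partial>PiM J (\<lambda>_. std_gauss)) = ennreal ((1 / sqrt (1 - 2 * a)) ^ card J)"
proof -
  have "(\<integral>\<^sup>+x. ennreal (exp (a * (\<Sum>l\<in>J. (x l)\<^sup>2))) \<partial>PiM J (\<lambda>_. std_gauss))
      = (\<integral>\<^sup>+x. (\<Prod>l\<in>J. ennreal (exp (a * (x l)\<^sup>2))) \<partial>PiM J (\<lambda>_. std_gauss))"
    using assms by (simp add: sum_distrib_left exp_sum prod_ennreal)
  also have "\<dots> = (\<Prod>l\<in>J. ennreal (1 / sqrt (1 - 2 * a)))"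
    by (subst PG.product_nn_integral_prod) (use assms in \<open>auto simp: nn_integral_std_gauss_exp_square simp del: prod_constant\<close>)
  also have "\<dots> = ennreal ((1 / sqrt (1 - 2 * a)) ^ card J)"
    using a by (subst prod_ennreal) auto
  finally show ?thesis .
qed

lemma nn_integral_Gamma_scaled:
  assumes a: "a > 0" and s: "s > 0"
  shows "(\<integral>\<^sup>+t. ennreal (indicator {0..} t * t powr (a - 1) * exp (- (s * t))) \<partial>lborel) = ennreal (Gamma a / s powr a)"
proof -
  have "ennreal (Gamma a) = (\<integral>\<^sup>+t. ennreal (indicator {0..} t * t powr (a - 1) / exp t) \<partial>lborel)"
    by (rule Gamma_conv_nn_integral_real[OF a])
  also have "\<dots> = ennreal s * (\<integral>\<^sup>+t. ennreal (indicator {0..} (s * t) * (s * t) powr (a - 1) / exp (s * t)) \<partial>lborel)"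
    using s by (subst nn_integral_real_affine[where c = s and t = 0]) auto
  also have "(\<integral>\<^sup>+t. ennreal (indicator {0..} (s * t) * (s * t) powr (a - 1) / exp (s * t)) \<partial>lborel)
     = (\<integral>\<^sup>+t. ennreal (s powr (a - 1)) * ennreal (indicator {0..} t * t powr (a - 1) * exp (- (s * t))) \<partial>lborel)"
    using s by (intro nn_integral_cong)
      (auto simp: ennreal_mult'[symmetric] powr_mult exp_minus field_simps indicator_def zero_le_mult_iff)
  also have "\<dots> = ennreal (s powr (a - 1)) * (\<integral>\<^sup>+t. ennreal (indicator {0..} t * t powr (a - 1) * exp (- (s * t))) \<partial>lborel)"
    by (rule nn_integral_cmult) measurable
  finally have "ennreal (Gamma a) = ennreal (s powr a) * (\<integral>\<^sup>+t. ennreal (indicator {0..} t * t powr (a - 1) * exp (- (s * t))) \<partial>lborel)" (is "_ = _ * ?I")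
    using s by (simp add: mult.assoc[symmetric] ennreal_mult[symmetric] powr_diff)
  then have "ennreal (1 / s powr a) * ennreal (Gamma a) = ennreal (1 / s powr a) * ennreal (s powr a) * ?I"
    by (simp add: mult.assoc)
  then show ?thesis using s a by (simp add: ennreal_mult[symmetric] Gamma_real_nonneg)
qed

text \<open>For the squared norm \<open>r\<close>, the power \<open>r powr (- a)\<close> is a Gamma
  integral of \<open>exp (- r * t)\<close>; integrating over the Gaussian vector first leaves
  \<open>(1 + 2 * t) powr (- b)\<close>. Writing this as a second Gamma integral, in
  \<open>s\<close>, and exchanging once more leads to Gamma functions only, without a Beta integral.
  The condition \<open>d < card J\<close> makes \<open>b - a\<close> positive.\<close>

lemma nn_integral_chi_inverse_power:
  assumes J: "finite J" and d: "0 < d" "d < card J"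
  shows "(\<integral>\<^sup>+x. (1 / ennreal (sqrt (\<Sum>l\<in>J. (x l)\<^sup>2))) ^ d \<partial>PiM J (\<lambda>_. std_gauss))
     \<le> ennreal (2 powr (- real d / 2) * Gamma ((real (card J) - real d) / 2) / Gamma (real (card J) / 2))"
proof -
  define a b where "a = real d / 2" and "b = real (card J) / 2"
  have ab: "0 < a" "a < b" "0 < b" using d by (auto simp: a_def b_def)
  define L where "L = (\<lambda>r. \<integral>\<^sup>+t. ennreal (indicator {0..} t * t powr (a - 1) * exp (- (r * t))) \<partial>lborel)"
  have L: "ennreal (Gamma a) * (1 / ennreal (sqrt r)) ^ d \<le> L r" if r: "r \<ge> 0" for r
  proof (cases "r = 0")
    case False
    with r have "r > 0" by simp
    then have "1 / ennreal (sqrt r) = ennreal (1 / sqrt r)"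
      using divide_ennreal[of 1 "sqrt r"] by simp
    moreover have "sqrt r ^ d = r powr a"
      using \<open>r > 0\<close> by (simp add: a_def powr_half_sqrt[symmetric] powr_powr powr_realpow[symmetric])
    ultimately have "(1 / ennreal (sqrt r)) ^ d = ennreal (1 / r powr a)"
      using \<open>r > 0\<close> by (simp add: ennreal_power power_divide)
    with \<open>r > 0\<close> show ?thesis using ab by (simp add: L_def nn_integral_Gamma_scaled ennreal_mult'[symmetric] Gamma_real_nonneg)
  next
    case True
    have "ennreal c \<le> L 0" for c
    proof -
      \<comment> \<open>At \<open>r = 0\<close> the left side is infinite, so \<open>L 0\<close> has
        to exceed every \<open>c\<close>. It dominates \<open>Gamma a / s powr a\<close> for all
        \<open>s > 0\<close>, and this \<open>s\<close> gives that quotient the value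
        \<open>\<bar>c\<bar> + 1\<close>.\<close>
      define s where "s = (Gamma a / (\<bar>c\<bar> + 1)) powr (1 / a)"
      have G: "Gamma a > 0" using ab by (intro Gamma_real_pos)
      have s: "s > 0" using G by (simp add: s_def)
      have "s powr a = Gamma a / (\<bar>c\<bar> + 1)" using ab G by (simp add: s_def powr_powr)
      then have "Gamma a / s powr a = \<bar>c\<bar> + 1" using G by simp
      then have "ennreal c \<le> ennreal (Gamma a / s powr a)" by (intro ennreal_leI) simp
      also have "\<dots> = (\<integral>\<^sup>+t. ennreal (indicator {0..} t * t powr (a - 1) * exp (- (s * t))) \<partial>lborel)"
        using nn_integral_Gamma_scaled[OF ab(1) s] by simp
      also have "\<dots> \<le> L 0" unfolding L_def
      proof (intro nn_integral_mono ennreal_leI)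
        fix t :: real
        have "exp (- (s * t)) \<le> exp (- (0 * t))" if "t \<ge> 0" using that s by simp
        then show "indicator {0..} t * t powr (a - 1) * exp (- (s * t)) \<le> indicator {0..} t * t powr (a - 1) * exp (- (0 * t))"
          using mult_left_le[of "exp (- (s * t))" "t powr (a - 1)"] by (cases "t \<ge> 0") auto
      qed
      finally show ?thesis .
    qed
    note le = this
    have "L 0 = \<infinity>"
    proof (cases "L 0")
      case (real x)
      then show ?thesis using le[of "x + 1"] by simp
    qed simp
    then show ?thesis using True by simp
  qed
  let ?r = "\<lambda>x. \<Sum>l\<in>J. (x l)\<^sup>2"
  interpret P: prob_space "PiM J (\<lambda>_. std_gauss)" by (rule prob_space_PiM_std_gauss)
  interpret PL: pair_sigma_finite "PiM J (\<lambda>_. std_gauss)" lborel ..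
  have "ennreal (Gamma b) * (ennreal (Gamma a) * (\<integral>\<^sup>+x. (1 / ennreal (sqrt (?r x))) ^ d \<partial>PiM J (\<lambda>_. std_gauss)))
     = ennreal (Gamma b) * (\<integral>\<^sup>+x. ennreal (Gamma a) * (1 / ennreal (sqrt (?r x))) ^ d \<partial>PiM J (\<lambda>_. std_gauss))"
    by (subst nn_integral_cmult) auto
  also have "\<dots> \<le> ennreal (Gamma b) * (\<integral>\<^sup>+x. L (?r x) \<partial>PiM J (\<lambda>_. std_gauss))"
    by (intro mult_left_mono nn_integral_mono L sum_nonneg) auto
  also have "(\<integral>\<^sup>+x. L (?r x) \<partial>PiM J (\<lambda>_. std_gauss))
     = (\<integral>\<^sup>+t. \<integral>\<^sup>+x. ennreal (indicator {0..} t * t powr (a - 1) * exp (- (?r x * t))) \<partial>PiM J (\<lambda>_. std_gauss) \<partial>lborel)"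
    unfolding L_def by (rule PL.Fubini'[symmetric]) measurable
  also have "\<dots> = (\<integral>\<^sup>+t. ennreal (indicator {0..} t * t powr (a - 1)) * ennreal ((1 + 2 * t) powr (- b)) \<partial>lborel)"
  proof (intro nn_integral_cong)
    fix t :: real
    have "(\<integral>\<^sup>+x. ennreal (indicator {0..} t * t powr (a - 1) * exp (- (?r x * t))) \<partial>PiM J (\<lambda>_. std_gauss))
      = (\<integral>\<^sup>+x. ennreal (indicator {0..} t * t powr (a - 1)) * ennreal (exp ((- t) * ?r x)) \<partial>PiM J (\<lambda>_. std_gauss))"
      by (intro nn_integral_cong) (simp add: ennreal_mult'[symmetric] mult.commute)
    also have "\<dots> = ennreal (indicator {0..} t * t powr (a - 1)) * (\<integral>\<^sup>+x. ennreal (exp ((- t) * ?r x)) \<partial>PiM J (\<lambda>_. std_gauss))"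
      by (rule nn_integral_cmult) auto
    also have "\<dots> = ennreal (indicator {0..} t * t powr (a - 1)) * ennreal ((1 + 2 * t) powr (- b))"
    proof (cases "t \<ge> 0")
      case True
      have "(1 / sqrt (1 - 2 * (- t))) ^ card J = (1 + 2 * t) powr (- b)"
      proof -
        have "sqrt (1 + 2 * t) ^ card J = (1 + 2 * t) powr b"
          using True by (simp add: b_def powr_half_sqrt[symmetric] powr_powr powr_realpow[symmetric])
        then show ?thesis by (simp add: power_divide powr_minus_divide)
      qed
      then show ?thesis using True by (subst nn_integral_PiM_exp_sum_squares) (use J in auto)
    qed auto
    finally show "(\<integral>\<^sup>+x. ennreal (indicator {0..} t * t powr (a - 1) * exp (- (?r x * t))) \<partial>PiM J (\<lambda>_. std_gauss))
      = ennreal (indicator {0..} t * t powr (a - 1)) * ennreal ((1 + 2 * t) powr (- b))" .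
  qed
  also have "ennreal (Gamma b) * \<dots> = (\<integral>\<^sup>+t. ennreal (Gamma b) * (ennreal (indicator {0..} t * t powr (a - 1)) * ennreal ((1 + 2 * t) powr (- b))) \<partial>lborel)"
    by (rule nn_integral_cmult[symmetric]) measurable
  also have "\<dots> = (\<integral>\<^sup>+t. \<integral>\<^sup>+s. ennreal (indicator {0..} t * t powr (a - 1) * (indicator {0..} s * s powr (b - 1) * exp (- ((1 + 2 * t) * s)))) \<partial>lborel \<partial>lborel)"
  proof (intro nn_integral_cong)
    fix t :: real
    have "(\<integral>\<^sup>+s. ennreal (indicator {0..} t * t powr (a - 1) * (indicator {0..} s * s powr (b - 1) * exp (- ((1 + 2 * t) * s)))) \<partial>lborel)
       = ennreal (indicator {0..} t * t powr (a - 1)) * (\<integral>\<^sup>+s. ennreal (indicator {0..} s * s powr (b - 1) * exp (- ((1 + 2 * t) * s))) \<partial>lborel)"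
      by (subst nn_integral_cmult[symmetric]) (auto simp: ennreal_mult'[symmetric])
    also have "\<dots> = ennreal (Gamma b) * (ennreal (indicator {0..} t * t powr (a - 1)) * ennreal ((1 + 2 * t) powr (- b)))"
    proof (cases "t \<ge> 0")
      case True
      then show ?thesis using ab by (subst nn_integral_Gamma_scaled) (auto simp: powr_minus divide_inverse ennreal_mult'[symmetric] ennreal_mult''[symmetric] Gamma_real_nonneg mult_ac)
    qed auto
    finally show "ennreal (Gamma b) * (ennreal (indicator {0..} t * t powr (a - 1)) * ennreal ((1 + 2 * t) powr (- b)))
      = (\<integral>\<^sup>+s. ennreal (indicator {0..} t * t powr (a - 1) * (indicator {0..} s * s powr (b - 1) * exp (- ((1 + 2 * t) * s)))) \<partial>lborel)" ..
  qed
  also have "\<dots> = (\<integral>\<^sup>+s. \<integral>\<^sup>+t. ennreal (indicator {0..} t * t powr (a - 1) * (indicator {0..} s * s powr (b - 1) * exp (- ((1 + 2 * t) * s)))) \<partial>lborel \<partial>lborel)"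
    by (rule lborel_pair.Fubini') measurable
  also have "\<dots> = (\<integral>\<^sup>+s. ennreal (Gamma a * 2 powr (- a)) * ennreal (indicator {0..} s * s powr (b - a - 1) * exp (- (1 * s))) \<partial>lborel)"
  proof (intro nn_integral_cong_AE AE_I2 impI)
    fix s :: real
    have "(\<integral>\<^sup>+t. ennreal (indicator {0..} t * t powr (a - 1) * (indicator {0..} s * s powr (b - 1) * exp (- ((1 + 2 * t) * s)))) \<partial>lborel)
      = ennreal (indicator {0..} s * s powr (b - 1) * exp (- s)) * (\<integral>\<^sup>+t. ennreal (indicator {0..} t * t powr (a - 1) * exp (- (2 * s * t))) \<partial>lborel)"
      by (subst nn_integral_cmult[symmetric]) (auto simp: ennreal_mult'[symmetric] exp_add[symmetric] algebra_simps intro!: nn_integral_cong)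
    also have "\<dots> = ennreal (Gamma a * 2 powr (- a)) * ennreal (indicator {0..} s * s powr (b - a - 1) * exp (- (1 * s)))"
    proof (cases "s > 0")
      case True
      have "s powr (b - 1) / (2 * s) powr a = 2 powr (- a) * s powr (b - a - 1)"
        using True by (simp add: powr_mult powr_minus powr_diff field_simps powr_mult_base)
      then have "(s powr (b - 1) / (2 * s) powr a) * (exp (- s) * Gamma a) = (2 powr (- a) * s powr (b - a - 1)) * (exp (- s) * Gamma a)"
        by (rule arg_cong)
      then have "(s powr (b - 1) * exp (- s)) * (Gamma a / (2 * s) powr a) = (Gamma a * 2 powr (- a)) * (s powr (b - a - 1) * exp (- s))"
        by (simp add: mult_ac)
      then show ?thesis using True ab by (subst nn_integral_Gamma_scaled) (auto simp: ennreal_mult'[symmetric] Gamma_real_nonneg)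
    next
      case False
      then show ?thesis by (cases "s = 0") auto
    qed
    finally show "(\<integral>\<^sup>+t. ennreal (indicator {0..} t * t powr (a - 1) * (indicator {0..} s * s powr (b - 1) * exp (- ((1 + 2 * t) * s)))) \<partial>lborel)
      = ennreal (Gamma a * 2 powr (- a)) * ennreal (indicator {0..} s * s powr (b - a - 1) * exp (- (1 * s)))" .
  qed
  also have "\<dots> = ennreal (Gamma a * 2 powr (- a)) * (\<integral>\<^sup>+s. ennreal (indicator {0..} s * s powr (b - a - 1) * exp (- (1 * s))) \<partial>lborel)"
    by (rule nn_integral_cmult) measurable
  also have "\<dots> = ennreal (Gamma a * 2 powr (- a)) * ennreal (Gamma (b - a))"
    using ab by (subst nn_integral_Gamma_scaled) auto
  also have "\<dots> = ennreal (Gamma b * (Gamma a * (2 powr (- a) * Gamma (b - a) / Gamma b)))"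
  proof -
    have G: "Gamma b > 0" "Gamma a > 0" using ab by (auto intro: Gamma_real_pos)
    have "Gamma b * (Gamma a * (2 powr (- a) * Gamma (b - a) / Gamma b)) = Gamma a * 2 powr (- a) * Gamma (b - a)"
    proof -
      have "g * (a' * (x / g)) = a' * x" if "g > 0" for g a' x :: real using that by simp
      from this[OF G(1), of "Gamma a" "2 powr (- a) * Gamma (b - a)"] show ?thesis by (simp only: mult.assoc)
    qed
    then show ?thesis using G by (simp only: ennreal_mult'[symmetric] mult_nonneg_nonneg less_imp_le powr_ge_zero)
  qed
  also have "\<dots> = ennreal (Gamma b) * (ennreal (Gamma a) * ennreal (2 powr (- a) * Gamma (b - a) / Gamma b))"
    using ennreal_mult'[of "Gamma b"] ennreal_mult'[of "Gamma a"] ab by (simp only: Gamma_real_nonneg less_imp_le)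
  finally have *: "ennreal (Gamma b) * (ennreal (Gamma a) * (\<integral>\<^sup>+x. (1 / ennreal (sqrt (?r x))) ^ d \<partial>PiM J (\<lambda>_. std_gauss)))
      \<le> ennreal (Gamma b) * (ennreal (Gamma a) * ennreal (2 powr (- a) * Gamma (b - a) / Gamma b))" .
  have "ennreal (Gamma b) \<noteq> 0" "ennreal (Gamma a) \<noteq> 0"
    using Gamma_real_pos[OF ab(1)] Gamma_real_pos[OF ab(3)] by auto
  then have "(\<integral>\<^sup>+x. (1 / ennreal (sqrt (?r x))) ^ d \<partial>PiM J (\<lambda>_. std_gauss)) \<le> ennreal (2 powr (- a) * Gamma (b - a) / Gamma b)"
    using * by (simp only: ennreal_mult_le_mult_iff ennreal_neq_top not_False_eq_True)
  then show ?thesis by (simp add: a_def b_def diff_divide_distrib)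
qed

text \<open>The \<open>d\<close>-th absolute moment of a standard Gaussian variable.\<close>

definition abs_moment :: "nat \<Rightarrow> real" where
  "abs_moment d = 2 powr (real d / 2) * Gamma ((real d + 1) / 2) / sqrt pi"

lemma abs_moment_pos: "abs_moment d > 0"
  unfolding abs_moment_def by (intro divide_pos_pos mult_pos_pos Gamma_real_pos) auto

lemma abs_moment_0: "abs_moment 0 = 1"
  by (simp add: abs_moment_def Gamma_one_half_real)

lemma abs_moment_1: "abs_moment 1 = sqrt (2 / pi)"
  by (simp add: abs_moment_def powr_half_sqrt real_sqrt_divide)

lemma abs_moment_Suc_Suc: "abs_moment (Suc (Suc d)) = (real d + 1) * abs_moment d"
proof -
  have "(real (Suc (Suc d)) + 1) / 2 = (real d + 1) / 2 + 1" "real (Suc (Suc d)) / 2 = real d / 2 + 1" by auto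
  moreover have "Gamma ((real d + 1) / 2 + 1) = (real d + 1) / 2 * Gamma ((real d + 1) / 2)"
    by (rule Gamma_plus1) (auto dest!: nonpos_Ints_nonpos)
  ultimately have "abs_moment (Suc (Suc d)) = 2 powr (real d / 2 + 1) * ((real d + 1) / 2 * Gamma ((real d + 1) / 2)) / sqrt pi"
    unfolding abs_moment_def by (simp only:)
  then show ?thesis by (simp add: abs_moment_def powr_add)
qed

text \<open>The known moments are expressed by factorials, separately for even and odd
  \<open>d\<close>; the recursion of \<open>abs_moment\<close> by steps of two reproduces both
  families.\<close>

lemma nn_integral_std_gauss_abs_power: "(\<integral>\<^sup>+x. ennreal (\<bar>x\<bar> ^ d) \<partial>std_gauss) = ennreal (abs_moment d)"
proof -
  have h: "has_bochner_integral lborel (\<lambda>x. std_normal_density x * \<bar>x\<bar> ^ d) (abs_moment d)"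
  proof (cases "even d")
    case True
    then obtain k where k: "d = 2 * k" by blast
    have "abs_moment (2 * k) = fact (2 * k) / (2^k * fact k)"
    proof (induction k)
      case (Suc k)
      have "abs_moment (2 * Suc k) = (2 * real k + 1) * abs_moment (2 * k)"
        using abs_moment_Suc_Suc[of "2 * k"] by simp
      also have "\<dots> = fact (2 * Suc k) / (2 ^ Suc k * fact (Suc k))"
      proof -
        have "fact (2 * Suc k) = (2 * (real k + 1)) * ((2 * real k + 1) * fact (2 * k))"
          by (simp add: algebra_simps)
        moreover have "2 ^ Suc k * fact (Suc k) = (2 * (real k + 1)) * (2 ^ k * fact k)"
          by (simp add: algebra_simps)
        ultimately show ?thesis
          unfolding Suc by (simp only: mult_divide_mult_cancel_left) (simp del: fact_Suc)
      qed
      finally show ?case .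
    qed (simp add: abs_moment_0)
    then show ?thesis using std_normal_moment_even[of k] by (simp add: k power_mult)
  next
    case False
    then obtain k where k: "d = 2 * k + 1" by (elim oddE)
    have "abs_moment (2 * k + 1) = sqrt (2/pi) * 2^k * fact k"
    proof (induction k)
      case (Suc k)
      have "abs_moment (2 * Suc k + 1) = (2 * real k + 2) * abs_moment (2 * k + 1)"
        using abs_moment_Suc_Suc[of "2 * k + 1"] by simp
      also have "\<dots> = sqrt (2/pi) * 2^Suc k * fact (Suc k)"
        unfolding Suc by (simp add: field_simps)
      finally show ?case .
    qed (use abs_moment_1 in simp)
    then show ?thesis using std_normal_moment_abs_odd[of k] by (simp add: k)
  qed
  have "(\<integral>\<^sup>+x. ennreal (\<bar>x\<bar> ^ d) \<partial>std_gauss) = (\<integral>\<^sup>+x. ennreal (std_normal_density x * \<bar>x\<bar> ^ d) \<partial>lborel)"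
    by (subst nn_integral_std_gauss) (auto simp: ennreal_mult')
  also have "\<dots> = ennreal (abs_moment d)"
    using h by (subst nn_integral_eq_integral) (auto simp: has_bochner_integral_iff)
  finally show ?thesis .
qed

text \<open>The left-hand side is the integral of \<open>ln\<close> over
  \<open>[m - 1, m + 1]\<close>, and a concave function has at most its midpoint value as average.
  The proof lets the interval \<open>[m - u, m + u]\<close> grow; the derivative of the difference
  is \<open>ln ((m + u) * (m - u)) - 2 * ln m\<close>.\<close>

lemma ln_antiderivative_le_midpoint:
  assumes m: "m > (1::real)"
  shows "(m + 1) * ln (m + 1) - (m - 1) * ln (m - 1) - 2 \<le> 2 * ln m"
proof -
  define h where "h = (\<lambda>u. (m + u) * ln (m + u) - (m - u) * ln (m - u) - 2 * u - 2 * u * ln m)"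
  have "h 1 \<le> h 0"
  proof (rule DERIV_nonpos_imp_nonincreasing[of 0 1 h])
    fix u :: real assume u: "0 \<le> u" "u \<le> 1"
    have "(h has_real_derivative (ln (m + u) + (m + u) * (1 / (m + u))) - (- ln (m - u) + (m - u) * (- 1 / (m - u))) - 2 - 2 * ln m) (at u)"
      unfolding h_def using u m by (auto intro!: derivative_eq_intros)
    then have "(h has_real_derivative ln (m + u) + ln (m - u) - 2 * ln m) (at u)"
      using u m by simp
    moreover have "ln (m + u) + ln (m - u) - 2 * ln m \<le> 0"
    proof -
      have "ln (m + u) + ln (m - u) = ln ((m + u) * (m - u))" using u m by (simp add: ln_mult)
      also have "\<dots> \<le> ln (m * m)" using u m by (intro ln_mono mult_pos_pos) (auto simp: algebra_simps)
      also have "\<dots> = 2 * ln m" using m by (simp add: ln_mult)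
      finally show ?thesis by simp
    qed
    ultimately show "\<exists>y. (h has_real_derivative y) (at u) \<and> y \<le> 0" by blast
  qed simp
  then show ?thesis by (simp add: h_def)
qed

text \<open>A Stirling-type bound and the origin of \<open>exp 1\<close> in the final constant. From
  \<open>c\<close> to \<open>c + 2\<close>, the exponent \<open>d * (ln d - 1)\<close> grows by the
  integral of \<open>ln\<close> over \<open>[c, c + 2]\<close>. By the midpoint estimate this is at
  most \<open>2 * ln (c + 1)\<close>, which is exactly what the recursion adds to the logarithm of
  \<open>(abs_moment d)\<^sup>2\<close>.\<close>

lemma abs_moment_lower: "d \<ge> 1 \<Longrightarrow> (real d / exp 1) ^ d \<le> (abs_moment d)\<^sup>2"
proof (induction d rule: nat_less_induct)
  case (1 d)
  have e2: "exp 1 \<ge> (2::real)" using exp_ge_add_one_self[of 1] by simp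
  consider "d = 1" | "d = 2" | c where "d = Suc (Suc c)" "c \<ge> 1" using 1(2) by (metis One_nat_def Suc_leI gr0I numeral_2_eq_2 old.nat.exhaust not_less_eq_eq zero_less_Suc)
  then show ?case
  proof cases
    case 1
    have "1 / exp 1 \<le> (1/2::real)" using e2 by (simp add: field_simps)
    also have "\<dots> \<le> 2 / pi" using pi_less_4 by (simp add: field_simps)
    finally show ?thesis unfolding 1 abs_moment_1 by simp
  next
    case 2
    have "abs_moment 2 = 1" using abs_moment_Suc_Suc[of 0] by (simp add: abs_moment_0 numeral_2_eq_2)
    then show ?thesis using e2 by (simp add: 2 power_le_one)
  next
    case 3
    have IH: "(real c / exp 1) ^ c \<le> (abs_moment c)\<^sup>2" using 1 3 by auto
    have c: "real c > 0" using 3 by simp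
    have "(real d / exp 1) ^ d = exp (real d * (ln (real d) - 1))"
      using 3 by (simp add: exp_of_nat_mult exp_diff del: of_nat_Suc)
    also have "\<dots> \<le> exp (2 * ln (real c + 1) + real c * (ln (real c) - 1))"
      using ln_antiderivative_le_midpoint[of "real c + 1"] c by (simp add: 3 algebra_simps)
    also have "\<dots> = (real c + 1)\<^sup>2 * (real c / exp 1) ^ c"
      using c by (simp add: exp_add exp_of_nat_mult exp_diff mult_exp_exp[symmetric] power2_eq_square ln_mult[symmetric] exp_double)
    also have "\<dots> \<le> (real c + 1)\<^sup>2 * (abs_moment c)\<^sup>2" using IH by (intro mult_left_mono) auto
    finally show ?thesis by (simp add: 3 abs_moment_Suc_Suc power_mult_distrib)
  qed
qed

text \<open>The inequality \<open>y \<le> exp (y - 1)\<close> at \<open>y = r / p\<close> bounds the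
  power by an exponential of rate \<open>d / (2 * p)\<close>. For \<open>p = k + d\<close> its
  Gaussian mean is \<open>sqrt (1 + d / k) ^ k\<close>, at most \<open>exp (d / 2)\<close>, and this
  cancels the denominator of \<open>(p / exp 1) powr (d / 2)\<close>.\<close>

lemma nn_integral_norm_power_le:
  assumes J: "finite J" and d: "d \<ge> 1" and k: "card J = k" "k \<ge> 1"
  shows "(\<integral>\<^sup>+x. ennreal (sqrt (\<Sum>l\<in>J. (x l)\<^sup>2) ^ d) \<partial>PiM J (\<lambda>_. std_gauss)) \<le> ennreal (sqrt (real (k + d)) ^ d)"
proof -
  define p where "p = real (k + d)"
  have p: "p > 0" "p = real k + real d" using d by (auto simp: p_def)
  let ?r = "\<lambda>x. \<Sum>l\<in>J. (x l)\<^sup>2"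
  have *: "sqrt r ^ d \<le> (p / exp 1) powr (d / 2) * exp ((d / (2 * p)) * r)" if r: "r \<ge> 0" for r :: real
  proof -
    have "r / p \<le> exp (r / p - 1)" using exp_ge_add_one_self[of "r / p - 1"] by simp
    then have "r \<le> (p / exp 1) * exp (r / p)" using p(1) by (simp add: exp_diff pos_divide_le_eq mult.commute)
    then have "r powr (d / 2) \<le> ((p / exp 1) * exp (r / p)) powr (d / 2)" using r by (intro powr_mono2) auto
    also have "\<dots> = (p / exp 1) powr (d / 2) * exp (r / p) powr (d / 2)" using p by (subst powr_mult) auto
    also have "exp (r / p) powr (d / 2) = exp ((d / (2 * p)) * r)" by (simp add: powr_def)
    finally have "r powr (d / 2) \<le> (p / exp 1) powr (d / 2) * exp ((d / (2 * p)) * r)" .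
    moreover have "r powr (d / 2) = sqrt r ^ d"
    proof (cases "r = 0")
      case False
      then have "r > 0" using r by simp
      then show ?thesis by (simp add: powr_half_sqrt[symmetric] powr_realpow[symmetric] powr_powr)
    qed (use d in auto)
    ultimately show ?thesis by simp
  qed
  have lt: "d / (2 * p) < 1/2" using p k d by (simp add: field_simps)
  have "(\<integral>\<^sup>+x. ennreal (sqrt (?r x) ^ d) \<partial>PiM J (\<lambda>_. std_gauss))
     \<le> (\<integral>\<^sup>+x. ennreal ((p / exp 1) powr (d / 2)) * ennreal (exp ((d / (2 * p)) * ?r x)) \<partial>PiM J (\<lambda>_. std_gauss))"
  proof (intro nn_integral_mono)
    fix x :: "'a \<Rightarrow> real"
    show "ennreal (sqrt (?r x) ^ d) \<le> ennreal ((p / exp 1) powr (d / 2)) * ennreal (exp ((d / (2 * p)) * ?r x))"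
      using *[of "?r x"] by (simp only: ennreal_mult'[symmetric] powr_ge_zero) (simp add: sum_nonneg ennreal_leI)
  qed
  also have "\<dots> = ennreal ((p / exp 1) powr (d / 2)) * ennreal ((1 / sqrt (1 - 2 * (d / (2 * p)))) ^ k)"
    by (subst nn_integral_cmult, simp, subst nn_integral_PiM_exp_sum_squares[OF J lt]) (simp add: k)
  also have "\<dots> = ennreal ((p / exp 1) powr (d / 2) * (1 / sqrt (1 - 2 * (d / (2 * p)))) ^ k)"
    by (simp add: ennreal_mult'[symmetric])
  also have "\<dots> \<le> ennreal (sqrt p ^ d)"
  proof (rule ennreal_leI)
    have "1 - 2 * (d / (2 * p)) = k / p" using p by (simp add: field_simps)
    then have "(1 / sqrt (1 - 2 * (d / (2 * p)))) ^ k = sqrt (1 + d / k) ^ k"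
    proof -
      have "1 / sqrt (k / p) = sqrt (p / k)" by (simp add: real_sqrt_divide)
      also have "p / k = 1 + d / k" using p k by (simp add: field_simps)
      finally show ?thesis using \<open>1 - 2 * (d / (2 * p)) = k / p\<close> by simp
    qed
    also have "\<dots> \<le> sqrt (exp (d / k)) ^ k"
      by (intro power_mono real_sqrt_le_mono exp_ge_add_one_self) auto
    also have "\<dots> = exp (d / 2)"
    proof -
      have "sqrt (exp (d / k)) ^ k = exp (d / k / 2) ^ k"
        by (rule arg_cong[of _ _ "\<lambda>x. x ^ k"]) (simp add: powr_half_sqrt[symmetric] powr_def)
      also have "\<dots> = exp (d / 2)" using k by (simp add: exp_of_nat_mult[symmetric])
      finally show ?thesis .
    qed
    finally have "(p / exp 1) powr (d / 2) * (1 / sqrt (1 - 2 * (d / (2 * p)))) ^ k \<le> (p / exp 1) powr (d / 2) * exp (d / 2)"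
      by (intro mult_left_mono) auto
    also have "\<dots> = p powr (d / 2)" using p by (simp add: powr_divide powr_def[of "exp 1"])
    also have "\<dots> = sqrt p ^ d" using p by (simp add: powr_half_sqrt[symmetric] powr_realpow[symmetric] powr_powr)
    finally show "(p / exp 1) powr (d / 2) * (1 / sqrt (1 - 2 * (d / (2 * p)))) ^ k \<le> sqrt p ^ d" .
  qed
  finally show ?thesis by (simp add: p_def)
qed

section \<open>Slepian's inequality\<close>

text \<open>Lipschitz in the l1 norm over \<open>I\<close>, hence dependent on the coordinates in
  \<open>I\<close> only. The class contains \<open>lse\<close> and the maximum and is stable under
  Gaussian averaging, so all integrability questions are settled by it.\<close>

definition lip_on :: "'i set \<Rightarrow> (('i \<Rightarrow> real) \<Rightarrow> real) \<Rightarrow> bool" where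
  "lip_on I f \<longleftrightarrow> (\<exists>c\<ge>0. \<forall>w w'. \<bar>f w - f w'\<bar> \<le> c * (\<Sum>i\<in>I. \<bar>w i - w' i\<bar>))"

text \<open>The real-valued counterpart of a single step of \<open>gint\<close>, read as an operator
  on functions: these smoothing operators are monotone, commute with each other and obey a semigroup
  law.\<close>

definition gavg :: "('i \<Rightarrow> real) \<Rightarrow> (('i \<Rightarrow> real) \<Rightarrow> real) \<Rightarrow> ('i \<Rightarrow> real) \<Rightarrow> real" where
  "gavg v f w = (\<integral>x. f (\<lambda>i. w i + x * v i) \<partial>std_gauss)"

primrec gavgs :: "('i \<Rightarrow> real) list \<Rightarrow> (('i \<Rightarrow> real) \<Rightarrow> real) \<Rightarrow> ('i \<Rightarrow> real) \<Rightarrow> real" where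
  "gavgs [] f = f"
| "gavgs (v # vs) f = gavg v (gavgs vs f)"

lemma integrable_std_gauss_abs_power: "integrable std_gauss (\<lambda>x. \<bar>x\<bar> ^ k)"
  unfolding std_gauss_def using integrable_std_normal_moment_abs[of k]
  by (subst integrable_density) auto

lemma integrable_std_gauss_power: "integrable std_gauss (\<lambda>x. x ^ k)"
  unfolding std_gauss_def using integrable_std_normal_moment[of k]
  by (subst integrable_density) auto

lemma integral_std_gauss: "f \<in> borel_measurable borel \<Longrightarrow> (\<integral>x. f x \<partial>std_gauss) = (\<integral>x. std_normal_density x * f x \<partial>lborel)" for f :: "real \<Rightarrow> real"
  unfolding std_gauss_def by (subst integral_density) auto

lemma integrable_std_gauss_abs [simp]: "integrable std_gauss (\<lambda>x. \<bar>x\<bar>)" "integrable std_gauss (\<lambda>x. x)" "integrable std_gauss (\<lambda>x. x\<^sup>2)" "integrable std_gauss (\<lambda>x. \<bar>x\<bar> ^ 3)"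
  using integrable_std_gauss_abs_power[of 1] integrable_std_gauss_power[of 1] integrable_std_gauss_power[of 2] integrable_std_gauss_abs_power[of 3] by auto

lemma integral_std_gauss_id [simp]: "(\<integral>x. x \<partial>std_gauss) = 0"
  by (subst integral_std_gauss) (use integral_std_normal_moment_odd[of 0] in auto)

lemma integral_std_gauss_square [simp]: "(\<integral>x. x\<^sup>2 \<partial>std_gauss) = 1"
  by (subst integral_std_gauss) (use integral_std_normal_moment_even[of 1] in \<open>auto simp: fact_2\<close>)

lemma sqrt_two_pi_le_1: "sqrt (2 / pi) \<le> 1"
  using pi_gt3 by simp

lemma integral_std_gauss_abs_le: "(\<integral>x. \<bar>x\<bar> \<partial>std_gauss) \<le> 1"
  by (subst integral_std_gauss) (use integral_std_normal_moment_abs_odd[of 0] sqrt_two_pi_le_1 in auto)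

lemma integral_std_gauss_abs_3_le: "(\<integral>x. \<bar>x\<bar> ^ 3 \<partial>std_gauss) \<le> 2"
proof -
  have "(\<integral>x. \<bar>x\<bar> ^ 3 \<partial>std_gauss) = sqrt (2 / pi) * 2"
    by (subst integral_std_gauss) (use integral_std_normal_moment_abs_odd[of 1] in \<open>auto simp: numeral_3_eq_3\<close>)
  then show ?thesis using sqrt_two_pi_le_1 by simp
qed

lemma lip_onD:
  assumes "lip_on I f"
  obtains c where "c \<ge> 0" "\<And>w w'. \<bar>f w - f w'\<bar> \<le> c * (\<Sum>i\<in>I. \<bar>w i - w' i\<bar>)"
  using assms by (auto simp: lip_on_def)

lemma lipschitz_line_measurable:
  fixes h :: "real \<Rightarrow> real"
  assumes "\<And>x y. \<bar>h x - h y\<bar> \<le> K * \<bar>x - y\<bar>"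
  shows "h \<in> borel_measurable borel" and "integrable std_gauss h"
proof -
  have K: "K \<ge> 0" using order_trans[OF abs_ge_zero assms[of 1 0]] by simp
  have "continuous_on UNIV h"
  proof (rule continuous_onI)
    fix x e :: real assume "e > 0"
    show "\<exists>d>0. \<forall>x'\<in>UNIV. dist x' x < d \<longrightarrow> dist (h x') (h x) \<le> e"
    proof (intro exI[of _ "e / (K + 1)"] conjI ballI impI)
      show "e / (K + 1) > 0" using K \<open>e > 0\<close> by simp
      fix x' assume "dist x' x < e / (K + 1)"
      then have "(K + 1) * \<bar>x' - x\<bar> \<le> e" using K by (simp add: dist_real_def field_simps)
      then show "dist (h x') (h x) \<le> e" using assms[of x' x] by (simp add: dist_real_def algebra_simps)
    qed
  qed
  then show m: "h \<in> borel_measurable borel" by (rule borel_measurable_continuous_onI)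
  show "integrable std_gauss h"
  proof (rule Bochner_Integration.integrable_bound[of _ "\<lambda>x. \<bar>h 0\<bar> + K * \<bar>x\<bar>"])
    show "AE x in std_gauss. norm (h x) \<le> norm (\<bar>h 0\<bar> + K * \<bar>x\<bar>)"
    proof (intro AE_I2)
      fix x show "norm (h x) \<le> norm (\<bar>h 0\<bar> + K * \<bar>x\<bar>)"
        using assms[of x 0] K by simp
    qed
  qed (use m in auto)
qed

lemma lip_on_line:
  assumes "lip_on I f"
  obtains K where "\<And>w x y. \<bar>f (\<lambda>i. w i + x * v i) - f (\<lambda>i. w i + y * v i)\<bar> \<le> K * \<bar>x - y\<bar>"
proof -
  obtain c where c: "c \<ge> 0" "\<And>w w'. \<bar>f w - f w'\<bar> \<le> c * (\<Sum>i\<in>I. \<bar>w i - w' i\<bar>)"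
    using lip_onD[OF assms] by blast
  have "\<bar>f (\<lambda>i. w i + x * v i) - f (\<lambda>i. w i + y * v i)\<bar> \<le> (c * (\<Sum>i\<in>I. \<bar>v i\<bar>)) * \<bar>x - y\<bar>" for w x y
    using c(2)[of "\<lambda>i. w i + x * v i" "\<lambda>i. w i + y * v i"]
    by (simp add: left_diff_distrib[symmetric] abs_mult sum_distrib_left sum_distrib_right mult_ac)
  then show ?thesis by (rule that)
qed

lemma integrable_line: "lip_on I f \<Longrightarrow> integrable std_gauss (\<lambda>x. f (\<lambda>i. w i + x * v i))"
  by (rule lip_on_line[of I f v]) (auto intro: lipschitz_line_measurable(2))

lemma lip_on_gavg [intro]:
  assumes f: "lip_on I f"
  shows "lip_on I (gavg v f)"
proof -
  obtain c where c: "c \<ge> 0" "\<And>w w'. \<bar>f w - f w'\<bar> \<le> c * (\<Sum>i\<in>I. \<bar>w i - w' i\<bar>)"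
    using lip_onD[OF f] by blast
  have "\<bar>gavg v f w - gavg v f w'\<bar> \<le> c * (\<Sum>i\<in>I. \<bar>w i - w' i\<bar>)" for w w'
  proof -
    have "gavg v f w - gavg v f w' = (\<integral>x. f (\<lambda>i. w i + x * v i) - f (\<lambda>i. w' i + x * v i) \<partial>std_gauss)"
      unfolding gavg_def by (rule Bochner_Integration.integral_diff[symmetric]) (rule integrable_line[OF f])+
    also have "\<bar>\<dots>\<bar> \<le> (\<integral>x. c * (\<Sum>i\<in>I. \<bar>w i - w' i\<bar>) \<partial>std_gauss)"
    proof (rule integral_abs_bound_integral)
      show "\<bar>f (\<lambda>i. w i + x * v i) - f (\<lambda>i. w' i + x * v i)\<bar> \<le> c * (\<Sum>i\<in>I. \<bar>w i - w' i\<bar>)" for x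
        using c(2)[of "\<lambda>i. w i + x * v i" "\<lambda>i. w' i + x * v i"] by simp
    qed (auto intro!: integrable_line f)
    finally show ?thesis by (simp add: SG.prob_space[simplified])
  qed
  then show ?thesis using c(1) by (auto simp: lip_on_def)
qed

lemma lip_on_gavgs [intro]: "lip_on I f \<Longrightarrow> lip_on I (gavgs vs f)"
  by (induction vs) auto

lemma gavg_mono: "lip_on I f \<Longrightarrow> lip_on I g \<Longrightarrow> (\<And>w. f w \<le> g w) \<Longrightarrow> gavg v f w \<le> gavg v g w"
  unfolding gavg_def by (intro integral_mono integrable_line) auto

lemma gavgs_mono: "lip_on I f \<Longrightarrow> lip_on I g \<Longrightarrow> (\<And>w. f w \<le> g w) \<Longrightarrow> gavgs vs f w \<le> gavgs vs g w"
proof (induction vs arbitrary: w)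
  case (Cons v vs)
  then show ?case by (auto intro!: gavg_mono[of I])
qed auto

lemma gavg_add_const: "lip_on I f \<Longrightarrow> gavg v (\<lambda>w. f w + c) = (\<lambda>w. gavg v f w + c)"
  unfolding gavg_def by (subst Bochner_Integration.integral_add) (auto intro!: integrable_line simp: SG.prob_space[simplified])

lemma lip_on_add_const [intro]: "lip_on I f \<Longrightarrow> lip_on I (\<lambda>w. f w + c)"
  by (simp add: lip_on_def)

lemma gavgs_add_const: "lip_on I f \<Longrightarrow> gavgs vs (\<lambda>w. f w + c) = (\<lambda>w. gavgs vs f w + c)"
  by (induction vs) (auto simp: gavg_add_const[of I] lip_on_gavgs)

text \<open>The Lipschitz bound stands in for measurability of \<open>f\<close>: with coordinates
  rounded down to multiples of \<open>1 / (n + 1)\<close>, the composition factors through a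
  discrete space of integer tuples, and the rounding error vanishes uniformly.\<close>

lemma measurable_lip:
  fixes I :: "'i set"
  assumes I: "finite I" and f: "lip_on I f" and W: "\<And>i. i \<in> I \<Longrightarrow> (\<lambda>x. W x i) \<in> borel_measurable M"
  shows "(\<lambda>x. f (W x)) \<in> borel_measurable M"
proof -
  obtain c where c: "c \<ge> 0" "\<And>w w'. \<bar>f w - f w'\<bar> \<le> c * (\<Sum>i\<in>I. \<bar>w i - w' i\<bar>)"
    using lip_onD[OF f] by blast
  define g where "g = (\<lambda>(n::nat) x. \<lambda>i\<in>I. \<lfloor>real (Suc n) * W x i\<rfloor>)"
  define r where "r = (\<lambda>(n::nat) (z::'i \<Rightarrow> int) i. real_of_int (z i) / real (Suc n))"
  have err: "\<bar>r n (g n x) i - W x i\<bar> \<le> 1 / real (Suc n)" if "i \<in> I" for n x i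
  proof -
    have "r n (g n x) i - W x i = (real_of_int \<lfloor>real (Suc n) * W x i\<rfloor> - real (Suc n) * W x i) / real (Suc n)"
      using that by (simp add: r_def g_def diff_divide_distrib del: of_nat_Suc)
    moreover have "\<bar>real_of_int \<lfloor>real (Suc n) * W x i\<rfloor> - real (Suc n) * W x i\<bar> \<le> 1" by linarith
    ultimately show ?thesis by (simp add: divide_right_mono del: of_nat_Suc)
  qed
  show ?thesis
  proof (rule borel_measurable_LIMSEQ_real)
    show "(\<lambda>x. f (r n (g n x))) \<in> borel_measurable M" for n
    proof -
      have "g n \<in> M \<rightarrow>\<^sub>M PiM I (\<lambda>_. count_space UNIV)"
        unfolding g_def by (rule measurable_restrict) (use W in measurable)
      also have "PiM I (\<lambda>_. count_space UNIV) = count_space (PiE I (\<lambda>_. UNIV :: int set))"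
        by (rule count_space_PiM_finite) (use I in auto)
      finally show ?thesis by (rule measurable_compose) simp
    qed
    fix x
    have "(\<lambda>n. c * (\<Sum>i\<in>I. 1 / real (Suc n))) \<longlonglongrightarrow> c * (\<Sum>i\<in>I. 0)"
      by (intro tendsto_intros LIMSEQ_Suc[OF lim_1_over_n])
    moreover have "\<bar>f (r n (g n x)) - f (W x)\<bar> \<le> c * (\<Sum>i\<in>I. 1 / real (Suc n))" for n
      by (rule order_trans[OF c(2)]) (intro mult_left_mono sum_mono err c)
    then have "\<forall>\<^sub>F n in sequentially. norm (f (r n (g n x)) - f (W x)) \<le> c * (\<Sum>i\<in>I. 1 / real (Suc n))"
      unfolding real_norm_def by (intro always_eventually allI)
    ultimately have "(\<lambda>n. f (r n (g n x)) - f (W x)) \<longlonglongrightarrow> 0"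
      using Lim_null_comparison[of "\<lambda>n. f (r n (g n x)) - f (W x)" "\<lambda>n. c * (\<Sum>i\<in>I. 1 / real (Suc n))" sequentially] by (simp only: sum.neutral_const mult_zero_right)
    then show "(\<lambda>n. f (r n (g n x))) \<longlonglongrightarrow> f (W x)"
      by (rule LIM_zero_cancel)
  qed
qed

lemma gavg_commute:
  assumes I: "finite I" and f: "lip_on I f"
  shows "gavg u (gavg v f) = gavg v (gavg u f)"
proof
  fix w
  obtain c where c: "c \<ge> 0" "\<And>w w'. \<bar>f w - f w'\<bar> \<le> c * (\<Sum>i\<in>I. \<bar>w i - w' i\<bar>)"
    using lip_onD[OF f] by blast
  let ?f = "\<lambda>x y. f (\<lambda>i. w i + x * u i + y * v i)"
  have m: "case_prod ?f \<in> borel_measurable (std_gauss \<Otimes>\<^sub>M std_gauss)"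
    unfolding case_prod_beta' by (rule measurable_lip[OF I f]) measurable
  have "integrable (std_gauss \<Otimes>\<^sub>M std_gauss) (case_prod ?f)"
  proof (rule Bochner_Integration.integrable_bound[OF _ m])
    show "integrable (std_gauss \<Otimes>\<^sub>M std_gauss) (\<lambda>(x, y). \<bar>f w\<bar> + c * (\<Sum>i\<in>I. \<bar>u i\<bar>) * \<bar>x\<bar> + c * (\<Sum>i\<in>I. \<bar>v i\<bar>) * \<bar>y\<bar>)"
    proof -
      interpret P: prob_space "std_gauss \<Otimes>\<^sub>M std_gauss"
        by (intro prob_space_pair prob_space_std_gauss)
      have "integrable (std_gauss \<Otimes>\<^sub>M std_gauss) (\<lambda>p. \<bar>fst p\<bar>)" "integrable (std_gauss \<Otimes>\<^sub>M std_gauss) (\<lambda>p. \<bar>snd p\<bar>)"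
        using PS.integrable_product_swap[of "\<lambda>p. \<bar>fst p\<bar>"]
        by (auto simp: SG.prob_space[simplified] case_prod_beta' intro!: PS.Fubini_integrable)
      then show ?thesis unfolding case_prod_beta' by (intro Bochner_Integration.integrable_add integrable_mult_right) auto
    qed
    show "AE p in std_gauss \<Otimes>\<^sub>M std_gauss. norm (case p of (x, y) \<Rightarrow> ?f x y)
        \<le> norm (case p of (x, y) \<Rightarrow> \<bar>f w\<bar> + c * (\<Sum>i\<in>I. \<bar>u i\<bar>) * \<bar>x\<bar> + c * (\<Sum>i\<in>I. \<bar>v i\<bar>) * \<bar>y\<bar>)"
    proof (intro AE_I2, clarify)
      fix x y
      have "\<bar>?f x y\<bar> \<le> \<bar>f w\<bar> + \<bar>?f x y - f w\<bar>" by linarith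
      also have "\<bar>?f x y - f w\<bar> \<le> c * (\<Sum>i\<in>I. \<bar>x * u i + y * v i\<bar>)"
        using c(2)[of "\<lambda>i. w i + x * u i + y * v i" w] by (simp add: add.assoc)
      also have "\<dots> \<le> c * (\<Sum>i\<in>I. \<bar>u i\<bar> * \<bar>x\<bar> + \<bar>v i\<bar> * \<bar>y\<bar>)"
        by (intro mult_left_mono sum_mono c) (metis abs_mult abs_triangle_ineq mult.commute)
      also have "\<dots> = c * (\<Sum>i\<in>I. \<bar>u i\<bar>) * \<bar>x\<bar> + c * (\<Sum>i\<in>I. \<bar>v i\<bar>) * \<bar>y\<bar>"
        by (simp add: sum.distrib sum_distrib_left sum_distrib_right distrib_left mult_ac)
      finally show "norm (?f x y) \<le> norm (\<bar>f w\<bar> + c * (\<Sum>i\<in>I. \<bar>u i\<bar>) * \<bar>x\<bar> + c * (\<Sum>i\<in>I. \<bar>v i\<bar>) * \<bar>y\<bar>)" by simp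
    qed
  qed
  from PS.Fubini_integral[OF this]
  show "gavg u (gavg v f) w = gavg v (gavg u f) w"
    by (simp add: gavg_def add_ac)
qed

lemma gavgs_gavg: "finite I \<Longrightarrow> lip_on I f \<Longrightarrow> gavgs vs (gavg v f) = gavg v (gavgs vs f)"
  by (induction vs) (auto simp: gavg_commute[of I] lip_on_gavgs)

lemma gavgs_commute: "finite I \<Longrightarrow> lip_on I f \<Longrightarrow> gavgs us (gavgs vs f) = gavgs vs (gavgs us f)"
  by (induction us) (auto simp: gavgs_gavg[of I] lip_on_gavgs)

text \<open>The semigroup law: \<open>(x + y) / sqrt 2\<close> is the first coordinate of the pair
  of coefficients after an eighth turn, hence again standard Gaussian.\<close>

lemma gavg_gavg_same:
  assumes I: "finite I" and f: "lip_on I f" and s: "s > 0"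
  shows "gavg (\<lambda>i. s * v i) (gavg (\<lambda>i. s * v i) f) = gavg (\<lambda>i. sqrt 2 * s * v i) f"
proof
  fix w
  let ?r = "1 / sqrt 2 :: real"
  have r: "?r\<^sup>2 + ?r\<^sup>2 = 1" "?r \<noteq> 0" by (auto simp: power_divide)
  have eq: "distr (std_gauss \<Otimes>\<^sub>M std_gauss) borel (\<lambda>(x, y). ?r * x + ?r * y) = std_gauss"
  proof (rule measure_eqI)
    fix A :: "real set" assume "A \<in> sets (distr (std_gauss \<Otimes>\<^sub>M std_gauss) borel (\<lambda>(x, y). ?r * x + ?r * y))"
    then have [measurable]: "A \<in> sets borel" by simp
    have "emeasure (distr (std_gauss \<Otimes>\<^sub>M std_gauss) borel (\<lambda>(x, y). ?r * x + ?r * y)) A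
       = (\<integral>\<^sup>+p. indicator A p \<partial>distr (std_gauss \<Otimes>\<^sub>M std_gauss) borel (\<lambda>(x, y). ?r * x + ?r * y))" by simp
    also have "\<dots> = (\<integral>\<^sup>+p. indicator A (?r * fst p + ?r * snd p) \<partial>(std_gauss \<Otimes>\<^sub>M std_gauss))"
      by (subst nn_integral_distr) (auto simp: case_prod_beta')
    also have "\<dots> = (\<integral>\<^sup>+x. \<integral>\<^sup>+y. indicator A (?r * x + ?r * y) \<partial>std_gauss \<partial>std_gauss)"
      by (subst SG.nn_integral_fst[symmetric]) auto
    also have "\<dots> = (\<integral>\<^sup>+x. \<integral>\<^sup>+y. (\<lambda>p. indicator A (fst p)) (?r * x + ?r * y, ?r * y - ?r * x) \<partial>std_gauss \<partial>std_gauss)" by simp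
    also have "\<dots> = (\<integral>\<^sup>+x. \<integral>\<^sup>+y. (\<lambda>p. indicator A (fst p)) (x, y) \<partial>std_gauss \<partial>std_gauss)"
      by (rule std_gauss_rotate[OF _ r]) (simp add: borel_prod[symmetric])
    also have "\<dots> = emeasure std_gauss A" by (simp add: SG.emeasure_space_1[simplified])
    finally show "emeasure (distr (std_gauss \<Otimes>\<^sub>M std_gauss) borel (\<lambda>(x, y). ?r * x + ?r * y)) A = emeasure std_gauss A" .
  qed simp
  let ?h = "\<lambda>z. f (\<lambda>i. w i + z * (sqrt 2 * s * v i))"
  obtain K where K: "\<And>w x y. \<bar>f (\<lambda>i. w i + x * (sqrt 2 * s * v i)) - f (\<lambda>i. w i + y * (sqrt 2 * s * v i))\<bar> \<le> K * \<bar>x - y\<bar>"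
    by (rule lip_on_line[OF f, of "\<lambda>i. sqrt 2 * s * v i"]) (rule that)
  have m: "?h \<in> borel_measurable borel" and i: "integrable std_gauss ?h"
    using lipschitz_line_measurable[of ?h K] K by blast+
  have "integrable (distr (std_gauss \<Otimes>\<^sub>M std_gauss) borel (\<lambda>(x, y). ?r * x + ?r * y)) ?h" unfolding eq by (rule i)
  then have i2: "integrable (std_gauss \<Otimes>\<^sub>M std_gauss) (\<lambda>(x, y). ?h (?r * x + ?r * y))"
    by (subst (asm) integrable_distr_eq) (use m in \<open>auto simp: case_prod_beta'\<close>)
  have "gavg (\<lambda>i. sqrt 2 * s * v i) f w = (\<integral>z. ?h z \<partial>distr (std_gauss \<Otimes>\<^sub>M std_gauss) borel (\<lambda>(x, y). ?r * x + ?r * y))"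
    unfolding eq gavg_def ..
  also have "\<dots> = (\<integral>p. ?h (?r * fst p + ?r * snd p) \<partial>(std_gauss \<Otimes>\<^sub>M std_gauss))"
    by (subst integral_distr) (use m in \<open>auto simp: case_prod_beta'\<close>)
  also have "\<dots> = (\<integral>x. \<integral>y. ?h (?r * x + ?r * y) \<partial>std_gauss \<partial>std_gauss)"
    using PS.integral_fst[OF i2] by (simp add: case_prod_beta')
  also have "\<dots> = gavg (\<lambda>i. s * v i) (gavg (\<lambda>i. s * v i) f) w"
  proof -
    have "(?r * x + ?r * y) * (sqrt 2 * s * a) = (?r * sqrt 2) * (x * (s * a) + y * (s * a))" for x y a
      by (simp only: distrib_left distrib_right mult_ac)
    then have "w i + (?r * x + ?r * y) * (sqrt 2 * s * v i) = w i + x * (s * v i) + y * (s * v i)" for x y i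
      by simp
    then show ?thesis unfolding gavg_def by (simp only:)
  qed
  finally show "gavg (\<lambda>i. s * v i) (gavg (\<lambda>i. s * v i) f) w = gavg (\<lambda>i. sqrt 2 * s * v i) f w" ..
qed

abbreviation scale_list :: "real \<Rightarrow> ('i \<Rightarrow> real) list \<Rightarrow> ('i \<Rightarrow> real) list" where
  "scale_list s vs \<equiv> map (\<lambda>v i. s * v i) vs"

lemma gavgs_gavgs_same:
  assumes I: "finite I" and f: "lip_on I f" and s: "s > 0"
  shows "gavgs (scale_list s vs) (gavgs (scale_list s vs) f) = gavgs (scale_list (sqrt 2 * s) vs) f"
proof (induction vs)
  case (Cons v vs)
  let ?A = "gavgs (scale_list s vs)"
  have "gavgs (scale_list s (v # vs)) (gavgs (scale_list s (v # vs)) f)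
      = gavg (\<lambda>i. s * v i) (?A (gavg (\<lambda>i. s * v i) (?A f)))" by simp
  also have "\<dots> = gavg (\<lambda>i. s * v i) (gavg (\<lambda>i. s * v i) (?A (?A f)))"
    using I f by (simp add: gavgs_gavg[of I] lip_on_gavgs)
  also have "\<dots> = gavg (\<lambda>i. sqrt 2 * s * v i) (?A (?A f))"
    using I f s by (intro gavg_gavg_same[of I]) auto
  finally show ?case using Cons by simp
qed simp

section \<open>The log-sum-exp function and its derivatives\<close>

definition lse :: "'i set \<Rightarrow> ('i \<Rightarrow> real) \<Rightarrow> real" where
  "lse I w = ln (\<Sum>i\<in>I. exp (w i))"

text \<open>The mean of \<open>g\<close> under the Gibbs weights proportional to
  \<open>exp (w i)\<close>. This mean and the corresponding variance are the first and second
  derivatives of \<open>lse I\<close> at \<open>w\<close> in direction \<open>g\<close>.\<close>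

definition gibbs_mean :: "'i set \<Rightarrow> ('i \<Rightarrow> real) \<Rightarrow> ('i \<Rightarrow> real) \<Rightarrow> real" where
  "gibbs_mean I w g = (\<Sum>i\<in>I. exp (w i) * g i) / (\<Sum>i\<in>I. exp (w i))"

definition gibbs_var :: "'i set \<Rightarrow> ('i \<Rightarrow> real) \<Rightarrow> ('i \<Rightarrow> real) \<Rightarrow> real" where
  "gibbs_var I w g = gibbs_mean I w (\<lambda>i. (g i)\<^sup>2) - (gibbs_mean I w g)\<^sup>2"

context
  fixes I :: "'i set"
  assumes I: "finite I" "I \<noteq> {}"
begin

lemma partition_pos: "(\<Sum>i\<in>I. exp (w i)) > (0::real)"
  using I by (intro sum_pos) auto

lemma lse_upper: "(\<And>i. i \<in> I \<Longrightarrow> w i \<le> c) \<Longrightarrow> lse I w \<le> c + ln (card I)"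
proof -
  assume "\<And>i. i \<in> I \<Longrightarrow> w i \<le> c"
  then have "(\<Sum>i\<in>I. exp (w i)) \<le> (\<Sum>i\<in>I. exp c)" by (intro sum_mono) auto
  then have "lse I w \<le> ln (\<Sum>i\<in>I. exp c)" unfolding lse_def using partition_pos by (intro ln_mono) auto
  also have "\<dots> = c + ln (card I)" using I by (simp add: ln_mult)
  finally show ?thesis .
qed

lemma lse_lower: "i \<in> I \<Longrightarrow> w i \<le> lse I w"
proof -
  assume i: "i \<in> I"
  have "ln (exp (w i)) \<le> lse I w" unfolding lse_def
    by (intro ln_mono member_le_sum) (use I i in auto)
  then show ?thesis by simp
qed

lemma lip_on_lse: "lip_on I (lse I)"
proof -
  have *: "lse I w - lse I w' \<le> (\<Sum>i\<in>I. \<bar>w i - w' i\<bar>)" for w w'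
  proof -
    let ?D = "\<Sum>i\<in>I. \<bar>w i - w' i\<bar>"
    have "exp (w i) \<le> exp ?D * exp (w' i)" if "i \<in> I" for i
    proof -
      have "\<bar>w i - w' i\<bar> \<le> ?D" by (rule member_le_sum) (use I that in auto)
      then have "w i \<le> ?D + w' i" by linarith
      then show ?thesis by (simp add: exp_add[symmetric])
    qed
    then have "(\<Sum>i\<in>I. exp (w i)) \<le> exp ?D * (\<Sum>i\<in>I. exp (w' i))"
      by (simp add: sum_distrib_left sum_mono)
    then have "lse I w \<le> ln (exp ?D * (\<Sum>i\<in>I. exp (w' i)))"
      unfolding lse_def using partition_pos by (intro ln_mono) auto
    also have "\<dots> = ?D + lse I w'" using partition_pos[of w'] by (simp add: lse_def ln_mult)
    finally show ?thesis by simp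
  qed
  have "\<bar>lse I w - lse I w'\<bar> \<le> 1 * (\<Sum>i\<in>I. \<bar>w i - w' i\<bar>)" for w w'
    using *[of w w'] *[of w' w] by (simp add: abs_minus_commute abs_le_iff)
  then show ?thesis unfolding lip_on_def by (intro exI[of _ 1]) simp
qed

lemma gibbs_mean_bound: "(\<And>i. i \<in> I \<Longrightarrow> \<bar>g i\<bar> \<le> B) \<Longrightarrow> \<bar>gibbs_mean I w g\<bar> \<le> B"
proof -
  assume g: "\<And>i. i \<in> I \<Longrightarrow> \<bar>g i\<bar> \<le> B"
  have "\<bar>\<Sum>i\<in>I. exp (w i) * g i\<bar> \<le> (\<Sum>i\<in>I. exp (w i) * B)"
    by (rule order_trans[OF sum_abs]) (auto intro!: sum_mono g simp: abs_mult)
  then show ?thesis using partition_pos[of w]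
    by (simp add: gibbs_mean_def pos_divide_le_eq sum_distrib_left mult.commute)
qed

lemma DERIV_exp_sum: "((\<lambda>t. \<Sum>i\<in>I. exp (w i + t * v i) * g i) has_real_derivative (\<Sum>i\<in>I. exp (w i + t * v i) * (v i * g i))) (at t)"
  by (auto intro!: derivative_eq_intros sum.cong)

lemma DERIV_exp_sum': "((\<lambda>t. \<Sum>i\<in>I. exp (w i + t * v i)) has_real_derivative (\<Sum>i\<in>I. exp (w i + t * v i) * v i)) (at t)"
  using DERIV_exp_sum[where g = "\<lambda>_. 1"] by simp

lemma DERIV_lse: "((\<lambda>t. lse I (\<lambda>i. w i + t * v i)) has_real_derivative gibbs_mean I (\<lambda>i. w i + t * v i) v) (at t)"
  unfolding lse_def gibbs_mean_def
  by (rule derivative_eq_intros DERIV_exp_sum' refl partition_pos)+ simp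

lemma DERIV_gibbs_mean:
  "((\<lambda>t. gibbs_mean I (\<lambda>i. w i + t * v i) g) has_real_derivative
    gibbs_mean I (\<lambda>i. w i + t * v i) (\<lambda>i. v i * g i) - gibbs_mean I (\<lambda>i. w i + t * v i) g * gibbs_mean I (\<lambda>i. w i + t * v i) v) (at t)"
proof -
  have Z: "(\<Sum>i\<in>I. exp (w i + t * v i)) \<noteq> 0" using partition_pos[of "\<lambda>i. w i + t * v i"] by simp
  show ?thesis unfolding gibbs_mean_def
    by (rule DERIV_cong[OF DERIV_divide[OF DERIV_exp_sum DERIV_exp_sum' Z]]) (use Z in \<open>simp add: field_simps\<close>)
qed

lemma DERIV_gibbs_var:
  "((\<lambda>t. gibbs_var I (\<lambda>i. w i + t * v i) u) has_real_derivative
    (gibbs_mean I (\<lambda>i. w i + t * v i) (\<lambda>i. v i * (u i)\<^sup>2) - gibbs_mean I (\<lambda>i. w i + t * v i) (\<lambda>i. (u i)\<^sup>2) * gibbs_mean I (\<lambda>i. w i + t * v i) v)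
    - 2 * gibbs_mean I (\<lambda>i. w i + t * v i) u * (gibbs_mean I (\<lambda>i. w i + t * v i) (\<lambda>i. v i * u i) - gibbs_mean I (\<lambda>i. w i + t * v i) u * gibbs_mean I (\<lambda>i. w i + t * v i) v)) (at t)"
  unfolding gibbs_var_def
  by (rule derivative_eq_intros DERIV_gibbs_mean refl)+ (simp add: power2_eq_square)

text \<open>For \<open>u = v\<close> this is the third derivative of \<open>lse\<close>. Every
  product of means is at most \<open>B ^ 3\<close>, and the terms count
  \<open>1 + 1 + 2 * (1 + 1) = 6\<close>.\<close>

lemma DERIV_gibbs_var_bound:
  assumes u: "\<And>i. i \<in> I \<Longrightarrow> \<bar>u i\<bar> \<le> B" and v: "\<And>i. i \<in> I \<Longrightarrow> \<bar>v i\<bar> \<le> B"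
  shows "\<bar>(gibbs_mean I w (\<lambda>i. v i * (u i)\<^sup>2) - gibbs_mean I w (\<lambda>i. (u i)\<^sup>2) * gibbs_mean I w v)
    - 2 * gibbs_mean I w u * (gibbs_mean I w (\<lambda>i. v i * u i) - gibbs_mean I w u * gibbs_mean I w v)\<bar> \<le> 6 * B ^ 3"
proof -
  have B: "B \<ge> 0" using I u by force
  have 1: "\<bar>gibbs_mean I w (\<lambda>i. v i * (u i)\<^sup>2)\<bar> \<le> B * B\<^sup>2"
    by (rule gibbs_mean_bound) (simp only: abs_mult power_abs, intro mult_mono power_mono u v, use B in auto)
  have 2: "\<bar>gibbs_mean I w (\<lambda>i. (u i)\<^sup>2)\<bar> \<le> B\<^sup>2"
    by (rule gibbs_mean_bound) (simp only: power_abs, intro power_mono u, use B in auto)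
  have 3: "\<bar>gibbs_mean I w v\<bar> \<le> B" "\<bar>gibbs_mean I w u\<bar> \<le> B" using u v by (auto intro: gibbs_mean_bound)
  have 4: "\<bar>gibbs_mean I w (\<lambda>i. v i * u i)\<bar> \<le> B * B"
    by (rule gibbs_mean_bound) (simp only: abs_mult, intro mult_mono u v, use B in auto)
  have 5: "\<bar>gibbs_mean I w (\<lambda>i. (u i)\<^sup>2) * gibbs_mean I w v\<bar> \<le> B\<^sup>2 * B"
    unfolding abs_mult by (intro mult_mono 2 3) (use B in auto)
  have 6: "\<bar>gibbs_mean I w u * gibbs_mean I w v\<bar> \<le> B * B"
    unfolding abs_mult by (intro mult_mono 3) (use B in auto)
  have "\<bar>gibbs_mean I w u * (gibbs_mean I w (\<lambda>i. v i * u i) - gibbs_mean I w u * gibbs_mean I w v)\<bar> \<le> B * (2 * (B * B))"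
    unfolding abs_mult[of "gibbs_mean I w u"] by (intro mult_mono 3) (use 4 6 B in auto)
  then show ?thesis using 1 5 by (simp add: power2_eq_square power3_eq_cube)
qed

lemma gibbs_var_lipschitz:
  assumes u: "\<And>i. i \<in> I \<Longrightarrow> \<bar>u i\<bar> \<le> B" and v: "\<And>i. i \<in> I \<Longrightarrow> \<bar>v i\<bar> \<le> B"
  shows "\<bar>gibbs_var I (\<lambda>i. w i + h * v i) u - gibbs_var I w u\<bar> \<le> 6 * B ^ 3 * \<bar>h\<bar>"
  using field_differentiable_bound[of UNIV "\<lambda>t. gibbs_var I (\<lambda>i. w i + t * v i) u" _ "6 * B ^ 3" h 0,
    OF _ DERIV_gibbs_var] DERIV_gibbs_var_bound[OF u v] by simp

text \<open>Maclaurin's formula along the line in direction \<open>v\<close>; the constant 6 of the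
  third derivative cancels against \<open>fact 3\<close>.\<close>

lemma lse_taylor:
  assumes v: "\<And>i. i \<in> I \<Longrightarrow> \<bar>v i\<bar> \<le> B"
  shows "\<bar>lse I (\<lambda>i. w i + h * v i) - lse I w - h * gibbs_mean I w v - h\<^sup>2 / 2 * gibbs_var I w v\<bar> \<le> B ^ 3 * \<bar>h\<bar> ^ 3"
proof -
  define W where "W = (\<lambda>t i. w i + t * v i)"
  define d3 where "d3 = (\<lambda>t. (gibbs_mean I (W t) (\<lambda>i. v i * (v i)\<^sup>2) - gibbs_mean I (W t) (\<lambda>i. (v i)\<^sup>2) * gibbs_mean I (W t) v)
    - 2 * gibbs_mean I (W t) v * (gibbs_mean I (W t) (\<lambda>i. v i * v i) - gibbs_mean I (W t) v * gibbs_mean I (W t) v))"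
  define diff where "diff = (\<lambda>(m::nat) t. if m = 0 then lse I (W t) else if m = 1 then gibbs_mean I (W t) v
     else if m = 2 then gibbs_var I (W t) v else d3 t)"
  have "\<exists>t. \<bar>t\<bar> \<le> \<bar>h\<bar> \<and> diff 0 h = (\<Sum>m<3. diff m 0 / fact m * h ^ m) + diff 3 t / fact 3 * h ^ 3"
  proof (rule Maclaurin_bi_le[OF refl], intro allI impI)
    fix m :: nat and t :: real assume "m < 3 \<and> \<bar>t\<bar> \<le> \<bar>h\<bar>"
    then consider "m = 0" | "m = 1" | "m = 2" by linarith
    then show "(diff m has_real_derivative diff (Suc m) t) (at t)"
    proof cases
      case 1 then show ?thesis using DERIV_lse[of w v t] by (simp add: diff_def W_def)
    next
      case 2 then show ?thesis using DERIV_gibbs_mean[of w v v t]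
        by (simp add: diff_def W_def gibbs_var_def power2_eq_square)
    next
      case 3 then show ?thesis using DERIV_gibbs_var[of w v v t]
        by (simp add: diff_def W_def d3_def)
    qed
  qed
  then obtain t where t: "diff 0 h = (\<Sum>m<3. diff m 0 / fact m * h ^ m) + diff 3 t / fact 3 * h ^ 3" by blast
  have W0: "W 0 = w" by (simp add: W_def)
  have "lse I (W h) = lse I w + h * gibbs_mean I w v + h\<^sup>2 / 2 * gibbs_var I w v + d3 t / 6 * h ^ 3"
    using t by (simp add: diff_def numeral_3_eq_3 lessThan_Suc W0 fact_2 power2_eq_square)
  moreover have "\<bar>d3 t / 6 * h ^ 3\<bar> \<le> B ^ 3 * \<bar>h\<bar> ^ 3"
  proof -
    have "\<bar>d3 t\<bar> \<le> 6 * B ^ 3" unfolding d3_def by (rule DERIV_gibbs_var_bound[OF v v])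
    then have "\<bar>d3 t / 6\<bar> \<le> B ^ 3" by simp
    then show ?thesis unfolding abs_mult power_abs by (rule mult_right_mono) simp
  qed
  ultimately show ?thesis by (simp add: W_def)
qed

text \<open>The linear Taylor term averages to 0 and the square of the coefficient to 1, so
  smoothing at scale \<open>s\<close> adds half the variance sum. The error constant does not depend
  on \<open>w\<close>; this uniformity is what permits iterating the estimate.\<close>

lemma gavgs_lse_expansion:
  assumes "\<And>v i. v \<in> set vs \<Longrightarrow> i \<in> I \<Longrightarrow> \<bar>v i\<bar> \<le> B"
  shows "\<exists>C. \<forall>s w. 0 < s \<longrightarrow>
     \<bar>gavgs (scale_list s vs) (lse I) w - lse I w - s\<^sup>2 / 2 * (\<Sum>v\<leftarrow>vs. gibbs_var I w v)\<bar> \<le> C * s ^ 3"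
  using assms
proof (induction vs)
  case Nil
  show ?case by (rule exI[of _ 0]) simp
next
  case (Cons v vs)
  then obtain C where C: "\<And>s w. 0 < s \<Longrightarrow> \<bar>gavgs (scale_list s vs) (lse I) w - lse I w - s\<^sup>2 / 2 * (\<Sum>v\<leftarrow>vs. gibbs_var I w v)\<bar> \<le> C * s ^ 3"
    by force
  have B: "B \<ge> 0" using I Cons.prems[of v] by force
  define n where "n = real (length vs)"
  \<comment> \<open>The remaining directions act at the point shifted along \<open>v\<close>, so
    their variance sum there has to be compared with the one at \<open>w\<close>.\<close>
  have var: "\<bar>(\<Sum>u\<leftarrow>vs. gibbs_var I (\<lambda>i. w i + h * v i) u) - (\<Sum>u\<leftarrow>vs. gibbs_var I w u)\<bar> \<le> n * (6 * B ^ 3 * \<bar>h\<bar>)" for w h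
  proof -
    have "\<bar>(\<Sum>u\<leftarrow>us. gibbs_var I (\<lambda>i. w i + h * v i) u) - (\<Sum>u\<leftarrow>us. gibbs_var I w u)\<bar> \<le> real (length us) * (6 * B ^ 3 * \<bar>h\<bar>)"
      if "set us \<subseteq> set vs" for us
      using that
    proof (induction us)
      case (Cons u us)
      have "\<bar>gibbs_var I (\<lambda>i. w i + h * v i) u - gibbs_var I w u\<bar> \<le> 6 * B ^ 3 * \<bar>h\<bar>"
        using Cons.prems \<open>\<And>va i. va \<in> set (v # vs) \<Longrightarrow> i \<in> I \<Longrightarrow> \<bar>va i\<bar> \<le> B\<close> by (intro gibbs_var_lipschitz) auto
      with Cons show ?case by (simp add: algebra_simps)
    qed simp
    then show ?thesis by (simp add: n_def)
  qed
  \<comment> \<open>The term \<open>2 * B ^ 3\<close> is the Taylor error with third absolute moment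
    at most 2; \<open>3 * n * B ^ 3\<close> is \<open>1 / 2\<close> times \<open>n\<close> Lipschitz
    constants \<open>6 * B ^ 3\<close>, with first absolute moment at most 1.\<close>
  show ?case
  proof (intro exI[of _ "C + 2 * B ^ 3 + 3 * n * B ^ 3"] allI impI)
    fix s :: real and w assume s: "0 < s"
    let ?G = "gavgs (scale_list s vs) (lse I)"
    let ?S = "\<Sum>u\<leftarrow>vs. gibbs_var I w u"
    let ?m = "gibbs_mean I w v" and ?V = "gibbs_var I w v"
    let ?P = "\<lambda>x. lse I w + s\<^sup>2 / 2 * ?S + (s * ?m) * x + (s\<^sup>2 / 2 * ?V) * x\<^sup>2"
    let ?R = "\<lambda>x. C * s ^ 3 + (B ^ 3 * s ^ 3) * \<bar>x\<bar> ^ 3 + (3 * n * B ^ 3 * s ^ 3) * \<bar>x\<bar>"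
    have iG: "integrable std_gauss (\<lambda>x. ?G (\<lambda>i. w i + x * (s * v i)))"
      by (rule integrable_line[of I "?G" w "\<lambda>i. s * v i"]) (intro lip_on_gavgs lip_on_lse)
    have iP: "integrable std_gauss ?P" by auto
    have iR: "integrable std_gauss ?R" by auto
    have pt: "\<bar>?G (\<lambda>i. w i + x * (s * v i)) - ?P x\<bar> \<le> ?R x" for x
    proof -
      let ?w = "\<lambda>i. w i + (x * s) * v i"
      have w: "(\<lambda>i. w i + x * (s * v i)) = ?w" by (simp add: mult.assoc)
      have 1: "\<bar>?G ?w - lse I ?w - s\<^sup>2 / 2 * (\<Sum>u\<leftarrow>vs. gibbs_var I ?w u)\<bar> \<le> C * s ^ 3" by (rule C[OF s])
      have 2: "\<bar>lse I ?w - lse I w - (x * s) * ?m - (x * s)\<^sup>2 / 2 * ?V\<bar> \<le> B ^ 3 * \<bar>x * s\<bar> ^ 3"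
        by (rule lse_taylor) (use Cons.prems in auto)
      have "\<bar>s\<^sup>2 / 2 * ((\<Sum>u\<leftarrow>vs. gibbs_var I ?w u) - ?S)\<bar> \<le> s\<^sup>2 / 2 * (n * (6 * B ^ 3 * \<bar>x * s\<bar>))"
        unfolding abs_mult[of "s\<^sup>2 / 2"] using var[of w "x * s"] by (intro mult_mono) auto
      then have 3: "\<bar>s\<^sup>2 / 2 * (\<Sum>u\<leftarrow>vs. gibbs_var I ?w u) - s\<^sup>2 / 2 * ?S\<bar> \<le> (3 * n * B ^ 3 * s ^ 3) * \<bar>x\<bar>"
        using s by (simp add: right_diff_distrib abs_mult power2_eq_square power3_eq_cube mult_ac)
      have 4: "B ^ 3 * \<bar>x * s\<bar> ^ 3 = (B ^ 3 * s ^ 3) * \<bar>x\<bar> ^ 3" using s by (simp add: abs_mult power_mult_distrib)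
      have 5: "(x * s) * ?m + (x * s)\<^sup>2 / 2 * ?V = (s * ?m) * x + (s\<^sup>2 / 2 * ?V) * x\<^sup>2" by (simp add: power_mult_distrib)
      show ?thesis unfolding w using 1 2 3 unfolding 4 using 5 by linarith
    qed
    have "(\<integral>x. ?G (\<lambda>i. w i + x * (s * v i)) - ?P x \<partial>std_gauss) = gavgs (scale_list s (v # vs)) (lse I) w - (\<integral>x. ?P x \<partial>std_gauss)"
      by (subst Bochner_Integration.integral_diff[OF iG iP]) (simp add: gavg_def)
    also have "(\<integral>x. ?P x \<partial>std_gauss) = lse I w + s\<^sup>2 / 2 * ?S + s\<^sup>2 / 2 * ?V"
      by (simp add: SG.prob_space[simplified])
    finally have "\<bar>gavgs (scale_list s (v # vs)) (lse I) w - (lse I w + s\<^sup>2 / 2 * ?S + s\<^sup>2 / 2 * ?V)\<bar>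
      = \<bar>\<integral>x. ?G (\<lambda>i. w i + x * (s * v i)) - ?P x \<partial>std_gauss\<bar>" by simp
    also have "\<dots> \<le> (\<integral>x. ?R x \<partial>std_gauss)"
      by (rule integral_abs_bound_integral) (use iG iP iR pt in \<open>auto intro!: Bochner_Integration.integrable_diff\<close>)
    also have "\<dots> = C * s ^ 3 + (B ^ 3 * s ^ 3) * (\<integral>x. \<bar>x\<bar> ^ 3 \<partial>std_gauss) + (3 * n * B ^ 3 * s ^ 3) * (\<integral>x. \<bar>x\<bar> \<partial>std_gauss)"
      by (simp add: SG.prob_space[simplified])
    also have "\<dots> \<le> C * s ^ 3 + (B ^ 3 * s ^ 3) * 2 + (3 * n * B ^ 3 * s ^ 3) * 1"
      using s B by (intro add_mono[OF add_mono[OF order_refl]] mult_left_mono integral_std_gauss_abs_3_le integral_std_gauss_abs_le) (auto simp: n_def)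
    finally show "\<bar>gavgs (scale_list s (v # vs)) (lse I) w - lse I w - s\<^sup>2 / 2 * (\<Sum>v\<leftarrow>v # vs. gibbs_var I w v)\<bar> \<le> (C + 2 * B ^ 3 + 3 * n * B ^ 3) * s ^ 3"
      by (simp add: algebra_simps)
  qed
qed

text \<open>Averaging twice with scale \<open>s\<close> is averaging once with scale \<open>sqrt 2 * s\<close>. Hence \<open>2 ^ n\<close> steps of scale
  \<open>2 powr (- n / 2)\<close> lead to scale 1; each exchanged step costs an error of order \<open>2 powr (- 3 * n / 2)\<close>, so the total
  error tends to 0.\<close>

theorem gavgs_lse_slepian:
  assumes var: "\<And>w. (\<Sum>v\<leftarrow>vs. gibbs_var I w v) \<le> (\<Sum>u\<leftarrow>us. gibbs_var I w u)"
  shows "gavgs vs (lse I) w \<le> gavgs us (lse I) w"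
proof -
  define B where "B = (\<Sum>v\<leftarrow>vs @ us. \<Sum>i\<in>I. \<bar>v i\<bar>)"
  have B: "\<bar>v i\<bar> \<le> B" if "v \<in> set vs \<union> set us" "i \<in> I" for v i
  proof -
    have "\<bar>v i\<bar> \<le> (\<Sum>i\<in>I. \<bar>v i\<bar>)" by (rule member_le_sum) (use I that in auto)
    also have "\<dots> \<le> B" unfolding B_def
      by (rule member_le_sum_list) (use that in \<open>auto intro!: sum_nonneg\<close>)
    finally show ?thesis .
  qed
  obtain C1 where C1: "\<And>s w. 0 < s \<Longrightarrow> \<bar>gavgs (scale_list s vs) (lse I) w - lse I w - s\<^sup>2 / 2 * (\<Sum>v\<leftarrow>vs. gibbs_var I w v)\<bar> \<le> C1 * s ^ 3"
    using gavgs_lse_expansion[of vs B] B by blast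
  obtain C2 where C2: "\<And>s w. 0 < s \<Longrightarrow> \<bar>gavgs (scale_list s us) (lse I) w - lse I w - s\<^sup>2 / 2 * (\<Sum>v\<leftarrow>us. gibbs_var I w v)\<bar> \<le> C2 * s ^ 3"
    using gavgs_lse_expansion[of us B] B by blast
  define C where "C = C1 + C2"
  let ?A = "\<lambda>s. gavgs (scale_list s vs)" and ?B = "\<lambda>s. gavgs (scale_list s us)"
  have one: "?A s (lse I) w \<le> ?B s (lse I) w + C * s ^ 3" if s: "0 < s" for s w
  proof -
    have "s\<^sup>2 / 2 * (\<Sum>v\<leftarrow>vs. gibbs_var I w v) \<le> s\<^sup>2 / 2 * (\<Sum>v\<leftarrow>us. gibbs_var I w v)"
      by (intro mult_left_mono var) simp
    then show ?thesis using C1[OF s, of w] C2[OF s, of w] by (simp add: C_def distrib_right abs_le_iff)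
  qed
  note L = lip_on_lse lip_on_gavgs lip_on_add_const
  \<comment> \<open>Two steps of scale \<open>s\<close> are exchanged one after the other: the inner
    one under the operator \<open>?A s\<close>, then, after commuting the operators, the second one
    under \<open>?B s\<close>. Each exchange costs \<open>d\<close>.\<close>
  have double: "?A (sqrt 2 * s) (lse I) w \<le> ?B (sqrt 2 * s) (lse I) w + 2 * d"
    if s: "0 < s" and d: "\<And>w. ?A s (lse I) w \<le> ?B s (lse I) w + d" for s d w
  proof -
    have "?A (sqrt 2 * s) (lse I) w = ?A s (?A s (lse I)) w"
      using gavgs_gavgs_same[OF I(1) lip_on_lse s] by simp
    also have "\<dots> \<le> ?A s (\<lambda>w. ?B s (lse I) w + d) w"
      by (rule gavgs_mono[of I]) (intro L d)+
    also have "\<dots> = ?B s (?A s (lse I)) w + d"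
      using gavgs_commute[OF I(1) lip_on_lse] by (subst gavgs_add_const[of I]) (auto intro!: L)
    also have "?B s (?A s (lse I)) w \<le> ?B s (\<lambda>w. ?B s (lse I) w + d) w"
      by (rule gavgs_mono[of I]) (intro L d)+
    also have "?B s (\<lambda>w. ?B s (lse I) w + d) w = ?B (sqrt 2 * s) (lse I) w + d"
      using gavgs_gavgs_same[OF I(1) lip_on_lse s] by (subst gavgs_add_const[of I]) (auto intro!: L)
    finally show ?thesis by simp
  qed
  have iter: "?A (sqrt 2 ^ n * s) (lse I) w \<le> ?B (sqrt 2 ^ n * s) (lse I) w + 2 ^ n * (C * s ^ 3)" if s: "0 < s" for n s w
  proof (induction n arbitrary: w)
    case (Suc n)
    have "?A (sqrt 2 * (sqrt 2 ^ n * s)) (lse I) w \<le> ?B (sqrt 2 * (sqrt 2 ^ n * s)) (lse I) w + 2 * (2 ^ n * (C * s ^ 3))"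
      by (rule double) (use s Suc in auto)
    then show ?case by (simp add: mult.assoc)
  qed (use one[OF s] in simp)
  have "gavgs vs (lse I) w \<le> gavgs us (lse I) w + C * (1 / sqrt 2) ^ n" for n
  proof -
    have "2 ^ n * (C * (1 / sqrt 2 ^ n) ^ 3) = C * (1 / sqrt 2) ^ n"
    proof -
      have "(2::real) ^ n = sqrt 2 ^ n * sqrt 2 ^ n" by (simp add: power_mult_distrib[symmetric])
      then show ?thesis by (simp add: power3_eq_cube power_divide)
    qed
    note eq = this
    show ?thesis using iter[of "1 / sqrt 2 ^ n" n w, unfolded eq] by simp
  qed
  moreover have "(\<lambda>n. gavgs us (lse I) w + C * (1 / sqrt 2) ^ n) \<longlonglongrightarrow> gavgs us (lse I) w + C * 0"
    by (intro tendsto_intros LIMSEQ_realpow_zero) auto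
  ultimately show ?thesis
    using LIMSEQ_le_const[of "\<lambda>n. gavgs us (lse I) w + C * (1 / sqrt 2) ^ n"] by auto
qed

text \<open>Multiplied by the squared partition function, the variance sum is linear in the
  differences of variance and covariance, with positive coefficients. So an entrywise comparison of
  these differences yields the hypothesis of \<open>gavgs_lse_slepian\<close>.\<close>

lemma sum_gibbs_var:
  assumes L: "finite L"
  shows "(\<Sum>l\<in>L. gibbs_var I w (c l)) * (\<Sum>i\<in>I. exp (w i))\<^sup>2
     = (\<Sum>i\<in>I. \<Sum>j\<in>I. exp (w i) * exp (w j) * ((\<Sum>l\<in>L. (c l i)\<^sup>2) - (\<Sum>l\<in>L. c l i * c l j)))"
proof -
  let ?Z = "\<Sum>i\<in>I. exp (w i)"
  have Z: "?Z \<noteq> 0" using partition_pos[of w] by simp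
  have "gibbs_var I w g * ?Z\<^sup>2 = (\<Sum>i\<in>I. \<Sum>j\<in>I. exp (w i) * exp (w j) * ((g i)\<^sup>2 - g i * g j))" for g
  proof -
    have "gibbs_var I w g * ?Z\<^sup>2 = (\<Sum>i\<in>I. exp (w i) * (g i)\<^sup>2) * ?Z - (\<Sum>i\<in>I. exp (w i) * g i)\<^sup>2"
      using Z by (simp add: gibbs_var_def gibbs_mean_def power2_eq_square field_simps)
    also have "\<dots> = (\<Sum>i\<in>I. \<Sum>j\<in>I. exp (w i) * exp (w j) * ((g i)\<^sup>2 - g i * g j))"
    proof -
      have "(\<Sum>i\<in>I. exp (w i) * (g i)\<^sup>2) * ?Z = (\<Sum>i\<in>I. \<Sum>j\<in>I. exp (w i) * exp (w j) * (g i)\<^sup>2)"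
        unfolding sum_product by (simp add: mult_ac)
      moreover have "(\<Sum>i\<in>I. exp (w i) * g i)\<^sup>2 = (\<Sum>i\<in>I. \<Sum>j\<in>I. exp (w i) * exp (w j) * (g i * g j))"
        unfolding power2_eq_square sum_product by (simp add: mult_ac)
      ultimately show ?thesis by (simp add: sum_subtractf[symmetric] right_diff_distrib)
    qed
    finally show ?thesis .
  qed
  then have "(\<Sum>l\<in>L. gibbs_var I w (c l)) * ?Z\<^sup>2 = (\<Sum>l\<in>L. \<Sum>i\<in>I. \<Sum>j\<in>I. exp (w i) * exp (w j) * ((c l i)\<^sup>2 - c l i * c l j))"
    by (simp add: sum_distrib_right)
  also have "\<dots> = (\<Sum>i\<in>I. \<Sum>j\<in>I. \<Sum>l\<in>L. exp (w i) * exp (w j) * ((c l i)\<^sup>2 - c l i * c l j))"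
    by (subst sum.swap, rule sum.cong[OF refl], subst sum.swap, rule refl)
  also have "\<dots> = (\<Sum>i\<in>I. \<Sum>j\<in>I. exp (w i) * exp (w j) * ((\<Sum>l\<in>L. (c l i)\<^sup>2) - (\<Sum>l\<in>L. c l i * c l j)))"
    by (simp add: sum_subtractf[symmetric] sum_distrib_left[symmetric])
  finally show ?thesis .
qed

text \<open>The shift \<open>x * v i\<close> has mean zero, so averaging \<open>lse_lower\<close>
  along \<open>v\<close> keeps the bound \<open>w i\<close>. This discards the auxiliary variable in
  \<open>slepian_max\<close>.\<close>

lemma lse_le_gavg: "i \<in> I \<Longrightarrow> w i \<le> gavg v (lse I) w" for w :: "'i \<Rightarrow> real"
proof -
  assume i: "i \<in> I"
  have "w i = (\<integral>x. w i + x * v i \<partial>std_gauss)"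
    by (simp add: SG.prob_space[simplified])
  also have "\<dots> \<le> gavg v (lse I) w" unfolding gavg_def
  proof (rule integral_mono)
    show "integrable std_gauss (\<lambda>x. lse I (\<lambda>i. w i + x * v i))" by (rule integrable_line[OF lip_on_lse])
    show "w i + x * v i \<le> lse I (\<lambda>i. w i + x * v i)" for x using lse_lower[OF i, of "\<lambda>i. w i + x * v i"] .
  qed auto
  finally show ?thesis .
qed

lemma lip_on_Max: "lip_on I (\<lambda>w. Max (w ` I))"
proof -
  have *: "Max (w ` I) - Max (w' ` I) \<le> (\<Sum>i\<in>I. \<bar>w i - w' i\<bar>)" for w w' :: "'i \<Rightarrow> real"
  proof -
    have "Max (w ` I) \<in> w ` I" using I by (intro Max_in) auto
    then obtain i where i: "i \<in> I" "Max (w ` I) = w i" by auto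
    have "w' i \<le> Max (w' ` I)" using I i by (intro Max_ge) auto
    moreover have "\<bar>w i - w' i\<bar> \<le> (\<Sum>i\<in>I. \<bar>w i - w' i\<bar>)" by (rule member_le_sum) (use I i in auto)
    ultimately show ?thesis using i by linarith
  qed
  have "\<bar>Max (w ` I) - Max (w' ` I)\<bar> \<le> 1 * (\<Sum>i\<in>I. \<bar>w i - w' i\<bar>)" for w w' :: "'i \<Rightarrow> real"
    using *[of w w'] *[of w' w] by (simp add: abs_minus_commute abs_le_iff)
  then show ?thesis unfolding lip_on_def by (intro exI[of _ 1]) simp
qed

end

section \<open>Comparison of maxima of finitely many Gaussian variables\<close>

lemma integrable_PiM_abs: "finite L \<Longrightarrow> l \<in> L \<Longrightarrow> integrable (PiM L (\<lambda>_. std_gauss)) (\<lambda>x. \<bar>x l\<bar>)"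
proof -
  assume L: "finite L" "l \<in> L"
  have "distr (PiM L (\<lambda>_. std_gauss)) std_gauss (\<lambda>x. x l) = std_gauss"
    by (rule distr_PiM_component) (use L prob_space_std_gauss in auto)
  then have "integrable (distr (PiM L (\<lambda>_. std_gauss)) std_gauss (\<lambda>x. x l)) (\<lambda>x. \<bar>x\<bar>)" by simp
  then show ?thesis by (subst (asm) integrable_distr_eq) (use L in auto)
qed

lemma integrable_PiM_lip:
  assumes I: "finite I" and f: "lip_on I f" and L: "finite L"
  shows "integrable (PiM L (\<lambda>_. std_gauss)) (\<lambda>x. f (\<lambda>i. w i + (\<Sum>l\<in>L. x l * c l i)))"
proof -
  interpret P: prob_space "PiM L (\<lambda>_. std_gauss)" by (rule prob_space_PiM_std_gauss)
  obtain K where K: "K \<ge> 0" "\<And>w w'. \<bar>f w - f w'\<bar> \<le> K * (\<Sum>i\<in>I. \<bar>w i - w' i\<bar>)"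
    using lip_onD[OF f] by blast
  show ?thesis
  proof (rule Bochner_Integration.integrable_bound[of _ "\<lambda>x. \<bar>f w\<bar> + K * (\<Sum>i\<in>I. \<Sum>l\<in>L. \<bar>x l\<bar> * \<bar>c l i\<bar>)"])
    show "integrable (PiM L (\<lambda>_. std_gauss)) (\<lambda>x. \<bar>f w\<bar> + K * (\<Sum>i\<in>I. \<Sum>l\<in>L. \<bar>x l\<bar> * \<bar>c l i\<bar>))"
      using L by (intro Bochner_Integration.integrable_add integrable_mult_right Bochner_Integration.integrable_sum integrable_mult_left integrable_PiM_abs) auto
    show "(\<lambda>x. f (\<lambda>i. w i + (\<Sum>l\<in>L. x l * c l i))) \<in> borel_measurable (PiM L (\<lambda>_. std_gauss))"
      by (rule measurable_lip[OF I f]) simp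
    show "AE x in PiM L (\<lambda>_. std_gauss). norm (f (\<lambda>i. w i + (\<Sum>l\<in>L. x l * c l i))) \<le> norm (\<bar>f w\<bar> + K * (\<Sum>i\<in>I. \<Sum>l\<in>L. \<bar>x l\<bar> * \<bar>c l i\<bar>))"
    proof (intro AE_I2)
      fix x :: "'b \<Rightarrow> real"
      have "\<bar>f (\<lambda>i. w i + (\<Sum>l\<in>L. x l * c l i)) - f w\<bar> \<le> K * (\<Sum>i\<in>I. \<bar>\<Sum>l\<in>L. x l * c l i\<bar>)"
        using K(2)[of "\<lambda>i. w i + (\<Sum>l\<in>L. x l * c l i)" w] by simp
      also have "\<dots> \<le> K * (\<Sum>i\<in>I. \<Sum>l\<in>L. \<bar>x l\<bar> * \<bar>c l i\<bar>)"
        by (intro mult_left_mono K sum_mono) (simp add: abs_mult[symmetric])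
      finally show "norm (f (\<lambda>i. w i + (\<Sum>l\<in>L. x l * c l i))) \<le> norm (\<bar>f w\<bar> + K * (\<Sum>i\<in>I. \<Sum>l\<in>L. \<bar>x l\<bar> * \<bar>c l i\<bar>))" by simp
    qed
  qed
qed

text \<open>The counterpart of \<open>gint_PiM\<close> for real-valued functions; the innermost
  average is moved through the others by \<open>gavgs_gavg\<close>.\<close>

lemma integral_PiM_gavgs:
  fixes c :: "'b \<Rightarrow> 'i \<Rightarrow> real"
  assumes I: "finite I"
  shows "lip_on I f \<Longrightarrow> distinct xs \<Longrightarrow>
    (\<integral>x. f (\<lambda>i. w i + (\<Sum>l\<in>set xs. x l * c l i)) \<partial>PiM (set xs) (\<lambda>_. std_gauss)) = gavgs (map c xs) f w"
proof (induction xs arbitrary: f)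
  case Nil
  interpret P: prob_space "PiM ({} :: 'b set) (\<lambda>_. std_gauss)" by (rule prob_space_PiM_std_gauss)
  show ?case using P.prob_space by (simp del: space_PiM_std_gauss)
next
  case (Cons a xs)
  have "(\<integral>x. f (\<lambda>i. w i + (\<Sum>l\<in>set (a # xs). x l * c l i)) \<partial>PiM (set (a # xs)) (\<lambda>_. std_gauss))
     = (\<integral>x. \<integral>y. f (\<lambda>i. w i + (\<Sum>l\<in>set (a # xs). (x(a := y)) l * c l i)) \<partial>std_gauss \<partial>PiM (set xs) (\<lambda>_. std_gauss))"
    using Cons.prems integrable_PiM_lip[OF I Cons.prems(1), of "set (a # xs)" w c]
    by (simp add: PG.product_integral_insert)
  also have "\<dots> = (\<integral>x. gavg (c a) f (\<lambda>i. w i + (\<Sum>l\<in>set xs. x l * c l i)) \<partial>PiM (set xs) (\<lambda>_. std_gauss))"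
  proof (intro Bochner_Integration.integral_cong refl)
    fix x
    have "(\<Sum>l\<in>set (a # xs). (x(a := y)) l * c l i) = (\<Sum>l\<in>set xs. x l * c l i) + y * c a i" for y i
    proof -
      have "(\<Sum>l\<in>set xs. (x(a := y)) l * c l i) = (\<Sum>l\<in>set xs. x l * c l i)"
        by (rule sum.cong) (use Cons.prems in auto)
      then show ?thesis using Cons.prems by simp
    qed
    then show "(\<integral>y. f (\<lambda>i. w i + (\<Sum>l\<in>set (a # xs). (x(a := y)) l * c l i)) \<partial>std_gauss)
      = gavg (c a) f (\<lambda>i. w i + (\<Sum>l\<in>set xs. x l * c l i))"
      by (simp only: gavg_def add.assoc)
  qed
  also have "\<dots> = gavgs (map c xs) (gavg (c a) f) w"
    using Cons by auto
  finally show ?case using I Cons.prems by (simp add: gavgs_gavg[of I])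
qed

text \<open>The term \<open>c i\<close> is the coefficient of one further Gaussian variable that equalises the variances. Being
  centred and independent of the others, it can only increase the left-hand side, so it may be left out.\<close>

theorem slepian_max:
  fixes v :: "'a \<Rightarrow> 'i \<Rightarrow> real" and u :: "'b \<Rightarrow> 'i \<Rightarrow> real"
  assumes I: "finite I" "I \<noteq> {}" and L: "finite L" "finite L'"
    and diag: "\<And>i. i \<in> I \<Longrightarrow> (\<Sum>l\<in>L. (v l i)\<^sup>2) + (c i)\<^sup>2 = (\<Sum>l\<in>L'. (u l i)\<^sup>2)"
    and off: "\<And>i j. i \<in> I \<Longrightarrow> j \<in> I \<Longrightarrow> (\<Sum>l\<in>L'. u l i * u l j) \<le> (\<Sum>l\<in>L. v l i * v l j) + c i * c j"
  shows "(\<integral>x. Max ((\<lambda>i. \<Sum>l\<in>L. x l * v l i) ` I) \<partial>PiM L (\<lambda>_. std_gauss))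
      \<le> (\<integral>y. Max ((\<lambda>i. \<Sum>l\<in>L'. y l * u l i) ` I) \<partial>PiM L' (\<lambda>_. std_gauss))" (is "?X \<le> ?Y")
proof -
  obtain xs where xs: "set xs = L" "distinct xs" using finite_distinct_list[OF L(1)] by blast
  obtain ys where ys: "set ys = L'" "distinct ys" using finite_distinct_list[OF L(2)] by blast
  define mx where "mx = (\<lambda>w::'i \<Rightarrow> real. Max (w ` I))"
  have lip: "lip_on I mx" unfolding mx_def by (rule lip_on_Max[OF I])
  have mx_scale: "mx (\<lambda>i. b * w i) = b * mx w" if "b > 0" for b w
  proof -
    have "mono ((*) b)" using that by (auto simp: mono_def)
    then show ?thesis using I mono_Max_commute[of "(*) b" "w ` I"] by (simp add: mx_def image_image)
  qed
  have pull: "mx (\<lambda>i. 0 + (\<Sum>l\<in>T. x l * (b * e l i))) = b * Max ((\<lambda>i. \<Sum>l\<in>T. x l * e l i) ` I)"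
    if "b > 0" for b T x and e :: "'a \<Rightarrow> 'i \<Rightarrow> real"
  proof -
    have "(\<lambda>i. 0 + (\<Sum>l\<in>T. x l * (b * e l i))) = (\<lambda>i. b * (\<Sum>l\<in>T. x l * e l i))"
      by (simp add: sum_distrib_left mult.left_commute)
    then show ?thesis using mx_scale[OF that, of "\<lambda>i. \<Sum>l\<in>T. x l * e l i"] by (simp only: mx_def)
  qed
  have pull': "mx (\<lambda>i. 0 + (\<Sum>l\<in>T. x l * (b * e l i))) = b * Max ((\<lambda>i. \<Sum>l\<in>T. x l * e l i) ` I)"
    if "b > 0" for b T x and e :: "'b \<Rightarrow> 'i \<Rightarrow> real"
  proof -
    have "(\<lambda>i. 0 + (\<Sum>l\<in>T. x l * (b * e l i))) = (\<lambda>i. b * (\<Sum>l\<in>T. x l * e l i))"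
      by (simp add: sum_distrib_left mult.left_commute)
    then show ?thesis using mx_scale[OF that, of "\<lambda>i. \<Sum>l\<in>T. x l * e l i"] by (simp only: mx_def)
  qed
  \<comment> \<open>\<open>lse\<close> exceeds the maximum by at most \<open>ln (card I)\<close>,
    whatever the scale \<open>b\<close>. As both sides are homogeneous in \<open>b\<close>, division
    by a large \<open>b\<close> removes this error.\<close>
  have bound: "b * ?X \<le> b * ?Y + ln (card I)" if b: "b > 0" for b
  proof -
    let ?v = "\<lambda>l i. b * v l i" and ?u = "\<lambda>l i. b * u l i" and ?c = "\<lambda>i. b * c i"
    have "b * ?X = (\<integral>x. mx (\<lambda>i. 0 + (\<Sum>l\<in>set xs. x l * ?v l i)) \<partial>PiM (set xs) (\<lambda>_. std_gauss))"
      by (simp only: xs pull[OF b] integral_mult_right_zero)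
    also have "\<dots> = gavgs (map ?v xs) mx (\<lambda>_. 0)"
      by (rule integral_PiM_gavgs[OF I(1) lip xs(2)])
    also have "\<dots> \<le> gavgs (map ?v xs) (gavg ?c (lse I)) (\<lambda>_. 0)"
    proof (rule gavgs_mono[OF lip])
      show "lip_on I (gavg ?c (lse I))" by (intro lip_on_gavg lip_on_lse I)
      show "mx w \<le> gavg ?c (lse I) w" for w
        unfolding mx_def using I by (intro Max.boundedI) (auto intro: lse_le_gavg)
    qed
    also have "\<dots> = gavgs (?c # map ?v xs) (lse I) (\<lambda>_. 0)"
      using I by (simp add: gavgs_gavg[of I] lip_on_lse)
    also have "\<dots> \<le> gavgs (map ?u ys) (lse I) (\<lambda>_. 0)"
    proof (rule gavgs_lse_slepian[OF I])
      fix w :: "'i \<Rightarrow> real"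
      let ?Z = "\<Sum>i\<in>I. exp (w i)"
      have Z: "?Z > 0" by (rule partition_pos[OF I])
      \<comment> \<open>The index \<open>None\<close> carries the auxiliary variable with
        coefficients \<open>c\<close>, so that \<open>sum_gibbs_var\<close> applies to the enlarged
        family.\<close>
      define V where "V = (\<lambda>l. case l of None \<Rightarrow> ?c | Some l \<Rightarrow> ?v l)"
      have opt: "(\<Sum>l\<in>insert None (Some ` L). g (V l)) = g ?c + (\<Sum>l\<in>L. g (?v l))" for g :: "('i \<Rightarrow> real) \<Rightarrow> real"
        using L by (subst sum.insert) (auto simp: V_def sum.reindex)
      have "(\<Sum>v\<leftarrow>?c # map ?v xs. gibbs_var I w v) * ?Z\<^sup>2 = (\<Sum>l\<in>insert None (Some ` L). gibbs_var I w (V l)) * ?Z\<^sup>2"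
        using xs by (simp add: opt sum_list_distinct_conv_sum_set o_def)
      also have "\<dots> = (\<Sum>i\<in>I. \<Sum>j\<in>I. exp (w i) * exp (w j) * ((\<Sum>l\<in>insert None (Some ` L). (V l i)\<^sup>2) - (\<Sum>l\<in>insert None (Some ` L). V l i * V l j)))"
        by (rule sum_gibbs_var[OF I]) (use L in auto)
      also have "\<dots> \<le> (\<Sum>i\<in>I. \<Sum>j\<in>I. exp (w i) * exp (w j) * ((\<Sum>l\<in>L'. (?u l i)\<^sup>2) - (\<Sum>l\<in>L'. ?u l i * ?u l j)))"
      proof (intro sum_mono mult_left_mono)
        fix i j assume ij: "i \<in> I" "j \<in> I"
        have "(\<Sum>l\<in>insert None (Some ` L). (V l i)\<^sup>2) = b\<^sup>2 * ((\<Sum>l\<in>L. (v l i)\<^sup>2) + (c i)\<^sup>2)"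
          by (simp add: opt[of "\<lambda>x. (x i)\<^sup>2"] power_mult_distrib sum_distrib_left[symmetric] distrib_left)
        moreover have "(\<Sum>l\<in>insert None (Some ` L). V l i * V l j) = b\<^sup>2 * ((\<Sum>l\<in>L. v l i * v l j) + c i * c j)"
          by (subst opt[of "\<lambda>x. x i * x j"]) (simp add: power2_eq_square sum_distrib_left distrib_left mult_ac)
        moreover have "(\<Sum>l\<in>L'. (?u l i)\<^sup>2) = b\<^sup>2 * (\<Sum>l\<in>L'. (u l i)\<^sup>2)"
          by (simp add: power_mult_distrib sum_distrib_left[symmetric])
        moreover have "(\<Sum>l\<in>L'. ?u l i * ?u l j) = b\<^sup>2 * (\<Sum>l\<in>L'. u l i * u l j)"
          by (simp add: power2_eq_square sum_distrib_left mult_ac)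
        moreover have "b\<^sup>2 * (\<Sum>l\<in>L'. u l i * u l j) \<le> b\<^sup>2 * ((\<Sum>l\<in>L. v l i * v l j) + c i * c j)"
          by (intro mult_left_mono off ij) simp
        ultimately show "(\<Sum>l\<in>insert None (Some ` L). (V l i)\<^sup>2) - (\<Sum>l\<in>insert None (Some ` L). V l i * V l j)
          \<le> (\<Sum>l\<in>L'. (?u l i)\<^sup>2) - (\<Sum>l\<in>L'. ?u l i * ?u l j)"
          using diag[OF ij(1)] by simp
      qed auto
      also have "\<dots> = (\<Sum>l\<in>L'. gibbs_var I w (?u l)) * ?Z\<^sup>2"
        by (rule sum_gibbs_var[OF I, symmetric]) (use L in auto)
      also have "(\<Sum>l\<in>L'. gibbs_var I w (?u l)) = (\<Sum>v\<leftarrow>map ?u ys. gibbs_var I w v)"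
        using ys by (simp add: sum_list_distinct_conv_sum_set o_def)
      finally show "(\<Sum>v\<leftarrow>?c # map ?v xs. gibbs_var I w v) \<le> (\<Sum>v\<leftarrow>map ?u ys. gibbs_var I w v)"
        using Z by simp
    qed
    also have "\<dots> \<le> gavgs (map ?u ys) (\<lambda>w. mx w + ln (card I)) (\<lambda>_. 0)"
    proof (rule gavgs_mono)
      show "lse I w \<le> mx w + ln (card I)" for w
        unfolding mx_def using I by (intro lse_upper) auto
    qed (use lip lip_on_lse[OF I] in auto)
    also have "\<dots> = gavgs (map ?u ys) mx (\<lambda>_. 0) + ln (card I)"
      by (simp add: gavgs_add_const[OF lip])
    also have "gavgs (map ?u ys) mx (\<lambda>_. 0) = (\<integral>x. mx (\<lambda>i. 0 + (\<Sum>l\<in>set ys. x l * ?u l i)) \<partial>PiM (set ys) (\<lambda>_. std_gauss))"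
      by (rule integral_PiM_gavgs[OF I(1) lip ys(2), symmetric])
    also have "\<dots> = b * ?Y"
      by (simp only: ys pull'[OF b] integral_mult_right_zero)
    finally show ?thesis .
  qed
  have "?X \<le> ?Y + e" if e: "e > 0" for e
  proof -
    have n: "ln (card I) \<ge> 0" using I by (simp add: Suc_le_eq card_gt_0_iff)
    define b where "b = (ln (card I) + 1) / e"
    have b: "b > 0" using n e by (simp add: b_def)
    have "b * ?X \<le> b * ?Y + b * e" using bound[OF b] e by (simp add: b_def)
    then have "b * ?X \<le> b * (?Y + e)" by (simp add: distrib_left)
    then show ?thesis using b by simp
  qed
  then show ?thesis by (rule field_le_epsilon)
qed

section \<open>Chevet's inequality\<close>

text \<open>Normalised, \<open>c\<close> is a single orthonormal column, and rotation invariance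
  applies with a one-point index set. The zero vector has no direction and is treated apart.\<close>

lemma nn_integral_PiM_linear:
  assumes I: "finite I" and f[measurable]: "f \<in> borel_measurable borel"
  shows "(\<integral>\<^sup>+x. f (\<Sum>i\<in>I. x i * c i) \<partial>PiM I (\<lambda>_. std_gauss)) = (\<integral>\<^sup>+z. f (sqrt (\<Sum>i\<in>I. (c i)\<^sup>2) * z) \<partial>std_gauss)"
proof -
  define r where "r = sqrt (\<Sum>i\<in>I. (c i)\<^sup>2)"
  have r2: "r\<^sup>2 = (\<Sum>i\<in>I. (c i)\<^sup>2)" by (simp add: r_def sum_nonneg)
  show ?thesis
  proof (cases "r = 0")
    case True
    then have "c i = 0" if "i \<in> I" for i
      using r2 that I by (simp add: sum_nonneg_eq_0_iff)
    then have "(\<integral>\<^sup>+x. f (\<Sum>i\<in>I. x i * c i) \<partial>PiM I (\<lambda>_. std_gauss)) = (\<integral>\<^sup>+x. f 0 \<partial>PiM I (\<lambda>_. std_gauss))"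
      by simp
    also have "\<dots> = f 0"
      using prob_space.emeasure_space_1[OF prob_space_PiM_std_gauss, of I] by (simp del: space_PiM_std_gauss)
    finally show ?thesis using True SG.emeasure_space_1 by (simp add: r_def[symmetric])
  next
    case False
    have 1: "(\<Sum>i\<in>I. (c i / r) * (c i / r)) = 1"
    proof -
      have "(\<Sum>i\<in>I. (c i / r) * (c i / r)) = (\<Sum>i\<in>I. (c i)\<^sup>2) / r\<^sup>2"
        by (simp add: power2_eq_square sum_divide_distrib)
      then show ?thesis using False unfolding r2[symmetric] by simp
    qed
    have "(\<integral>\<^sup>+x. f (\<Sum>i\<in>I. x i * c i) \<partial>PiM I (\<lambda>_. std_gauss))
       = (\<integral>\<^sup>+x. (\<lambda>y. f (r * y ())) (\<lambda>l\<in>{()}. \<Sum>i\<in>I. x i * (c i / r)) \<partial>PiM I (\<lambda>_. std_gauss))"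
      using False by (simp add: sum_distrib_left)
    also have "\<dots> = (\<integral>\<^sup>+y. f (r * y ()) \<partial>PiM {()} (\<lambda>_. std_gauss))"
      by (rule nn_integral_PiM_orthonormal) (use I 1 in auto)
    also have "\<dots> = (\<integral>\<^sup>+z. f (r * z) \<partial>std_gauss)"
      by (rule PG.product_nn_integral_singleton[of "\<lambda>z. f (r * z)" "()"]) simp
    finally show ?thesis by (simp add: r_def)
  qed
qed

lemma has_bochner_integral_PiM_square:
  assumes I: "finite I"
  shows "has_bochner_integral (PiM I (\<lambda>_. std_gauss)) (\<lambda>x. (\<Sum>i\<in>I. x i * c i)\<^sup>2) (\<Sum>i\<in>I. (c i)\<^sup>2)"
proof (rule has_bochner_integral_nn_integral)
  have "(\<integral>\<^sup>+x. ennreal ((\<Sum>i\<in>I. x i * c i)\<^sup>2) \<partial>PiM I (\<lambda>_. std_gauss)) = (\<integral>\<^sup>+z. ennreal ((sqrt (\<Sum>i\<in>I. (c i)\<^sup>2) * z)\<^sup>2) \<partial>std_gauss)"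
    by (rule nn_integral_PiM_linear[OF I]) simp
  also have "\<dots> = (\<integral>\<^sup>+z. ennreal (\<Sum>i\<in>I. (c i)\<^sup>2) * ennreal (\<bar>z\<bar> ^ 2) \<partial>std_gauss)"
    by (simp add: power_mult_distrib sum_nonneg ennreal_mult')
  also have "\<dots> = ennreal (\<Sum>i\<in>I. (c i)\<^sup>2) * (\<integral>\<^sup>+z. ennreal (\<bar>z\<bar> ^ 2) \<partial>std_gauss)"
    by (rule nn_integral_cmult) simp
  also have "(\<integral>\<^sup>+z. ennreal (\<bar>z\<bar> ^ 2) \<partial>std_gauss) = 1"
    using nn_integral_std_gauss_abs_power[of 2] abs_moment_Suc_Suc[of 0] by (simp add: abs_moment_0 numeral_2_eq_2)
  finally show "(\<integral>\<^sup>+x. ennreal ((\<Sum>i\<in>I. x i * c i)\<^sup>2) \<partial>PiM I (\<lambda>_. std_gauss)) = ennreal (\<Sum>i\<in>I. (c i)\<^sup>2)" by simp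
qed (auto simp: sum_nonneg)

text \<open>Jensen's inequality for the square root, obtained from the nonnegativity of the variance
  of \<open>sqrt (Q x)\<close>.\<close>

lemma (in prob_space) expectation_sqrt_le:
  fixes Q :: "'a \<Rightarrow> real"
  assumes Q: "integrable M Q" "\<And>x. Q x \<ge> 0"
  shows "integrable M (\<lambda>x. sqrt (Q x))" "expectation (\<lambda>x. sqrt (Q x)) \<le> sqrt (expectation Q)"
proof -
  have m: "(\<lambda>x. sqrt (Q x)) \<in> borel_measurable M" using Q by measurable
  have s: "integrable M (\<lambda>x. (sqrt (Q x))\<^sup>2)" using Q by simp
  show i: "integrable M (\<lambda>x. sqrt (Q x))"
    by (rule square_integrable_imp_integrable[OF m s])
  have "0 \<le> expectation (\<lambda>x. (sqrt (Q x))\<^sup>2) - (expectation (\<lambda>x. sqrt (Q x)))\<^sup>2"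
    using variance_eq[OF i s] variance_positive[of "\<lambda>x. sqrt (Q x)"] by simp
  then have "(expectation (\<lambda>x. sqrt (Q x)))\<^sup>2 \<le> expectation Q" using Q by simp
  then show "expectation (\<lambda>x. sqrt (Q x)) \<le> sqrt (expectation Q)" by (rule real_le_rsqrt)
qed

text \<open>Rounding goes towards zero, so that no coordinate grows in absolute value and rounded
  points stay in the unit ball.\<close>

definition round0 :: "nat \<Rightarrow> real \<Rightarrow> real" where
  "round0 N x = sgn x * real_of_int \<lfloor>real N * \<bar>x\<bar>\<rfloor> / real N"

lemma abs_round0_le: "\<bar>round0 N x\<bar> \<le> \<bar>x\<bar>"
proof (cases "N = 0 \<or> x = 0")
  case False
  have "real_of_int \<lfloor>real N * \<bar>x\<bar>\<rfloor> \<le> real N * \<bar>x\<bar>" by linarith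
  moreover have "0 \<le> real_of_int \<lfloor>real N * \<bar>x\<bar>\<rfloor>" by simp
  ultimately show ?thesis using False by (simp add: round0_def abs_mult abs_sgn_eq pos_divide_le_eq mult.commute)
qed (auto simp: round0_def)

lemma round0_error: "N > 0 \<Longrightarrow> \<bar>x - round0 N x\<bar> \<le> 1 / real N"
proof -
  assume N: "N > 0"
  have "x - round0 N x = sgn x * (real N * \<bar>x\<bar> - real_of_int \<lfloor>real N * \<bar>x\<bar>\<rfloor>) / real N"
    using N abs_mult_sgn[of x] by (simp add: round0_def field_simps)
  moreover have "\<bar>real N * \<bar>x\<bar> - real_of_int \<lfloor>real N * \<bar>x\<bar>\<rfloor>\<bar> \<le> 1" by linarith
  ultimately show ?thesis using N by (auto simp: abs_mult abs_sgn_eq divide_right_mono)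
qed

text \<open>A finite net of the unit ball contained in the ball; it is needed because
  \<open>slepian_max\<close> compares finite maxima only.\<close>

definition unit_grid :: "'l set \<Rightarrow> nat \<Rightarrow> ('l \<Rightarrow> real) set" where
  "unit_grid L N = (\<lambda>u. \<lambda>l\<in>L. round0 N (u l)) ` {u. (\<Sum>l\<in>L. (u l)\<^sup>2) \<le> 1}"

lemma sum_squares_le_1D:
  fixes u :: "'l \<Rightarrow> real"
  assumes "finite L" "(\<Sum>l\<in>L. (u l)\<^sup>2) \<le> 1" "l \<in> L"
  shows "\<bar>u l\<bar> \<le> 1"
proof -
  have "(u l)\<^sup>2 \<le> (\<Sum>l\<in>L. (u l)\<^sup>2)" by (rule member_le_sum) (use assms in auto)
  then show ?thesis using assms(2) by (simp add: abs_square_le_1[symmetric])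
qed

lemma finite_unit_grid:
  assumes L: "finite L"
  shows "finite (unit_grid L N)"
proof (rule finite_subset)
  let ?S = "(\<lambda>z. real_of_int z / real N) ` {- int N..int N}"
  show "finite (PiE L (\<lambda>_. ?S))" using L by (intro finite_PiE) auto
  show "unit_grid L N \<subseteq> PiE L (\<lambda>_. ?S)"
  proof (clarsimp simp: unit_grid_def)
    fix u l assume u: "(\<Sum>l\<in>L. (u l)\<^sup>2) \<le> (1::real)" and l: "l \<in> L"
    have 1: "\<bar>u l\<bar> \<le> 1" by (rule sum_squares_le_1D[OF L u l])
    define k where "k = \<lfloor>real N * \<bar>u l\<bar>\<rfloor>"
    have "real N * \<bar>u l\<bar> \<le> real N * 1" using 1 by (intro mult_left_mono) auto
    then have k: "0 \<le> k" "k \<le> int N" by (auto simp: k_def floor_le_iff)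
    have "round0 N (u l) = real_of_int (if u l > 0 then k else if u l < 0 then - k else 0) / real N"
      by (auto simp: round0_def k_def sgn_if)
    moreover have "(if u l > 0 then k else if u l < 0 then - k else 0) \<in> {- int N..int N}" using k by auto
    ultimately show "round0 N (u l) \<in> ?S" by (rule image_eqI)
  qed
qed

lemma unit_grid_le_1:
  assumes L: "finite L" and u: "u \<in> unit_grid L N"
  shows "(\<Sum>l\<in>L. (u l)\<^sup>2) \<le> 1"
proof -
  obtain u' where u': "(\<Sum>l\<in>L. (u' l)\<^sup>2) \<le> 1" "u = (\<lambda>l\<in>L. round0 N (u' l))" using u by (auto simp: unit_grid_def)
  have "(\<Sum>l\<in>L. (u l)\<^sup>2) \<le> (\<Sum>l\<in>L. (u' l)\<^sup>2)"
    using u'(2) by (intro sum_mono) (auto simp: abs_le_square_iff[symmetric] abs_round0_le)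
  then show ?thesis using u' by simp
qed

lemma Cauchy_Schwarz_sum:
  fixes a b :: "'l \<Rightarrow> real"
  shows "(\<Sum>l\<in>L. a l * b l) \<le> sqrt (\<Sum>l\<in>L. (a l)\<^sup>2) * sqrt (\<Sum>l\<in>L. (b l)\<^sup>2)"
  using Cauchy_Schwarz_ineq_sum[of a b L] by (simp add: real_le_rsqrt real_sqrt_mult[symmetric])

text \<open>The Gaussian bilinear form is compared with a sum of two independent linear forms. The
  difference of covariances is the product of
  \<open>\<alpha> i * \<alpha> j - (\<Sum>l\<in>L. a i l * a j l)\<close> and the analogous term for
  \<open>\<beta>\<close> and \<open>b\<close>; both are nonnegative by the Cauchy-Schwarz
  inequality. Assumption \<open>fb\<close> places \<open>f\<close> below the operator norm without
  mentioning a supremum over unit vectors.\<close>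

theorem chevet:
  fixes t :: "'k \<Rightarrow> 'p \<Rightarrow> real" and s :: "'l \<Rightarrow> real"
  assumes fin: "finite L" "finite P" "finite R"
    and smax: "\<And>l. l \<in> L \<Longrightarrow> \<bar>s l\<bar> \<le> smax" "smax \<ge> 0"
    and \<tau>: "\<And>v. (\<Sum>i\<in>R. (v i)\<^sup>2) \<le> 1 \<Longrightarrow> sqrt (\<Sum>j\<in>P. (\<Sum>i\<in>R. v i * t i j)\<^sup>2) \<le> \<tau>"
    and f: "f \<in> borel_measurable (PiM (L \<times> P) (\<lambda>_. borel))"
    and fb: "\<And>x c. c \<ge> 0 \<Longrightarrow> (\<And>u v. (\<Sum>l\<in>L. (u l)\<^sup>2) \<le> 1 \<Longrightarrow> (\<Sum>i\<in>R. (v i)\<^sup>2) \<le> 1 \<Longrightarrow>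
        (\<Sum>l\<in>L. \<Sum>j\<in>P. x (l, j) * (u l * s l * (\<Sum>i\<in>R. v i * t i j))) \<le> c) \<Longrightarrow> f x \<le> ennreal c"
  shows "(\<integral>\<^sup>+x. f x \<partial>PiM (L \<times> P) (\<lambda>_. std_gauss))
     \<le> ennreal (smax * sqrt (\<Sum>i\<in>R. \<Sum>j\<in>P. (t i j)\<^sup>2) + sqrt (\<Sum>l\<in>L. (s l)\<^sup>2) * \<tau>)" (is "_ \<le> ennreal ?C")
proof -
  let ?G = "PiM (L \<times> P) (\<lambda>_. std_gauss)" and ?H = "PiM (L <+> P) (\<lambda>_. std_gauss)"
  interpret G: prob_space ?G by (rule prob_space_PiM_std_gauss)
  interpret H: prob_space ?H by (rule prob_space_PiM_std_gauss)
  have \<tau>0: "\<tau> \<ge> 0" using \<tau>[of "\<lambda>_. 0"] by simp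
  define a where "a = (\<lambda>(u :: 'l \<Rightarrow> real, v :: 'k \<Rightarrow> real) l. u l * s l)"
  define b where "b = (\<lambda>(u :: 'l \<Rightarrow> real, v :: 'k \<Rightarrow> real) j. \<Sum>i\<in>R. v i * t i j)"
  define \<alpha> where "\<alpha> = (\<lambda>i. sqrt (\<Sum>l\<in>L. (a i l)\<^sup>2))"
  define \<beta> where "\<beta> = (\<lambda>i. sqrt (\<Sum>j\<in>P. (b i j)\<^sup>2))"
  have sq: "(\<alpha> i)\<^sup>2 = (\<Sum>l\<in>L. (a i l)\<^sup>2)" "(\<beta> i)\<^sup>2 = (\<Sum>j\<in>P. (b i j)\<^sup>2)" "\<alpha> i \<ge> 0" "\<beta> i \<ge> 0" for i
    by (auto simp: \<alpha>_def \<beta>_def sum_nonneg)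
  define w where "w = (\<lambda>l i. case l of Inl l \<Rightarrow> \<beta> i * a i l | Inr j \<Rightarrow> \<alpha> i * b i j)"
  have plus: "(\<Sum>l\<in>L <+> P. g l) = (\<Sum>l\<in>L. g (Inl l)) + (\<Sum>j\<in>P. g (Inr j))" for g :: "'l + 'p \<Rightarrow> real"
    using fin by (simp add: sum.Plus)
  have prod: "(\<Sum>q\<in>L \<times> P. g q) = (\<Sum>l\<in>L. \<Sum>j\<in>P. g (l, j))" for g :: "'l \<times> 'p \<Rightarrow> real"
    by (simp add: sum.cartesian_product case_prod_beta')
  define W where "W = (\<lambda>x. \<Sum>l\<in>L. \<Sum>j\<in>P. \<bar>x (l, j)\<bar> * (\<bar>s l\<bar> * (\<Sum>i\<in>R. \<bar>t i j\<bar>)))"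
  have iW: "integrable ?G W"
    unfolding W_def using fin
    by (intro Bochner_Integration.integrable_sum integrable_mult_left integrable_PiM_abs) auto
  define \<omega> where "\<omega> = (\<integral>x. W x \<partial>?G)"
  \<comment> \<open>On a grid of mesh \<open>1 / N\<close> the bilinear form changes by at most
    \<open>2 / N\<close> times \<open>W\<close>, whose mean is finite; \<open>N\<close> tends to
    infinity at the end.\<close>
  have step: "(\<integral>\<^sup>+x. f x \<partial>?G) \<le> ennreal (?C + 2 / real N * \<omega>)" if N: "N > 0" for N
  proof -
    define I where "I = unit_grid L N \<times> unit_grid R N"
    have I: "finite I" unfolding I_def using fin by (intro finite_cartesian_product finite_unit_grid)
    have z: "(\<lambda>l\<in>L. 0, \<lambda>i\<in>R. 0) \<in> I"
      unfolding I_def unit_grid_def by (auto intro!: image_eqI[of _ _ "\<lambda>_. 0"] simp: round0_def)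
    have I': "I \<noteq> {}" using z by auto
    define X where "X = (\<lambda>x. Max ((\<lambda>i. \<Sum>q\<in>L \<times> P. x q * (a i (fst q) * b i (snd q))) ` I))"
    define Y where "Y = (\<lambda>y. Max ((\<lambda>i. \<Sum>l\<in>L <+> P. y l * w l i) ` I))"
    have iX: "integrable ?G X" unfolding X_def
      using integrable_PiM_lip[OF I lip_on_Max[OF I I'], of "L \<times> P" "\<lambda>_. 0" "\<lambda>q i. a i (fst q) * b i (snd q)"] fin by simp
    have iY: "integrable ?H Y" unfolding Y_def
      using integrable_PiM_lip[OF I lip_on_Max[OF I I'], of "L <+> P" "\<lambda>_. 0" w] fin by simp
    \<comment> \<open>The bilinear form has variance \<open>(\<alpha> i * \<beta> i)\<^sup>2\<close>
      and the comparison variable twice that, so the extra Gaussian variable has coefficient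
      \<open>\<alpha> i * \<beta> i\<close>.\<close>
    have "(\<integral>x. X x \<partial>?G) \<le> (\<integral>y. Y y \<partial>?H)"
      unfolding X_def Y_def
    proof (rule slepian_max[OF I I', where c = "\<lambda>i. \<alpha> i * \<beta> i"])
      fix i
      show "(\<Sum>q\<in>L \<times> P. (a i (fst q) * b i (snd q))\<^sup>2) + (\<alpha> i * \<beta> i)\<^sup>2 = (\<Sum>l\<in>L <+> P. (w l i)\<^sup>2)"
        unfolding plus prod
        by (simp add: w_def power_mult_distrib sum_distrib_left[symmetric] sum_distrib_right[symmetric] sq)
    next
      fix i j
      have "(\<Sum>l\<in>L. a i l * a j l) \<le> \<alpha> i * \<alpha> j" "(\<Sum>q\<in>P. b i q * b j q) \<le> \<beta> i * \<beta> j"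
        unfolding \<alpha>_def \<beta>_def by (rule Cauchy_Schwarz_sum)+
      then have "0 \<le> (\<alpha> i * \<alpha> j - (\<Sum>l\<in>L. a i l * a j l)) * (\<beta> i * \<beta> j - (\<Sum>q\<in>P. b i q * b j q))" by simp
      moreover have "(\<Sum>l\<in>L <+> P. w l i * w l j) = \<beta> i * \<beta> j * (\<Sum>l\<in>L. a i l * a j l) + \<alpha> i * \<alpha> j * (\<Sum>q\<in>P. b i q * b j q)"
        unfolding plus by (simp add: w_def sum_distrib_left mult_ac)
      moreover have "(\<Sum>q\<in>L \<times> P. a i (fst q) * b i (snd q) * (a j (fst q) * b j (snd q))) = (\<Sum>l\<in>L. a i l * a j l) * (\<Sum>q\<in>P. b i q * b j q)"
        unfolding prod sum_product by (simp add: mult_ac)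
      ultimately show "(\<Sum>l\<in>L <+> P. w l i * w l j) \<le> (\<Sum>q\<in>L \<times> P. a i (fst q) * b i (snd q) * (a j (fst q) * b j (snd q))) + \<alpha> i * \<beta> i * (\<alpha> j * \<beta> j)"
        by (simp add: algebra_simps)
    qed (use fin in auto)
    also have "\<dots> \<le> ?C"
    proof -
      define Q1 where "Q1 = (\<lambda>y::('l + 'p) \<Rightarrow> real. \<Sum>l\<in>L. (y (Inl l) * s l)\<^sup>2)"
      define Q2 where "Q2 = (\<lambda>y::('l + 'p) \<Rightarrow> real. \<Sum>i\<in>R. (\<Sum>j\<in>P. y (Inr j) * t i j)\<^sup>2)"
      have sqr: "has_bochner_integral ?H (\<lambda>y. (\<Sum>q\<in>L <+> P. y q * c q)\<^sup>2) (\<Sum>q\<in>L <+> P. (c q)\<^sup>2)" for c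
        by (rule has_bochner_integral_PiM_square) (use fin in simp)
      have h1: "has_bochner_integral ?H (\<lambda>y. (y (Inl l) * s l)\<^sup>2) ((s l)\<^sup>2)" if "l \<in> L" for l
        using sqr[of "\<lambda>q. case q of Inl l' \<Rightarrow> if l' = l then s l else 0 | Inr j \<Rightarrow> 0"] that fin
        by (simp add: plus if_distrib if_distribR sum.delta cong: if_cong)
      have h2: "has_bochner_integral ?H (\<lambda>y. (\<Sum>j\<in>P. y (Inr j) * t i j)\<^sup>2) (\<Sum>j\<in>P. (t i j)\<^sup>2)" for i
        using sqr[of "\<lambda>q. case q of Inl l' \<Rightarrow> 0 | Inr j \<Rightarrow> t i j"] by (simp add: plus)
      have Q1: "has_bochner_integral ?H Q1 (\<Sum>l\<in>L. (s l)\<^sup>2)" unfolding Q1_def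
        by (rule has_bochner_integral_sum) (rule h1)
      have Q2: "has_bochner_integral ?H Q2 (\<Sum>i\<in>R. \<Sum>j\<in>P. (t i j)\<^sup>2)" unfolding Q2_def
        by (rule has_bochner_integral_sum) (rule h2)
      have E1: "integrable ?H (\<lambda>y. sqrt (Q1 y))" "(\<integral>y. sqrt (Q1 y) \<partial>?H) \<le> sqrt (\<Sum>l\<in>L. (s l)\<^sup>2)"
        using H.expectation_sqrt_le[of Q1] Q1 by (auto simp: has_bochner_integral_iff Q1_def sum_nonneg)
      have E2: "integrable ?H (\<lambda>y. sqrt (Q2 y))" "(\<integral>y. sqrt (Q2 y) \<partial>?H) \<le> sqrt (\<Sum>i\<in>R. \<Sum>j\<in>P. (t i j)\<^sup>2)"
        using H.expectation_sqrt_le[of Q2] Q2 by (auto simp: has_bochner_integral_iff Q2_def sum_nonneg)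
      \<comment> \<open>Over the unit balls the two linear forms are at most the norms
        \<open>sqrt (Q1 y)\<close> and \<open>sqrt (Q2 y)\<close>. Jensen's inequality bounds their
        means by the Frobenius norms of \<open>s\<close> and \<open>t\<close>.\<close>
      have pt: "Y y \<le> \<tau> * sqrt (Q1 y) + smax * sqrt (Q2 y)" for y
        unfolding Y_def
      proof (intro Max.boundedI)
        fix z assume "z \<in> (\<lambda>i. \<Sum>l\<in>L <+> P. y l * w l i) ` I"
        then obtain u v where uv: "u \<in> unit_grid L N" "v \<in> unit_grid R N" and z: "z = (\<Sum>l\<in>L <+> P. y l * w l (u, v))"
          by (auto simp: I_def)
        have u1: "(\<Sum>l\<in>L. (u l)\<^sup>2) \<le> 1" and v1: "(\<Sum>i\<in>R. (v i)\<^sup>2) \<le> 1"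
          using uv unit_grid_le_1 fin by blast+
        have \<beta>: "\<beta> (u, v) \<le> \<tau>" using \<tau>[OF v1] by (simp add: \<beta>_def b_def)
        have \<alpha>: "\<alpha> (u, v) \<le> smax"
        proof -
          have "(\<Sum>l\<in>L. (u l * s l)\<^sup>2) \<le> (\<Sum>l\<in>L. (u l)\<^sup>2 * smax\<^sup>2)"
            using smax by (intro sum_mono) (auto simp: power_mult_distrib intro!: mult_left_mono power_mono[of "\<bar>s _\<bar>" smax 2, simplified])
          also have "\<dots> \<le> 1 * smax\<^sup>2" unfolding sum_distrib_right[symmetric] by (intro mult_right_mono u1) auto
          finally show ?thesis using smax by (simp add: \<alpha>_def a_def real_le_lsqrt)
        qed
        have A: "(\<Sum>l\<in>L. u l * (y (Inl l) * s l)) \<le> sqrt (Q1 y)"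
        proof -
          have "(\<Sum>l\<in>L. u l * (y (Inl l) * s l)) \<le> sqrt (\<Sum>l\<in>L. (u l)\<^sup>2) * sqrt (Q1 y)"
            unfolding Q1_def by (rule Cauchy_Schwarz_sum)
          also have "\<dots> \<le> 1 * sqrt (Q1 y)" using u1 by (intro mult_right_mono) (auto simp: Q1_def sum_nonneg)
          finally show ?thesis by simp
        qed
        have B: "(\<Sum>i\<in>R. v i * (\<Sum>j\<in>P. y (Inr j) * t i j)) \<le> sqrt (Q2 y)"
        proof -
          have "(\<Sum>i\<in>R. v i * (\<Sum>j\<in>P. y (Inr j) * t i j)) \<le> sqrt (\<Sum>i\<in>R. (v i)\<^sup>2) * sqrt (Q2 y)"
            unfolding Q2_def by (rule Cauchy_Schwarz_sum)
          also have "\<dots> \<le> 1 * sqrt (Q2 y)" using v1 by (intro mult_right_mono) (auto simp: Q2_def sum_nonneg)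
          finally show ?thesis by simp
        qed
        have "z = \<beta> (u, v) * (\<Sum>l\<in>L. u l * (y (Inl l) * s l)) + \<alpha> (u, v) * (\<Sum>j\<in>P. \<Sum>i\<in>R. v i * (y (Inr j) * t i j))"
          unfolding z plus by (simp add: w_def a_def b_def sum_distrib_left mult_ac)
        also have "(\<Sum>j\<in>P. \<Sum>i\<in>R. v i * (y (Inr j) * t i j)) = (\<Sum>i\<in>R. v i * (\<Sum>j\<in>P. y (Inr j) * t i j))"
          by (subst sum.swap) (simp add: sum_distrib_left)
        also have "\<beta> (u, v) * (\<Sum>l\<in>L. u l * (y (Inl l) * s l)) + \<alpha> (u, v) * (\<Sum>i\<in>R. v i * (\<Sum>j\<in>P. y (Inr j) * t i j))
           \<le> \<beta> (u, v) * sqrt (Q1 y) + \<alpha> (u, v) * sqrt (Q2 y)"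
          by (intro add_mono mult_left_mono A B sq)
        also have "\<dots> \<le> \<tau> * sqrt (Q1 y) + smax * sqrt (Q2 y)"
          by (intro add_mono mult_right_mono \<alpha> \<beta>) (auto simp: Q1_def Q2_def sum_nonneg)
        finally show "z \<le> \<tau> * sqrt (Q1 y) + smax * sqrt (Q2 y)" .
      qed (use I I' in auto)
      have "(\<integral>y. Y y \<partial>?H) \<le> (\<integral>y. \<tau> * sqrt (Q1 y) + smax * sqrt (Q2 y) \<partial>?H)"
        by (intro integral_mono iY pt) (use E1 E2 in auto)
      also have "\<dots> = \<tau> * (\<integral>y. sqrt (Q1 y) \<partial>?H) + smax * (\<integral>y. sqrt (Q2 y) \<partial>?H)"
        using E1 E2 by simp
      also have "\<dots> \<le> \<tau> * sqrt (\<Sum>l\<in>L. (s l)\<^sup>2) + smax * sqrt (\<Sum>i\<in>R. \<Sum>j\<in>P. (t i j)\<^sup>2)"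
        by (intro add_mono mult_left_mono E1 E2 \<tau>0 smax)
      finally show ?thesis by (simp add: mult.commute)
    qed
    finally have EX: "(\<integral>x. X x \<partial>?G) \<le> ?C" .
    have X0: "X x \<ge> 0" for x
      unfolding X_def using I by (intro Max_ge) (auto intro!: image_eqI[OF _ z] simp: a_def b_def sum.neutral)
    have W0: "W x \<ge> 0" for x unfolding W_def by (intro sum_nonneg mult_nonneg_nonneg) auto
    have fX: "f x \<le> ennreal (X x + 2 / real N * W x)" for x
    proof (rule fb)
      show "0 \<le> X x + 2 / real N * W x" using X0 W0 by simp
      fix u :: "'l \<Rightarrow> real" and v :: "'k \<Rightarrow> real" assume uv: "(\<Sum>l\<in>L. (u l)\<^sup>2) \<le> 1" "(\<Sum>i\<in>R. (v i)\<^sup>2) \<le> 1"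
      let ?u = "\<lambda>l\<in>L. round0 N (u l)" and ?v = "\<lambda>i\<in>R. round0 N (v i)"
      have mem: "(?u, ?v) \<in> I" using uv by (auto simp: I_def unit_grid_def)
      have bil: "(\<Sum>l\<in>L. \<Sum>j\<in>P. x (l, j) * (u l * s l * (\<Sum>i\<in>R. v i * t i j))) = (\<Sum>l\<in>L. \<Sum>j\<in>P. \<Sum>i\<in>R. (u l * v i) * (x (l, j) * s l * t i j))" for u v
        by (simp add: sum_distrib_left mult_ac)
      have "(\<Sum>l\<in>L. \<Sum>j\<in>P. x (l, j) * (u l * s l * (\<Sum>i\<in>R. v i * t i j))) - (\<Sum>l\<in>L. \<Sum>j\<in>P. x (l, j) * (?u l * s l * (\<Sum>i\<in>R. ?v i * t i j)))
         = (\<Sum>l\<in>L. \<Sum>j\<in>P. \<Sum>i\<in>R. (u l * v i - ?u l * ?v i) * (x (l, j) * s l * t i j))"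
        unfolding bil by (simp add: sum_subtractf[symmetric] left_diff_distrib)
      also have "\<dots> \<le> (\<Sum>l\<in>L. \<Sum>j\<in>P. \<Sum>i\<in>R. 2 / real N * (\<bar>x (l, j)\<bar> * \<bar>s l\<bar> * \<bar>t i j\<bar>))"
      proof (intro sum_mono)
        fix l j i assume i: "l \<in> L" "i \<in> R"
        have "u l * v i - ?u l * ?v i = (u l - round0 N (u l)) * v i + round0 N (u l) * (v i - round0 N (v i))"
          using i by (simp add: algebra_simps)
        also have "\<bar>\<dots>\<bar> \<le> \<bar>u l - round0 N (u l)\<bar> * \<bar>v i\<bar> + \<bar>round0 N (u l)\<bar> * \<bar>v i - round0 N (v i)\<bar>"
          by (simp only: abs_mult[symmetric] abs_triangle_ineq)
        also have "\<dots> \<le> 1 / real N * 1 + 1 * (1 / real N)"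
          using sum_squares_le_1D[OF fin(1) uv(1) i(1)] sum_squares_le_1D[OF fin(3) uv(2) i(2)] abs_round0_le[of N "u l"]
          by (intro add_mono mult_mono round0_error N) auto
        finally have e: "\<bar>u l * v i - ?u l * ?v i\<bar> \<le> 2 / real N" by simp
        have "(u l * v i - ?u l * ?v i) * (x (l, j) * s l * t i j) \<le> \<bar>u l * v i - ?u l * ?v i\<bar> * \<bar>x (l, j) * s l * t i j\<bar>"
          unfolding abs_mult[symmetric] by (rule abs_ge_self)
        also have "\<dots> \<le> 2 / real N * \<bar>x (l, j) * s l * t i j\<bar>"
          by (intro mult_right_mono e) simp
        finally show "(u l * v i - ?u l * ?v i) * (x (l, j) * s l * t i j) \<le> 2 / real N * (\<bar>x (l, j)\<bar> * \<bar>s l\<bar> * \<bar>t i j\<bar>)"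
          by (simp only: abs_mult)
      qed
      also have "\<dots> = 2 / real N * W x"
        unfolding W_def sum_distrib_left by (simp only: mult.assoc)
      moreover have "(\<Sum>l\<in>L. \<Sum>j\<in>P. x (l, j) * (?u l * s l * (\<Sum>i\<in>R. ?v i * t i j))) \<le> X x"
        unfolding X_def using I mem
        by (intro Max_ge) (auto intro!: image_eqI[OF _ mem] simp: prod a_def b_def)
      ultimately show "(\<Sum>l\<in>L. \<Sum>j\<in>P. x (l, j) * (u l * s l * (\<Sum>i\<in>R. v i * t i j))) \<le> X x + 2 / real N * W x"
        by linarith
    qed
    have "(\<integral>\<^sup>+x. f x \<partial>?G) \<le> (\<integral>\<^sup>+x. ennreal (X x + 2 / real N * W x) \<partial>?G)"
      by (intro nn_integral_mono fX)
    also have "\<dots> = ennreal (\<integral>x. X x + 2 / real N * W x \<partial>?G)"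
      by (rule nn_integral_eq_integral) (use iX iW X0 W0 in auto)
    also have "(\<integral>x. X x + 2 / real N * W x \<partial>?G) = (\<integral>x. X x \<partial>?G) + 2 / real N * \<omega>"
      using iX iW by (simp add: \<omega>_def)
    finally show ?thesis using EX by (meson add_right_mono ennreal_leI order_trans)
  qed
  have "(\<lambda>N. ?C + 2 * (1 / real (Suc N)) * \<omega>) \<longlonglongrightarrow> ?C + 2 * 0 * \<omega>"
    by (intro tendsto_intros LIMSEQ_Suc[OF lim_1_over_n])
  then have "(\<lambda>N. ennreal (?C + 2 * (1 / real (Suc N)) * \<omega>)) \<longlonglongrightarrow> ennreal (?C + 2 * 0 * \<omega>)"
    by (rule tendsto_ennrealI)
  then have "(\<integral>\<^sup>+x. f x \<partial>?G) \<le> ennreal (?C + 2 * 0 * \<omega>)"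
    by (rule LIMSEQ_le_const) (use step[of "Suc _"] in \<open>auto intro!: exI[of _ 0]\<close>)
  then show ?thesis by simp
qed

section \<open>Inverse moments of Gaussian matrices\<close>

unbundle no vec_syntax

lemma vec_nonzero_entry:
  assumes v: "v \<in> carrier_vec k" "v \<noteq> 0\<^sub>v k"
  obtains i where "i < k" "v $ i \<noteq> 0"
proof -
  have "\<exists>i<k. v $ i \<noteq> 0"
  proof (rule ccontr)
    assume "\<not> (\<exists>i<k. v $ i \<noteq> 0)"
    then have "v = 0\<^sub>v k" using v(1) by (intro eq_vecI) auto
    then show False using v(2) by contradiction
  qed
  then show ?thesis using that by blast
qed

definition rat_vecs :: "nat \<Rightarrow> (nat \<Rightarrow> real) set" where
  "rat_vecs k = PiE {..<k} (\<lambda>_. \<rat>)"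

lemma countable_rat_vecs: "countable (rat_vecs k)"
  unfolding rat_vecs_def by (intro countable_PiE) (auto simp: countable_rat)

lemma rat_vecs_nonempty: "rat_vecs k \<noteq> {}"
  by (auto simp: rat_vecs_def PiE_eq_empty_iff intro: exI[of _ 0])

lemma rat_vecs_dense:
  fixes u :: "nat \<Rightarrow> real"
  obtains w where "\<And>n. w n \<in> rat_vecs k" "\<And>i. i < k \<Longrightarrow> (\<lambda>n. w n i) \<longlonglongrightarrow> u i"
proof -
  have "\<exists>q\<in>\<rat>. u i < q \<and> q < u i + 1 / real (Suc n)" for i n
    by (rule Rats_dense_in_real) simp
  then obtain q where q: "\<And>i n. q i n \<in> \<rat>" "\<And>i n. u i < q i n" "\<And>i n. q i n < u i + 1 / real (Suc n)"
    by metis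
  show ?thesis
  proof
    show "(\<lambda>i\<in>{..<k}. q i n) \<in> rat_vecs k" for n by (auto simp: rat_vecs_def q)
    fix i assume i: "i < k"
    have "(\<lambda>n. q i n) \<longlonglongrightarrow> u i"
    proof (rule tendsto_sandwich[of "\<lambda>_. u i" _ _ "\<lambda>n. u i + 1 / real (Suc n)"])
      have "(\<lambda>n. u i + 1 / real (Suc n)) \<longlonglongrightarrow> u i + 0"
        by (intro tendsto_intros LIMSEQ_Suc[OF lim_1_over_n])
      then show "(\<lambda>n. u i + 1 / real (Suc n)) \<longlonglongrightarrow> u i" by simp
    qed (use q in \<open>auto intro!: always_eventually less_imp_le\<close>)
    then show "(\<lambda>n. (\<lambda>i\<in>{..<k}. q i n) i) \<longlonglongrightarrow> u i" using i by simp
  qed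
qed

definition row_norm :: "nat \<Rightarrow> nat \<Rightarrow> (nat \<times> nat \<Rightarrow> real) \<Rightarrow> (nat \<Rightarrow> real) \<Rightarrow> real" where
  "row_norm k p H u = sqrt (\<Sum>j<p. (\<Sum>i<k. u i * H (i, j))\<^sup>2)"

text \<open>If the rows of \<open>H\<close> are independent, this is the norm of the shortest vector whose inner products with them
  are the entries of \<open>g\<close>; the supremum runs over rational vectors for the sake of measurability. In \<open>ennreal\<close>,
  \<open>0 / 0 = 0\<close> and \<open>a / 0 = \<infinity>\<close> for \<open>a > 0\<close>, so dependent rows give \<open>\<infinity>\<close> unless \<open>g\<close> satisfies the same relations.\<close>

definition inv_gain :: "nat \<Rightarrow> nat \<Rightarrow> (nat \<times> nat \<Rightarrow> real) \<Rightarrow> (nat \<Rightarrow> real) \<Rightarrow> ennreal" where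
  "inv_gain k p H g = (SUP u\<in>rat_vecs k. ennreal \<bar>\<Sum>i<k. u i * g i\<bar> / ennreal (row_norm k p H u))"

lemma measurable_inv_gain:
  assumes [measurable]: "\<And>i j. i < k \<Longrightarrow> j < p \<Longrightarrow> (\<lambda>x. H x (i, j)) \<in> borel_measurable M"
    and [measurable]: "\<And>i. i < k \<Longrightarrow> (\<lambda>x. g x i) \<in> borel_measurable M"
  shows "(\<lambda>x. inv_gain k p (H x) (g x)) \<in> borel_measurable M"
  unfolding inv_gain_def row_norm_def
proof (rule borel_measurable_SUP[OF countable_rat_vecs])
  fix u
  have [measurable]: "(\<lambda>x. \<Sum>i<k. u i * g x i) \<in> borel_measurable M"
    by (intro borel_measurable_sum borel_measurable_times) auto
  have [measurable]: "(\<lambda>x. \<Sum>j<p. (\<Sum>i<k. u i * H x (i, j))\<^sup>2) \<in> borel_measurable M"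
    by (intro borel_measurable_sum borel_measurable_power borel_measurable_times) auto
  show "(\<lambda>x. ennreal \<bar>\<Sum>i<k. u i * g x i\<bar> / ennreal (sqrt (\<Sum>j<p. (\<Sum>i<k. u i * H x (i, j))\<^sup>2))) \<in> borel_measurable M"
    by measurable
qed

lemma ennreal_divide_le_imp:
  assumes "ennreal a / ennreal b \<le> ennreal c" "a \<ge> 0" "b \<ge> 0" "c \<ge> 0"
  shows "a \<le> c * b"
proof (cases "b = 0")
  case True
  then show ?thesis using assms by (cases "a = 0") (auto simp: ennreal_divide_zero top_unique)
next
  case False
  then have "ennreal (a / b) \<le> ennreal c" using assms by (simp add: divide_ennreal)
  then show ?thesis using False assms by (simp add: pos_divide_le_eq)
qed

text \<open>For rational \<open>u\<close> this is the definition; both sides are continuous in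
  \<open>u\<close>.\<close>

lemma inv_gain_bound:
  assumes c: "inv_gain k p H g \<le> ennreal c" "c \<ge> 0"
  shows "\<bar>\<Sum>i<k. u i * g i\<bar> \<le> c * row_norm k p H u"
proof -
  obtain w where w: "\<And>n. w n \<in> rat_vecs k" "\<And>i. i < k \<Longrightarrow> (\<lambda>n. w n i) \<longlonglongrightarrow> u i"
    using rat_vecs_dense[of k u] by blast
  have le: "\<bar>\<Sum>i<k. w n i * g i\<bar> \<le> c * row_norm k p H (w n)" for n
  proof (rule ennreal_divide_le_imp)
    have "ennreal \<bar>\<Sum>i<k. w n i * g i\<bar> / ennreal (row_norm k p H (w n)) \<le> inv_gain k p H g"
      unfolding inv_gain_def by (rule SUP_upper[OF w(1)])
    then show "ennreal \<bar>\<Sum>i<k. w n i * g i\<bar> / ennreal (row_norm k p H (w n)) \<le> ennreal c"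
      using c(1) by (rule order_trans)
  qed (use c in \<open>auto simp: row_norm_def sum_nonneg\<close>)
  have "(\<lambda>n. \<bar>\<Sum>i<k. w n i * g i\<bar>) \<longlonglongrightarrow> \<bar>\<Sum>i<k. u i * g i\<bar>"
    by (intro tendsto_intros w) auto
  moreover have "(\<lambda>n. c * row_norm k p H (w n)) \<longlonglongrightarrow> c * row_norm k p H u"
    unfolding row_norm_def by (intro tendsto_intros w) auto
  ultimately show ?thesis by (rule LIMSEQ_le) (use le in auto)
qed

text \<open>The rows of \<open>t\<close> are the columns of the pseudo-inverse of \<open>H\<close>,
  formed with the inverse of the Gram matrix \<open>W\<close>. A kernel vector of \<open>W\<close>
  would have row norm 0 and a nonzero entry \<open>i\<close>, contradicting the finite gain at
  \<open>i\<close>. Any combination \<open>y\<close> of these rows is itself \<open>u\<close> times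
  \<open>H\<close>, so its squared norm equals \<open>(\<Sum>l<k. u l * g l)\<close>, at most
  \<open>c\<close> times its norm.\<close>

lemma dual_rows:
  assumes fin: "\<And>i. i < k \<Longrightarrow> inv_gain k p H (\<lambda>l. if l = i then 1 else 0) < \<infinity>"
  obtains t where "\<And>i i'. i < k \<Longrightarrow> i' < k \<Longrightarrow> (\<Sum>j<p. H (i, j) * t i' j) = (if i = i' then 1 else 0)"
    and "\<And>g c. c \<ge> 0 \<Longrightarrow> inv_gain k p H g \<le> ennreal c \<Longrightarrow> sqrt (\<Sum>j<p. (\<Sum>i<k. g i * t i j)\<^sup>2) \<le> c"
proof -
  define W where "W = mat k k (\<lambda>(i, l). \<Sum>j<p. H (i, j) * H (l, j))"
  have W: "W \<in> carrier_mat k k" by (simp add: W_def)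
  have "det W \<noteq> 0"
  proof
    assume "det W = 0"
    then obtain v where v: "v \<in> carrier_vec k" "v \<noteq> 0\<^sub>v k" "W *\<^sub>v v = 0\<^sub>v k"
      using det_0_iff_vec_prod_zero_field[OF W] by blast
    have Wv: "(\<Sum>l<k. (\<Sum>j<p. H (i, j) * H (l, j)) * v $ l) = 0" if "i < k" for i
      using arg_cong[OF v(3), of "\<lambda>x. x $ i"] that v(1)
      by (simp add: W_def scalar_prod_def atLeast0LessThan)
    have "(\<Sum>j<p. (\<Sum>i<k. v $ i * H (i, j))\<^sup>2) = (\<Sum>i<k. v $ i * (\<Sum>l<k. (\<Sum>j<p. H (i, j) * H (l, j)) * v $ l))"
      unfolding power2_eq_square sum_product sum_distrib_left sum_distrib_right
      by (subst sum.swap, rule sum.cong[OF refl], subst sum.swap) (simp add: mult_ac)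
    also have "\<dots> = 0" using Wv by simp
    finally have z: "row_norm k p H (\<lambda>i. v $ i) = 0" by (simp add: row_norm_def)
    obtain i where i: "i < k" "v $ i \<noteq> 0" using v(1,2) by (rule vec_nonzero_entry)
    obtain c where c: "c \<ge> 0" "inv_gain k p H (\<lambda>l. if l = i then 1 else 0) = ennreal c"
      using fin[OF i(1)] by (cases "inv_gain k p H (\<lambda>l. if l = i then 1 else 0)") auto
    have "\<bar>\<Sum>l<k. v $ l * (if l = i then 1 else 0)\<bar> \<le> c * row_norm k p H (\<lambda>i. v $ i)"
      by (rule inv_gain_bound) (use c in auto)
    then show False using i z by (simp add: if_distrib sum.delta cong: if_cong)
  qed
  then obtain B where B: "B \<in> carrier_mat k k" "B * W = 1\<^sub>m k"
    using det_non_zero_imp_unit[OF W, of "TYPE(real)"] unfolding Units_def ring_mat_def by auto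
  have BW: "(\<Sum>l<k. B $$ (i', l) * (\<Sum>j<p. H (l, j) * H (i, j))) = (if i = i' then 1 else 0)" if "i < k" "i' < k" for i i'
    using arg_cong[OF B(2), of "\<lambda>X. X $$ (i', i)"] that B(1)
    by (simp add: W_def times_mat_def scalar_prod_def atLeast0LessThan)
  define t where "t = (\<lambda>i j. \<Sum>l<k. B $$ (i, l) * H (l, j))"
  have dual: "(\<Sum>j<p. H (i, j) * t i' j) = (if i = i' then 1 else 0)" if "i < k" "i' < k" for i i'
  proof -
    have "(\<Sum>j<p. H (i, j) * t i' j) = (\<Sum>l<k. B $$ (i', l) * (\<Sum>j<p. H (l, j) * H (i, j)))"
      unfolding t_def sum_distrib_left by (subst sum.swap) (simp add: mult_ac)
    then show ?thesis using BW[OF that] by simp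
  qed
  show ?thesis
  proof (rule that[OF dual])
    fix g and c :: real assume c: "c \<ge> 0" "inv_gain k p H g \<le> ennreal c"
    define y where "y = (\<lambda>j. \<Sum>i<k. g i * t i j)"
    define u where "u = (\<lambda>l. \<Sum>i<k. g i * B $$ (i, l))"
    have yu: "y j = (\<Sum>l<k. u l * H (l, j))" for j
      unfolding y_def u_def t_def sum_distrib_left sum_distrib_right by (subst sum.swap) (simp add: mult_ac)
    have Hy: "(\<Sum>j<p. H (l, j) * y j) = g l" if "l < k" for l
    proof -
      have "(\<Sum>j<p. H (l, j) * y j) = (\<Sum>i<k. g i * (\<Sum>j<p. H (l, j) * t i j))"
        unfolding y_def sum_distrib_left by (subst sum.swap) (simp add: mult_ac)
      then show ?thesis using that by (simp add: dual if_distrib sum.delta cong: if_cong)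
    qed
    have "(\<Sum>j<p. (y j)\<^sup>2) = (\<Sum>j<p. y j * (\<Sum>l<k. u l * H (l, j)))"
      by (simp add: power2_eq_square yu[symmetric])
    also have "\<dots> = (\<Sum>l<k. u l * (\<Sum>j<p. H (l, j) * y j))"
      unfolding sum_distrib_left by (subst sum.swap) (simp add: mult_ac)
    also have "\<dots> = (\<Sum>l<k. u l * g l)" by (simp add: Hy)
    finally have y2: "(\<Sum>j<p. (y j)\<^sup>2) = (\<Sum>l<k. u l * g l)" .
    have N: "row_norm k p H u = sqrt (\<Sum>j<p. (y j)\<^sup>2)" by (simp add: row_norm_def yu)
    let ?n = "sqrt (\<Sum>j<p. (y j)\<^sup>2)"
    have "?n * ?n = (\<Sum>j<p. (y j)\<^sup>2)" by (simp add: sum_nonneg)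
    moreover have "(\<Sum>l<k. u l * g l) \<le> c * ?n" using inv_gain_bound[OF c(2,1), of u] unfolding N by linarith
    ultimately have le: "?n * ?n \<le> c * ?n" unfolding y2 by linarith
    have "?n \<le> c"
    proof (rule ccontr)
      assume "\<not> ?n \<le> c"
      then have "c * ?n < ?n * ?n" using c(1) by (intro mult_strict_right_mono) linarith+
      then show False using le by linarith
    qed
    then show "sqrt (\<Sum>j<p. (\<Sum>i<k. g i * t i j)\<^sup>2) \<le> c" by (simp add: y_def)
  qed
qed

text \<open>Padded by zero columns to a \<open>p\<close> times \<open>p\<close> matrix, the fewer
  than \<open>p\<close> vectors give determinant 0, so the transposed matrix has a nonzero kernel
  vector, which is then normalised.\<close>

lemma ex_orthogonal_vector:
  fixes r :: "'a \<Rightarrow> nat \<Rightarrow> real"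
  assumes "finite A" "card A < p"
  shows "\<exists>x. (\<Sum>j<p. (x j)\<^sup>2) = 1 \<and> (\<forall>a\<in>A. (\<Sum>j<p. x j * r a j) = 0)"
proof -
  obtain as where as: "set as = A" "distinct as" using finite_distinct_list[OF assms(1)] by blast
  have len: "length as < p" using as assms(2) distinct_card by fastforce
  define T where "T = mat p p (\<lambda>(j, i). if i < length as then r (as ! i) j else 0)"
  have T: "T \<in> carrier_mat p p" by (simp add: T_def)
  have "T *\<^sub>v unit_vec p (p - 1) = 0\<^sub>v p"
    using len by (intro eq_vecI) (auto simp: T_def scalar_prod_right_unit)
  moreover have "unit_vec p (p - 1) \<noteq> (0\<^sub>v p :: real vec)" using len by simp
  ultimately have "det T = 0" using det_0_iff_vec_prod_zero_field[OF T] by (metis unit_vec_carrier)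
  then have "det T\<^sup>T = 0" using det_transpose[OF T] by simp
  then obtain v where v: "v \<in> carrier_vec p" "v \<noteq> 0\<^sub>v p" "T\<^sup>T *\<^sub>v v = 0\<^sub>v p"
    using det_0_iff_vec_prod_zero_field[of "T\<^sup>T" p] T by auto
  have o: "(\<Sum>j<p. r a j * v $ j) = 0" if "a \<in> A" for a
  proof -
    have "a \<in> set as" using that as by simp
    then obtain i where i: "i < length as" "as ! i = a" unfolding in_set_conv_nth by blast
    then have ip: "i < p" using len by simp
    show ?thesis using arg_cong[OF v(3), of "\<lambda>x. x $ i"] i ip v(1)
      by (simp add: T_def scalar_prod_def atLeast0LessThan)
  qed
  define n where "n = sqrt (\<Sum>j<p. (v $ j)\<^sup>2)"
  have n: "n > 0"
  proof -
    obtain i where i: "i < p" "v $ i \<noteq> 0" using v(1,2) by (rule vec_nonzero_entry)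
    have "0 < (v $ i)\<^sup>2" using i by simp
    also have "\<dots> \<le> (\<Sum>j<p. (v $ j)\<^sup>2)" by (rule member_le_sum) (use i in auto)
    finally show ?thesis by (simp add: n_def)
  qed
  show ?thesis
  proof (intro exI[of _ "\<lambda>j. v $ j / n"] conjI ballI)
    have "(\<Sum>j<p. (v $ j / n)\<^sup>2) = (\<Sum>j<p. (v $ j)\<^sup>2) / n\<^sup>2" by (simp add: power_divide sum_divide_distrib)
    also have "n\<^sup>2 = (\<Sum>j<p. (v $ j)\<^sup>2)" by (simp add: n_def sum_nonneg)
    finally show "(\<Sum>j<p. (v $ j / n)\<^sup>2) = 1" using n by (auto simp: n_def)
    fix a assume "a \<in> A"
    then show "(\<Sum>j<p. v $ j / n * r a j) = 0"
      using o[of a] by (simp add: sum_divide_distrib[symmetric] mult.commute)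
  qed
qed

text \<open>Each new vector is chosen orthogonal to the given ones and to those already found, both
  collected in a disjoint sum. A bound on the number of given vectors suffices; they may be
  dependent.\<close>

lemma ex_orthonormal_complement:
  fixes r :: "'a \<Rightarrow> nat \<Rightarrow> real"
  assumes A: "finite A" and "card A + \<nu> \<le> p"
  shows "\<exists>n. (\<forall>l<\<nu>. \<forall>l'<\<nu>. (\<Sum>j<p. n l j * n l' j) = (if l = l' then 1 else 0)) \<and>
     (\<forall>l<\<nu>. \<forall>a\<in>A. (\<Sum>j<p. n l j * r a j) = 0)"
  using assms(2)
proof (induction \<nu>)
  case (Suc \<nu>)
  then obtain n where n: "\<forall>l<\<nu>. \<forall>l'<\<nu>. (\<Sum>j<p. n l j * n l' j) = (if l = l' then 1 else 0)"
    "\<forall>l<\<nu>. \<forall>a\<in>A. (\<Sum>j<p. n l j * r a j) = 0" by auto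
  define r' where "r' = case_sum r n"
  have "card (A <+> {..<\<nu>}) < p" using Suc.prems A by (simp add: card_Plus)
  then obtain x where x: "(\<Sum>j<p. (x j)\<^sup>2) = 1" "\<forall>a\<in>A <+> {..<\<nu>}. (\<Sum>j<p. x j * r' a j) = 0"
    using ex_orthogonal_vector[of "A <+> {..<\<nu>}" p r'] A by auto
  have xn: "(\<Sum>j<p. x j * n l j) = 0" "(\<Sum>j<p. n l j * x j) = 0" if "l < \<nu>" for l
    using x(2) that by (auto simp: r'_def mult.commute dest!: bspec[of _ _ "Inr l"])
  have xr: "(\<Sum>j<p. x j * r a j) = 0" if "a \<in> A" for a
    using x(2) that by (auto simp: r'_def dest!: bspec[of _ _ "Inl a"])
  show ?case
    by (rule exI[of _ "n(\<nu> := x)"]) (use n x(1) xn xr in \<open>auto simp: less_Suc_eq power2_eq_square\<close>)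
qed simp

text \<open>The construction yields orthonormal rows \<open>b a\<close>; as the matrix is square,
  its columns are orthonormal too, which is the form that \<open>nn_integral_PiM_orthonormal\<close>
  requires.\<close>

lemma ex_orthonormal_basis:
  fixes g :: "nat \<Rightarrow> real"
  assumes k: "k \<ge> 1" and g: "(\<Sum>i<k. (g i)\<^sup>2) = 1"
  obtains b where "b 0 = g" "\<And>i i'. i < k \<Longrightarrow> i' < k \<Longrightarrow> (\<Sum>a<k. b a i * b a i') = (if i = i' then 1 else 0)"
proof -
  have c: "finite {()}" "card {()} + (k - 1) \<le> k" using k by auto
  obtain n where n: "\<forall>l<k - 1. \<forall>l'<k - 1. (\<Sum>j<k. n l j * n l' j) = (if l = l' then 1 else 0)"
     "\<forall>l<k - 1. \<forall>a\<in>{()}. (\<Sum>j<k. n l j * g j) = 0"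
    using ex_orthonormal_complement[OF c, of "\<lambda>_. g"] by blast
  define b where "b = case_nat g n"
  have o: "(\<Sum>i<k. b a i * b a' i) = (if a = a' then 1 else 0)" if "a < k" "a' < k" for a a'
    using n g that by (auto simp: b_def power2_eq_square mult.commute split: nat.splits)
  define B where "B = mat k k (\<lambda>(a, i). b a i)"
  have B: "B \<in> carrier_mat k k" by (simp add: B_def)
  have "B * B\<^sup>T = 1\<^sub>m k"
    by (rule eq_matI) (use o in \<open>auto simp: B_def times_mat_def scalar_prod_def atLeast0LessThan\<close>)
  then have "B\<^sup>T * B = 1\<^sub>m k" using mat_mult_left_right_inverse[OF B] B by simp
  then have "(\<Sum>a<k. b a i * b a i') = (if i = i' then 1 else 0)" if "i < k" "i' < k" for i i'
  proof -
    have "(B\<^sup>T * B) $$ (i, i') = (\<Sum>a<k. b a i * b a i')"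
      using that by (simp add: B_def scalar_prod_def atLeast0LessThan)
    then show ?thesis using \<open>B\<^sup>T * B = 1\<^sub>m k\<close> that by simp
  qed
  then show ?thesis by (intro that[of b]) (auto simp: b_def)
qed

lemma bessel:
  fixes n :: "nat \<Rightarrow> nat \<Rightarrow> real"
  assumes n: "\<And>l l'. l < \<nu> \<Longrightarrow> l' < \<nu> \<Longrightarrow> (\<Sum>j<p. n l j * n l' j) = (if l = l' then 1 else 0)"
  shows "(\<Sum>l<\<nu>. (\<Sum>j<p. n l j * y j)\<^sup>2) \<le> (\<Sum>j<p. (y j)\<^sup>2)"
proof -
  define c where "c = (\<lambda>l. \<Sum>j<p. n l j * y j)"
  have "(\<Sum>j<p. y j * (\<Sum>l<\<nu>. c l * n l j)) = (\<Sum>l<\<nu>. (c l)\<^sup>2)"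
    unfolding sum_distrib_left by (subst sum.swap) (simp add: c_def power2_eq_square sum_distrib_left mult_ac)
  moreover have "(\<Sum>j<p. (\<Sum>l<\<nu>. c l * n l j)\<^sup>2) = (\<Sum>l<\<nu>. (c l)\<^sup>2)"
  proof -
    have "(\<Sum>j<p. (\<Sum>l<\<nu>. c l * n l j)\<^sup>2) = (\<Sum>j<p. \<Sum>l<\<nu>. \<Sum>l'<\<nu>. (c l * n l j) * (c l' * n l' j))"
      by (simp only: power2_eq_square sum_product)
    also have "\<dots> = (\<Sum>l<\<nu>. \<Sum>j<p. \<Sum>l'<\<nu>. (c l * n l j) * (c l' * n l' j))" by (rule sum.swap)
    also have "\<dots> = (\<Sum>l<\<nu>. \<Sum>l'<\<nu>. \<Sum>j<p. (c l * n l j) * (c l' * n l' j))"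
      by (rule sum.cong[OF refl], rule sum.swap)
    also have "\<dots> = (\<Sum>l<\<nu>. \<Sum>l'<\<nu>. c l * c l' * (\<Sum>j<p. n l j * n l' j))"
      by (simp add: sum_distrib_left mult_ac)
    also have "\<dots> = (\<Sum>l<\<nu>. (c l)\<^sup>2)"
      by (rule sum.cong[OF refl]) (simp add: n power2_eq_square if_distrib sum.delta cong: if_cong)
    finally show ?thesis .
  qed
  moreover have "0 \<le> (\<Sum>j<p. (y j - (\<Sum>l<\<nu>. c l * n l j))\<^sup>2)" by (intro sum_nonneg) auto
  moreover have "(\<Sum>j<p. (y j - (\<Sum>l<\<nu>. c l * n l j))\<^sup>2)
     = (\<Sum>j<p. (y j)\<^sup>2) - 2 * (\<Sum>j<p. y j * (\<Sum>l<\<nu>. c l * n l j)) + (\<Sum>j<p. (\<Sum>l<\<nu>. c l * n l j)\<^sup>2)"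
    by (simp add: power2_diff sum.distrib sum_subtractf sum_distrib_left mult_ac)
  ultimately show ?thesis by (simp add: c_def)
qed

text \<open>The mean of \<open>1 / R ^ d\<close> for a chi variable \<open>R\<close> with \<open>\<nu>\<close> degrees of freedom.\<close>

definition inv_chi_moment :: "nat \<Rightarrow> nat \<Rightarrow> real" where
  "inv_chi_moment \<nu> d = 2 powr (- real d / 2) * Gamma ((real \<nu> - real d) / 2) / Gamma (real \<nu> / 2)"

text \<open>An orthogonal change of rows moves \<open>g\<close> to a multiple of the first unit
  vector. Then the gain is at most \<open>r\<close> divided by the norm of the projection of one
  Gaussian row to \<open>\<nu>\<close> directions orthogonal to all other rows. Conditionally on
  these rows, that norm is a chi variable.\<close>

lemma nn_integral_inv_gain_power:
  assumes k: "k \<ge> 1" and \<nu>: "k + \<nu> = p + 1" and d: "0 < d" "d < \<nu>"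
  shows "(\<integral>\<^sup>+H. inv_gain k p H g ^ d \<partial>PiM ({..<k} \<times> {..<p}) (\<lambda>_. std_gauss))
     \<le> ennreal (sqrt (\<Sum>i<k. (g i)\<^sup>2) ^ d) * ennreal (inv_chi_moment \<nu> d)"
proof (cases "(\<Sum>i<k. (g i)\<^sup>2) = 0")
  case True
  then have "inv_gain k p H g = 0" for H
    by (auto simp: inv_gain_def sum_nonneg_eq_0_iff rat_vecs_nonempty)
  then show ?thesis using d by (simp add: zero_power)
next
  case False
  define r where "r = sqrt (\<Sum>i<k. (g i)\<^sup>2)"
  have r: "r > 0" "r\<^sup>2 = (\<Sum>i<k. (g i)\<^sup>2)" using False by (auto simp: r_def sum_nonneg less_le)
  have unit: "(\<Sum>i<k. (g i / r)\<^sup>2) = 1" using False r(2) by (simp add: power_divide sum_divide_distrib[symmetric])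
  obtain b where b: "b 0 = (\<lambda>i. g i / r)" "\<And>i i'. i < k \<Longrightarrow> i' < k \<Longrightarrow> (\<Sum>a<k. b a i * b a i') = (if i = i' then 1 else 0)"
    by (rule ex_orthonormal_basis[OF k unit]) (rule that)
  let ?J = "{..<k} \<times> {..<p}"
  let ?Ja = "{0::nat} \<times> {..<p}" and ?Jb = "{1..<k} \<times> {..<p}"
  have J: "?Jb \<union> ?Ja = ?J" "?Jb \<inter> ?Ja = {}" using k by auto
  \<comment> \<open>Row \<open>i\<close> of \<open>T x\<close> combines the rows of \<open>x\<close>
    with weights \<open>b a i\<close>. As \<open>b 0\<close> is the normalised \<open>g\<close>, the
    pairing of \<open>u\<close> with \<open>g\<close> is \<open>r\<close> times the coefficient with
    which row 0 of \<open>x\<close> enters.\<close>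
  define T where "T = (\<lambda>x :: nat \<times> nat \<Rightarrow> real. \<lambda>(i, j)\<in>?J. \<Sum>a<k. x (a, j) * b a i)"
  have mT: "(\<lambda>x. inv_gain k p (T x) g ^ d) \<in> borel_measurable (PiM ?J (\<lambda>_. borel))"
  proof (intro borel_measurable_power_ennreal measurable_inv_gain)
    fix i j assume ij: "i < k" "j < p"
    have "(\<lambda>x. \<Sum>a<k. x (a, j) * b a i) \<in> borel_measurable (PiM ?J (\<lambda>_. borel))"
      by (intro borel_measurable_sum borel_measurable_times measurable_component_singleton) (use ij in auto)
    then show "(\<lambda>x. T x (i, j)) \<in> borel_measurable (PiM ?J (\<lambda>_. borel))" using ij by (simp add: T_def)
  qed auto
  have TT: "(\<lambda>x. \<lambda>l\<in>?J. \<Sum>q\<in>?J. x q * (if snd q = snd l then b (fst q) (fst l) else 0)) = T"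
  proof -
    have "(\<Sum>q\<in>?J. x q * (if snd q = j then b (fst q) i else 0)) = (\<Sum>a<k. x (a, j) * b a i)" if "j < p" for x :: "nat \<times> nat \<Rightarrow> real" and i j
    proof -
      have "(\<Sum>q\<in>?J. x q * (if snd q = j then b (fst q) i else 0)) = (\<Sum>a<k. \<Sum>j'<p. if j' = j then x (a, j) * b a i else 0)"
        unfolding sum.cartesian_product by (intro sum.cong) auto
      then show ?thesis using that by (simp add: sum.delta)
    qed
    then show ?thesis by (auto simp: T_def fun_eq_iff restrict_def)
  qed
  have "(\<integral>\<^sup>+H. inv_gain k p H g ^ d \<partial>PiM ?J (\<lambda>_. std_gauss))
     = (\<integral>\<^sup>+x. inv_gain k p (\<lambda>l\<in>?J. \<Sum>q\<in>?J. x q * (if snd q = snd l then b (fst q) (fst l) else 0)) g ^ d \<partial>PiM ?J (\<lambda>_. std_gauss))"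
  proof (rule nn_integral_PiM_orthonormal[symmetric])
    show "(\<lambda>H. inv_gain k p H g ^ d) \<in> borel_measurable (PiM ?J (\<lambda>_. borel))"
      by (intro borel_measurable_power_ennreal measurable_inv_gain) auto
    fix l l' assume l: "l \<in> ?J" "l' \<in> ?J"
    have "(\<Sum>q\<in>?J. (if snd q = snd l then b (fst q) (fst l) else 0) * (if snd q = snd l' then b (fst q) (fst l') else 0))
       = (\<Sum>a<k. \<Sum>j<p. if j = snd l then (if snd l = snd l' then b a (fst l) * b a (fst l') else 0) else 0)"
      unfolding sum.cartesian_product by (intro sum.cong) auto
    also have "\<dots> = (if snd l = snd l' then (\<Sum>a<k. b a (fst l) * b a (fst l')) else 0)"
      using l by (auto simp: sum.delta)
    also have "\<dots> = (if l = l' then 1 else 0)" using l b(2) by (auto simp: prod_eq_iff)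
    finally show "(\<Sum>q\<in>?J. (if snd q = snd l then b (fst q) (fst l) else 0) * (if snd q = snd l' then b (fst q) (fst l') else 0))
       = (if l = l' then 1 else 0)" .
  qed auto
  also have "(\<integral>\<^sup>+x. inv_gain k p (\<lambda>l\<in>?J. \<Sum>q\<in>?J. x q * (if snd q = snd l then b (fst q) (fst l) else 0)) g ^ d \<partial>PiM ?J (\<lambda>_. std_gauss))
     = (\<integral>\<^sup>+x. inv_gain k p (T x) g ^ d \<partial>PiM ?J (\<lambda>_. std_gauss))"
    by (simp only: fun_cong[OF TT])
  also have "\<dots> = (\<integral>\<^sup>+x. \<integral>\<^sup>+y. inv_gain k p (T (merge ?Jb ?Ja (x, y))) g ^ d \<partial>PiM ?Ja (\<lambda>_. std_gauss) \<partial>PiM ?Jb (\<lambda>_. std_gauss))"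
    using PG.product_nn_integral_fold[OF J(2), of "\<lambda>x. inv_gain k p (T x) g ^ d"] mT unfolding J(1) by simp
  also have "\<dots> \<le> (\<integral>\<^sup>+x. ennreal (r ^ d) * ennreal (inv_chi_moment \<nu> d) \<partial>PiM ?Jb (\<lambda>_. std_gauss))"
  proof (rule nn_integral_mono)
    fix x :: "nat \<times> nat \<Rightarrow> real"
    \<comment> \<open>Only row 0 is still random. The \<open>k - 1\<close> fixed rows leave room for
      \<open>\<nu> = p - (k - 1)\<close> orthonormal vectors orthogonal to them.\<close>
    have c: "finite {1..<k}" "card {1..<k} + \<nu> \<le> p" using k \<nu> by auto
    obtain n where n: "\<forall>l<\<nu>. \<forall>l'<\<nu>. (\<Sum>j<p. n l j * n l' j) = (if l = l' then 1 else 0)"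
      "\<forall>l<\<nu>. \<forall>a\<in>{1..<k}. (\<Sum>j<p. n l j * x (a, j)) = 0"
      using ex_orthonormal_complement[OF c, of "\<lambda>a j. x (a, j)"] by blast
    have pt: "inv_gain k p (T (merge ?Jb ?Ja (x, y))) g \<le> ennreal r * (1 / ennreal (sqrt (\<Sum>l<\<nu>. (\<Sum>j<p. y (0, j) * n l j)\<^sup>2)))" for y
      unfolding inv_gain_def
    proof (rule SUP_least)
      fix u
      define X where "X = (\<lambda>a j. merge ?Jb ?Ja (x, y) (a, j))"
      have X0: "X 0 j = y (0, j)" if "j < p" for j using that by (simp add: X_def merge_def)
      have Xa: "X a j = x (a, j)" if "j < p" "a \<in> {1..<k}" for a j using that by (simp add: X_def merge_def)
      define \<rho> where "\<rho> = sqrt (\<Sum>l<\<nu>. (\<Sum>j<p. y (0, j) * n l j)\<^sup>2)"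
      define \<zeta> where "\<zeta> = (\<lambda>a. \<Sum>i<k. u i * b a i)"
      define z where "z = (\<lambda>j. \<Sum>i<k. u i * T (merge ?Jb ?Ja (x, y)) (i, j))"
      have z: "z j = (\<Sum>a<k. \<zeta> a * X a j)" if "j < p" for j
      proof -
        have "z j = (\<Sum>i<k. u i * (\<Sum>a<k. X a j * b a i))"
          unfolding z_def T_def X_def using that by (intro sum.cong) auto
        also have "\<dots> = (\<Sum>a<k. \<zeta> a * X a j)"
          unfolding \<zeta>_def sum_distrib_left sum_distrib_right by (subst sum.swap) (simp add: mult_ac)
        finally show ?thesis .
      qed
      \<comment> \<open>Pairing with \<open>n l\<close> annihilates the rows from 1 on, so only the
        contribution of row 0 survives; Bessel's inequality then bounds the norm of \<open>z\<close>
        from below.\<close>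
      have nz: "(\<Sum>j<p. n l j * z j) = \<zeta> 0 * (\<Sum>j<p. y (0, j) * n l j)" if l: "l < \<nu>" for l
      proof -
        have "(\<Sum>j<p. n l j * z j) = (\<Sum>a<k. \<zeta> a * (\<Sum>j<p. n l j * X a j))"
          by (simp add: z sum_distrib_left) (subst sum.swap, simp add: mult_ac)
        also have "\<dots> = (\<Sum>a\<in>{0}. \<zeta> a * (\<Sum>j<p. n l j * X a j))"
        proof (rule sum.mono_neutral_right)
          show "\<forall>a\<in>{..<k} - {0}. \<zeta> a * (\<Sum>j<p. n l j * X a j) = 0"
          proof
            fix a assume "a \<in> {..<k} - {0}"
            then have a: "a \<in> {1..<k}" by auto
            then have "(\<Sum>j<p. n l j * X a j) = 0" using n(2) l by (simp add: Xa)
            then show "\<zeta> a * (\<Sum>j<p. n l j * X a j) = 0" by simp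
          qed
        qed (use k in auto)
        finally show ?thesis by (simp add: X0 mult.commute)
      qed
      have "(\<Sum>l<\<nu>. (\<zeta> 0 * (\<Sum>j<p. y (0, j) * n l j))\<^sup>2) \<le> (\<Sum>j<p. (z j)\<^sup>2)"
        using bessel[of \<nu> n p z] n(1) by (simp add: nz)
      then have "(\<zeta> 0)\<^sup>2 * (\<Sum>l<\<nu>. (\<Sum>j<p. y (0, j) * n l j)\<^sup>2) \<le> (\<Sum>j<p. (z j)\<^sup>2)"
        by (simp only: power_mult_distrib sum_distrib_left[symmetric])
      then have "sqrt ((\<zeta> 0)\<^sup>2 * (\<Sum>l<\<nu>. (\<Sum>j<p. y (0, j) * n l j)\<^sup>2)) \<le> sqrt (\<Sum>j<p. (z j)\<^sup>2)"
        by (rule real_sqrt_le_mono)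
      then have N: "\<bar>\<zeta> 0\<bar> * \<rho> \<le> row_norm k p (T (merge ?Jb ?Ja (x, y))) u"
        by (simp add: row_norm_def z_def \<rho>_def real_sqrt_mult)
      have ug: "\<bar>\<Sum>i<k. u i * g i\<bar> = r * \<bar>\<zeta> 0\<bar>"
      proof -
        have "(\<Sum>i<k. u i * g i) = r * \<zeta> 0" using r by (simp add: \<zeta>_def b(1) sum_distrib_left)
        then show ?thesis using r by (simp add: abs_mult)
      qed
      have \<rho>0: "\<rho> \<ge> 0" by (simp add: \<rho>_def sum_nonneg)
      show "ennreal \<bar>\<Sum>i<k. u i * g i\<bar> / ennreal (row_norm k p (T (merge ?Jb ?Ja (x, y))) u) \<le> ennreal r * (1 / ennreal \<rho>)"
      \<comment> \<open>In the degenerate cases the numerator is 0 or the right-hand side is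
        infinite, so the conventions for division in \<open>ennreal\<close> suffice.\<close>
      proof (cases "\<zeta> 0 = 0 \<or> \<rho> = 0")
        case True
        then show ?thesis using r ug by (auto simp: ennreal_divide_zero ennreal_mult_top)
      next
        case False
        then have pos: "\<bar>\<zeta> 0\<bar> * \<rho> > 0" using \<rho>0 by simp
        then have Np: "row_norm k p (T (merge ?Jb ?Ja (x, y))) u > 0" using N by linarith
        have "r * \<bar>\<zeta> 0\<bar> / row_norm k p (T (merge ?Jb ?Ja (x, y))) u \<le> r * \<bar>\<zeta> 0\<bar> / (\<bar>\<zeta> 0\<bar> * \<rho>)"
          using N False \<rho>0 Np r by (intro divide_left_mono mult_pos_pos) auto
        also have "\<dots> = r * (1 / \<rho>)" using False by simp
        finally have "ennreal (r * \<bar>\<zeta> 0\<bar> / row_norm k p (T (merge ?Jb ?Ja (x, y))) u) \<le> ennreal (r * (1 / \<rho>))"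
          by (rule ennreal_leI)
        moreover have "ennreal (r * (1 / \<rho>)) = ennreal r * (1 / ennreal \<rho>)"
          using divide_ennreal[of 1 \<rho>] False \<rho>0 r by (simp add: ennreal_mult'[symmetric])
        ultimately show ?thesis unfolding ug using Np r by (simp add: divide_ennreal)
      qed
    qed
    let ?\<phi> = "\<lambda>w. (1 / ennreal (sqrt (\<Sum>l<\<nu>. (w l)\<^sup>2))) ^ d"
    have m\<phi>: "?\<phi> \<in> borel_measurable (PiM {..<\<nu>} (\<lambda>_. borel))" by measurable
    have "(\<integral>\<^sup>+y. inv_gain k p (T (merge ?Jb ?Ja (x, y))) g ^ d \<partial>PiM ?Ja (\<lambda>_. std_gauss))
       \<le> (\<integral>\<^sup>+y. ennreal (r ^ d) * ?\<phi> (\<lambda>l\<in>{..<\<nu>}. \<Sum>q\<in>?Ja. y q * n l (snd q)) \<partial>PiM ?Ja (\<lambda>_. std_gauss))"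
    proof (rule nn_integral_mono)
      fix y
      have s: "(\<Sum>q\<in>?Ja. y q * n l (snd q)) = (\<Sum>j<p. y (0, j) * n l j)" for l
        using sum.cartesian_product[of "\<lambda>a j. y (a, j) * n l j" "{..<p}" "{0::nat}"] by (simp add: case_prod_beta')
      have "inv_gain k p (T (merge ?Jb ?Ja (x, y))) g ^ d \<le> (ennreal r * (1 / ennreal (sqrt (\<Sum>l<\<nu>. (\<Sum>j<p. y (0, j) * n l j)\<^sup>2)))) ^ d"
        by (intro power_mono pt) simp
      then show "inv_gain k p (T (merge ?Jb ?Ja (x, y))) g ^ d \<le> ennreal (r ^ d) * ?\<phi> (\<lambda>l\<in>{..<\<nu>}. \<Sum>q\<in>?Ja. y q * n l (snd q))"
        using r by (simp add: power_mult_distrib ennreal_power s)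
    qed
    also have "\<dots> = ennreal (r ^ d) * (\<integral>\<^sup>+y. ?\<phi> (\<lambda>l\<in>{..<\<nu>}. \<Sum>q\<in>?Ja. y q * n l (snd q)) \<partial>PiM ?Ja (\<lambda>_. std_gauss))"
      by (rule nn_integral_cmult) simp
    also have "(\<integral>\<^sup>+y. ?\<phi> (\<lambda>l\<in>{..<\<nu>}. \<Sum>q\<in>?Ja. y q * n l (snd q)) \<partial>PiM ?Ja (\<lambda>_. std_gauss)) = (\<integral>\<^sup>+w. ?\<phi> w \<partial>PiM {..<\<nu>} (\<lambda>_. std_gauss))"
    proof (rule nn_integral_PiM_orthonormal[OF _ _ _ m\<phi>])
      fix l l' assume "l \<in> {..<\<nu>}" "l' \<in> {..<\<nu>}"
      then show "(\<Sum>q\<in>?Ja. n l (snd q) * n l' (snd q)) = (if l = l' then 1 else 0)"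
        using n(1) sum.cartesian_product[of "\<lambda>a j. n l j * n l' j" "{..<p}" "{0::nat}"] by (simp add: case_prod_beta')
    qed auto
    also have "ennreal (r ^ d) * (\<integral>\<^sup>+w. ?\<phi> w \<partial>PiM {..<\<nu>} (\<lambda>_. std_gauss)) \<le> ennreal (r ^ d) * ennreal (inv_chi_moment \<nu> d)"
      using nn_integral_chi_inverse_power[of "{..<\<nu>}" d] d by (intro mult_left_mono) (auto simp: inv_chi_moment_def)
    finally show "(\<integral>\<^sup>+y. inv_gain k p (T (merge ?Jb ?Ja (x, y))) g ^ d \<partial>PiM ?Ja (\<lambda>_. std_gauss)) \<le> ennreal (r ^ d) * ennreal (inv_chi_moment \<nu> d)" .
  qed
  also have "\<dots> = ennreal (r ^ d) * ennreal (inv_chi_moment \<nu> d)"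
    using prob_space.emeasure_space_1[OF prob_space_PiM_std_gauss, of ?Jb] by (simp del: space_PiM_std_gauss)
  finally show ?thesis by (simp add: r_def)
qed

text \<open>For \<open>d = p - k\<close> this is the source of the factor
  \<open>1 / sqrt (p - k - 1)\<close> in both bounds; it requires \<open>d \<ge> 2\<close>, that is
  \<open>k \<le> p - 2\<close>.\<close>

lemma inv_chi_moment_2: "d \<ge> 2 \<Longrightarrow> inv_chi_moment (Suc d) 2 = 1 / (real d - 1)"
proof -
  assume d: "d \<ge> 2"
  have "Gamma ((real d - 1) / 2 + 1) = (real d - 1) / 2 * Gamma ((real d - 1) / 2)"
    by (rule Gamma_plus1) (use d in \<open>auto dest!: nonpos_Ints_nonpos\<close>)
  moreover have "(real d - 1) / 2 + 1 = real (Suc d) / 2" by (simp add: field_simps)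
  ultimately have G1: "Gamma (real (Suc d) / 2) = (real d - 1) / 2 * Gamma ((real d - 1) / 2)" by (simp only:)
  have G2: "(real (Suc d) - real 2) / 2 = (real d - 1) / 2" by simp
  have "Gamma ((real d - 1) / 2) > 0" using d by (intro Gamma_real_pos) auto
  then have "x * Gamma ((real d - 1) / 2) / (y * Gamma ((real d - 1) / 2)) = x / y" for x y by simp
  then show ?thesis unfolding inv_chi_moment_def G1 G2 using d by (simp only:) (simp add: powr_minus_divide)
qed

text \<open>With exponent one below the degrees of freedom, the numerator is
  \<open>Gamma (1 / 2) = sqrt pi\<close>, so the moment becomes the reciprocal of an absolute
  moment.\<close>

lemma inv_chi_moment_abs_moment: "inv_chi_moment (Suc d) d = 1 / abs_moment d"
proof -
  have "(real (Suc d) - real d) / 2 = 1 / 2" "real (Suc d) / 2 = (real d + 1) / 2" by auto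
  then show ?thesis
    unfolding inv_chi_moment_def abs_moment_def by (simp only: Gamma_one_half_real) (simp add: powr_minus_divide)
qed

text \<open>Integrating tangent inequalities with optimised base point replaces Jensen's inequality, and works for
  nonnegative integrals.\<close>

lemma sqrt_le_tangent: "F > 0 \<Longrightarrow> x \<ge> 0 \<Longrightarrow> sqrt x \<le> (x + F\<^sup>2) / (2 * F)"
proof -
  assume F: "F > 0" and x: "x \<ge> 0"
  have "0 \<le> (sqrt x - F)\<^sup>2" by simp
  then have "sqrt x * (2 * F) \<le> x + F\<^sup>2" using x by (simp add: power2_diff)
  then show ?thesis using F by (simp add: pos_le_divide_eq)
qed

lemma le_power_tangent:
  fixes x a :: real
  assumes a: "a > 0" and x: "x \<ge> 0" and d: "d \<ge> 1"
  shows "x \<le> (x ^ d / a ^ (d - 1) + (real d - 1) * a) / real d"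
proof -
  have "1 + real d * (x / a - 1) \<le> (1 + (x / a - 1)) ^ d"
    by (rule Bernoulli_inequality) (use a x in simp)
  then have "1 + real d * (x / a - 1) \<le> x ^ d / a ^ d" by (simp add: power_divide)
  then have "a * (1 + real d * (x / a - 1)) \<le> a * (x ^ d / a ^ d)" using a by (intro mult_left_mono) auto
  moreover have "a * (x ^ d / a ^ d) = x ^ d / a ^ (d - 1)"
    using a d by (cases d) auto
  moreover have "a * (1 + real d * (x / a - 1)) = real d * x - (real d - 1) * a"
    using a by (simp add: field_simps)
  ultimately have "real d * x \<le> x ^ d / a ^ (d - 1) + (real d - 1) * a" by simp
  then show ?thesis using d by (simp add: pos_le_divide_eq mult.commute)
qed

text \<open>No singular vector is needed: the direction of the image \<open>y\<close> of
  \<open>v\<close> serves as test direction. For Gaussian \<open>g\<close>, the component of the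
  image of \<open>g\<close> along it is Gaussian with standard deviation \<open>r\<close>, so
  \<open>Q\<close> forces \<open>r \<le> \<tau>\<close>, and \<open>n\<close> is at most
  \<open>r\<close> times the norm of \<open>v\<close>.\<close>

lemma dual_operator_norm:
  fixes t :: "nat \<Rightarrow> nat \<Rightarrow> real"
  assumes t: "\<And>g c. c \<ge> 0 \<Longrightarrow> inv_gain k p H g \<le> ennreal c \<Longrightarrow> sqrt (\<Sum>j<p. (\<Sum>i<k. g i * t i j)\<^sup>2) \<le> c"
    and Q: "(\<integral>\<^sup>+g. inv_gain k p H g ^ d \<partial>PiM {..<k} (\<lambda>_. std_gauss)) \<le> ennreal (abs_moment d * \<tau> ^ d)"
    and \<tau>: "\<tau> \<ge> 0" and d: "d \<ge> 1"
  shows "sqrt (\<Sum>j<p. (\<Sum>i<k. v i * t i j)\<^sup>2) \<le> \<tau> * sqrt (\<Sum>i<k. (v i)\<^sup>2)"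
proof -
  define y where "y = (\<lambda>j. \<Sum>i<k. v i * t i j)"
  define n where "n = sqrt (\<Sum>j<p. (y j)\<^sup>2)"
  have n2: "n * n = (\<Sum>j<p. (y j)\<^sup>2)" by (simp add: n_def sum_nonneg)
  have n0: "n \<ge> 0" by (simp add: n_def sum_nonneg)
  show ?thesis
  proof (cases "n = 0")
    case True
    then show ?thesis using \<tau> by (simp add: n_def y_def sum_nonneg)
  next
    case False
    then have n: "n > 0" using n0 by simp
    \<comment> \<open>The transposed map applied to the unit vector \<open>y / n\<close>.\<close>
    define \<theta> where "\<theta> = (\<lambda>i. \<Sum>j<p. y j / n * t i j)"
    define r where "r = sqrt (\<Sum>i<k. (\<theta> i)\<^sup>2)"
    have r: "r \<ge> 0" by (simp add: r_def sum_nonneg)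
    have pt: "ennreal (\<bar>\<Sum>i<k. g i * \<theta> i\<bar> ^ d) \<le> inv_gain k p H g ^ d" for g
    proof (cases "inv_gain k p H g")
      case (real c)
      have "\<bar>\<Sum>i<k. g i * \<theta> i\<bar> = \<bar>\<Sum>j<p. (y j / n) * (\<Sum>i<k. g i * t i j)\<bar>"
        unfolding \<theta>_def sum_distrib_left by (subst sum.swap) (simp add: mult_ac)
      also have "\<dots> \<le> sqrt (\<Sum>j<p. (y j / n)\<^sup>2) * sqrt (\<Sum>j<p. (\<Sum>i<k. g i * t i j)\<^sup>2)"
      proof -
        have "(\<Sum>j<p. (y j / n) * (\<Sum>i<k. g i * t i j)) \<le> sqrt (\<Sum>j<p. (y j / n)\<^sup>2) * sqrt (\<Sum>j<p. (\<Sum>i<k. g i * t i j)\<^sup>2)"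
          by (rule Cauchy_Schwarz_sum)
        moreover have "(\<Sum>j<p. (- (y j / n)) * (\<Sum>i<k. g i * t i j)) \<le> sqrt (\<Sum>j<p. (- (y j / n))\<^sup>2) * sqrt (\<Sum>j<p. (\<Sum>i<k. g i * t i j)\<^sup>2)"
          by (rule Cauchy_Schwarz_sum)
        ultimately show ?thesis by (simp add: sum_negf)
      qed
      also have "(\<Sum>j<p. (y j / n)\<^sup>2) = 1"
      proof -
        have "(\<Sum>j<p. (y j / n)\<^sup>2) = (\<Sum>j<p. (y j)\<^sup>2) / (n * n)"
          by (simp add: power_divide sum_divide_distrib power2_eq_square)
        then show ?thesis unfolding n2[symmetric] using n by simp
      qed
      also have "sqrt 1 * sqrt (\<Sum>j<p. (\<Sum>i<k. g i * t i j)\<^sup>2) \<le> c"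
        using t[of c g] real by simp
      finally have "\<bar>\<Sum>i<k. g i * \<theta> i\<bar> ^ d \<le> c ^ d" by (intro power_mono) auto
      then show ?thesis using real by (simp add: ennreal_power ennreal_leI)
    qed (use d in auto)
    have "ennreal (abs_moment d * r ^ d) = ennreal (r ^ d) * (\<integral>\<^sup>+z. ennreal (\<bar>z\<bar> ^ d) \<partial>std_gauss)"
      using r ennreal_mult'[of "r ^ d" "abs_moment d"] by (simp add: nn_integral_std_gauss_abs_power mult.commute)
    also have "\<dots> = (\<integral>\<^sup>+z. ennreal (r ^ d) * ennreal (\<bar>z\<bar> ^ d) \<partial>std_gauss)"
      by (rule nn_integral_cmult[symmetric]) simp
    also have "\<dots> = (\<integral>\<^sup>+z. ennreal (\<bar>r * z\<bar> ^ d) \<partial>std_gauss)"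
      using r by (simp add: ennreal_mult'[symmetric] abs_mult power_mult_distrib)
    also have "\<dots> = (\<integral>\<^sup>+g. ennreal (\<bar>\<Sum>i<k. g i * \<theta> i\<bar> ^ d) \<partial>PiM {..<k} (\<lambda>_. std_gauss))"
      unfolding r_def by (rule nn_integral_PiM_linear[symmetric]) auto
    also have "\<dots> \<le> (\<integral>\<^sup>+g. inv_gain k p H g ^ d \<partial>PiM {..<k} (\<lambda>_. std_gauss))"
      by (intro nn_integral_mono pt)
    also note Q
    finally have "abs_moment d * r ^ d \<le> abs_moment d * \<tau> ^ d"
      using abs_moment_pos[of d] \<tau> by (subst (asm) ennreal_le_iff) auto
    then have "r ^ d \<le> \<tau> ^ d" using abs_moment_pos[of d] by simp
    then have r\<tau>: "r \<le> \<tau>" using \<tau> d power_le_imp_le_base[of r "d - 1" \<tau>] by (cases d) auto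
    have "n * n = n * (\<Sum>i<k. v i * \<theta> i)"
    proof -
      have "(\<Sum>i<k. v i * \<theta> i) = (\<Sum>j<p. y j / n * y j)"
      proof -
        have "(\<Sum>i<k. v i * \<theta> i) = (\<Sum>j<p. y j / n * (\<Sum>i<k. v i * t i j))"
          unfolding \<theta>_def sum_distrib_left by (subst sum.swap) (simp add: mult_ac)
        then show ?thesis by (simp only: y_def)
      qed
      also have "\<dots> = (n * n) / n" by (simp add: n2 sum_divide_distrib power2_eq_square)
      finally show ?thesis using n by simp
    qed
    then have "n = (\<Sum>i<k. v i * \<theta> i)" using n by simp
    also have "\<dots> \<le> sqrt (\<Sum>i<k. (v i)\<^sup>2) * r" unfolding r_def by (rule Cauchy_Schwarz_sum)
    also have "\<dots> \<le> sqrt (\<Sum>i<k. (v i)\<^sup>2) * \<tau>" by (intro mult_left_mono r\<tau>) (simp add: sum_nonneg)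
    finally show ?thesis by (simp add: n_def y_def mult.commute)
  qed
qed

text \<open>Conditionally on the first \<open>k\<close> rows, Chevet's inequality applies with the
  dual vectors as \<open>t\<close>. Its bound is not integrable in an obvious way; it is replaced by
  the linear majorant \<open>b\<close> in the squared gains and in \<open>Q\<close>, whose means are
  inverse chi moments. Assumption \<open>fb\<close> leaves the choice of the dual vectors
  open.\<close>

theorem gaussian_quotient_bound:
  fixes s \<delta> :: "nat \<Rightarrow> real" and f :: "(nat \<times> nat \<Rightarrow> real) \<Rightarrow> ennreal"
  assumes k: "k \<ge> 1" and d: "d \<ge> 2" and p: "p = k + d"
    and L: "finite L" "L \<inter> {..<k} = {}"
    and s: "\<And>l. l \<in> L \<Longrightarrow> \<bar>s l\<bar> \<le> smax" "smax > 0" "(\<Sum>l\<in>L. (s l)\<^sup>2) > 0"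
    and \<delta>: "\<And>i. i < k \<Longrightarrow> 0 < \<delta> i" "\<And>i. i < k \<Longrightarrow> \<delta> i \<le> \<delta>max"
    and f: "f \<in> borel_measurable (PiM (({..<k} \<union> L) \<times> {..<p}) (\<lambda>_. borel))"
    and fb: "\<And>x t c. c \<ge> 0 \<Longrightarrow>
        (\<And>i i'. i < k \<Longrightarrow> i' < k \<Longrightarrow> (\<Sum>j<p. x (i, j) * t i' j) = (if i = i' then 1 else 0)) \<Longrightarrow>
        (\<And>u v. (\<Sum>l\<in>L. (u l)\<^sup>2) \<le> 1 \<Longrightarrow> (\<Sum>i<k. (v i)\<^sup>2) \<le> 1 \<Longrightarrow>
           (\<Sum>l\<in>L. \<Sum>j<p. x (l, j) * (u l * s l * (\<Sum>i<k. v i * (\<delta> i * t i j)))) \<le> c) \<Longrightarrow> f x \<le> ennreal c"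
  shows "(\<integral>\<^sup>+x. f x \<partial>PiM (({..<k} \<union> L) \<times> {..<p}) (\<lambda>_. std_gauss))
     \<le> ennreal (smax * sqrt ((\<Sum>i<k. (\<delta> i)\<^sup>2) / (real d - 1)) + sqrt (\<Sum>l\<in>L. (s l)\<^sup>2) * (\<delta>max * (exp 1 * sqrt (real p) / real d)))"
proof -
  let ?A = "{..<k} \<times> {..<p}" and ?B = "L \<times> {..<p}"
  have AB: "?A \<union> ?B = ({..<k} \<union> L) \<times> {..<p}" "?A \<inter> ?B = {}" using L by auto
  \<comment> \<open>\<open>F\<close> and \<open>a\<close> are the bounds aimed at for the Frobenius
    norm of \<open>T \<delta>\<close> and the operator norm of \<open>T\<close>. They are the base
    points of the tangents, so that integration returns at most these values again.\<close>
  define F where "F = sqrt ((\<Sum>i<k. (\<delta> i)\<^sup>2) / (real d - 1))"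
  define a where "a = exp 1 * sqrt (real p) / real d"
  define S where "S = sqrt (\<Sum>l\<in>L. (s l)\<^sup>2)"
  have \<delta>sum: "(\<Sum>i<k. (\<delta> i)\<^sup>2) > 0" using k \<delta>(1) by (intro sum_pos zero_less_power) (auto simp: lessThan_empty_iff)
  have F: "F > 0" "F\<^sup>2 = (\<Sum>i<k. (\<delta> i)\<^sup>2) / (real d - 1)" using \<delta>sum d by (auto simp: F_def)
  have a: "a > 0" using k d p by (simp add: a_def)
  have S: "S > 0" using s by (simp add: S_def)
  have \<delta>m: "\<delta>max > 0" using \<delta>[of 0] k by simp
  have am: "abs_moment d > 0" by (rule abs_moment_pos)
  define e :: "nat \<Rightarrow> nat \<Rightarrow> real" where e: "e = (\<lambda>i l. if l = i then 1 else 0)"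
  define R where "R = (\<lambda>H i. inv_gain k p H (e i))"
  define Q where "Q = (\<lambda>H. \<integral>\<^sup>+g. inv_gain k p H g ^ d \<partial>PiM {..<k} (\<lambda>_. std_gauss))"
  \<comment> \<open>The coefficients of the two tangent inequalities: \<open>c1\<close> belongs to
    the squared gains, \<open>c2\<close> to \<open>Q\<close>, where \<open>abs_moment d\<close>
    converts \<open>Q\<close> into \<open>\<tau> ^ d\<close>, and \<open>c3\<close> collects the
    constant terms.\<close>
  define c1 where "c1 = smax / (2 * F)"
  define c2 where "c2 = S * \<delta>max / (abs_moment d * real d * a ^ (d - 1))"
  define c3 where "c3 = smax * F / 2 + S * \<delta>max * (real d - 1) * a / real d"
  have c: "c1 > 0" "c2 > 0" "c3 \<ge> 0"
    using s F S \<delta>m am a d by (auto simp: c1_def c2_def c3_def)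
  define b where "b = (\<lambda>H. ennreal c1 * (\<Sum>i<k. ennreal ((\<delta> i)\<^sup>2) * R H i ^ 2) + ennreal c2 * Q H + ennreal c3)"
  have mR: "(\<lambda>H. R H i) \<in> borel_measurable (PiM ?A (\<lambda>_. borel))" for i
    unfolding R_def by (rule measurable_inv_gain) auto
  interpret PA: prob_space "PiM ?A (\<lambda>_. std_gauss)" by (rule prob_space_PiM_std_gauss)
  interpret Pk: prob_space "PiM {..<k} (\<lambda>_. std_gauss)" by (rule prob_space_PiM_std_gauss)
  interpret PP: pair_sigma_finite "PiM ?A (\<lambda>_. std_gauss)" "PiM {..<k} (\<lambda>_. std_gauss)" ..
  have mG: "(\<lambda>z. inv_gain k p (fst z) (snd z) ^ d) \<in> borel_measurable (PiM ?A (\<lambda>_. std_gauss) \<Otimes>\<^sub>M PiM {..<k} (\<lambda>_. std_gauss))"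
  proof (intro borel_measurable_power_ennreal measurable_inv_gain)
    fix i j assume "i < k" "j < p"
    then show "(\<lambda>z. fst z (i, j)) \<in> borel_measurable (PiM ?A (\<lambda>_. std_gauss) \<Otimes>\<^sub>M PiM {..<k} (\<lambda>_. std_gauss))"
      by (intro measurable_compose[OF measurable_fst]) simp
  next
    fix i assume "i < k"
    then show "(\<lambda>z. snd z i) \<in> borel_measurable (PiM ?A (\<lambda>_. std_gauss) \<Otimes>\<^sub>M PiM {..<k} (\<lambda>_. std_gauss))"
      by (intro measurable_compose[OF measurable_snd]) simp
  qed
  have mQ: "Q \<in> borel_measurable (PiM ?A (\<lambda>_. std_gauss))"
    unfolding Q_def using Pk.borel_measurable_nn_integral_fst[OF mG] by simp
  \<comment> \<open>If \<open>b H\<close> is infinite, as for every \<open>H\<close> with dependent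
    rows, nothing is to be shown. Otherwise the positive coefficients make all gains and
    \<open>Q H\<close> finite, and the dual vectors exist.\<close>
  have inner: "(\<integral>\<^sup>+y. f (merge ?A ?B (H, y)) \<partial>PiM ?B (\<lambda>_. std_gauss)) \<le> b H" if H: "H \<in> space (PiM ?A (\<lambda>_. std_gauss))" for H
  proof (cases "b H")
    case top
    then show ?thesis by simp
  next
    case (real bH)
    then have fin: "b H < \<infinity>" by simp
    have Rfin: "R H i < \<infinity>" if i: "i < k" for i
    proof (rule ccontr)
      assume "\<not> R H i < \<infinity>"
      then have "R H i = \<infinity>" by (simp add: top.not_eq_extremum[symmetric])
      then have "ennreal ((\<delta> i)\<^sup>2) * R H i ^ 2 = \<infinity>" using \<delta>(1)[OF i] by (simp add: ennreal_mult_top)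
      then have "(\<Sum>i<k. ennreal ((\<delta> i)\<^sup>2) * R H i ^ 2) = \<infinity>"
        using member_le_sum[of i "{..<k}" "\<lambda>i. ennreal ((\<delta> i)\<^sup>2) * R H i ^ 2"] i by (simp add: top_unique)
      then have "b H = \<infinity>" unfolding b_def using c by (simp only:) (simp add: ennreal_mult_top)
      then show False using fin by simp
    qed
    have Qfin: "Q H < \<infinity>"
    proof (rule ccontr)
      assume "\<not> Q H < \<infinity>"
      then have "Q H = \<infinity>" by (simp add: top.not_eq_extremum[symmetric])
      then have "b H = \<infinity>" using c by (simp add: b_def ennreal_mult_top)
      then show False using fin by simp
    qed
    obtain t where dual: "\<And>i i'. i < k \<Longrightarrow> i' < k \<Longrightarrow> (\<Sum>j<p. H (i, j) * t i' j) = (if i = i' then 1 else 0)"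
      and t: "\<And>g c. c \<ge> 0 \<Longrightarrow> inv_gain k p H g \<le> ennreal c \<Longrightarrow> sqrt (\<Sum>j<p. (\<Sum>i<k. g i * t i j)\<^sup>2) \<le> c"
      by (rule dual_rows[of k p H]) (use Rfin in \<open>auto simp: R_def e\<close>)
    define \<rho> where "\<rho> = (\<lambda>i. enn2real (R H i))"
    have \<rho>: "R H i = ennreal (\<rho> i)" "\<rho> i \<ge> 0" if "i < k" for i
      using Rfin[OF that] by (auto simp: \<rho>_def)
    have t\<rho>: "(\<Sum>j<p. (t i j)\<^sup>2) \<le> (\<rho> i)\<^sup>2" if i: "i < k" for i
    proof -
      have "sqrt (\<Sum>j<p. (\<Sum>l<k. e i l * t l j)\<^sup>2) \<le> \<rho> i"
        by (rule t) (use \<rho>[OF i] in \<open>auto simp: R_def\<close>)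
      then have "sqrt (\<Sum>j<p. (t i j)\<^sup>2) \<le> \<rho> i"
        using i by (simp add: e if_distribR if_distrib sum.delta cong: if_cong)
      then show ?thesis by (simp add: real_sqrt_le_iff' sqrt_le_D)
    qed
    define \<kappa> where "\<kappa> = enn2real (Q H)"
    have \<kappa>: "Q H = ennreal \<kappa>" "\<kappa> \<ge> 0" using Qfin by (auto simp: \<kappa>_def)
    \<comment> \<open>Chosen so that \<open>abs_moment d * \<tau> ^ d\<close> is the Gaussian moment
      \<open>Q H\<close>, as \<open>dual_operator_norm\<close> demands.\<close>
    define \<tau> where "\<tau> = root d (\<kappa> / abs_moment d)"
    have \<tau>: "\<tau> \<ge> 0" "\<tau> ^ d = \<kappa> / abs_moment d" using \<kappa> am d by (auto simp: \<tau>_def)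
    have op: "sqrt (\<Sum>j<p. (\<Sum>i<k. v i * t i j)\<^sup>2) \<le> \<tau> * sqrt (\<Sum>i<k. (v i)\<^sup>2)" for v
      by (rule dual_operator_norm[where d = d, OF t _ \<tau>(1)]) (use \<kappa>(1)[unfolded Q_def] \<tau> am d in auto)
    have "(\<integral>\<^sup>+y. f (merge ?A ?B (H, y)) \<partial>PiM ?B (\<lambda>_. std_gauss))
       \<le> ennreal (smax * sqrt (\<Sum>i\<in>{..<k}. \<Sum>j\<in>{..<p}. (\<delta> i * t i j)\<^sup>2) + sqrt (\<Sum>l\<in>L. (s l)\<^sup>2) * (\<delta>max * \<tau>))"
    proof (rule chevet)
      fix v :: "nat \<Rightarrow> real" assume v: "(\<Sum>i<k. (v i)\<^sup>2) \<le> 1"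
      have "sqrt (\<Sum>j<p. (\<Sum>i<k. v i * (\<delta> i * t i j))\<^sup>2) \<le> \<tau> * sqrt (\<Sum>i<k. (v i * \<delta> i)\<^sup>2)"
        using op[of "\<lambda>i. v i * \<delta> i"] by (simp add: mult.assoc)
      also have "\<dots> \<le> \<tau> * \<delta>max"
      proof (intro mult_left_mono \<tau>)
        have "(\<Sum>i<k. (v i * \<delta> i)\<^sup>2) \<le> (\<Sum>i<k. (v i)\<^sup>2 * \<delta>max\<^sup>2)"
          unfolding power_mult_distrib using \<delta> by (intro sum_mono mult_left_mono power_mono) (auto intro: less_imp_le)
        also have "\<dots> \<le> 1 * \<delta>max\<^sup>2" unfolding sum_distrib_right[symmetric] by (intro mult_right_mono v) simp
        finally show "sqrt (\<Sum>i<k. (v i * \<delta> i)\<^sup>2) \<le> \<delta>max" using \<delta>m by (simp add: real_le_lsqrt)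
      qed
      finally show "sqrt (\<Sum>j<p. (\<Sum>i<k. v i * (\<delta> i * t i j))\<^sup>2) \<le> \<delta>max * \<tau>" by (simp add: mult.commute)
    next
      have "(\<lambda>y. merge ?A ?B (H, y)) \<in> PiM ?B (\<lambda>_. borel) \<rightarrow>\<^sub>M PiM (?A \<union> ?B) (\<lambda>_. borel)"
        by (rule measurable_compose[OF measurable_Pair1' measurable_merge]) (use H in simp)
      then show "(\<lambda>y. f (merge ?A ?B (H, y))) \<in> borel_measurable (PiM ?B (\<lambda>_. borel))"
        by (rule measurable_compose) (use f in \<open>simp add: AB\<close>)
    next
      fix y :: "nat \<times> nat \<Rightarrow> real" and c :: real
      assume c0: "0 \<le> c" and bil: "\<And>u v. (\<Sum>l\<in>L. (u l)\<^sup>2) \<le> 1 \<Longrightarrow> (\<Sum>i<k. (v i)\<^sup>2) \<le> 1 \<Longrightarrow>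
          (\<Sum>l\<in>L. \<Sum>j<p. y (l, j) * (u l * s l * (\<Sum>i<k. v i * (\<delta> i * t i j)))) \<le> c"
      show "f (merge ?A ?B (H, y)) \<le> ennreal c"
      proof (rule fb[OF c0, where t = t])
        fix i i' assume i: "i < k" "i' < k"
        show "(\<Sum>j<p. merge ?A ?B (H, y) (i, j) * t i' j) = (if i = i' then 1 else 0)"
          using dual[OF i] i by (simp add: merge_def)
      next
        fix u v :: "nat \<Rightarrow> real" assume uv: "(\<Sum>l\<in>L. (u l)\<^sup>2) \<le> 1" "(\<Sum>i<k. (v i)\<^sup>2) \<le> 1"
        have "merge ?A ?B (H, y) (l, j) = y (l, j)" if "l \<in> L" "j < p" for l j
          using that L(2) by (auto simp: merge_def)
        then show "(\<Sum>l\<in>L. \<Sum>j<p. merge ?A ?B (H, y) (l, j) * (u l * s l * (\<Sum>i<k. v i * (\<delta> i * t i j)))) \<le> c"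
          using bil[OF uv] by simp
      qed
    qed (use L s in auto)
    also have "smax * sqrt (\<Sum>i\<in>{..<k}. \<Sum>j\<in>{..<p}. (\<delta> i * t i j)\<^sup>2) + sqrt (\<Sum>l\<in>L. (s l)\<^sup>2) * (\<delta>max * \<tau>)
       \<le> c1 * (\<Sum>i<k. (\<delta> i)\<^sup>2 * (\<rho> i)\<^sup>2) + c2 * \<kappa> + c3"
    proof -
      have "sqrt (\<Sum>i<k. \<Sum>j<p. (\<delta> i * t i j)\<^sup>2) \<le> sqrt (\<Sum>i<k. (\<delta> i)\<^sup>2 * (\<rho> i)\<^sup>2)"
        unfolding power_mult_distrib sum_distrib_left[symmetric]
        by (intro real_sqrt_le_mono sum_mono mult_left_mono t\<rho>) auto
      also have "\<dots> \<le> ((\<Sum>i<k. (\<delta> i)\<^sup>2 * (\<rho> i)\<^sup>2) + F\<^sup>2) / (2 * F)"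
        by (rule sqrt_le_tangent[OF F(1)]) (simp add: sum_nonneg)
      finally have "smax * sqrt (\<Sum>i<k. \<Sum>j<p. (\<delta> i * t i j)\<^sup>2) \<le> smax * (((\<Sum>i<k. (\<delta> i)\<^sup>2 * (\<rho> i)\<^sup>2) + F\<^sup>2) / (2 * F))"
        using s by (intro mult_left_mono) auto
      also have "\<dots> = c1 * (\<Sum>i<k. (\<delta> i)\<^sup>2 * (\<rho> i)\<^sup>2) + smax * F / 2"
        using F(1) by (simp add: c1_def field_simps power2_eq_square)
      finally have 1: "smax * sqrt (\<Sum>i<k. \<Sum>j<p. (\<delta> i * t i j)\<^sup>2) \<le> c1 * (\<Sum>i<k. (\<delta> i)\<^sup>2 * (\<rho> i)\<^sup>2) + smax * F / 2" .
      have "\<tau> \<le> (\<tau> ^ d / a ^ (d - 1) + (real d - 1) * a) / real d"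
        by (rule le_power_tangent[OF a \<tau>(1)]) (use d in simp)
      then have "S * \<delta>max * \<tau> \<le> S * \<delta>max * ((\<tau> ^ d / a ^ (d - 1) + (real d - 1) * a) / real d)"
        using S \<delta>m by (intro mult_left_mono) auto
      also have "\<dots> = c2 * \<kappa> + S * \<delta>max * (real d - 1) * a / real d"
        using am by (simp add: \<tau>(2) c2_def add_divide_distrib distrib_left mult_ac)
      finally have 2: "S * \<delta>max * \<tau> \<le> c2 * \<kappa> + S * \<delta>max * (real d - 1) * a / real d" .
      show ?thesis using 1 2 by (simp add: c3_def S_def mult.assoc)
    qed
    also have "ennreal (c1 * (\<Sum>i<k. (\<delta> i)\<^sup>2 * (\<rho> i)\<^sup>2) + c2 * \<kappa> + c3) = b H"
    proof -
      have "(\<Sum>i<k. ennreal ((\<delta> i)\<^sup>2) * R H i ^ 2) = ennreal (\<Sum>i<k. (\<delta> i)\<^sup>2 * (\<rho> i)\<^sup>2)"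
        by (subst sum_ennreal[symmetric]) (auto simp: \<rho> ennreal_power ennreal_mult')
      then show ?thesis using c \<kappa> by (simp add: b_def ennreal_mult' ennreal_plus sum_nonneg)
    qed
    finally show ?thesis by (simp add: ennreal_leI)
  qed
  have IR: "(\<integral>\<^sup>+H. R H i ^ 2 \<partial>PiM ?A (\<lambda>_. std_gauss)) \<le> ennreal (1 / (real d - 1))" if i: "i < k" for i
  proof -
    have "(\<integral>\<^sup>+H. R H i ^ 2 \<partial>PiM ?A (\<lambda>_. std_gauss)) \<le> ennreal (sqrt (\<Sum>l<k. (e i l)\<^sup>2) ^ 2) * ennreal (inv_chi_moment (Suc d) 2)"
      unfolding R_def by (rule nn_integral_inv_gain_power) (use k d p in auto)
    also have "(\<Sum>l<k. (e i l)\<^sup>2) = 1" using i by (simp add: e if_distrib if_distribR sum.delta cong: if_cong)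
    finally show ?thesis using d by (simp add: inv_chi_moment_2)
  qed
  have IQ: "(\<integral>\<^sup>+H. Q H \<partial>PiM ?A (\<lambda>_. std_gauss)) \<le> ennreal (sqrt (real p) ^ d / abs_moment d)"
  proof -
    have "(\<integral>\<^sup>+H. Q H \<partial>PiM ?A (\<lambda>_. std_gauss)) = (\<integral>\<^sup>+g. \<integral>\<^sup>+H. inv_gain k p H g ^ d \<partial>PiM ?A (\<lambda>_. std_gauss) \<partial>PiM {..<k} (\<lambda>_. std_gauss))"
      unfolding Q_def by (rule PP.Fubini'[symmetric]) (use mG in \<open>simp add: case_prod_beta'\<close>)
    also have "\<dots> \<le> (\<integral>\<^sup>+g. ennreal (sqrt (\<Sum>i<k. (g i)\<^sup>2) ^ d) * ennreal (inv_chi_moment (Suc d) d) \<partial>PiM {..<k} (\<lambda>_. std_gauss))"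
      by (intro nn_integral_mono nn_integral_inv_gain_power) (use k d p in auto)
    also have "\<dots> = (\<integral>\<^sup>+g. ennreal (sqrt (\<Sum>i<k. (g i)\<^sup>2) ^ d) \<partial>PiM {..<k} (\<lambda>_. std_gauss)) * ennreal (inv_chi_moment (Suc d) d)"
      by (rule nn_integral_multc) simp
    also have "\<dots> \<le> ennreal (sqrt (real (k + d)) ^ d) * ennreal (inv_chi_moment (Suc d) d)"
      by (intro mult_right_mono nn_integral_norm_power_le) (use k d in auto)
    also have "\<dots> = ennreal (sqrt (real p) ^ d / abs_moment d)"
      by (simp add: inv_chi_moment_abs_moment p ennreal_mult'[symmetric])
    finally show ?thesis .
  qed
  have "(\<integral>\<^sup>+x. f x \<partial>PiM (({..<k} \<union> L) \<times> {..<p}) (\<lambda>_. std_gauss))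
     = (\<integral>\<^sup>+H. \<integral>\<^sup>+y. f (merge ?A ?B (H, y)) \<partial>PiM ?B (\<lambda>_. std_gauss) \<partial>PiM ?A (\<lambda>_. std_gauss))"
    using PG.product_nn_integral_fold[OF AB(2), of f] f L by (simp add: AB)
  also have "\<dots> \<le> (\<integral>\<^sup>+H. b H \<partial>PiM ?A (\<lambda>_. std_gauss))"
    by (intro nn_integral_mono inner)
  also have "\<dots> = ennreal c1 * (\<Sum>i<k. ennreal ((\<delta> i)\<^sup>2) * (\<integral>\<^sup>+H. R H i ^ 2 \<partial>PiM ?A (\<lambda>_. std_gauss)))
      + ennreal c2 * (\<integral>\<^sup>+H. Q H \<partial>PiM ?A (\<lambda>_. std_gauss)) + ennreal c3"
    unfolding b_def using mR mQ
    by (simp add: nn_integral_add nn_integral_cmult nn_integral_sum PA.emeasure_space_1[simplified])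
  also have "\<dots> \<le> ennreal c1 * (\<Sum>i<k. ennreal ((\<delta> i)\<^sup>2) * ennreal (1 / (real d - 1))) + ennreal c2 * ennreal (sqrt (real p) ^ d / abs_moment d) + ennreal c3"
    by (intro add_mono mult_left_mono sum_mono IQ order_refl) (auto intro: IR)
  also have "\<dots> = ennreal (c1 * (\<Sum>i<k. (\<delta> i)\<^sup>2 * (1 / (real d - 1))) + c2 * (sqrt (real p) ^ d / abs_moment d) + c3)"
  proof -
    have "(\<Sum>i<k. ennreal ((\<delta> i)\<^sup>2) * ennreal (1 / (real d - 1))) = ennreal (\<Sum>i<k. (\<delta> i)\<^sup>2 * (1 / (real d - 1)))"
    proof -
      have "ennreal ((\<delta> i)\<^sup>2) * ennreal (1 / (real d - 1)) = ennreal ((\<delta> i)\<^sup>2 * (1 / (real d - 1)))" for i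
        by (rule ennreal_mult''[symmetric]) (use d in simp)
      moreover have "(\<Sum>i<k. ennreal ((\<delta> i)\<^sup>2 * (1 / (real d - 1)))) = ennreal (\<Sum>i<k. (\<delta> i)\<^sup>2 * (1 / (real d - 1)))"
        by (rule sum_ennreal) (use d in simp)
      ultimately show ?thesis by (simp only:)
    qed
    moreover have "(\<Sum>i<k. (\<delta> i)\<^sup>2 * (1 / (real d - 1))) \<ge> 0" using d by (intro sum_nonneg) auto
    moreover have "sqrt (real p) ^ d / abs_moment d \<ge> 0" using am by simp
    moreover have "ennreal c1 * ennreal X + ennreal c2 * ennreal Y + ennreal c3 = ennreal (c1 * X + c2 * Y + c3)"
      if "X \<ge> 0" "Y \<ge> 0" for X Y
      using that c by (simp add: ennreal_mult' ennreal_plus)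
    ultimately show ?thesis by (simp only:)
  qed
  also have "\<dots> \<le> ennreal (smax * F + S * (\<delta>max * a))"
  proof (rule ennreal_leI)
    have "(\<Sum>i<k. (\<delta> i)\<^sup>2 * (1 / (real d - 1))) = F\<^sup>2" by (simp add: F(2) sum_divide_distrib)
    then have 1: "c1 * (\<Sum>i<k. (\<delta> i)\<^sup>2 * (1 / (real d - 1))) = smax * F / 2"
      using F(1) by (simp add: c1_def power2_eq_square)
    \<comment> \<open>The left-hand side bounds the mean of \<open>\<tau> ^ d\<close>: one factor
      \<open>abs_moment d\<close> stems from the inverse chi moment, the other from the definition
      of \<open>\<tau>\<close>.\<close>
    have "sqrt (real p) ^ d / abs_moment d / abs_moment d \<le> a ^ d"
    proof -
      have "(real d / exp 1) ^ d \<le> (abs_moment d)\<^sup>2" by (rule abs_moment_lower) (use d in simp)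
      then have "sqrt (real p) ^ d / (abs_moment d)\<^sup>2 \<le> sqrt (real p) ^ d / (real d / exp 1) ^ d"
        using d am by (intro divide_left_mono mult_pos_pos) auto
      also have "\<dots> = a ^ d" by (simp add: a_def power_divide power_mult_distrib)
      finally show ?thesis by (simp add: power2_eq_square)
    qed
    then have "S * \<delta>max / (real d * a ^ (d - 1)) * (sqrt (real p) ^ d / abs_moment d / abs_moment d) \<le> S * \<delta>max / (real d * a ^ (d - 1)) * a ^ d"
      using S \<delta>m a by (intro mult_left_mono) auto
    moreover have "a ^ d / a ^ (d - 1) = a" using a d by (cases d) auto
    then have "S * \<delta>max / (real d * a ^ (d - 1)) * a ^ d = S * \<delta>max * a / real d"
      by (metis (no_types, lifting) divide_divide_eq_left' times_divide_eq_left times_divide_eq_right mult.assoc)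
    moreover have "c2 * (sqrt (real p) ^ d / abs_moment d) = S * \<delta>max / (real d * a ^ (d - 1)) * (sqrt (real p) ^ d / abs_moment d / abs_moment d)"
      by (simp add: c2_def mult_ac)
    ultimately have 2: "c2 * (sqrt (real p) ^ d / abs_moment d) \<le> S * \<delta>max * a / real d" by simp
    \<comment> \<open>The shares \<open>1 / d\<close> and \<open>(d - 1) / d\<close> of the tangent
      inequality add up to the base point \<open>a\<close>.\<close>
    have "S * \<delta>max * a / real d + S * \<delta>max * (real d - 1) * a / real d = S * \<delta>max * a"
      using d by (simp add: field_simps)
    then show "c1 * (\<Sum>i<k. (\<delta> i)\<^sup>2 * (1 / (real d - 1))) + c2 * (sqrt (real p) ^ d / abs_moment d) + c3 \<le> smax * F + S * (\<delta>max * a)"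
      using 1 2 by (simp add: c3_def mult.assoc)
  qed
  finally show ?thesis by (simp only: F_def S_def a_def)
qed

section \<open>Projections and singular values\<close>

lemma vec_norm2_eq: "v \<in> carrier_vec n \<Longrightarrow> vec_norm2 v = sqrt (\<Sum>i<n. (v $ i)\<^sup>2)"
  by (simp add: vec_norm2_def scalar_prod_def power2_eq_square atLeast0LessThan)

lemma vec_norm2_nonneg [simp]: "vec_norm2 v \<ge> 0"
  by (simp add: vec_norm2_def scalar_prod_def sum_nonneg)

lemma vec_norm2_zero [simp]: "vec_norm2 (0\<^sub>v n) = 0"
  by (simp add: vec_norm2_def)

lemma vec_norm2_triangle:
  assumes "a \<in> carrier_vec n" "b \<in> carrier_vec n"
  shows "vec_norm2 (a + b) \<le> vec_norm2 a + vec_norm2 b"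
proof -
  have L2: "vec_norm2 v = L2_set (\<lambda>i. v $ i) {..<n}" if "v \<in> carrier_vec n" for v
    using that by (simp add: vec_norm2_eq L2_set_def)
  have "vec_norm2 (a + b) = L2_set (\<lambda>i. a $ i + b $ i) {..<n}"
    using assms by (simp add: L2 L2_set_def)
  then show ?thesis using L2_set_triangle_ineq[of "\<lambda>i. a $ i" "\<lambda>i. b $ i"] assms by (simp add: L2)
qed

lemma vec_norm2_orthogonal_add:
  assumes c: "a \<in> carrier_vec n" "b \<in> carrier_vec n" and o: "a \<bullet> b = 0"
  shows "vec_norm2 a \<le> vec_norm2 (a + b)"
proof -
  have "(a + b) \<bullet> (a + b) = a \<bullet> a + b \<bullet> b"
    using c o by (simp add: scalar_prod_add_distrib[of _ n] add_scalar_prod_distrib[of _ n] comm_scalar_prod[of b n a])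
  moreover have "b \<bullet> b \<ge> 0" by (simp add: scalar_prod_def sum_nonneg)
  ultimately show ?thesis unfolding vec_norm2_def by (intro real_sqrt_le_mono) simp
qed

lemma vec_norm2_orthogonal_mult:
  assumes U: "U \<in> carrier_mat n k" "U\<^sup>T * U = 1\<^sub>m k" and v: "v \<in> carrier_vec k"
  shows "vec_norm2 (U *\<^sub>v v) = vec_norm2 v"
proof -
  have "(U *\<^sub>v v) \<bullet> (U *\<^sub>v v) = (U\<^sup>T *\<^sub>v (U *\<^sub>v v)) \<bullet> v"
    using U v by (simp add: transpose_vec_mult_scalar[of _ n k])
  also have "U\<^sup>T *\<^sub>v (U *\<^sub>v v) = (U\<^sup>T * U) *\<^sub>v v"
    by (rule assoc_mult_mat_vec[symmetric, of _ k n _ k]) (use U v in auto)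
  finally show ?thesis using U v by (simp add: vec_norm2_def)
qed

lemma spectral_norm_least:
  assumes "\<And>x. x \<in> carrier_vec (dim_col A) \<Longrightarrow> vec_norm2 x \<le> 1 \<Longrightarrow> vec_norm2 (A *\<^sub>v x) \<le> c"
  shows "spectral_norm A \<le> c"
  unfolding spectral_norm_def
proof (rule cSUP_least)
  have "0\<^sub>v (dim_col A) \<in> {x \<in> carrier_vec (dim_col A). vec_norm2 x \<le> 1}" by simp
  then show "{x \<in> carrier_vec (dim_col A). vec_norm2 x \<le> 1} \<noteq> {}" by blast
qed (use assms in auto)

lemma spectral_norm_upper:
  "x \<in> carrier_vec (dim_col A) \<Longrightarrow> vec_norm2 x \<le> 1 \<Longrightarrow> vec_norm2 (A *\<^sub>v x) \<le> spectral_norm A"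
  unfolding spectral_norm_def by (rule cSUP_upper[OF _ vec_norm2_mult_bdd_above]) simp

lemma spectral_norm_nonneg: "spectral_norm A \<ge> 0"
  by (rule order_trans[OF vec_norm2_nonneg spectral_norm_upper[of "0\<^sub>v (dim_col A)"]]) auto

lemma vec_norm2_smult: "vec_norm2 (c \<cdot>\<^sub>v x) = \<bar>c\<bar> * vec_norm2 x"
proof -
  have "(c \<cdot>\<^sub>v x) \<bullet> (c \<cdot>\<^sub>v x) = c\<^sup>2 * (x \<bullet> x)"
    by (simp add: scalar_prod_def sum_distrib_left power2_eq_square mult_ac)
  then show ?thesis by (simp add: vec_norm2_def real_sqrt_mult)
qed

lemma spectral_norm_mult_vec:
  assumes A: "A \<in> carrier_mat n m" and x: "x \<in> carrier_vec m"
  shows "vec_norm2 (A *\<^sub>v x) \<le> spectral_norm A * vec_norm2 x"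
proof (cases "vec_norm2 x = 0")
  case True
  then have "(\<Sum>i<m. (x $ i)\<^sup>2) = 0" using x by (simp add: vec_norm2_eq)
  then have "x = 0\<^sub>v m" using x by (intro eq_vecI) (auto simp: sum_nonneg_eq_0_iff)
  then have "A *\<^sub>v x = 0\<^sub>v n" using A by (intro eq_vecI) auto
  then show ?thesis using True by simp
next
  case False
  then have r: "vec_norm2 x > 0" using vec_norm2_nonneg[of x] by linarith
  have "vec_norm2 (A *\<^sub>v ((1 / vec_norm2 x) \<cdot>\<^sub>v x)) \<le> spectral_norm A"
    by (rule spectral_norm_upper) (use A x r in \<open>auto simp: vec_norm2_smult\<close>)
  also have "A *\<^sub>v ((1 / vec_norm2 x) \<cdot>\<^sub>v x) = (1 / vec_norm2 x) \<cdot>\<^sub>v (A *\<^sub>v x)"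
    using A x by (rule mult_mat_vec)
  finally show ?thesis using r by (simp add: vec_norm2_smult pos_divide_le_eq)
qed

text \<open>The residual realises the distance to the column space: it is minimal and of the form
  \<open>y - Z *\<^sub>v w\<close>. These facts are all that the later arguments use of
  \<open>orth_proj\<close>.\<close>

lemma orth_proj_residual:
  assumes Z: "Z \<in> carrier_mat n p"
  shows "orth_proj Z \<in> carrier_mat n n"
    and "y \<in> carrier_vec n \<Longrightarrow> w \<in> carrier_vec p \<Longrightarrow> vec_norm2 ((1\<^sub>m n - orth_proj Z) *\<^sub>v y) \<le> vec_norm2 (y - Z *\<^sub>v w)"
    and "y \<in> carrier_vec n \<Longrightarrow> \<exists>w\<in>carrier_vec p. (1\<^sub>m n - orth_proj Z) *\<^sub>v y = y - Z *\<^sub>v w"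
proof -
  let ?P = "orth_proj Z"
  have "is_orth_proj n (vec_space.col_space n Z) ?P" using is_orth_proj_orth_proj[of Z] Z by simp
  then have P: "?P \<in> carrier_mat n n" "\<And>x. x \<in> carrier_vec n \<Longrightarrow> ?P *\<^sub>v x \<in> vec_space.col_space n Z"
    "\<And>x w. x \<in> carrier_vec n \<Longrightarrow> w \<in> vec_space.col_space n Z \<Longrightarrow> (x - ?P *\<^sub>v x) \<bullet> w = 0"
    by (auto simp: is_orth_proj_def)
  have col: "vec_space.col_space n Z = {y \<in> carrier_vec n. \<exists>x\<in>carrier_vec p. Z *\<^sub>v x = y}"
    using vec_space.col_space_eq[OF Z] Z by simp
  show "?P \<in> carrier_mat n n" by (rule P)
  have res: "(1\<^sub>m n - ?P) *\<^sub>v y = y - ?P *\<^sub>v y" if "y \<in> carrier_vec n" for y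
    using P(1) that by (simp add: minus_mult_distrib_mat_vec[of _ n n])
  { assume y: "y \<in> carrier_vec n" and w: "w \<in> carrier_vec p"
    have Zw: "Z *\<^sub>v w \<in> carrier_vec n" "Z *\<^sub>v w \<in> vec_space.col_space n Z" using Z w by (auto simp: col)
    have Py: "?P *\<^sub>v y \<in> carrier_vec n" using P(1) y by simp
    have "(y - ?P *\<^sub>v y) \<bullet> (?P *\<^sub>v y - Z *\<^sub>v w) = 0"
      using P(3)[OF y P(2)[OF y]] P(3)[OF y Zw(2)] y Py Zw by (simp add: scalar_prod_minus_distrib[of _ n])
    then have "vec_norm2 (y - ?P *\<^sub>v y) \<le> vec_norm2 ((y - ?P *\<^sub>v y) + (?P *\<^sub>v y - Z *\<^sub>v w))"
      using y Py Zw by (intro vec_norm2_orthogonal_add[of _ n]) auto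
    also have "(y - ?P *\<^sub>v y) + (?P *\<^sub>v y - Z *\<^sub>v w) = y - Z *\<^sub>v w"
    proof -
      have "(a - b) + (b - c) = a - c" if "a \<in> carrier_vec n" "b \<in> carrier_vec n" "c \<in> carrier_vec n" for a b c :: "real vec"
        using that by (intro eq_vecI) auto
      then show ?thesis using y Py Zw by blast
    qed
    finally show "vec_norm2 ((1\<^sub>m n - ?P) *\<^sub>v y) \<le> vec_norm2 (y - Z *\<^sub>v w)" using res[OF y] by simp }
  { assume y: "y \<in> carrier_vec n"
    obtain w where "w \<in> carrier_vec p" "Z *\<^sub>v w = ?P *\<^sub>v y" using P(2)[OF y] by (auto simp: col)
    then show "\<exists>w\<in>carrier_vec p. (1\<^sub>m n - ?P) *\<^sub>v y = y - Z *\<^sub>v w" unfolding res[OF y] by (intro bexI[of _ w]) simp }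
qed

lemma residual_norm_le:
  assumes Z: "Z \<in> carrier_mat n p" and y: "y \<in> carrier_vec n"
  shows "vec_norm2 ((1\<^sub>m n - orth_proj Z) *\<^sub>v y) \<le> vec_norm2 y"
proof -
  have "Z *\<^sub>v 0\<^sub>v p = 0\<^sub>v n" using Z by (intro eq_vecI) auto
  then have "y - Z *\<^sub>v 0\<^sub>v p = y" using y by (intro eq_vecI) auto
  then show ?thesis using orth_proj_residual(2)[OF Z y, of "0\<^sub>v p"] by simp
qed

lemma spectral_norm_residual_le:
  assumes Z: "Z \<in> carrier_mat n p" and B: "B \<in> carrier_mat n m"
  shows "spectral_norm ((1\<^sub>m n - orth_proj Z) * B) \<le> spectral_norm B"
proof (rule spectral_norm_least)
  note P = orth_proj_residual(1)[OF Z]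
  fix x assume x: "x \<in> carrier_vec (dim_col ((1\<^sub>m n - orth_proj Z) * B))" "vec_norm2 x \<le> 1"
  then have x': "x \<in> carrier_vec m" using B by simp
  have "((1\<^sub>m n - orth_proj Z) * B) *\<^sub>v x = (1\<^sub>m n - orth_proj Z) *\<^sub>v (B *\<^sub>v x)"
    using P B x' by (intro assoc_mult_mat_vec[of _ n n _ m]) auto
  also have "vec_norm2 \<dots> \<le> vec_norm2 (B *\<^sub>v x)" by (rule residual_norm_le[OF Z]) (use B x' in auto)
  also have "\<dots> \<le> spectral_norm B" by (rule spectral_norm_upper) (use B x x' in auto)
  finally show "vec_norm2 (((1\<^sub>m n - orth_proj Z) * B) *\<^sub>v x) \<le> spectral_norm B" .
qed

section \<open>Matrices given by a singular value decomposition\<close>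

lemma sing_mat_carrier [simp]: "sing_mat n m \<tau> \<in> carrier_mat n m"
  by (simp add: sing_mat_def)

lemma mult_sing_mat_transpose_carrier:
  "U \<in> carrier_mat n n \<Longrightarrow> V \<in> carrier_mat m m \<Longrightarrow> U * sing_mat n m \<tau> * V\<^sup>T \<in> carrier_mat n m"
  by (intro mult_carrier_mat[of _ n m _ m] mult_carrier_mat[of _ n n _ m]) auto

lemma mult_sing_mat_transpose_index:
  assumes U: "U \<in> carrier_mat n N" and V: "V \<in> carrier_mat m M" and "M \<le> N" "a < n" "b < m"
  shows "(U * sing_mat N M \<tau> * V\<^sup>T) $$ (a, b) = (\<Sum>i<M. U $$ (a, i) * \<tau> (Suc i) * V $$ (b, i))"
proof -
  have S: "sing_mat N M \<tau> \<in> carrier_mat N M" by (simp add: sing_mat_def)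
  have US: "(U * sing_mat N M \<tau>) $$ (a, i) = U $$ (a, i) * \<tau> (Suc i)" if "i < M" for i
  proof -
    have "(U * sing_mat N M \<tau>) $$ (a, i) = (\<Sum>l<N. U $$ (a, l) * (if l = i then \<tau> (Suc l) else 0))"
      using U assms that by (simp add: sing_mat_def scalar_prod_def atLeast0LessThan)
    also have "\<dots> = (\<Sum>l<N. if l = i then U $$ (a, l) * \<tau> (Suc l) else 0)" by (intro sum.cong) auto
    finally show ?thesis using that assms by (simp add: sum.delta)
  qed
  have "(U * sing_mat N M \<tau> * V\<^sup>T) $$ (a, b) = (\<Sum>i<M. (U * sing_mat N M \<tau>) $$ (a, i) * V $$ (b, i))"
  proof -
    have c: "U * sing_mat N M \<tau> \<in> carrier_mat n M" using U S by (rule mult_carrier_mat)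
    have "(X * V\<^sup>T) $$ (a, b) = (\<Sum>i<M. X $$ (a, i) * V $$ (b, i))" if "X \<in> carrier_mat n M" for X
      using that V assms by (simp add: scalar_prod_def atLeast0LessThan)
    from this[OF c] show ?thesis .
  qed
  then show ?thesis by (simp add: US)
qed

lemma mult_sing_mat_transpose_vec:
  assumes U: "U \<in> carrier_mat n n" and V: "V \<in> carrier_mat m m" and mn: "m \<le> n" and y: "y \<in> carrier_vec m"
  shows "(U * sing_mat n m \<tau> * V\<^sup>T) *\<^sub>v y = U *\<^sub>v vec n (\<lambda>i. if i < m then \<tau> (Suc i) * (V\<^sup>T *\<^sub>v y) $ i else 0)"
proof -
  have S: "sing_mat n m \<tau> \<in> carrier_mat n m" by (simp add: sing_mat_def)
  have V': "V\<^sup>T \<in> carrier_mat m m" using V by simp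
  have z: "V\<^sup>T *\<^sub>v y \<in> carrier_vec m" using V' y by (rule mult_mat_vec_carrier)
  have "(U * sing_mat n m \<tau> * V\<^sup>T) *\<^sub>v y = U *\<^sub>v (sing_mat n m \<tau> *\<^sub>v (V\<^sup>T *\<^sub>v y))"
    using U S V' y z by (simp add: assoc_mult_mat_vec[of _ n m _ m] assoc_mult_mat_vec[of _ n n _ m])
  also have "sing_mat n m \<tau> *\<^sub>v z = vec n (\<lambda>i. if i < m then \<tau> (Suc i) * z $ i else 0)" if "z \<in> carrier_vec m" for z
  proof (rule eq_vecI)
    fix i assume "i < dim_vec (vec n (\<lambda>i. if i < m then \<tau> (Suc i) * z $ i else 0))"
    then have i: "i < n" by simp
    have "(sing_mat n m \<tau> *\<^sub>v z) $ i = (\<Sum>j<m. (if i = j then \<tau> (Suc i) else 0) * z $ j)"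
      using i that by (simp add: sing_mat_def scalar_prod_def atLeast0LessThan)
    also have "\<dots> = (\<Sum>j<m. if j = i then \<tau> (Suc i) * z $ i else 0)" by (intro sum.cong) auto
    finally show "(sing_mat n m \<tau> *\<^sub>v z) $ i = vec n (\<lambda>i. if i < m then \<tau> (Suc i) * z $ i else 0) $ i"
      using i by (simp add: sum.delta)
  qed (simp add: sing_mat_def)
  note this[OF z]
  finally show ?thesis .
qed

text \<open>In this form the tail and the full matrix share \<open>U\<close> and \<open>V\<close>
  and differ in the diagonal only. Entry \<open>i\<close> of the tail block holds
  \<open>\<sigma> (k + Suc i)\<close>, which is entry \<open>k + i\<close> of the full
  diagonal.\<close>

lemma svd_tail_eq:
  assumes U: "U \<in> carrier_mat n n" and V: "V \<in> carrier_mat m m" and mn: "m \<le> n" and k: "k \<le> m"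
  shows "svd_tail n m k U \<sigma> V = U * sing_mat n m (\<lambda>i. if i \<le> k then 0 else \<sigma> i) * V\<^sup>T"
proof (rule eq_matI)
  have rc: "remaining_cols k B \<in> carrier_mat N (N - k)" "\<And>a i. a < N \<Longrightarrow> i < N - k \<Longrightarrow> remaining_cols k B $$ (a, i) = B $$ (a, k + i)"
    if "B \<in> carrier_mat N N" for B :: "real mat" and N
    using that by (auto simp: remaining_cols_def mat_of_cols_index)
  note rcU = rc[OF U] and rcV = rc[OF V]
  fix a b assume "a < dim_row (U * sing_mat n m (\<lambda>i. if i \<le> k then 0 else \<sigma> i) * V\<^sup>T)"
    "b < dim_col (U * sing_mat n m (\<lambda>i. if i \<le> k then 0 else \<sigma> i) * V\<^sup>T)"
  then have ab: "a < n" "b < m" using U V by auto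
  have "svd_tail n m k U \<sigma> V $$ (a, b) = (\<Sum>i<m - k. remaining_cols k U $$ (a, i) * \<sigma> (k + Suc i) * remaining_cols k V $$ (b, i))"
    unfolding svd_tail_def by (rule mult_sing_mat_transpose_index[OF rcU(1) rcV(1)]) (use mn ab in auto)
  also have "\<dots> = (\<Sum>i<m - k. U $$ (a, k + i) * \<sigma> (Suc (k + i)) * V $$ (b, k + i))"
    using rcU rcV ab mn by (intro sum.cong) auto
  also have "\<dots> = (\<Sum>i\<in>{k..<m}. U $$ (a, i) * \<sigma> (Suc i) * V $$ (b, i))"
    using k sum.shift_bounds_nat_ivl[of "\<lambda>i. U $$ (a, i) * \<sigma> (Suc i) * V $$ (b, i)" 0 k "m - k"]
    by (simp add: atLeast0LessThan add.commute)
  also have "\<dots> = (\<Sum>i<m. U $$ (a, i) * (if Suc i \<le> k then 0 else \<sigma> (Suc i)) * V $$ (b, i))"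
    by (intro sum.mono_neutral_cong_left) auto
  also have "\<dots> = (U * sing_mat n m (\<lambda>i. if i \<le> k then 0 else \<sigma> i) * V\<^sup>T) $$ (a, b)"
    by (rule mult_sing_mat_transpose_index[OF U V mn ab, symmetric])
  finally show "svd_tail n m k U \<sigma> V $$ (a, b) = (U * sing_mat n m (\<lambda>i. if i \<le> k then 0 else \<sigma> i) * V\<^sup>T) $$ (a, b)" .
qed (use U V in \<open>auto simp: svd_tail_def remaining_cols_def\<close>)

text \<open>Orthogonality cancels the inner factors, so each multiplication by
  \<open>A * A\<^sup>T\<close> multiplies the diagonal by the squared singular values.\<close>

lemma power_scheme_svd:
  assumes U: "U \<in> carrier_mat n n" "U\<^sup>T * U = 1\<^sub>m n" and V: "V \<in> carrier_mat m m" "V\<^sup>T * V = 1\<^sub>m m" and mn: "m \<le> n"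
    and A: "A = U * sing_mat n m \<sigma> * V\<^sup>T"
  shows "power_scheme q A = U * sing_mat n m (\<lambda>i. \<sigma> i ^ (2 * q + 1)) * V\<^sup>T"
proof -
  have S: "sing_mat n m \<tau> \<in> carrier_mat n m" for \<tau> by (simp add: sing_mat_def)
  note c = U(1) V(1) S transpose_carrier_mat[THEN iffD2, OF U(1)] transpose_carrier_mat[THEN iffD2, OF V(1)]
  have cS: "(sing_mat n m \<tau>)\<^sup>T \<in> carrier_mat m n" for \<tau> using S by simp
  have Ac: "A \<in> carrier_mat n m" unfolding A by (rule mult_sing_mat_transpose_carrier[OF U(1) V(1)])
  have AAc: "A * A\<^sup>T \<in> carrier_mat n n" using Ac by (intro mult_carrier_mat) auto
  have cancelU: "U\<^sup>T * (U * X) = X" if "X \<in> carrier_mat n l" for X l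
    using U that by (simp add: assoc_mult_mat[of "U\<^sup>T" n n U n X l, symmetric])
  have cancelV: "V\<^sup>T * (V * X) = X" if "X \<in> carrier_mat m l" for X l
    using V that by (simp add: assoc_mult_mat[of "V\<^sup>T" m m V m X l, symmetric])
  have SS: "sing_mat n m \<sigma> * ((sing_mat n m \<sigma>)\<^sup>T * sing_mat n m \<tau>) = sing_mat n m (\<lambda>i. (\<sigma> i)\<^sup>2 * \<tau> i)" for \<tau>
  proof (rule eq_matI)
    fix i j assume ij: "i < dim_row (sing_mat n m (\<lambda>i. (\<sigma> i)\<^sup>2 * \<tau> i))" "j < dim_col (sing_mat n m (\<lambda>i. (\<sigma> i)\<^sup>2 * \<tau> i))"
    then have ij: "i < n" "j < m" by (auto simp: sing_mat_def)
    have T: "((sing_mat n m \<sigma>)\<^sup>T * sing_mat n m \<tau>) $$ (l, j) = (if l = j then \<sigma> (Suc j) * \<tau> (Suc j) else 0)" if "l < m" for l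
    proof -
      have "((sing_mat n m \<sigma>)\<^sup>T * sing_mat n m \<tau>) $$ (l, j) = (\<Sum>i<n. (if i = l then \<sigma> (Suc i) else 0) * (if i = j then \<tau> (Suc i) else 0))"
        using that ij by (simp add: sing_mat_def scalar_prod_def atLeast0LessThan)
      also have "\<dots> = (\<Sum>i<n. if i = l then (if l = j then \<sigma> (Suc j) * \<tau> (Suc j) else 0) else 0)" by (intro sum.cong) auto
      finally show ?thesis using that mn by (simp add: sum.delta)
    qed
    have "(sing_mat n m \<sigma> * ((sing_mat n m \<sigma>)\<^sup>T * sing_mat n m \<tau>)) $$ (i, j)
      = (\<Sum>l<m. sing_mat n m \<sigma> $$ (i, l) * ((sing_mat n m \<sigma>)\<^sup>T * sing_mat n m \<tau>) $$ (l, j))"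
    proof -
      have "(sing_mat n m \<sigma> * X) $$ (i, j) = (\<Sum>l<m. sing_mat n m \<sigma> $$ (i, l) * X $$ (l, j))" if "X \<in> carrier_mat m m" for X
        using that ij by (simp add: scalar_prod_def atLeast0LessThan sing_mat_def)
      from this[OF mult_carrier_mat[OF cS S]] show ?thesis .
    qed
    also have "\<dots> = (\<Sum>l<m. if l = j then (if i = j then \<sigma> (Suc i) * (\<sigma> (Suc j) * \<tau> (Suc j)) else 0) else 0)"
    proof -
      have "sing_mat n m \<sigma> $$ (i, l) = (if i = l then \<sigma> (Suc i) else 0)" if "l < m" for l
        using ij that by (simp add: sing_mat_def)
      then show ?thesis by (intro sum.cong refl) (auto simp: T)
    qed
    finally show "(sing_mat n m \<sigma> * ((sing_mat n m \<sigma>)\<^sup>T * sing_mat n m \<tau>)) $$ (i, j) = sing_mat n m (\<lambda>i. (\<sigma> i)\<^sup>2 * \<tau> i) $$ (i, j)"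
      using ij by (auto simp: sing_mat_def sum.delta power2_eq_square)
  qed (auto simp: sing_mat_def)
  have step: "A * A\<^sup>T * (U * sing_mat n m \<tau> * V\<^sup>T) = U * sing_mat n m (\<lambda>i. (\<sigma> i)\<^sup>2 * \<tau> i) * V\<^sup>T" for \<tau>
  proof -
    let ?S = "sing_mat n m \<sigma>" and ?T = "sing_mat n m \<tau>"
    have At: "A\<^sup>T = V * (?S\<^sup>T * U\<^sup>T)"
      unfolding A using c by (subst transpose_mult[of _ n m _ m]) (auto simp: transpose_mult[of _ n n _ m])
    have Vt: "V\<^sup>T \<in> carrier_mat m m" and Ut: "U\<^sup>T \<in> carrier_mat n n" and At_c: "A\<^sup>T \<in> carrier_mat m n"
      using U V Ac by auto
    have TV: "?T * V\<^sup>T \<in> carrier_mat n m" by (rule mult_carrier_mat[OF S Vt])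
    have UTV: "U * (?T * V\<^sup>T) \<in> carrier_mat n m" by (rule mult_carrier_mat[OF U(1) TV])
    have STV: "?S\<^sup>T * (?T * V\<^sup>T) \<in> carrier_mat m m" by (rule mult_carrier_mat[OF cS TV])
    have ST: "?S\<^sup>T * ?T \<in> carrier_mat m m" by (rule mult_carrier_mat[OF cS S])
    have "A * A\<^sup>T * (U * ?T * V\<^sup>T) = A * (A\<^sup>T * (U * (?T * V\<^sup>T)))"
      unfolding assoc_mult_mat[OF U(1) S Vt] by (rule assoc_mult_mat[OF Ac At_c UTV])
    also have "A\<^sup>T * (U * (?T * V\<^sup>T)) = V * (?S\<^sup>T * (?T * V\<^sup>T))"
      unfolding At assoc_mult_mat[OF V(1) mult_carrier_mat[OF cS Ut] UTV] assoc_mult_mat[OF cS Ut UTV]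
      by (simp only: cancelU[OF TV])
    also have "A * (V * (?S\<^sup>T * (?T * V\<^sup>T))) = U * (?S * (?S\<^sup>T * (?T * V\<^sup>T)))"
      unfolding A assoc_mult_mat[OF mult_carrier_mat[OF U(1) S] Vt mult_carrier_mat[OF V(1) STV]]
        cancelV[OF STV] by (rule assoc_mult_mat[OF U(1) S STV])
    also have "?S * (?S\<^sup>T * (?T * V\<^sup>T)) = (?S * (?S\<^sup>T * ?T)) * V\<^sup>T"
      unfolding assoc_mult_mat[OF cS S Vt, symmetric] by (rule assoc_mult_mat[OF S ST Vt, symmetric])
    also have "U * ((?S * (?S\<^sup>T * ?T)) * V\<^sup>T) = U * sing_mat n m (\<lambda>i. (\<sigma> i)\<^sup>2 * \<tau> i) * V\<^sup>T"
      unfolding SS by (rule assoc_mult_mat[OF U(1) S Vt, symmetric])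
    finally show ?thesis .
  qed
  \<comment> \<open>The diagonal \<open>\<tau>\<close> is left general, because in the induction the
    innermost factor acts first and changes it.\<close>
  have "(A * A\<^sup>T) ^\<^sub>m q * (U * sing_mat n m \<tau> * V\<^sup>T) = U * sing_mat n m (\<lambda>i. \<sigma> i ^ (2 * q) * \<tau> i) * V\<^sup>T" for \<tau>
  proof (induction q arbitrary: \<tau>)
    case 0
    show ?case using Ac c by (simp add: left_mult_one_mat[of _ n m])
  next
    case (Suc q)
    have X: "U * sing_mat n m \<tau> * V\<^sup>T \<in> carrier_mat n m" by (rule mult_sing_mat_transpose_carrier[OF U(1) V(1)])
    have "(A * A\<^sup>T) ^\<^sub>m Suc q * (U * sing_mat n m \<tau> * V\<^sup>T) = (A * A\<^sup>T) ^\<^sub>m q * (A * A\<^sup>T * (U * sing_mat n m \<tau> * V\<^sup>T))"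
      using assoc_mult_mat[OF pow_carrier_mat[OF AAc, of q] AAc X] by simp
    also have "\<dots> = U * sing_mat n m (\<lambda>i. \<sigma> i ^ (2 * q) * ((\<sigma> i)\<^sup>2 * \<tau> i)) * V\<^sup>T"
      unfolding step by (rule Suc)
    also have "(\<lambda>i. \<sigma> i ^ (2 * q) * ((\<sigma> i)\<^sup>2 * \<tau> i)) = (\<lambda>i. \<sigma> i ^ (2 * Suc q) * \<tau> i)"
      by (simp add: fun_eq_iff power_add power2_eq_square mult_ac)
    finally show ?case .
  qed
  from this[of \<sigma>] show ?thesis by (simp add: power_scheme_def A[symmetric] mult.commute)
qed

section \<open>Rank and the number of positive singular values\<close>

lemma rank_sum_outer_le:
  "vec_space.rank n (mat n m (\<lambda>(a, b). \<Sum>i<N. f i a * g i b)) \<le> N" for f g :: "nat \<Rightarrow> nat \<Rightarrow> real"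
proof (induction N)
  case 0
  have "mat n m (\<lambda>(a, b). \<Sum>i<0::nat. f i a * g i b) = 0\<^sub>m n m" by (intro eq_matI) auto
  then have "vec_space.rank n (mat n m (\<lambda>(a, b). \<Sum>i<0::nat. f i a * g i b)) = vec_space.rank n (0\<^sub>m n m :: real mat)"
    by (rule arg_cong)
  then show ?case using vec_space.rank_0I[of n m, where 'a = real] by linarith
next
  case (Suc N)
  let ?B = "mat n m (\<lambda>(a, b). \<Sum>i<N. f i a * g i b)" and ?C = "mat n m (\<lambda>(a, b). f N a * g N b)"
  have "mat n m (\<lambda>(a, b). \<Sum>i<Suc N. f i a * g i b) = ?B + ?C" by (intro eq_matI) auto
  moreover have "vec_space.rank n (?B + ?C) \<le> vec_space.rank n ?B + vec_space.rank n ?C"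
    by (rule vec_space.rank_subadditive) auto
  moreover have "vec_space.rank n ?C \<le> 1"
    by (rule vec_space.rank_le_1_product_entries[of _ n m "f N" "g N"]) auto
  ultimately show ?case using Suc by simp
qed

lemma rank_injective:
  assumes A: "A \<in> carrier_mat n m" and inj: "\<And>v. v \<in> carrier_vec m \<Longrightarrow> A *\<^sub>v v = 0\<^sub>v n \<Longrightarrow> v = 0\<^sub>v m"
  shows "vec_space.rank n (A :: real mat) = m"
proof -
  interpret vec_space "TYPE(real)" n .
  have "cols A ! i \<noteq> cols A ! j" if ij: "i < m" "j < m" "i \<noteq> j" for i j
  proof
    assume "cols A ! i = cols A ! j"
    then have "A *\<^sub>v (unit_vec m i - unit_vec m j) = 0\<^sub>v n"
    proof -
      have u: "A *\<^sub>v unit_vec m l = cols A ! l" if "l < m" for l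
        using A that by (intro eq_vecI) (auto simp: scalar_prod_right_unit)
      show ?thesis using A ij \<open>cols A ! i = cols A ! j\<close> by (simp add: mult_minus_distrib_mat_vec[of _ n m] u)
    qed
    then have "unit_vec m i - unit_vec m j = (0\<^sub>v m :: real vec)" by (intro inj) auto
    then have "(unit_vec m i - unit_vec m j) $ i = (0\<^sub>v m :: real vec) $ i" by simp
    then show False using ij by simp
  qed
  then have d: "distinct (cols A)" using A by (auto simp: distinct_conv_nth)
  moreover have "lin_indpt (set (cols A))"
    using lin_depE[OF A _ d] inj by metis
  ultimately show ?thesis by (rule lin_indpt_full_rank[OF A])
qed

text \<open>Both directions count rank-one terms. If \<open>\<sigma> j\<close> vanishes, then
  \<open>A\<close> is a sum of \<open>j - 1\<close> of them. If it is positive, replacing the later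
  singular values by 1 gives a matrix of rank \<open>m\<close> that differs from \<open>A\<close> by
  \<open>m - j\<close> of them.\<close>

lemma rank_svd:
  assumes "is_svd n m A U \<sigma> V" and mn: "m \<le> n" and j: "1 \<le> j" "j \<le> m"
  shows "\<sigma> j > 0 \<longleftrightarrow> j \<le> vec_space.rank n A"
proof -
  have U: "U \<in> carrier_mat n n" "U\<^sup>T * U = 1\<^sub>m n" and V: "V \<in> carrier_mat m m" "V\<^sup>T * V = 1\<^sub>m m"
    and nn: "\<And>i. i \<in> {1..m} \<Longrightarrow> 0 \<le> \<sigma> i" and dec: "\<And>i j. i \<in> {1..m} \<Longrightarrow> j \<in> {1..m} \<Longrightarrow> i \<le> j \<Longrightarrow> \<sigma> j \<le> \<sigma> i"
    and A: "A = U * sing_mat n m \<sigma> * V\<^sup>T"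
    using assms(1) by (auto simp: is_svd_def)
  have Ac: "A \<in> carrier_mat n m" unfolding A by (rule mult_sing_mat_transpose_carrier[OF U(1) V(1)])
  have VVt: "V * V\<^sup>T = 1\<^sub>m m" using mat_mult_left_right_inverse[of "V\<^sup>T" m V] V by simp
  have idx: "(U * sing_mat n m \<tau> * V\<^sup>T) $$ (a, b) = (\<Sum>i<m. U $$ (a, i) * \<tau> (Suc i) * V $$ (b, i))" if "a < n" "b < m" for \<tau> a b
    by (rule mult_sing_mat_transpose_index[OF U(1) V(1) mn that])
  show ?thesis
  proof
    assume pos: "\<sigma> j > 0"
    \<comment> \<open>All entries used are nonzero, by monotonicity up to \<open>j\<close> and by
      definition beyond, which makes \<open>B\<close> injective.\<close>
    define \<tau> where "\<tau> = (\<lambda>i. if i \<le> j then \<sigma> i else 1)"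
    have \<tau>: "\<tau> (Suc i) \<noteq> 0" if "i < m" for i
      using dec[of "Suc i" j] pos j that by (auto simp: \<tau>_def)
    define B where "B = U * sing_mat n m \<tau> * V\<^sup>T"
    have Bc: "B \<in> carrier_mat n m" unfolding B_def by (rule mult_sing_mat_transpose_carrier[OF U(1) V(1)])
    have "vec_space.rank n B = m"
    proof (rule rank_injective[OF Bc])
      fix v assume v: "v \<in> carrier_vec m" and "B *\<^sub>v v = 0\<^sub>v n"
      define z where "z = vec n (\<lambda>i. if i < m then \<tau> (Suc i) * (V\<^sup>T *\<^sub>v v) $ i else 0)"
      have "U *\<^sub>v z = 0\<^sub>v n"
        using \<open>B *\<^sub>v v = 0\<^sub>v n\<close> mult_sing_mat_transpose_vec[OF U(1) V(1) mn v, of \<tau>] by (simp add: B_def z_def)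
      then have "U\<^sup>T *\<^sub>v (U *\<^sub>v z) = 0\<^sub>v n" using U by (intro eq_vecI) auto
      moreover have "U\<^sup>T *\<^sub>v (U *\<^sub>v z) = (U\<^sup>T * U) *\<^sub>v z"
        by (rule assoc_mult_mat_vec[symmetric, of _ n n _ n]) (use U in \<open>auto simp: z_def\<close>)
      ultimately have "(U\<^sup>T * U) *\<^sub>v z = 0\<^sub>v n" by simp
      then have "z = 0\<^sub>v n" using U by (simp add: z_def)
      then have "z $ i = 0" if "i < m" for i using that mn by simp
      moreover have "z $ i = \<tau> (Suc i) * (V\<^sup>T *\<^sub>v v) $ i" if "i < m" for i
        using that mn by (simp add: z_def del: index_mult_mat_vec)
      ultimately have "(V\<^sup>T *\<^sub>v v) $ i = 0" if "i < m" for i using \<tau>[OF that] that by (metis mult_eq_0_iff)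
      then have Vv: "V\<^sup>T *\<^sub>v v = 0\<^sub>v m" using V by (intro eq_vecI) auto
      have "v = (V * V\<^sup>T) *\<^sub>v v" using VVt v by simp
      also have "\<dots> = V *\<^sub>v (V\<^sup>T *\<^sub>v v)" using V v by (intro assoc_mult_mat_vec[of _ m m _ m]) auto
      also have "\<dots> = 0\<^sub>v m" unfolding Vv using V by (intro eq_vecI) auto
      finally show "v = 0\<^sub>v m" .
    qed
    moreover define N where "N = mat n m (\<lambda>(a, b). \<Sum>i<m - j. U $$ (a, j + i) * ((1 - \<sigma> (Suc (j + i))) * V $$ (b, j + i)))"
    have BAN: "B = A + N"
    proof (rule eq_matI)
      fix a b assume "a < dim_row (A + N)" "b < dim_col (A + N)"
      then have ab: "a < n" "b < m" by (auto simp: N_def)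
      have "(\<Sum>i<m - j. U $$ (a, j + i) * ((1 - \<sigma> (Suc (j + i))) * V $$ (b, j + i))) = (\<Sum>i\<in>{j..<m}. U $$ (a, i) * ((1 - \<sigma> (Suc i)) * V $$ (b, i)))"
        using j sum.shift_bounds_nat_ivl[of "\<lambda>i. U $$ (a, i) * ((1 - \<sigma> (Suc i)) * V $$ (b, i))" 0 j "m - j"]
        by (simp add: atLeast0LessThan add.commute)
      also have "\<dots> = (\<Sum>i<m. U $$ (a, i) * (\<tau> (Suc i) - \<sigma> (Suc i)) * V $$ (b, i))"
        by (intro sum.mono_neutral_cong_left) (auto simp: \<tau>_def)
      also have "\<dots> = B $$ (a, b) - A $$ (a, b)"
        unfolding B_def A idx[OF ab] by (simp add: sum_subtractf[symmetric] algebra_simps)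
      finally show "B $$ (a, b) = (A + N) $$ (a, b)" using ab Ac by (simp add: N_def)
    qed (use Bc in \<open>auto simp: N_def\<close>)
    from BAN have "vec_space.rank n B = vec_space.rank n (A + N)" by (rule arg_cong)
    moreover have "vec_space.rank n (A + N) \<le> vec_space.rank n A + vec_space.rank n N"
      by (rule vec_space.rank_subadditive[OF Ac]) (simp add: N_def)
    moreover have "vec_space.rank n N \<le> m - j"
      unfolding N_def by (rule rank_sum_outer_le[where f = "\<lambda>i a. U $$ (a, j + i)" and g = "\<lambda>i b. (1 - \<sigma> (Suc (j + i))) * V $$ (b, j + i)"])
    ultimately show "j \<le> vec_space.rank n A" using j by linarith
  next
    assume le: "j \<le> vec_space.rank n A"
    show "\<sigma> j > 0"
    proof (rule ccontr)
      assume "\<not> \<sigma> j > 0"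
      then have z: "\<sigma> (Suc i) = 0" if "j - 1 \<le> i" "i < m" for i
        using dec[of j "Suc i"] nn[of "Suc i"] nn[of j] j that by auto
      have "A = mat n m (\<lambda>(a, b). \<Sum>i<j - 1. U $$ (a, i) * (\<sigma> (Suc i) * V $$ (b, i)))"
      proof (rule eq_matI)
        fix a b assume "a < dim_row (mat n m (\<lambda>(a, b). \<Sum>i<j - 1. U $$ (a, i) * (\<sigma> (Suc i) * V $$ (b, i))))"
          "b < dim_col (mat n m (\<lambda>(a, b). \<Sum>i<j - 1. U $$ (a, i) * (\<sigma> (Suc i) * V $$ (b, i))))"
        then have ab: "a < n" "b < m" by auto
        have "A $$ (a, b) = (\<Sum>i<j - 1. U $$ (a, i) * (\<sigma> (Suc i) * V $$ (b, i)))"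
          unfolding A idx[OF ab] by (rule sum.mono_neutral_cong_right) (use j z in auto)
        then show "A $$ (a, b) = mat n m (\<lambda>(a, b). \<Sum>i<j - 1. U $$ (a, i) * (\<sigma> (Suc i) * V $$ (b, i))) $$ (a, b)"
          using ab by simp
      qed (use Ac in auto)
      then have "vec_space.rank n A \<le> j - 1"
        using rank_sum_outer_le[of n m "\<lambda>i a. U $$ (a, i)" "\<lambda>i b. \<sigma> (Suc i) * V $$ (b, i)" "j - 1"] by simp
      then show False using le j by simp
    qed
  qed
qed

section \<open>The error of the projection\<close>

text \<open>The norm is attained at the normalised vector \<open>a l / r\<close>, which is an
  admissible \<open>u\<close>.\<close>

lemma sum_squares_le_dual:
  fixes a :: "'l \<Rightarrow> real"
  assumes L: "finite L" and c: "c \<ge> 0" and dual: "\<And>u. (\<Sum>l\<in>L. (u l)\<^sup>2) \<le> 1 \<Longrightarrow> (\<Sum>l\<in>L. u l * a l) \<le> c"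
  shows "(\<Sum>l\<in>L. (a l)\<^sup>2) \<le> c\<^sup>2"
proof -
  define r where "r = sqrt (\<Sum>l\<in>L. (a l)\<^sup>2)"
  have r2: "r\<^sup>2 = (\<Sum>l\<in>L. (a l)\<^sup>2)" by (simp add: r_def sum_nonneg)
  have r0: "r \<ge> 0" by (simp add: r_def sum_nonneg)
  have "r \<le> c"
  proof (cases "r = 0")
    case False
    have "(\<Sum>l\<in>L. (a l / r)\<^sup>2) = r\<^sup>2 / r\<^sup>2" by (simp only: r2 power_divide sum_divide_distrib[symmetric])
    then have "(\<Sum>l\<in>L. a l / r * a l) \<le> c" using False by (intro dual) simp
    moreover have "(\<Sum>l\<in>L. a l / r * a l) = (\<Sum>l\<in>L. (a l)\<^sup>2) / r" by (simp add: sum_divide_distrib power2_eq_square)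
    then have "(\<Sum>l\<in>L. a l / r * a l) = r\<^sup>2 / r" by (simp only: r2)
    ultimately show ?thesis using False by (simp add: power2_eq_square)
  qed (use c in simp)
  then show ?thesis using r0 by (simp add: r2[symmetric] power_mono)
qed

text \<open>A bound of the bilinear form on unit balls is a bound of the operator
  \<open>S K T \<delta>\<close>; this is its homogeneous version for a vector \<open>\<zeta>\<close>
  of any length.\<close>

lemma quotient_sum_squares_le:
  fixes x :: "nat \<times> nat \<Rightarrow> real" and k p :: nat
  assumes L: "finite L" and c: "c \<ge> 0"
    and bil: "\<And>u v. (\<Sum>l\<in>L. (u l)\<^sup>2) \<le> 1 \<Longrightarrow> (\<Sum>i<k. (v i)\<^sup>2) \<le> 1 \<Longrightarrow>
        (\<Sum>l\<in>L. \<Sum>j<p. x (l, j) * (u l * s l * (\<Sum>i<k. v i * (\<delta> i * t i j)))) \<le> c"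
  shows "(\<Sum>l\<in>L. (s l * (\<Sum>j<p. x (l, j) * (\<Sum>i<k. \<zeta> i * (\<delta> i * t i j))))\<^sup>2) \<le> c\<^sup>2 * (\<Sum>i<k. (\<zeta> i)\<^sup>2)"
proof -
  define r where "r = sqrt (\<Sum>i<k. (\<zeta> i)\<^sup>2)"
  have r2: "r\<^sup>2 = (\<Sum>i<k. (\<zeta> i)\<^sup>2)" by (simp add: r_def sum_nonneg)
  show ?thesis
  proof (cases "r = 0")
    case True
    then have z: "(\<Sum>i<k. (\<zeta> i)\<^sup>2) = 0" using r2 by simp
    have "\<zeta> i = 0" if "i < k" for i
    proof -
      have "(\<zeta> i)\<^sup>2 \<le> (\<Sum>i<k. (\<zeta> i)\<^sup>2)" by (rule member_le_sum) (use that in auto)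
      then show ?thesis using z by simp
    qed
    then show ?thesis by simp
  next
    case False
    define a where "a = (\<lambda>l. s l * (\<Sum>j<p. x (l, j) * (\<Sum>i<k. \<zeta> i / r * (\<delta> i * t i j))))"
    have "(\<Sum>l\<in>L. (a l)\<^sup>2) \<le> c\<^sup>2"
    proof (rule sum_squares_le_dual[OF L c])
      fix u :: "nat \<Rightarrow> real" assume u: "(\<Sum>l\<in>L. (u l)\<^sup>2) \<le> 1"
      have "(\<Sum>i<k. (\<zeta> i / r)\<^sup>2) = r\<^sup>2 / r\<^sup>2" by (simp only: r2 power_divide sum_divide_distrib[symmetric])
      then have "(\<Sum>l\<in>L. \<Sum>j<p. x (l, j) * (u l * s l * (\<Sum>i<k. \<zeta> i / r * (\<delta> i * t i j)))) \<le> c"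
        using False by (intro bil[OF u]) simp
      then show "(\<Sum>l\<in>L. u l * a l) \<le> c" by (simp add: a_def sum_distrib_left mult_ac)
    qed
    moreover have "s l * (\<Sum>j<p. x (l, j) * (\<Sum>i<k. \<zeta> i * (\<delta> i * t i j))) = r * a l" for l
      using False by (simp add: a_def sum_distrib_left)
    ultimately show ?thesis
      by (simp add: power_mult_distrib sum_distrib_left[symmetric] r2[symmetric] mult.commute[of "c\<^sup>2"] mult_left_mono)
  qed
qed

text \<open>The vector \<open>A y\<close> is the image of the tail plus a head supported on the
  first \<open>k\<close> left singular vectors. The residual of the head is at most its distance
  from any \<open>Z *\<^sub>v w\<close>, and since \<open>U\<close> is an isometry, this distance is
  computed coordinatewise. The choice of \<open>w\<close> is left to the applications.\<close>

lemma residual_split: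
  assumes U: "U \<in> carrier_mat n n" "U\<^sup>T * U = 1\<^sub>m n" and V: "V \<in> carrier_mat m m" and mn: "m \<le> n" and k: "k \<le> m"
    and y: "y \<in> carrier_vec m"
    and Z: "Z = U * (sing_mat n m \<tau> * mat m p x)"
  shows "vec_norm2 ((1\<^sub>m n - orth_proj Z) *\<^sub>v ((U * sing_mat n m \<sigma> * V\<^sup>T) *\<^sub>v y))
    \<le> vec_norm2 ((1\<^sub>m n - orth_proj Z) *\<^sub>v ((U * sing_mat n m (\<lambda>i. if i \<le> k then 0 else \<sigma> i) * V\<^sup>T) *\<^sub>v y))
      + sqrt ((\<Sum>i<k. (\<sigma> (Suc i) * (V\<^sup>T *\<^sub>v y) $ i - \<tau> (Suc i) * (\<Sum>j<p. x (i, j) * w j))\<^sup>2)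
            + (\<Sum>l\<in>{k..<m}. (\<tau> (Suc l) * (\<Sum>j<p. x (l, j) * w j))\<^sup>2))"
proof -
  define z where "z = V\<^sup>T *\<^sub>v y"
  define h where "h = (\<lambda>l. \<Sum>j<p. x (l, j) * w j)"
  define a where "a = vec n (\<lambda>i. if i < m then \<sigma> (Suc i) * z $ i else 0)"
  define b where "b = vec n (\<lambda>i. if i < m then (if Suc i \<le> k then 0 else \<sigma> (Suc i)) * z $ i else 0)"
  define d where "d = vec n (\<lambda>i. if i < k then \<sigma> (Suc i) * z $ i else 0)"
  define c where "c = vec n (\<lambda>i. if i < m then \<tau> (Suc i) * h i else 0)"
  have abcd: "a \<in> carrier_vec n" "b \<in> carrier_vec n" "c \<in> carrier_vec n" "d \<in> carrier_vec n"
    by (auto simp: a_def b_def c_def d_def)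
  have X: "mat m p x \<in> carrier_mat m p" by simp
  have SX: "sing_mat n m \<tau> * mat m p x \<in> carrier_mat n p" by (rule mult_carrier_mat[OF sing_mat_carrier X])
  have Zc: "Z \<in> carrier_mat n p" unfolding Z by (rule mult_carrier_mat[OF U(1) SX])
  let ?R = "1\<^sub>m n - orth_proj Z"
  have R: "?R \<in> carrier_mat n n" by (rule minus_carrier_mat[OF orth_proj_residual(1)[OF Zc]])
  have A: "(U * sing_mat n m \<sigma> * V\<^sup>T) *\<^sub>v y = U *\<^sub>v a"
    unfolding a_def z_def by (rule mult_sing_mat_transpose_vec[OF U(1) V mn y])
  have T: "(U * sing_mat n m (\<lambda>i. if i \<le> k then 0 else \<sigma> i) * V\<^sup>T) *\<^sub>v y = U *\<^sub>v b"
    unfolding b_def z_def by (rule mult_sing_mat_transpose_vec[OF U(1) V mn y])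
  have W: "vec p w \<in> carrier_vec p" by simp
  have Zw: "Z *\<^sub>v vec p w = U *\<^sub>v c"
  proof -
    have "mat m p x *\<^sub>v vec p w = vec m h"
      by (intro eq_vecI) (auto simp: h_def scalar_prod_def atLeast0LessThan)
    moreover have "sing_mat n m \<tau> *\<^sub>v vec m h = c"
    proof (rule eq_vecI)
      fix i assume "i < dim_vec c"
      then have i: "i < n" by (simp add: c_def)
      have "(sing_mat n m \<tau> *\<^sub>v vec m h) $ i = (\<Sum>l<m. (if i = l then \<tau> (Suc i) else 0) * h l)"
        using i by (simp add: sing_mat_def scalar_prod_def atLeast0LessThan)
      also have "\<dots> = (\<Sum>l<m. if l = i then \<tau> (Suc i) * h i else 0)" by (intro sum.cong) auto
      finally show "(sing_mat n m \<tau> *\<^sub>v vec m h) $ i = c $ i" using i by (simp add: c_def sum.delta)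
    qed (simp add: sing_mat_def c_def)
    ultimately show ?thesis unfolding Z
      by (simp only: assoc_mult_mat_vec[OF U(1) SX W] assoc_mult_mat_vec[OF sing_mat_carrier X W])
  qed
  have ab: "a = b + d" by (intro eq_vecI) (use k mn in \<open>auto simp: a_def b_def d_def\<close>)
  have Ubd: "U *\<^sub>v b \<in> carrier_vec n" "U *\<^sub>v d \<in> carrier_vec n" using U abcd by auto
  have "?R *\<^sub>v (U *\<^sub>v a) = ?R *\<^sub>v (U *\<^sub>v b) + ?R *\<^sub>v (U *\<^sub>v d)"
    unfolding ab mult_add_distrib_mat_vec[OF U(1) abcd(2,4)] by (rule mult_add_distrib_mat_vec[OF R Ubd])
  then have "vec_norm2 (?R *\<^sub>v (U *\<^sub>v a)) \<le> vec_norm2 (?R *\<^sub>v (U *\<^sub>v b)) + vec_norm2 (?R *\<^sub>v (U *\<^sub>v d))"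
    using vec_norm2_triangle[of "?R *\<^sub>v (U *\<^sub>v b)" n "?R *\<^sub>v (U *\<^sub>v d)"] R Ubd by simp
  also have "vec_norm2 (?R *\<^sub>v (U *\<^sub>v d)) \<le> vec_norm2 (U *\<^sub>v d - Z *\<^sub>v vec p w)"
    by (rule orth_proj_residual(2)[OF Zc Ubd(2) W])
  also have "U *\<^sub>v d - Z *\<^sub>v vec p w = U *\<^sub>v (d - c)"
    unfolding Zw by (rule mult_minus_distrib_mat_vec[OF U(1) abcd(4,3), symmetric])
  also have "vec_norm2 (U *\<^sub>v (d - c)) = vec_norm2 (d - c)"
    by (rule vec_norm2_orthogonal_mult[OF U]) (use abcd in simp)
  also have "vec_norm2 (d - c) = sqrt (\<Sum>i<n. ((d - c) $ i)\<^sup>2)"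
    by (rule vec_norm2_eq) (use abcd in simp)
  also have "(\<Sum>i<n. ((d - c) $ i)\<^sup>2) = (\<Sum>i<k. ((d - c) $ i)\<^sup>2) + (\<Sum>l\<in>{k..<m}. ((d - c) $ l)\<^sup>2)"
  proof -
    have "(\<Sum>i<n. ((d - c) $ i)\<^sup>2) = (\<Sum>i\<in>{..<k} \<union> {k..<m}. ((d - c) $ i)\<^sup>2)"
      by (rule sum.mono_neutral_right) (use k mn in \<open>auto simp: d_def c_def\<close>)
    then show ?thesis by (subst (asm) sum.union_disjoint) auto
  qed
  also have "(\<Sum>i<k. ((d - c) $ i)\<^sup>2) = (\<Sum>i<k. (\<sigma> (Suc i) * z $ i - \<tau> (Suc i) * h i)\<^sup>2)"
    by (intro sum.cong) (use k mn in \<open>auto simp: d_def c_def\<close>)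
  also have "(\<Sum>l\<in>{k..<m}. ((d - c) $ l)\<^sup>2) = (\<Sum>l\<in>{k..<m}. (\<tau> (Suc l) * h l)\<^sup>2)"
    by (intro sum.cong) (use k mn in \<open>auto simp: d_def c_def\<close>)
  finally show ?thesis by (simp add: A T z_def h_def)
qed

text \<open>Since \<open>orth_proj\<close> is a definite description, measurability is read off from
  countably many conditions: the residual norm is an infimum over \<open>w\<close>, hence strict
  sublevel sets and a countable union, and the spectral norm is a supremum, hence non-strict ones
  and a countable intersection.\<close>

lemma measurable_spectral_norm_residual:
  assumes Z: "\<And>x. Z x \<in> carrier_mat n p" and B: "B \<in> carrier_mat n m"
    and mZ: "\<And>i j. i < n \<Longrightarrow> j < p \<Longrightarrow> (\<lambda>x. Z x $$ (i, j)) \<in> borel_measurable M"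
  shows "(\<lambda>x. spectral_norm ((1\<^sub>m n - orth_proj (Z x)) * B)) \<in> borel_measurable M"
proof -
  let ?R = "\<lambda>x. 1\<^sub>m n - orth_proj (Z x)"
  have R: "?R x \<in> carrier_mat n n" for x by (rule minus_carrier_mat[OF orth_proj_residual(1)[OF Z]])
  have m1: "(\<lambda>x. vec_norm2 (?R x *\<^sub>v y)) \<in> borel_measurable M" if y: "y \<in> carrier_vec n" for y
    unfolding borel_measurable_iff_less
  proof
    fix c
    have norm: "vec_norm2 (y - Z x *\<^sub>v vec p w) = sqrt (\<Sum>i<n. (y $ i - (\<Sum>j<p. Z x $$ (i, j) * w j))\<^sup>2)" for x w
    proof -
      have "y - Z x *\<^sub>v vec p w \<in> carrier_vec n" using y Z[of x] by simp
      moreover have "(y - Z x *\<^sub>v vec p w) $ i = y $ i - (\<Sum>j<p. Z x $$ (i, j) * w j)" if "i < n" for i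
        using that y Z[of x] by (simp add: scalar_prod_def atLeast0LessThan)
      ultimately show ?thesis by (simp add: vec_norm2_eq)
    qed
    have "vec_norm2 (?R x *\<^sub>v y) < c \<longleftrightarrow> (\<exists>w\<in>rat_vecs p. vec_norm2 (y - Z x *\<^sub>v vec p w) < c)" for x
    proof
      assume lt: "vec_norm2 (?R x *\<^sub>v y) < c"
      obtain v where v: "v \<in> carrier_vec p" "?R x *\<^sub>v y = y - Z x *\<^sub>v v"
        using orth_proj_residual(3)[OF Z y] by blast
      obtain w where w: "\<And>i. w i \<in> rat_vecs p" "\<And>j. j < p \<Longrightarrow> (\<lambda>i. w i j) \<longlonglongrightarrow> v $ j"
        using rat_vecs_dense[of p "\<lambda>j. v $ j"] by blast
      have v': "vec p (\<lambda>j. v $ j) = v" using v(1) by auto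
      have "(\<lambda>i. vec_norm2 (y - Z x *\<^sub>v vec p (w i))) \<longlonglongrightarrow> vec_norm2 (y - Z x *\<^sub>v vec p (\<lambda>j. v $ j))"
        unfolding norm by (intro tendsto_intros w) auto
      then have "\<forall>\<^sub>F i in sequentially. vec_norm2 (y - Z x *\<^sub>v vec p (w i)) < c"
        by (rule order_tendstoD) (use lt v v' in simp)
      then show "\<exists>w\<in>rat_vecs p. vec_norm2 (y - Z x *\<^sub>v vec p w) < c"
        using w(1) by (auto simp: eventually_sequentially)
    next
      assume "\<exists>w\<in>rat_vecs p. vec_norm2 (y - Z x *\<^sub>v vec p w) < c"
      then show "vec_norm2 (?R x *\<^sub>v y) < c"
        using orth_proj_residual(2)[OF Z y] by (meson order_le_less_trans vec_carrier)
    qed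
    then have "{x \<in> space M. vec_norm2 (?R x *\<^sub>v y) < c} = {x \<in> space M. \<exists>w\<in>rat_vecs p. vec_norm2 (y - Z x *\<^sub>v vec p w) < c}"
      by blast
    also have "\<dots> \<in> sets M"
    proof (rule sets.sets_Collect_countable_Ex'[OF _ countable_rat_vecs])
      fix w
      have [measurable]: "(\<lambda>x. vec_norm2 (y - Z x *\<^sub>v vec p w)) \<in> borel_measurable M"
        unfolding norm
        by (intro borel_measurable_sum borel_measurable_power borel_measurable_diff borel_measurable_times borel_measurable_const
            measurable_compose[OF _ borel_measurable_sqrt] mZ) auto
      show "{x \<in> space M. vec_norm2 (y - Z x *\<^sub>v vec p w) < c} \<in> sets M" by measurable
    qed
    finally show "{x \<in> space M. vec_norm2 (?R x *\<^sub>v y) < c} \<in> sets M" .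
  qed
  show ?thesis
    unfolding borel_measurable_iff_le
  proof
    fix c
    have RB: "?R x * B \<in> carrier_mat n m" for x by (rule mult_carrier_mat[OF R B])
    have assoc: "(?R x * B) *\<^sub>v y = ?R x *\<^sub>v (B *\<^sub>v y)" if "y \<in> carrier_vec m" for x y
      by (rule assoc_mult_mat_vec[OF R B that])
    \<comment> \<open>The homogeneous form spares the approximating rational vectors from having to
      stay inside the unit ball.\<close>
    have eq: "spectral_norm (?R x * B) \<le> c \<longleftrightarrow> 0 \<le> c \<and> (\<forall>v\<in>rat_vecs m. vec_norm2 (?R x *\<^sub>v (B *\<^sub>v vec m v)) \<le> c * vec_norm2 (vec m v))" for x
    proof
      assume le: "spectral_norm (?R x * B) \<le> c"
      have "vec_norm2 (?R x *\<^sub>v (B *\<^sub>v vec m v)) \<le> c * vec_norm2 (vec m v)" for v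
      proof -
        have "vec_norm2 ((?R x * B) *\<^sub>v vec m v) \<le> spectral_norm (?R x * B) * vec_norm2 (vec m v)"
          by (rule spectral_norm_mult_vec[OF RB]) simp
        also have "\<dots> \<le> c * vec_norm2 (vec m v)" by (intro mult_right_mono le) simp
        finally show ?thesis by (simp add: assoc)
      qed
      then show "0 \<le> c \<and> (\<forall>v\<in>rat_vecs m. vec_norm2 (?R x *\<^sub>v (B *\<^sub>v vec m v)) \<le> c * vec_norm2 (vec m v))"
        using le spectral_norm_nonneg[of "?R x * B"] by auto
    next
      assume h: "0 \<le> c \<and> (\<forall>v\<in>rat_vecs m. vec_norm2 (?R x *\<^sub>v (B *\<^sub>v vec m v)) \<le> c * vec_norm2 (vec m v))"
      show "spectral_norm (?R x * B) \<le> c"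
      proof (rule spectral_norm_least)
        fix y assume "y \<in> carrier_vec (dim_col (?R x * B))" and y1: "vec_norm2 y \<le> 1"
        then have y: "y \<in> carrier_vec m" using B by simp
        obtain w where w: "\<And>i. w i \<in> rat_vecs m" "\<And>j. j < m \<Longrightarrow> (\<lambda>i. w i j) \<longlonglongrightarrow> y $ j"
          using rat_vecs_dense[of m "\<lambda>j. y $ j"] by blast
        have y': "vec m (\<lambda>j. y $ j) = y" using y by auto
        have nv: "vec_norm2 (vec m v) = sqrt (\<Sum>j<m. (v j)\<^sup>2)" for v
          by (simp add: vec_norm2_eq[of _ m])
        have nR: "vec_norm2 ((?R x * B) *\<^sub>v vec m v) = sqrt (\<Sum>i<n. (\<Sum>j<m. (?R x * B) $$ (i, j) * v j)\<^sup>2)" for v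
        proof -
          have "C *\<^sub>v vec m v \<in> carrier_vec n \<and> (\<forall>i<n. (C *\<^sub>v vec m v) $ i = (\<Sum>j<m. C $$ (i, j) * v j))" if "C \<in> carrier_mat n m" for C
            using that by (auto simp: scalar_prod_def atLeast0LessThan)
          from this[OF RB] show ?thesis by (simp add: vec_norm2_eq[of _ n] del: index_mult_mat_vec)
        qed
        have "(\<lambda>i. vec_norm2 ((?R x * B) *\<^sub>v vec m (w i))) \<longlonglongrightarrow> vec_norm2 ((?R x * B) *\<^sub>v vec m (\<lambda>j. y $ j))"
          unfolding nR by (intro tendsto_intros w) auto
        moreover have "(\<lambda>i. c * vec_norm2 (vec m (w i))) \<longlonglongrightarrow> c * vec_norm2 (vec m (\<lambda>j. y $ j))"
          unfolding nv by (intro tendsto_intros w) auto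
        ultimately have "vec_norm2 ((?R x * B) *\<^sub>v vec m (\<lambda>j. y $ j)) \<le> c * vec_norm2 (vec m (\<lambda>j. y $ j))"
          by (rule LIMSEQ_le) (use h w(1) in \<open>auto simp: assoc\<close>)
        also have "\<dots> \<le> c * 1" unfolding y' using h y1 by (intro mult_left_mono) auto
        finally show "vec_norm2 ((?R x * B) *\<^sub>v y) \<le> c" by (simp add: y')
      qed
    qed
    have "{x \<in> space M. \<forall>v\<in>rat_vecs m. vec_norm2 (?R x *\<^sub>v (B *\<^sub>v vec m v)) \<le> c * vec_norm2 (vec m v)} \<in> sets M"
    proof (rule sets.sets_Collect_countable_All'[OF _ countable_rat_vecs])
      fix v
      have [measurable]: "(\<lambda>x. vec_norm2 (?R x *\<^sub>v (B *\<^sub>v vec m v))) \<in> borel_measurable M"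
        by (rule m1) (use B in simp)
      show "{x \<in> space M. vec_norm2 (?R x *\<^sub>v (B *\<^sub>v vec m v)) \<le> c * vec_norm2 (vec m v)} \<in> sets M" by measurable
    qed
    moreover have "{x \<in> space M. spectral_norm (?R x * B) \<le> c} = (if 0 \<le> c then {x \<in> space M. \<forall>v\<in>rat_vecs m. vec_norm2 (?R x *\<^sub>v (B *\<^sub>v vec m v)) \<le> c * vec_norm2 (vec m v)} else {})"
      by (simp only: eq) auto
    ultimately show "{x \<in> space M. spectral_norm (?R x * B) \<le> c} \<in> sets M" by simp
  qed
qed

text \<open>Independence of the columns and their product laws determine the joint law of the
  entries on boxes. With \<open>p > 0\<close> the preimage of a box is an intersection over a
  nonempty set of columns.\<close>

lemma std_gaussian_mat_entries:
  assumes "prob_space M" and G: "std_gaussian_mat M m p G" and p: "p > 0"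
  shows "(\<lambda>\<omega>. \<lambda>(l, j)\<in>{..<m} \<times> {..<p}. G \<omega> $$ (l, j)) \<in> M \<rightarrow>\<^sub>M PiM ({..<m} \<times> {..<p}) (\<lambda>_. borel)" (is "?E \<in> _")
    and "distr M (PiM ({..<m} \<times> {..<p}) (\<lambda>_. borel)) (\<lambda>\<omega>. \<lambda>(l, j)\<in>{..<m} \<times> {..<p}. G \<omega> $$ (l, j)) = PiM ({..<m} \<times> {..<p}) (\<lambda>_. std_gauss)"
proof -
  interpret prob_space M by fact
  let ?J = "{..<m} \<times> {..<p}"
  let ?X = "\<lambda>j \<omega>. col_coords m (G \<omega>) j"
  have ind: "indep_vars (\<lambda>_. PiM {..<m} (\<lambda>_. borel)) ?X {..<p}"
    and law: "\<And>j. j < p \<Longrightarrow> distr M (PiM {..<m} (\<lambda>_. borel)) (?X j) = PiM {..<m} (\<lambda>_. std_gauss)"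
    using G by (auto simp: std_gaussian_mat_def std_gaussian_vec_def std_gauss_def)
  have rv: "?X j \<in> M \<rightarrow>\<^sub>M PiM {..<m} (\<lambda>_. borel)" if "j < p" for j
    using ind that by (auto simp: indep_vars_def)
  have ent: "(\<lambda>\<omega>. G \<omega> $$ (l, j)) \<in> borel_measurable M" if "l < m" "j < p" for l j
  proof -
    have "(\<lambda>\<omega>. ?X j \<omega> l) \<in> borel_measurable M"
      by (rule measurable_compose[OF rv]) (use that in auto)
    then show ?thesis using that by (simp add: col_coords_def)
  qed
  show E: "?E \<in> M \<rightarrow>\<^sub>M PiM ?J (\<lambda>_. borel)"
    by (rule measurable_restrict) (use ent in auto)
  show "distr M (PiM ?J (\<lambda>_. borel)) ?E = PiM ?J (\<lambda>_. std_gauss)"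
  proof (rule PG.PiM_eqI)
    fix A :: "nat \<times> nat \<Rightarrow> real set" assume A: "\<And>i. i \<in> ?J \<Longrightarrow> A i \<in> sets std_gauss"
    define B where "B = (\<lambda>j. PiE {..<m} (\<lambda>l. A (l, j)))"
    have B: "B j \<in> sets (PiM {..<m} (\<lambda>_. borel))" if "j < p" for j
      unfolding B_def by (intro sets_PiM_I_finite) (use A that in auto)
    have "emeasure (distr M (PiM ?J (\<lambda>_. borel)) ?E) (PiE ?J A) = emeasure M (?E -` PiE ?J A \<inter> space M)"
      by (rule emeasure_distr[OF E]) (intro sets_PiM_I_finite, use A in auto)
    also have "?E -` PiE ?J A \<inter> space M = (\<Inter>j\<in>{..<p}. ?X j -` B j \<inter> space M)"
      using p by (auto simp: B_def col_coords_def PiE_iff restrict_def extensional_def)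
    also have "emeasure M \<dots> = ennreal (prob (\<Inter>j\<in>{..<p}. ?X j -` B j \<inter> space M))"
      by (rule emeasure_eq_measure)
    also have "prob (\<Inter>j\<in>{..<p}. ?X j -` B j \<inter> space M) = (\<Prod>j<p. prob (?X j -` B j \<inter> space M))"
      by (rule indep_varsD[OF ind]) (use p B in auto)
    also have "ennreal (\<Prod>j<p. prob (?X j -` B j \<inter> space M)) = (\<Prod>j<p. emeasure M (?X j -` B j \<inter> space M))"
      by (simp add: emeasure_eq_measure prod_ennreal)
    also have "\<dots> = (\<Prod>j<p. \<Prod>l<m. emeasure std_gauss (A (l, j)))"
    proof (rule prod.cong[OF refl])
      fix j assume "j \<in> {..<p}"
      then have j: "j < p" by simp
      have "emeasure M (?X j -` B j \<inter> space M) = emeasure (PiM {..<m} (\<lambda>_. std_gauss)) (B j)"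
        unfolding law[OF j, symmetric] by (rule emeasure_distr[symmetric, OF rv[OF j] B[OF j]])
      also have "\<dots> = (\<Prod>l<m. emeasure std_gauss (A (l, j)))"
        unfolding B_def by (rule PG.emeasure_PiM) (use A j in auto)
      finally show "emeasure M (?X j -` B j \<inter> space M) = (\<Prod>l<m. emeasure std_gauss (A (l, j)))" .
    qed
    also have "\<dots> = (\<Prod>l<m. \<Prod>j<p. emeasure std_gauss (A (l, j)))" by (rule prod.swap)
    also have "\<dots> = (\<Prod>i\<in>?J. emeasure std_gauss (A i))" by (simp add: prod.cartesian_product)
    finally show "emeasure (distr M (PiM ?J (\<lambda>_. borel)) ?E) (PiE ?J A) = (\<Prod>i\<in>?J. emeasure std_gauss (A i))" .
  qed auto
qed

lemma distr_PiM_orthonormal: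
  fixes c :: "'i \<Rightarrow> 'j \<Rightarrow> real"
  assumes I: "finite I" and J: "finite J"
    and c: "\<And>l l'. l \<in> J \<Longrightarrow> l' \<in> J \<Longrightarrow> (\<Sum>i\<in>I. c i l * c i l') = (if l = l' then 1 else 0)"
  shows "distr (PiM I (\<lambda>_. std_gauss)) (PiM J (\<lambda>_. borel)) (\<lambda>x. \<lambda>l\<in>J. \<Sum>i\<in>I. x i * c i l) = PiM J (\<lambda>_. std_gauss)"
proof (rule measure_eqI)
  fix A assume "A \<in> sets (distr (PiM I (\<lambda>_. std_gauss)) (PiM J (\<lambda>_. borel)) (\<lambda>x. \<lambda>l\<in>J. \<Sum>i\<in>I. x i * c i l))"
  then have A: "A \<in> sets (PiM J (\<lambda>_. borel))" by simp
  have m: "(\<lambda>x. \<lambda>l\<in>J. \<Sum>i\<in>I. x i * c i l) \<in> PiM I (\<lambda>_. std_gauss) \<rightarrow>\<^sub>M PiM J (\<lambda>_. borel)"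
    by (rule measurable_restrict) simp
  have "emeasure (distr (PiM I (\<lambda>_. std_gauss)) (PiM J (\<lambda>_. borel)) (\<lambda>x. \<lambda>l\<in>J. \<Sum>i\<in>I. x i * c i l)) A
     = (\<integral>\<^sup>+x. indicator A (\<lambda>l\<in>J. \<Sum>i\<in>I. x i * c i l) \<partial>PiM I (\<lambda>_. std_gauss))"
    using nn_integral_distr[OF m, of "indicator A"] A by simp
  also have "\<dots> = (\<integral>\<^sup>+x. indicator A x \<partial>PiM J (\<lambda>_. std_gauss))"
    by (rule nn_integral_PiM_orthonormal[OF I J c]) (use A in auto)
  finally show "emeasure (distr (PiM I (\<lambda>_. std_gauss)) (PiM J (\<lambda>_. borel)) (\<lambda>x. \<lambda>l\<in>J. \<Sum>i\<in>I. x i * c i l)) A = emeasure (PiM J (\<lambda>_. std_gauss)) A"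
    using A by simp
qed simp

text \<open>Concavity of \<open>phi\<close> as its tangent line at \<open>a\<close>, of slope
  \<open>1 / sqrt (1 + a\<^sup>2) ^ 3\<close>. The line equals \<open>(a ^ 3 + x) / A ^ 3\<close>,
  and after squaring, the difference is a polynomial divisible by
  \<open>(x - a)\<^sup>2\<close>.\<close>

lemma phi_tangent:
  assumes "x \<ge> 0" "a \<ge> 0"
  shows "phi x \<le> phi a + (x - a) / sqrt (1 + a\<^sup>2) ^ 3"
proof -
  define A B where "A = sqrt (1 + a\<^sup>2)" and "B = sqrt (1 + x\<^sup>2)"
  have AB: "A > 0" "B > 0" "A\<^sup>2 = 1 + a\<^sup>2" "B\<^sup>2 = 1 + x\<^sup>2" by (auto simp: A_def B_def add_pos_nonneg)
  have "x\<^sup>2 * (A\<^sup>2) ^ 3 \<le> B\<^sup>2 * (a ^ 3 + x)\<^sup>2"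
  proof -
    have "B\<^sup>2 * (a ^ 3 + x)\<^sup>2 - x\<^sup>2 * (A\<^sup>2) ^ 3 = (x - a)\<^sup>2 * (x\<^sup>2 + (2 * a + 2 * a ^ 3) * x + a ^ 4)"
      unfolding AB(3,4) by (simp add: power2_eq_square power3_eq_cube power4_eq_xxxx algebra_simps)
    moreover have "\<dots> \<ge> 0" using assms by (intro mult_nonneg_nonneg add_nonneg_nonneg) auto
    ultimately show ?thesis by linarith
  qed
  then have "(x * A ^ 3)\<^sup>2 \<le> (B * (a ^ 3 + x))\<^sup>2"
    by (simp add: power_mult_distrib power_mult[symmetric] mult.commute)
  then have "x * A ^ 3 \<le> B * (a ^ 3 + x)"
    by (rule power2_le_imp_le) (use assms AB in auto)
  then have "x / B \<le> (a ^ 3 + x) / A ^ 3" using AB by (simp add: divide_simps mult.commute)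
  also have "\<dots> = a / A + (x - a) / A ^ 3"
  proof -
    have "a ^ 3 + x = a * A\<^sup>2 + (x - a)" unfolding AB(3) by (simp add: power2_eq_square power3_eq_cube algebra_simps)
    then have "(a ^ 3 + x) / A ^ 3 = a * A\<^sup>2 / A ^ 3 + (x - a) / A ^ 3" by (simp only: add_divide_distrib)
    also have "a * A\<^sup>2 / A ^ 3 = a / A" using AB(1) by (simp add: power2_eq_square power3_eq_cube)
    finally show ?thesis .
  qed
  finally show ?thesis by (simp add: phi_def A_def B_def)
qed

text \<open>The vector \<open>w\<close> may depend on \<open>y\<close>; only the bound
  \<open>b\<close> has to be common to all \<open>y\<close> in the unit ball.\<close>

lemma residual_diff_le:
  assumes U: "U \<in> carrier_mat n n" "U\<^sup>T * U = 1\<^sub>m n" and V: "V \<in> carrier_mat m m" and mn: "m \<le> n" and k: "k \<le> m"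
    and Z: "Z = U * (sing_mat n m \<tau> * mat m p x)"
    and b: "\<And>y. y \<in> carrier_vec m \<Longrightarrow> vec_norm2 y \<le> 1 \<Longrightarrow> \<exists>w.
      sqrt ((\<Sum>i<k. (\<sigma> (Suc i) * (V\<^sup>T *\<^sub>v y) $ i - \<tau> (Suc i) * (\<Sum>j<p. x (i, j) * w j))\<^sup>2)
            + (\<Sum>l\<in>{k..<m}. (\<tau> (Suc l) * (\<Sum>j<p. x (l, j) * w j))\<^sup>2)) \<le> b"
  shows "spectral_norm ((1\<^sub>m n - orth_proj Z) * (U * sing_mat n m \<sigma> * V\<^sup>T)) - spectral_norm ((1\<^sub>m n - orth_proj Z) * svd_tail n m k U \<sigma> V) \<le> b"
proof -
  have Zc: "Z \<in> carrier_mat n p" unfolding Z by (intro mult_carrier_mat[OF U(1)] mult_carrier_mat[OF sing_mat_carrier]) simp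
  let ?R = "1\<^sub>m n - orth_proj Z"
  let ?A = "U * sing_mat n m \<sigma> * V\<^sup>T" and ?T = "U * sing_mat n m (\<lambda>i. if i \<le> k then 0 else \<sigma> i) * V\<^sup>T"
  have R: "?R \<in> carrier_mat n n" by (rule minus_carrier_mat[OF orth_proj_residual(1)[OF Zc]])
  have A: "?A \<in> carrier_mat n m" and T: "?T \<in> carrier_mat n m"
    by (rule mult_sing_mat_transpose_carrier[OF U(1) V])+
  have "spectral_norm (?R * ?A) \<le> spectral_norm (?R * ?T) + b"
  proof (rule spectral_norm_least)
    fix y assume "y \<in> carrier_vec (dim_col (?R * ?A))" and y1: "vec_norm2 y \<le> 1"
    then have y: "y \<in> carrier_vec m" using V by simp
    obtain w where w: "sqrt ((\<Sum>i<k. (\<sigma> (Suc i) * (V\<^sup>T *\<^sub>v y) $ i - \<tau> (Suc i) * (\<Sum>j<p. x (i, j) * w j))\<^sup>2)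
            + (\<Sum>l\<in>{k..<m}. (\<tau> (Suc l) * (\<Sum>j<p. x (l, j) * w j))\<^sup>2)) \<le> b"
      using b[OF y y1] by blast
    have "vec_norm2 (?R *\<^sub>v (?T *\<^sub>v y)) \<le> spectral_norm (?R * ?T)"
      unfolding assoc_mult_mat_vec[OF R T y, symmetric] by (rule spectral_norm_upper) (use y y1 V in auto)
    then show "vec_norm2 ((?R * ?A) *\<^sub>v y) \<le> spectral_norm (?R * ?T) + b"
      unfolding assoc_mult_mat_vec[OF R A y]
      using residual_split[OF U V mn k y Z, of \<sigma> w] w by linarith
  qed
  then show ?thesis unfolding svd_tail_eq[OF U(1) V mn k] by simp
qed

lemma orthogonal_transpose_coords:
  assumes V: "V \<in> carrier_mat m m" "V\<^sup>T * V = 1\<^sub>m m" and k: "k \<le> m" and y: "y \<in> carrier_vec m" "vec_norm2 y \<le> 1"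
  shows "(\<Sum>i<k. ((V\<^sup>T *\<^sub>v y) $ i)\<^sup>2) \<le> 1"
proof -
  have VVt: "V * V\<^sup>T = 1\<^sub>m m" using mat_mult_left_right_inverse[of "V\<^sup>T" m V] V by simp
  have c: "V\<^sup>T *\<^sub>v y \<in> carrier_vec m" using V y by auto
  have "vec_norm2 (V\<^sup>T *\<^sub>v y) = vec_norm2 y"
    by (rule vec_norm2_orthogonal_mult) (use V VVt y in auto)
  then have "sqrt (\<Sum>i<m. ((V\<^sup>T *\<^sub>v y) $ i)\<^sup>2) \<le> 1" using y(2) unfolding vec_norm2_eq[OF c] by simp
  then have "(\<Sum>i<m. ((V\<^sup>T *\<^sub>v y) $ i)\<^sup>2) \<le> 1" by simp
  moreover have "(\<Sum>i<k. ((V\<^sup>T *\<^sub>v y) $ i)\<^sup>2) \<le> (\<Sum>i<m. ((V\<^sup>T *\<^sub>v y) $ i)\<^sup>2)"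
    by (rule sum_mono2) (use k in auto)
  ultimately show ?thesis by linarith
qed

context
  fixes U V :: "real mat" and \<sigma> :: "nat \<Rightarrow> real" and n m p q k :: nat and Z :: "real mat"
    and x :: "nat \<times> nat \<Rightarrow> real" and t :: "nat \<Rightarrow> nat \<Rightarrow> real" and c :: real
  assumes U: "U \<in> carrier_mat n n" "U\<^sup>T * U = 1\<^sub>m n" and V: "V \<in> carrier_mat m m" "V\<^sup>T * V = 1\<^sub>m m"
    and mn: "m \<le> n" and k: "k \<le> m" and \<sigma>: "\<And>i. i < k \<Longrightarrow> \<sigma> (Suc i) > 0"
    and Z: "Z = U * (sing_mat n m (\<lambda>i. \<sigma> i ^ (2 * q + 1)) * mat m p x)" and c: "c \<ge> 0"
    and dual: "\<And>i i'. i < k \<Longrightarrow> i' < k \<Longrightarrow> (\<Sum>j<p. x (i, j) * t i' j) = (if i = i' then 1 else 0)"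
begin

lemma dual_combination:
  "i < k \<Longrightarrow> (\<Sum>j<p. x (i, j) * (\<Sum>i'<k. \<zeta> i' * (\<delta> i' * t i' j))) = \<zeta> i * \<delta> i"
proof -
  assume i: "i < k"
  have "(\<Sum>j<p. x (i, j) * (\<Sum>i'<k. \<zeta> i' * (\<delta> i' * t i' j))) = (\<Sum>i'<k. \<zeta> i' * \<delta> i' * (\<Sum>j<p. x (i, j) * t i' j))"
    unfolding sum_distrib_left by (subst sum.swap) (simp add: mult_ac)
  also have "\<dots> = (\<Sum>i'<k. if i' = i then \<zeta> i * \<delta> i else 0)"
    by (intro sum.cong) (use dual i in auto)
  finally show ?thesis using i by (simp add: sum.delta)
qed

text \<open>The weights \<open>(1 / \<sigma> (Suc i)) ^ (2 * q)\<close> make the combination match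
  the head exactly: row \<open>i\<close> contributes \<open>\<sigma> (Suc i) * ?z i\<close>, the
  first \<open>k\<close> coordinates cancel, and only the spill into the others remains.\<close>

lemma svd_residual_diff_le:
  assumes bil: "\<And>u v. (\<Sum>l\<in>{k..<m}. (u l)\<^sup>2) \<le> 1 \<Longrightarrow> (\<Sum>i<k. (v i)\<^sup>2) \<le> 1 \<Longrightarrow>
      (\<Sum>l\<in>{k..<m}. \<Sum>j<p. x (l, j) * (u l * \<sigma> (Suc l) ^ (2 * q + 1) * (\<Sum>i<k. v i * ((1 / \<sigma> (Suc i)) ^ (2 * q) * t i j)))) \<le> c"
  shows "spectral_norm ((1\<^sub>m n - orth_proj Z) * (U * sing_mat n m \<sigma> * V\<^sup>T)) - spectral_norm ((1\<^sub>m n - orth_proj Z) * svd_tail n m k U \<sigma> V) \<le> c"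
proof (rule residual_diff_le[OF U V(1) mn k Z])
  fix y assume y: "y \<in> carrier_vec m" "vec_norm2 y \<le> 1"
  let ?z = "\<lambda>i. (V\<^sup>T *\<^sub>v y) $ i"
  let ?w = "\<lambda>j. \<Sum>i<k. ?z i * ((1 / \<sigma> (Suc i)) ^ (2 * q) * t i j)"
  have "(\<Sum>i<k. (\<sigma> (Suc i) * ?z i - \<sigma> (Suc i) ^ (2 * q + 1) * (\<Sum>j<p. x (i, j) * ?w j))\<^sup>2) = 0"
  proof (rule sum.neutral, rule ballI)
    fix i assume "i \<in> {..<k}"
    then have i: "i < k" by simp
    have "\<sigma> (Suc i) ^ (2 * q + 1) * (?z i * (1 / \<sigma> (Suc i)) ^ (2 * q)) = \<sigma> (Suc i) * ?z i"
      using \<sigma>[OF i] by (simp add: power_divide)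
    then show "(\<sigma> (Suc i) * ?z i - \<sigma> (Suc i) ^ (2 * q + 1) * (\<Sum>j<p. x (i, j) * ?w j))\<^sup>2 = 0"
      unfolding dual_combination[OF i] by simp
  qed
  moreover have "(\<Sum>l\<in>{k..<m}. (\<sigma> (Suc l) ^ (2 * q + 1) * (\<Sum>j<p. x (l, j) * ?w j))\<^sup>2) \<le> c\<^sup>2 * (\<Sum>i<k. (?z i)\<^sup>2)"
    by (rule quotient_sum_squares_le[OF _ c bil]) auto
  moreover have "c\<^sup>2 * (\<Sum>i<k. (?z i)\<^sup>2) \<le> c\<^sup>2 * 1"
    by (intro mult_left_mono orthogonal_transpose_coords[OF V k y]) simp
  ultimately have "sqrt ((\<Sum>i<k. (\<sigma> (Suc i) * ?z i - \<sigma> (Suc i) ^ (2 * q + 1) * (\<Sum>j<p. x (i, j) * ?w j))\<^sup>2)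
      + (\<Sum>l\<in>{k..<m}. (\<sigma> (Suc l) ^ (2 * q + 1) * (\<Sum>j<p. x (l, j) * ?w j))\<^sup>2)) \<le> c"
    using c by (intro real_le_lsqrt) auto
  then show "\<exists>w. sqrt ((\<Sum>i<k. (\<sigma> (Suc i) * (V\<^sup>T *\<^sub>v y) $ i - \<sigma> (Suc i) ^ (2 * q + 1) * (\<Sum>j<p. x (i, j) * w j))\<^sup>2)
      + (\<Sum>l\<in>{k..<m}. (\<sigma> (Suc l) ^ (2 * q + 1) * (\<Sum>j<p. x (l, j) * w j))\<^sup>2)) \<le> c"
    by - (rule exI[of _ ?w])
qed

text \<open>The weight \<open>1 / (1 + c\<^sup>2)\<close> minimises \<open>(1 - \<eta>)\<^sup>2 + \<eta>\<^sup>2 * c\<^sup>2\<close>, with minimum \<open>(phi c)\<^sup>2\<close>.\<close>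

lemma svd_residual_diff_phi_le:
  assumes \<sigma>1: "\<And>i. i < k \<Longrightarrow> \<sigma> (Suc i) \<le> \<sigma> 1"
    and bil: "\<And>u v. (\<Sum>l\<in>{k..<m}. (u l)\<^sup>2) \<le> 1 \<Longrightarrow> (\<Sum>i<k. (v i)\<^sup>2) \<le> 1 \<Longrightarrow>
      (\<Sum>l\<in>{k..<m}. \<Sum>j<p. x (l, j) * (u l * \<sigma> (Suc l) ^ (2 * q + 1) * (\<Sum>i<k. v i * ((1 / \<sigma> (Suc i)) ^ (2 * q + 1) * t i j)))) \<le> c"
    and pos: "\<sigma> 1 \<ge> 0"
  shows "spectral_norm ((1\<^sub>m n - orth_proj Z) * (U * sing_mat n m \<sigma> * V\<^sup>T)) - spectral_norm ((1\<^sub>m n - orth_proj Z) * svd_tail n m k U \<sigma> V) \<le> phi c * \<sigma> 1"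
proof (rule residual_diff_le[OF U V(1) mn k Z])
  fix y assume y: "y \<in> carrier_vec m" "vec_norm2 y \<le> 1"
  let ?z = "\<lambda>i. (V\<^sup>T *\<^sub>v y) $ i"
  define \<eta> where "\<eta> = 1 / (1 + c\<^sup>2)"
  \<comment> \<open>Only the fraction \<open>\<eta>\<close> of the head is matched. The unmatched
    part contributes \<open>(1 - \<eta>)\<^sup>2 * S\<close>, and the spill into the other
    coordinates at most \<open>c\<^sup>2 * \<eta>\<^sup>2 * S\<close>.\<close>
  define \<zeta> where "\<zeta> = (\<lambda>i. \<eta> * (\<sigma> (Suc i) * ?z i))"
  define S where "S = (\<Sum>i<k. (\<sigma> (Suc i) * ?z i)\<^sup>2)"
  let ?w = "\<lambda>j. \<Sum>i<k. \<zeta> i * ((1 / \<sigma> (Suc i)) ^ (2 * q + 1) * t i j)"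
  have "(\<Sum>i<k. (\<sigma> (Suc i) * ?z i - \<sigma> (Suc i) ^ (2 * q + 1) * (\<Sum>j<p. x (i, j) * ?w j))\<^sup>2) = (\<Sum>i<k. (1 - \<eta>)\<^sup>2 * (\<sigma> (Suc i) * ?z i)\<^sup>2)"
  proof (rule sum.cong[OF refl])
    fix i assume "i \<in> {..<k}"
    then have i: "i < k" by simp
    have "\<sigma> (Suc i) ^ (2 * q + 1) * (\<zeta> i * (1 / \<sigma> (Suc i)) ^ (2 * q + 1)) = \<zeta> i"
      using \<sigma>[OF i] by (simp add: power_divide)
    then have "\<sigma> (Suc i) * ?z i - \<sigma> (Suc i) ^ (2 * q + 1) * (\<Sum>j<p. x (i, j) * ?w j) = (1 - \<eta>) * (\<sigma> (Suc i) * ?z i)"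
      unfolding dual_combination[OF i] by (simp only: \<zeta>_def) (simp add: algebra_simps)
    then show "(\<sigma> (Suc i) * ?z i - \<sigma> (Suc i) ^ (2 * q + 1) * (\<Sum>j<p. x (i, j) * ?w j))\<^sup>2 = (1 - \<eta>)\<^sup>2 * (\<sigma> (Suc i) * ?z i)\<^sup>2"
      by (simp only: power_mult_distrib)
  qed
  also have "\<dots> = (1 - \<eta>)\<^sup>2 * S" by (simp add: S_def sum_distrib_left)
  finally have 1: "(\<Sum>i<k. (\<sigma> (Suc i) * ?z i - \<sigma> (Suc i) ^ (2 * q + 1) * (\<Sum>j<p. x (i, j) * ?w j))\<^sup>2) = (1 - \<eta>)\<^sup>2 * S" .
  have 2: "(\<Sum>l\<in>{k..<m}. (\<sigma> (Suc l) ^ (2 * q + 1) * (\<Sum>j<p. x (l, j) * ?w j))\<^sup>2) \<le> c\<^sup>2 * (\<Sum>i<k. (\<zeta> i)\<^sup>2)"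
    by (rule quotient_sum_squares_le[OF _ c bil]) auto
  have 3: "(\<Sum>i<k. (\<zeta> i)\<^sup>2) = \<eta>\<^sup>2 * S"
    unfolding \<zeta>_def S_def power_mult_distrib[of \<eta>] by (simp only: sum_distrib_left)
  have "S \<le> (\<Sum>i<k. (\<sigma> 1)\<^sup>2 * (?z i)\<^sup>2)"
    unfolding S_def power_mult_distrib using \<sigma> \<sigma>1 by (intro sum_mono mult_right_mono power_mono) (auto intro: less_imp_le)
  also have "\<dots> \<le> (\<sigma> 1)\<^sup>2 * 1"
    unfolding sum_distrib_left[symmetric] by (intro mult_left_mono orthogonal_transpose_coords[OF V k y]) simp
  finally have S: "S \<le> (\<sigma> 1)\<^sup>2" by simp
  have c1: "1 + c\<^sup>2 > 0" by (simp add: add_pos_nonneg)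
  have \<eta>: "(1 - \<eta>)\<^sup>2 + c\<^sup>2 * \<eta>\<^sup>2 = (phi c)\<^sup>2"
  proof -
    have "1 - \<eta> = c\<^sup>2 / (1 + c\<^sup>2)" using c1 by (simp add: \<eta>_def field_simps)
    then have "(1 - \<eta>)\<^sup>2 + c\<^sup>2 * \<eta>\<^sup>2 = (c\<^sup>2 * (1 + c\<^sup>2)) / (1 + c\<^sup>2)\<^sup>2"
      by (simp add: \<eta>_def power_divide add_divide_distrib distrib_left power2_eq_square)
    also have "\<dots> = c\<^sup>2 / (1 + c\<^sup>2)" using c1 by (simp add: power2_eq_square[of "1 + c\<^sup>2"])
    also have "\<dots> = (phi c)\<^sup>2" using c1 by (simp add: phi_def power_divide)
    finally show ?thesis .
  qed
  have "(1 - \<eta>)\<^sup>2 * S + c\<^sup>2 * (\<eta>\<^sup>2 * S) = (phi c)\<^sup>2 * S"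
    unfolding \<eta>[symmetric] by (simp add: algebra_simps)
  also have "\<dots> \<le> (phi c * \<sigma> 1)\<^sup>2" unfolding power_mult_distrib by (intro mult_left_mono S) simp
  finally have "(1 - \<eta>)\<^sup>2 * S + c\<^sup>2 * (\<eta>\<^sup>2 * S) \<le> (phi c * \<sigma> 1)\<^sup>2" .
  moreover have "phi c * \<sigma> 1 \<ge> 0" using c pos by (simp add: phi_def)
  ultimately have "sqrt ((\<Sum>i<k. (\<sigma> (Suc i) * ?z i - \<sigma> (Suc i) ^ (2 * q + 1) * (\<Sum>j<p. x (i, j) * ?w j))\<^sup>2)
      + (\<Sum>l\<in>{k..<m}. (\<sigma> (Suc l) ^ (2 * q + 1) * (\<Sum>j<p. x (l, j) * ?w j))\<^sup>2)) \<le> phi c * \<sigma> 1"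
    using 1 2 3 by (intro real_le_lsqrt) auto
  then show "\<exists>w. sqrt ((\<Sum>i<k. (\<sigma> (Suc i) * (V\<^sup>T *\<^sub>v y) $ i - \<sigma> (Suc i) ^ (2 * q + 1) * (\<Sum>j<p. x (i, j) * w j))\<^sup>2)
      + (\<Sum>l\<in>{k..<m}. (\<sigma> (Suc l) ^ (2 * q + 1) * (\<Sum>j<p. x (l, j) * w j))\<^sup>2)) \<le> phi c * \<sigma> 1"
    by - (rule exI[of _ ?w])
qed

end

text \<open>Pulling \<open>s ^ e\<close> into the sum produces the powers of
  \<open>\<gamma>\<close>, here with the shift between \<open>\<sigma> (Suc i)\<close> for
  \<open>i < k\<close> and \<open>\<sigma> i\<close> for \<open>i\<close> from 1 to
  \<open>k\<close>.\<close>

lemma sqrt_sum_quotient: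
  assumes d: "d > 1" and s: "s \<ge> (0::real)"
  shows "s ^ e * sqrt ((\<Sum>i<k. ((1 / \<sigma> (Suc i)) ^ e)\<^sup>2) / (d - 1)) = 1 / sqrt (d - 1) * sqrt (\<Sum>i=1..k. (s / \<sigma> i) ^ (2 * e))"
proof -
  have "(\<Sum>i=1..k. (s / \<sigma> i) ^ (2 * e)) = (\<Sum>i<k. (s / \<sigma> (Suc i)) ^ (2 * e))"
    by (simp add: sum.atLeast1_atMost_eq)
  also have "\<dots> = (s ^ e)\<^sup>2 * (\<Sum>i<k. ((1 / \<sigma> (Suc i)) ^ e)\<^sup>2)"
    unfolding sum_distrib_left by (intro sum.cong) (auto simp: power_divide power_mult power_mult_distrib power2_eq_square)
  finally show ?thesis using s by (simp add: real_sqrt_mult real_sqrt_divide)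
qed

text \<open>Singular values beyond the rank vanish, so the sum may stop at \<open>r\<close>; the
  factor \<open>\<sigma> k\<close> is pulled under the root.\<close>

lemma sqrt_sum_tail:
  fixes \<sigma> :: "nat \<Rightarrow> real"
  assumes zero: "\<And>i. r < i \<Longrightarrow> i \<le> m \<Longrightarrow> \<sigma> i = 0" and rm: "r \<le> m" and k: "\<sigma> k > 0"
  shows "sqrt (\<Sum>l\<in>{k..<m}. (\<sigma> (Suc l) ^ (2 * q + 1))\<^sup>2) * (1 / \<sigma> k) ^ (2 * q + 1) = sqrt (\<Sum>i=k+1..r. (\<sigma> i / \<sigma> k) ^ (4 * q + 2))"
proof -
  have e: "4 * q + 2 = (2 * q + 1) * 2" by simp
  have "(\<Sum>i=k+1..r. (\<sigma> i / \<sigma> k) ^ (4 * q + 2)) = (\<Sum>i=k+1..m. (\<sigma> i / \<sigma> k) ^ (4 * q + 2))"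
    by (rule sum.mono_neutral_left) (use zero rm in auto)
  also have "\<dots> = (\<Sum>l\<in>{k..<m}. (\<sigma> (Suc l) / \<sigma> k) ^ (4 * q + 2))"
    using sum.shift_bounds_Suc_ivl[of "\<lambda>i. (\<sigma> i / \<sigma> k) ^ (4 * q + 2)" k m]
    unfolding atLeastLessThanSuc_atLeastAtMost by simp
  also have "\<dots> = (\<Sum>l\<in>{k..<m}. (\<sigma> (Suc l) ^ (2 * q + 1))\<^sup>2) * ((1 / \<sigma> k) ^ (2 * q + 1))\<^sup>2"
    unfolding sum_distrib_right
    by (simp only: e power_mult power_divide power_one times_divide_eq_right mult_1_right)
  finally show ?thesis using k by (simp add: real_sqrt_mult del: power_Suc)
qed

theorem corollary4p5:
  fixes M :: "'a measure" and G Z \<Omega> :: "'a \<Rightarrow> real mat"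
    and A U V :: "real mat" and \<sigma> :: "nat \<Rightarrow> real" and n m p q k r :: nat
  assumes "prob_space M"
    and "A \<in> carrier_mat n m" and "m \<le> n"
    and "is_svd n m A U \<sigma> V"
    and "r = vec_space.rank n A"
    and "2 < p" and "p \<le> r"
    and "std_gaussian_mat M m p G"
    and "Z = (\<lambda>\<omega>. power_scheme q A * G \<omega>)"
    and "k \<in> {1..p - 2}"
    and "\<Omega> = (\<lambda>\<omega>. (first_cols k U)\<^sup>T * Z \<omega>)"
    and "AE \<omega> in M. vec_space.rank k (\<Omega> \<omega>) = k"
  shows "let D = (\<lambda>\<omega>. spectral_norm ((1\<^sub>m n - orth_proj (Z \<omega>)) * A)
                   - spectral_norm ((1\<^sub>m n - orth_proj (Z \<omega>)) * svd_tail n m k U \<sigma> V))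
    in integrable M D \<and>
       prob_space.expectation M D
         \<le> min (c_bound \<sigma> r p q k) (phi (d_bound \<sigma> r p q k) * \<sigma> 1)"
proof -

  \<comment> \<open>Singular values, rank and parameters\<close>
  interpret prob_space M by fact
  note mn = \<open>m \<le> n\<close>
  have U: "U \<in> carrier_mat n n" "U\<^sup>T * U = 1\<^sub>m n" and V: "V \<in> carrier_mat m m" "V\<^sup>T * V = 1\<^sub>m m"
    and nn: "\<And>i. i \<in> {1..m} \<Longrightarrow> 0 \<le> \<sigma> i" and dec: "\<And>i j. i \<in> {1..m} \<Longrightarrow> j \<in> {1..m} \<Longrightarrow> i \<le> j \<Longrightarrow> \<sigma> j \<le> \<sigma> i"
    and A: "A = U * sing_mat n m \<sigma> * V\<^sup>T"
    using \<open>is_svd n m A U \<sigma> V\<close> by (auto simp: is_svd_def)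
  have rm: "r \<le> m" using vec_space.rank_le_nc[OF \<open>A \<in> carrier_mat n m\<close>] \<open>r = _\<close> by simp
  have k: "1 \<le> k" "k + 2 \<le> p" using \<open>k \<in> _\<close> \<open>2 < p\<close> by auto
  have km: "k \<le> m" "k + 1 \<le> r" using k \<open>p \<le> r\<close> rm by auto
  have pos: "\<sigma> i > 0" if "1 \<le> i" "i \<le> r" for i
    using rank_svd[OF \<open>is_svd n m A U \<sigma> V\<close> mn that(1)] that rm \<open>r = _\<close> by auto
  have zero: "\<sigma> i = 0" if "r < i" "i \<le> m" for i
    using rank_svd[OF \<open>is_svd n m A U \<sigma> V\<close> mn, of i] nn[of i] that \<open>r = _\<close> by fastforce
  define d where "d = p - k"
  have d: "d \<ge> 2" "p = k + d" "real d = real p - real k" using k by (auto simp: d_def)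

  \<comment> \<open>The norm difference on the space of matrix entries\<close>
  let ?J = "{..<m} \<times> {..<p}"
  let ?\<gamma> = "PiM ?J (\<lambda>_. std_gauss)"
  interpret P: prob_space ?\<gamma> by (rule prob_space_PiM_std_gauss)
  \<comment> \<open>The matrix \<open>Z\<close> as a function of the entries \<open>x\<close> of
    \<open>V\<^sup>T * G\<close>; the left factors come from
    \<open>power_scheme_svd\<close>.\<close>
  define Z' where "Z' = (\<lambda>x. U * (sing_mat n m (\<lambda>i. \<sigma> i ^ (2 * q + 1)) * mat m p x))"
  define T where "T = svd_tail n m k U \<sigma> V"
  define D where "D = (\<lambda>x. spectral_norm ((1\<^sub>m n - orth_proj (Z' x)) * A) - spectral_norm ((1\<^sub>m n - orth_proj (Z' x)) * T))"
  have Z'c: "Z' x \<in> carrier_mat n p" for x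
    unfolding Z'_def by (intro mult_carrier_mat[OF U(1)] mult_carrier_mat[OF sing_mat_carrier]) simp
  have Tc: "T \<in> carrier_mat n m"
    unfolding T_def svd_tail_eq[OF U(1) V(1) mn km(1)] by (rule mult_sing_mat_transpose_carrier[OF U(1) V(1)])
  have mZ: "(\<lambda>x. Z' x $$ (i, j)) \<in> borel_measurable (PiM ?J (\<lambda>_. borel))" if ij: "i < n" "j < p" for i j
  proof -
    have US: "U * sing_mat n m \<tau> \<in> carrier_mat n m" for \<tau> using mult_carrier_mat[OF U(1) sing_mat_carrier] .
    have "(C * mat m p x) $$ (i, j) = (\<Sum>l<m. C $$ (i, l) * x (l, j))" if "C \<in> carrier_mat n m" for C x
      using that ij by (simp add: scalar_prod_def atLeast0LessThan)
    note e = this[OF US]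
    have "Z' x = U * sing_mat n m (\<lambda>i. \<sigma> i ^ (2 * q + 1)) * mat m p x" for x
      unfolding Z'_def by (rule assoc_mult_mat[OF U(1) sing_mat_carrier mat_carrier, symmetric])
    then have "(\<lambda>x. Z' x $$ (i, j)) = (\<lambda>x. \<Sum>l<m. (U * sing_mat n m (\<lambda>i. \<sigma> i ^ (2 * q + 1))) $$ (i, l) * x (l, j))"
      by (simp only: e)
    also have "\<dots> \<in> borel_measurable (PiM ?J (\<lambda>_. borel))"
      by (intro borel_measurable_sum borel_measurable_times borel_measurable_const measurable_component_singleton) (use ij in auto)
    finally show ?thesis .
  qed
  have mD: "D \<in> borel_measurable (PiM ?J (\<lambda>_. borel))"
    unfolding D_def by (intro borel_measurable_diff measurable_spectral_norm_residual[OF Z'c \<open>A \<in> carrier_mat n m\<close> mZ]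
        measurable_spectral_norm_residual[OF Z'c Tc mZ])
  have bD: "\<bar>D x\<bar> \<le> spectral_norm A + spectral_norm T" for x
    using spectral_norm_residual_le[OF Z'c \<open>A \<in> carrier_mat n m\<close>, of x] spectral_norm_residual_le[OF Z'c Tc, of x]
      spectral_norm_nonneg[of "(1\<^sub>m n - orth_proj (Z' x)) * A"] spectral_norm_nonneg[of "(1\<^sub>m n - orth_proj (Z' x)) * T"]
    unfolding D_def by linarith
  \<comment> \<open>Both residual norms are bounded by the norms of the unprojected matrices, so
    boundedness gives integrability.\<close>
  have iD: "integrable ?\<gamma> D"
    by (rule P.integrable_const_bound[of _ "spectral_norm A + spectral_norm T"]) (use bD mD in auto)

  \<comment> \<open>Transfer to a standard Gaussian family\<close>
  define E where "E = (\<lambda>\<omega>. \<lambda>(l, j)\<in>?J. G \<omega> $$ (l, j))"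
  \<comment> \<open>The entries of \<open>V\<^sup>T\<close> times the matrix with entries
    \<open>g\<close>, written as a linear map on pairs of indices so that
    \<open>distr_PiM_orthonormal\<close> applies.\<close>
  define X where "X = (\<lambda>g :: nat \<times> nat \<Rightarrow> real. \<lambda>l\<in>?J. \<Sum>i\<in>?J. g i * (if snd i = snd l then V $$ (fst i, fst l) else 0))"
  have E: "E \<in> M \<rightarrow>\<^sub>M PiM ?J (\<lambda>_. borel)" "distr M (PiM ?J (\<lambda>_. borel)) E = ?\<gamma>"
    unfolding E_def using std_gaussian_mat_entries[OF \<open>prob_space M\<close> \<open>std_gaussian_mat M m p G\<close>] \<open>2 < p\<close> by auto
  have mX: "X \<in> PiM ?J (\<lambda>_. borel) \<rightarrow>\<^sub>M PiM ?J (\<lambda>_. borel)"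
    unfolding X_def by (rule measurable_restrict) auto
  have X: "distr ?\<gamma> (PiM ?J (\<lambda>_. borel)) X = ?\<gamma>"
    unfolding X_def
  proof (rule distr_PiM_orthonormal)
    fix l l' assume l: "l \<in> ?J" "l' \<in> ?J"
    have "(\<Sum>i\<in>?J. (if snd i = snd l then V $$ (fst i, fst l) else 0) * (if snd i = snd l' then V $$ (fst i, fst l') else 0))
       = (\<Sum>a<m. \<Sum>j<p. if j = snd l then (if snd l = snd l' then V $$ (a, fst l) * V $$ (a, fst l') else 0) else 0)"
      unfolding sum.cartesian_product by (intro sum.cong) auto
    also have "\<dots> = (if snd l = snd l' then (\<Sum>a<m. V $$ (a, fst l) * V $$ (a, fst l')) else 0)"
      using l by (auto simp: sum.delta)
    also have "(\<Sum>a<m. V $$ (a, fst l) * V $$ (a, fst l')) = (V\<^sup>T * V) $$ (fst l, fst l')"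
      using l V(1) by (auto simp: scalar_prod_def atLeast0LessThan)
    also have "\<dots> = (if fst l = fst l' then 1 else 0)" unfolding V(2) using l by auto
    finally show "(\<Sum>i\<in>?J. (if snd i = snd l then V $$ (fst i, fst l) else 0) * (if snd i = snd l' then V $$ (fst i, fst l') else 0))
       = (if l = l' then 1 else 0)" by (auto simp: prod_eq_iff)
  qed auto
  have XE: "distr M (PiM ?J (\<lambda>_. borel)) (\<lambda>\<omega>. X (E \<omega>)) = ?\<gamma>"
  proof -
    have "distr M (PiM ?J (\<lambda>_. borel)) (X \<circ> E) = distr (distr M (PiM ?J (\<lambda>_. borel)) E) (PiM ?J (\<lambda>_. borel)) X"
      by (rule distr_distr[symmetric, OF mX E(1)])
    then show ?thesis unfolding E(2) X by (simp add: o_def)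
  qed
  have mXE: "(\<lambda>\<omega>. X (E \<omega>)) \<in> M \<rightarrow>\<^sub>M PiM ?J (\<lambda>_. borel)" by (rule measurable_compose[OF E(1) mX])
  have Gc: "G \<omega> \<in> carrier_mat m p" if "\<omega> \<in> space M" for \<omega>
    using \<open>std_gaussian_mat M m p G\<close> that by (auto simp: std_gaussian_mat_def)
  have ZX: "Z \<omega> = Z' (X (E \<omega>))" if \<omega>: "\<omega> \<in> space M" for \<omega>
  proof -
    have Vt: "V\<^sup>T \<in> carrier_mat m m" using V by simp
    have "V\<^sup>T * G \<omega> = mat m p (X (E \<omega>))"
    proof (rule eq_matI)
      fix i j assume "i < dim_row (mat m p (X (E \<omega>)))" "j < dim_col (mat m p (X (E \<omega>)))"
      then have ij: "i < m" "j < p" by auto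
      have "X (E \<omega>) (i, j) = (\<Sum>a<m. \<Sum>j'<p. if j' = j then G \<omega> $$ (a, j) * V $$ (a, i) else 0)"
        using ij unfolding X_def E_def sum.cartesian_product by (auto intro!: sum.cong)
      also have "\<dots> = (V\<^sup>T * G \<omega>) $$ (i, j)"
        using ij V Gc[OF \<omega>] by (simp add: sum.delta scalar_prod_def atLeast0LessThan mult.commute)
      finally show "(V\<^sup>T * G \<omega>) $$ (i, j) = mat m p (X (E \<omega>)) $$ (i, j)" using ij by simp
    qed (use V Gc[OF \<omega>] in auto)
    then show ?thesis
      unfolding Z'_def \<open>Z = _\<close> power_scheme_svd[OF U V mn A]
      using assoc_mult_mat[OF mult_carrier_mat[OF U(1) sing_mat_carrier] Vt Gc[OF \<omega>]]
        assoc_mult_mat[OF U(1) sing_mat_carrier mult_carrier_mat[OF Vt Gc[OF \<omega>]]] by simp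
  qed
  let ?D = "\<lambda>\<omega>. spectral_norm ((1\<^sub>m n - orth_proj (Z \<omega>)) * A) - spectral_norm ((1\<^sub>m n - orth_proj (Z \<omega>)) * svd_tail n m k U \<sigma> V)"
  have DX: "?D \<omega> = D (X (E \<omega>))" if "\<omega> \<in> space M" for \<omega>
    using ZX[OF that] by (simp add: D_def T_def)
  have iDX: "integrable M (\<lambda>\<omega>. D (X (E \<omega>)))"
    using integrable_distr_eq[OF mXE mD] iD XE by simp
  then have int: "integrable M ?D" using DX by (simp cong: Bochner_Integration.integrable_cong)
  have exp: "expectation ?D = (\<integral>x. D x \<partial>?\<gamma>)"
  proof -
    have "expectation ?D = expectation (\<lambda>\<omega>. D (X (E \<omega>)))" by (rule Bochner_Integration.integral_cong[OF refl DX])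
    also have "\<dots> = (\<integral>x. D x \<partial>distr M (PiM ?J (\<lambda>_. borel)) (\<lambda>\<omega>. X (E \<omega>)))"
      by (rule integral_distr[symmetric, OF mXE mD])
    finally show ?thesis by (simp only: XE)
  qed

  \<comment> \<open>The bounds for the two exponents\<close>
  let ?L = "{k..<m}"
  have L: "finite ?L" "?L \<inter> {..<k} = {}" and JL: "({..<k} \<union> ?L) \<times> {..<p} = ?J" using km by auto
  define S where "S = sqrt (\<Sum>l\<in>?L. (\<sigma> (Suc l) ^ (2 * q + 1))\<^sup>2)"
  have sb: "\<bar>\<sigma> (Suc l) ^ (2 * q + 1)\<bar> \<le> \<sigma> (k + 1) ^ (2 * q + 1)" if "l \<in> ?L" for l
    unfolding power_abs by (intro power_mono) (use that nn[of "Suc l"] dec[of "k + 1" "Suc l"] km in auto)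
  have sp: "\<sigma> (k + 1) ^ (2 * q + 1) > 0" using pos km by (intro zero_less_power) auto
  have ss: "(\<Sum>l\<in>?L. (\<sigma> (Suc l) ^ (2 * q + 1))\<^sup>2) > 0"
  proof -
    have "0 < (\<sigma> (Suc k) ^ (2 * q + 1))\<^sup>2" using zero_less_power[OF sp, of 2] by (simp only: Suc_eq_plus1)
    also have "\<dots> \<le> (\<Sum>l\<in>?L. (\<sigma> (Suc l) ^ (2 * q + 1))\<^sup>2)"
      by (rule member_le_sum) (use km rm in auto)
    finally show ?thesis .
  qed
  \<comment> \<open>As \<open>\<sigma> k\<close> is the smallest of the first \<open>k\<close>
    singular values, the weight at \<open>k\<close> is the largest one.\<close>
  have \<delta>: "0 < (1 / \<sigma> (Suc i)) ^ e" "(1 / \<sigma> (Suc i)) ^ e \<le> (1 / \<sigma> k) ^ e" if "i < k" for i e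
  proof -
    have "\<sigma> (Suc i) > 0" "\<sigma> k > 0" "\<sigma> k \<le> \<sigma> (Suc i)" using that pos km k dec[of "Suc i" k] by auto
    then show "0 < (1 / \<sigma> (Suc i)) ^ e" "(1 / \<sigma> (Suc i)) ^ e \<le> (1 / \<sigma> k) ^ e"
      by (auto intro!: power_mono divide_left_mono)
  qed
  have \<sigma>k: "\<And>i. i < k \<Longrightarrow> \<sigma> (Suc i) > 0" "\<And>i. i < k \<Longrightarrow> \<sigma> (Suc i) \<le> \<sigma> 1" "\<sigma> k > 0" "\<sigma> 1 > 0"
    using pos km k dec[of 1] rm by auto
  have d1: "real d > 1" using d by simp
  have S0: "S \<ge> 0" by (simp add: S_def sum_nonneg)
  have tail: "S * (1 / \<sigma> k) ^ (2 * q + 1) = sqrt (\<Sum>i=k+1..r. (\<sigma> i / \<sigma> k) ^ (4 * q + 2))"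
    unfolding S_def by (rule sqrt_sum_tail[of r m \<sigma> k, OF zero rm \<sigma>k(3)])
  \<comment> \<open>The exponent \<open>e = 2 * q\<close> of the weights produces
    \<open>c_bound\<close>, and \<open>e = 2 * q + 1\<close> produces
    \<open>d_bound\<close>.\<close>
  define bound where "bound = (\<lambda>e. \<sigma> (k + 1) ^ (2 * q + 1) * sqrt ((\<Sum>i<k. ((1 / \<sigma> (Suc i)) ^ e)\<^sup>2) / (real d - 1))
      + S * ((1 / \<sigma> k) ^ e * (exp 1 * sqrt (real p) / real d)))"
  have quotient: "(\<integral>\<^sup>+x. f x \<partial>?\<gamma>) \<le> ennreal (bound e)"
    if "f \<in> borel_measurable (PiM ?J (\<lambda>_. borel))"
      and "\<And>x t c. c \<ge> 0 \<Longrightarrow>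
        (\<And>i i'. i < k \<Longrightarrow> i' < k \<Longrightarrow> (\<Sum>j<p. x (i, j) * t i' j) = (if i = i' then 1 else 0)) \<Longrightarrow>
        (\<And>u v. (\<Sum>l\<in>?L. (u l)\<^sup>2) \<le> 1 \<Longrightarrow> (\<Sum>i<k. (v i)\<^sup>2) \<le> 1 \<Longrightarrow>
           (\<Sum>l\<in>?L. \<Sum>j<p. x (l, j) * (u l * \<sigma> (Suc l) ^ (2 * q + 1) * (\<Sum>i<k. v i * ((1 / \<sigma> (Suc i)) ^ e * t i j)))) \<le> c) \<Longrightarrow> f x \<le> ennreal c"
    for f e
    unfolding bound_def S_def JL[symmetric]
    by (rule gaussian_quotient_bound[where s = "\<lambda>l. \<sigma> (Suc l) ^ (2 * q + 1)" and \<delta> = "\<lambda>i. (1 / \<sigma> (Suc i)) ^ e",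
          OF k(1) d(1,2) L sb sp ss \<delta> that(1)[folded JL] that(2)])
  have bound0: "bound e \<ge> 0" for e
    unfolding bound_def using sp S0 \<sigma>k d1 by (intro add_nonneg_nonneg mult_nonneg_nonneg) (auto intro!: sum_nonneg divide_nonneg_nonneg)
  have bound_c: "bound (2 * q) = c_bound \<sigma> r p q k"
  proof -
    have "\<sigma> (k + 1) ^ (2 * q + 1) * sqrt ((\<Sum>i<k. ((1 / \<sigma> (Suc i)) ^ (2 * q))\<^sup>2) / (real d - 1))
       = \<sigma> (k + 1) * (1 / sqrt (real d - 1) * sqrt (\<Sum>i=1..k. (\<sigma> (k + 1) / \<sigma> i) ^ (2 * (2 * q))))"
      using sqrt_sum_quotient[OF d1, of "\<sigma> (k + 1)" "2 * q" \<sigma> k] pos[of "k + 1"] km by (simp add: mult.assoc)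
    moreover have "S * (1 / \<sigma> k) ^ (2 * q) = \<sigma> k * sqrt (\<Sum>i=k+1..r. (\<sigma> i / \<sigma> k) ^ (4 * q + 2))"
      unfolding tail[symmetric] using \<sigma>k(3) by simp
    ultimately show ?thesis unfolding bound_def c_bound_def d(3) by (simp add: mult.assoc[symmetric])
  qed
  have bound_d: "bound (2 * q + 1) = d_bound \<sigma> r p q k"
  proof -
    have "\<sigma> (k + 1) ^ (2 * q + 1) * sqrt ((\<Sum>i<k. ((1 / \<sigma> (Suc i)) ^ (2 * q + 1))\<^sup>2) / (real d - 1))
       = 1 / sqrt (real d - 1) * sqrt (\<Sum>i=1..k. (\<sigma> (k + 1) / \<sigma> i) ^ (2 * (2 * q + 1)))"
      using sqrt_sum_quotient[OF d1, of "\<sigma> (k + 1)" "2 * q + 1" \<sigma> k] pos[of "k + 1"] km by simp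
    moreover have "2 * (2 * q + 1) = 4 * q + 2" by simp
    ultimately show ?thesis
      unfolding bound_def d_bound_def d(3) mult.assoc[of S, symmetric] tail by (simp only:)
  qed

  \<comment> \<open>The mean of the norm difference\<close>
  have Dc: "(\<integral>x. D x \<partial>?\<gamma>) \<le> c_bound \<sigma> r p q k"
  proof (rule integral_real_bounded)
    show "0 \<le> c_bound \<sigma> r p q k" using bound0[of "2 * q"] by (simp only: bound_c)
    show "(\<integral>\<^sup>+x. ennreal (D x) \<partial>?\<gamma>) \<le> ennreal (c_bound \<sigma> r p q k)"
      unfolding bound_c[symmetric]
    proof (rule quotient)
      show "(\<lambda>x. ennreal (D x)) \<in> borel_measurable (PiM ?J (\<lambda>_. borel))" using mD by measurable
      fix x t c assume "(0::real) \<le> c"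
        and "\<And>i i'. i < k \<Longrightarrow> i' < k \<Longrightarrow> (\<Sum>j<p. x (i, j) * t i' j) = (if i = i' then 1 else 0)"
        and "\<And>u v. (\<Sum>l\<in>?L. (u l)\<^sup>2) \<le> 1 \<Longrightarrow> (\<Sum>i<k. (v i)\<^sup>2) \<le> 1 \<Longrightarrow>
           (\<Sum>l\<in>?L. \<Sum>j<p. x (l, j) * (u l * \<sigma> (Suc l) ^ (2 * q + 1) * (\<Sum>i<k. v i * ((1 / \<sigma> (Suc i)) ^ (2 * q) * t i j)))) \<le> c"
      then have "D x \<le> c"
        unfolding D_def A T_def by (intro svd_residual_diff_le[OF U V mn km(1) \<sigma>k(1) Z'_def[THEN fun_cong]])
      then show "ennreal (D x) \<le> ennreal c" by (rule ennreal_leI)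
    qed
  qed
  define a where "a = d_bound \<sigma> r p q k"
  have a: "a \<ge> 0" using bound0[of "2 * q + 1"] by (simp only: bound_d a_def)
  define h where "h = sqrt (1 + a\<^sup>2) ^ 3"
  have h: "h > 0" by (simp add: h_def add_pos_nonneg)
  \<comment> \<open>\<open>quotient\<close> needs a function that is at most \<open>c\<close>
    itself, whereas \<open>D\<close> is bounded by \<open>phi c * \<sigma> 1\<close>. Solving the
    tangent inequality of \<open>phi\<close> at \<open>a\<close> for \<open>c\<close> gives such a
    function, affine in \<open>D\<close>. With \<open>a\<close> equal to \<open>d_bound\<close>, the
    bound on its mean is the base point.\<close>
  have tangent: "(\<integral>x. (D x / \<sigma> 1 - phi a) * h + a \<partial>?\<gamma>) \<le> a"
  proof (rule integral_real_bounded[OF a])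
    show "(\<integral>\<^sup>+x. ennreal ((D x / \<sigma> 1 - phi a) * h + a) \<partial>?\<gamma>) \<le> ennreal a"
    proof (rule order_trans[OF quotient[of _ "2 * q + 1"]])
      show "ennreal (bound (2 * q + 1)) \<le> ennreal a" by (simp only: bound_d a_def order_refl)
      show "(\<lambda>x. ennreal ((D x / \<sigma> 1 - phi a) * h + a)) \<in> borel_measurable (PiM ?J (\<lambda>_. borel))" using mD by measurable
      fix x t c assume c: "(0::real) \<le> c"
        and "\<And>i i'. i < k \<Longrightarrow> i' < k \<Longrightarrow> (\<Sum>j<p. x (i, j) * t i' j) = (if i = i' then 1 else 0)"
        and "\<And>u v. (\<Sum>l\<in>?L. (u l)\<^sup>2) \<le> 1 \<Longrightarrow> (\<Sum>i<k. (v i)\<^sup>2) \<le> 1 \<Longrightarrow>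
           (\<Sum>l\<in>?L. \<Sum>j<p. x (l, j) * (u l * \<sigma> (Suc l) ^ (2 * q + 1) * (\<Sum>i<k. v i * ((1 / \<sigma> (Suc i)) ^ (2 * q + 1) * t i j)))) \<le> c"
      then have "D x \<le> phi c * \<sigma> 1"
        unfolding D_def A T_def
        by (intro svd_residual_diff_phi_le[OF U V mn km(1) \<sigma>k(1) Z'_def[THEN fun_cong] _ _ \<sigma>k(2)] less_imp_le[OF \<sigma>k(4)])
      then have "D x / \<sigma> 1 \<le> phi c" using \<sigma>k(4) by (simp add: pos_divide_le_eq)
      also have "\<dots> \<le> phi a + (c - a) / h" unfolding h_def by (rule phi_tangent[OF c a])
      finally have "(D x / \<sigma> 1 - phi a) * h \<le> (c - a) / h * h" using h by (intro mult_right_mono) auto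
      then show "ennreal ((D x / \<sigma> 1 - phi a) * h + a) \<le> ennreal c" using h by (intro ennreal_leI) simp
    qed
  qed
  have "(\<integral>x. (D x / \<sigma> 1 - phi a) * h + a \<partial>?\<gamma>) = ((\<integral>x. D x \<partial>?\<gamma>) / \<sigma> 1 - phi a) * h + a"
    using iD by (simp add: P.prob_space[simplified])
  then have "((\<integral>x. D x \<partial>?\<gamma>) / \<sigma> 1 - phi a) * h \<le> 0" using tangent by simp
  then have "(\<integral>x. D x \<partial>?\<gamma>) / \<sigma> 1 \<le> phi a" using h by (simp add: mult_le_0_iff)
  then have "(\<integral>x. D x \<partial>?\<gamma>) \<le> phi a * \<sigma> 1" using \<sigma>k(4) by (simp add: pos_divide_le_eq)
  then show ?thesis using Dc int exp by (simp add: Let_def a_def)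
qed

end
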